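(* Let $2<p<N$, $p<q<p^*=\frac{Np}{N-p}$ and $\lambda>0$. Let $\{c_m\}_{m\in\mathbb{N}}$ be the sequence of critical values of $J$ given by $$c_m=\sup_{h\in\Gamma}\ \inf_{u\in\partial B\cap E_{m-1}^c}J(h(u)).$$ Then $c_m\to\infty$ as $m\to\infty$.
   Context: Setting. $n\ge 1$ is an integer, $N=n+2$, $\delta>0$ is a fixed small constant, $X$ is a bounded open set with coordinates $x'=(x_1',\dots,x_n')$, and $\mathbb{M}=(0,\delta)\times(0,\delta)\times X$ with points $(x_1,x_2,x')$. Put $\nabla_{\mathbb{M}}=(x_1\partial_{x_1},\,x_1x_2\partial_{x_2},\,\partial_{x_1'},\dots,\partial_{x_n'})$ and $d\sigma=\frac{dx_1}{x_1}\frac{dx_2}{x_1x_2}dx'$. All functions are real-valued. Weighted spaces. For $1\le p<\infty$ and $\gamma_1,\gamma_2\in\mathbb{R}$, $L_p^{\gamma_1,\gamma_2}(\mathbb{M})$ has norm $\|u\|_{L_p^{\gamma_1,\gamma_2}(\mathbb{M})}=\big(\int_{\mathbb{M}}|x_1^{\frac Np-\gamma_1}x_2^{\frac Np-\gamma_2}u|^p\,d\sigma\big)^{1/p}$. $\mathcal{H}_p^{1,(\gamma_1,\gamma_2)}(\mathbb{M})$ is the space of $u\in W^{1,p}_{\mathrm{loc}}(\mathrm{int}\,\mathbb{M})$ such that $u$ and all components of $\nabla_{\mathbb{M}}u$ lie in $L_p^{\gamma_1,\gamma_2}(\mathbb{M})$, and $\mathcal{H}_{p,0}^{1,(\gamma_1,\gamma_2)}(\mathbb{M})$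 is the closure of $C_0^\infty(\mathrm{int}\,\mathbb{M})$ in it. Write $E=\mathcal{H}_{p,0}^{1,(\frac{N-1}{p},\frac Np)}(\mathbb{M})$, normed (equivalently, by a Poincaré inequality) by $\|u\|_E=\big(\int_{\mathbb{M}}x_1|\nabla_{\mathbb{M}}u|^p\,d\sigma\big)^{1/p}$. Energy functional on $E$: $J(u)=\frac1p\int_{\mathbb{M}}x_1|\nabla_{\mathbb{M}}u|^p\,d\sigma-\frac{\lambda}{q}\int_{\mathbb{M}}x_1(x_1x_2)^p|u|^q\,d\sigma$. Its critical points are the weak solutions of $-(x_1x_2)^{-p}\mathrm{div}_{\mathbb{M}}(|\nabla_{\mathbb{M}}u|^{p-2}\nabla_{\mathbb{M}}u)=\lambda|u|^{q-2}u$ with zero Dirichlet condition, where $\mathrm{div}_{\mathbb{M}}=\nabla_{\mathbb{M}}\cdot$. Min-max classes. $B=\{u\in E:\|u\|_E\le1\}$, $\partial B$ is the unit sphere of $E$, $A_0=\{u\in E: 0\le J(u)<+\infty\}$, and $\Gamma=\{h\in C(E,E): h(0)=0,\ h\text{ is an odd homeomorphism},\ h(B)\subset A_0\}$. $\{E_m\}$ is a sequence of linear subspaces of $E$ with $\dim E_m=m$, $E_m\subset E_{m+1}$, and the linear span of $\bigcup_mE_m$ dense in $E$; $E_m^c$ denotes an algebraic and topological complement of $E_m$ in $E$. *)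

theory Defs
  imports "HOL-Analysis.Analysis"
begin

section \<open>Measurable functions modulo null sets\<close>

text \<open>
  Elements of the function spaces below are classes of functions modulo equality almost everywhere.
  Every Lebesgue measurable function agrees almost everywhere with a Borel measurable one, so Borel
  measurable representatives suffice.
\<close>

definition ae_eq :: "('a::euclidean_space \<Rightarrow> real) \<Rightarrow> ('a \<Rightarrow> real) \<Rightarrow> bool" where
  "ae_eq f g \<longleftrightarrow>
     f \<in> borel_measurable lborel \<and> g \<in> borel_measurable lborel \<and> (AE x in lborel. f x = g x)"

quotient_type (overloaded) 'a aefun = "'a::euclidean_space \<Rightarrow> real" / partial: ae_eq
proof (rule part_equivpI)
  show "\<exists>f :: 'a \<Rightarrow> real. ae_eq f f"
    by (rule exI[of _ "\<lambda>_. 0"]) (simp add: ae_eq_def)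
  show "symp (ae_eq :: ('a \<Rightarrow> real) \<Rightarrow> _)"
    by (rule sympI) (auto simp: ae_eq_def)
  show "transp (ae_eq :: ('a \<Rightarrow> real) \<Rightarrow> _)"
    by (rule transpI) (auto simp: ae_eq_def)
qed

instantiation aefun :: (euclidean_space) real_vector
begin

lift_definition zero_aefun :: "'a aefun" is "\<lambda>_. 0"
  by (simp add: ae_eq_def)

lift_definition plus_aefun :: "'a aefun \<Rightarrow> 'a aefun \<Rightarrow> 'a aefun" is "\<lambda>f g x. f x + g x"
  by (auto simp: ae_eq_def elim: AE_mp)

lift_definition uminus_aefun :: "'a aefun \<Rightarrow> 'a aefun" is "\<lambda>f x. - f x"
  by (auto simp: ae_eq_def)

lift_definition minus_aefun :: "'a aefun \<Rightarrow> 'a aefun \<Rightarrow> 'a aefun" is "\<lambda>f g x. f x - g x"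
  by (auto simp: ae_eq_def elim: AE_mp)

lift_definition scaleR_aefun :: "real \<Rightarrow> 'a aefun \<Rightarrow> 'a aefun" is "\<lambda>c f x. c * f x"
  by (auto simp: ae_eq_def elim: AE_mp)

instance
  by standard (transfer; auto simp: ae_eq_def algebra_simps)+

end


section \<open>Test functions and weak derivatives\<close>

fun Ck :: "nat \<Rightarrow> ('a::euclidean_space \<Rightarrow> real) \<Rightarrow> bool" where
  "Ck 0 f \<longleftrightarrow> continuous_on UNIV f"
| "Ck (Suc k) f \<longleftrightarrow>
     (\<forall>x. f differentiable (at x)) \<and> (\<forall>v. Ck k (\<lambda>x. frechet_derivative f (at x) v))"

definition test_functions :: "'a::euclidean_space set \<Rightarrow> ('a \<Rightarrow> real) set" where
  "test_functions \<Omega> =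
     {\<phi>. (\<forall>k. Ck k \<phi>) \<and> compact (closure {x. \<phi> x \<noteq> 0}) \<and> closure {x. \<phi> x \<noteq> 0} \<subseteq> \<Omega>}"

definition locally_Lp ::
    "real \<Rightarrow> 'a::euclidean_space set \<Rightarrow> ('a \<Rightarrow> 'b::euclidean_space) \<Rightarrow> bool" where
  "locally_Lp p \<Omega> f \<longleftrightarrow>
     f \<in> borel_measurable lborel \<and>
     (\<forall>K. compact K \<longrightarrow> K \<subseteq> \<Omega> \<longrightarrow> set_integrable lborel K (\<lambda>x. norm (f x) powr p))"

definition has_weak_gradient ::
    "'a::euclidean_space set \<Rightarrow> ('a \<Rightarrow> real) \<Rightarrow> ('a \<Rightarrow> 'a) \<Rightarrow> bool" where
  "has_weak_gradient \<Omega> u G \<longleftrightarrow>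
     locally_Lp 1 \<Omega> u \<and> locally_Lp 1 \<Omega> G \<and>
     (\<forall>\<phi>\<in>test_functions \<Omega>. \<forall>b\<in>Basis.
        (LINT x:\<Omega>|lborel. u x * frechet_derivative \<phi> (at x) b) =
        - (LINT x:\<Omega>|lborel. (G x \<bullet> b) * \<phi> x))"

text \<open>Unique up to null subsets of \<open>\<Omega>\<close>, whenever it exists.\<close>

definition weak_gradient :: "'a::euclidean_space set \<Rightarrow> 'a aefun \<Rightarrow> 'a \<Rightarrow> 'a" where
  "weak_gradient \<Omega> u = (SOME G. has_weak_gradient \<Omega> (rep_aefun u) G)"

text \<open>Functions on \<open>\<Omega>\<close> are identified with their extensions by zero.\<close>

definition W1p_loc :: "real \<Rightarrow> 'a::euclidean_space set \<Rightarrow> 'a aefun set" where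
  "W1p_loc p \<Omega> =
     {u. (AE x in lborel. x \<notin> \<Omega> \<longrightarrow> rep_aefun u x = 0) \<and> locally_Lp p \<Omega> (rep_aefun u) \<and>
         (\<exists>G. has_weak_gradient \<Omega> (rep_aefun u) G \<and> locally_Lp p \<Omega> G)}"


section \<open>Weighted Sobolev spaces on the stretched corner\<close>

text \<open>
  A point is a triple \<open>(x1, x2, x')\<close>. The dimension \<open>n\<close> of \<open>X\<close> is \<open>CARD('n)\<close>, so \<open>N = CARD('n) + 2\<close>.
\<close>

type_synonym 'n pt = "real \<times> real \<times> (real ^ 'n)"

definition corner :: "real \<Rightarrow> (real ^ 'n::finite) set \<Rightarrow> 'n pt set" where
  "corner \<delta> X = {0<..<\<delta>} \<times> {0<..<\<delta>} \<times> X"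

definition sigma_measure :: "'n::finite pt set \<Rightarrow> 'n pt measure" where
  "sigma_measure M =
     density lborel (\<lambda>(x1, x2, x'). ennreal (indicator M (x1, x2, x') / (x1 * (x1 * x2))))"

definition grad_M :: "'n::finite pt set \<Rightarrow> 'n pt aefun \<Rightarrow> 'n pt \<Rightarrow> 'n pt" where
  "grad_M M u = (\<lambda>(x1, x2, x').
     case weak_gradient M u (x1, x2, x') of (g1, g2, g') \<Rightarrow> (x1 * g1, x1 * x2 * g2, g'))"

definition Lp_integrand ::
    "real \<Rightarrow> real \<Rightarrow> real \<Rightarrow> ('n::finite pt \<Rightarrow> real) \<Rightarrow> 'n pt \<Rightarrow> real" where
  "Lp_integrand p \<gamma>1 \<gamma>2 f = (\<lambda>(x1, x2, x').
     \<bar>x1 powr ((real CARD('n) + 2) / p - \<gamma>1) * x2 powr ((real CARD('n) + 2) / p - \<gamma>2)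
        * f (x1, x2, x')\<bar> powr p)"

definition Lp_space ::
    "'n::finite pt set \<Rightarrow> real \<Rightarrow> real \<Rightarrow> real \<Rightarrow> ('n pt \<Rightarrow> real) set" where
  "Lp_space M p \<gamma>1 \<gamma>2 =
     {f. f \<in> borel_measurable lborel \<and> integrable (sigma_measure M) (Lp_integrand p \<gamma>1 \<gamma>2 f)}"

definition Lp_norm ::
    "'n::finite pt set \<Rightarrow> real \<Rightarrow> real \<Rightarrow> real \<Rightarrow> ('n pt \<Rightarrow> real) \<Rightarrow> real" where
  "Lp_norm M p \<gamma>1 \<gamma>2 f = (LINT x|sigma_measure M. Lp_integrand p \<gamma>1 \<gamma>2 f x) powr (1 / p)"

definition H1 :: "'n::finite pt set \<Rightarrow> real \<Rightarrow> real \<Rightarrow> real \<Rightarrow> 'n pt aefun set" where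
  "H1 M p \<gamma>1 \<gamma>2 =
     {u \<in> W1p_loc p M. rep_aefun u \<in> Lp_space M p \<gamma>1 \<gamma>2 \<and>
        (\<forall>b\<in>Basis. (\<lambda>x. grad_M M u x \<bullet> b) \<in> Lp_space M p \<gamma>1 \<gamma>2)}"

definition H1_norm :: "'n::finite pt set \<Rightarrow> real \<Rightarrow> real \<Rightarrow> real \<Rightarrow> 'n pt aefun \<Rightarrow> real" where
  "H1_norm M p \<gamma>1 \<gamma>2 u =
     Lp_norm M p \<gamma>1 \<gamma>2 (rep_aefun u) + (\<Sum>b\<in>Basis. Lp_norm M p \<gamma>1 \<gamma>2 (\<lambda>x. grad_M M u x \<bullet> b))"

definition H10 :: "'n::finite pt set \<Rightarrow> real \<Rightarrow> real \<Rightarrow> real \<Rightarrow> 'n pt aefun set" where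
  "H10 M p \<gamma>1 \<gamma>2 =
     {u \<in> H1 M p \<gamma>1 \<gamma>2.
        \<forall>\<epsilon>>0. \<exists>\<phi>\<in>test_functions M. H1_norm M p \<gamma>1 \<gamma>2 (u - abs_aefun \<phi>) < \<epsilon>}"

definition E_space :: "'n::finite pt set \<Rightarrow> real \<Rightarrow> 'n pt aefun set" where
  "E_space M p = H10 M p ((real CARD('n) + 2 - 1) / p) ((real CARD('n) + 2) / p)"

definition E_norm :: "'n::finite pt set \<Rightarrow> real \<Rightarrow> 'n pt aefun \<Rightarrow> real" where
  "E_norm M p u = (LINT x|sigma_measure M. fst x * norm (grad_M M u x) powr p) powr (1 / p)"

definition E_topology :: "'n::finite pt set \<Rightarrow> real \<Rightarrow> 'n pt aefun topology" where
  "E_topology M p = Metric_space.mtopology (E_space M p) (\<lambda>u v. E_norm M p (u - v))"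


section \<open>The energy functional and the min-max values\<close>

text \<open>
  The first integral is finite on \<open>E\<close>. The second one is taken in \<open>[0, \<infinity>]\<close>: a Bochner integral would
  assign the value 0 to a divergent integral, whereas the energy has to be \<open>-\<infinity>\<close> there.
\<close>

definition energy :: "'n::finite pt set \<Rightarrow> real \<Rightarrow> real \<Rightarrow> real \<Rightarrow> 'n pt aefun \<Rightarrow> ereal" where
  "energy M p q lam u =
     ereal (1 / p * (LINT x|sigma_measure M. fst x * norm (grad_M M u x) powr p)) -
     ereal (lam / q) * enn2ereal (\<integral>\<^sup>+x. ennreal
        (fst x * (fst x * fst (snd x)) powr p * \<bar>rep_aefun u x\<bar> powr q) \<partial>sigma_measure M)"

text \<open>\<open>u\<close> is a critical point if the energy is finite at \<open>u\<close> and its Frechet derivative there is 0.\<close>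

definition critical_point ::
    "'n::finite pt set \<Rightarrow> real \<Rightarrow> real \<Rightarrow> real \<Rightarrow> 'n pt aefun \<Rightarrow> bool" where
  "critical_point M p q lam u \<longleftrightarrow>
     u \<in> E_space M p \<and> \<bar>energy M p q lam u\<bar> \<noteq> \<infinity> \<and>
     (\<forall>\<epsilon>>0. \<exists>r>0. \<forall>v\<in>E_space M p. E_norm M p v < r \<longrightarrow>
        \<bar>energy M p q lam (u + v) - energy M p q lam u\<bar> \<le> ereal (\<epsilon> * E_norm M p v))"

definition critical_value :: "'n::finite pt set \<Rightarrow> real \<Rightarrow> real \<Rightarrow> real \<Rightarrow> real \<Rightarrow> bool" where
  "critical_value M p q lam c \<longleftrightarrow>
     (\<exists>u. critical_point M p q lam u \<and> energy M p q lam u = ereal c)"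

definition unit_ball :: "'n::finite pt set \<Rightarrow> real \<Rightarrow> 'n pt aefun set" where
  "unit_ball M p = {u \<in> E_space M p. E_norm M p u \<le> 1}"

definition unit_sphere :: "'n::finite pt set \<Rightarrow> real \<Rightarrow> 'n pt aefun set" where
  "unit_sphere M p = {u \<in> E_space M p. E_norm M p u = 1}"

definition A0 :: "'n::finite pt set \<Rightarrow> real \<Rightarrow> real \<Rightarrow> real \<Rightarrow> 'n pt aefun set" where
  "A0 M p q lam = {u \<in> E_space M p. 0 \<le> energy M p q lam u \<and> energy M p q lam u < \<infinity>}"

text \<open>Only the restriction of \<open>h\<close> to \<open>E\<close> matters.\<close>

definition Gamma ::
    "'n::finite pt set \<Rightarrow> real \<Rightarrow> real \<Rightarrow> real \<Rightarrow> ('n pt aefun \<Rightarrow> 'n pt aefun) set" where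
  "Gamma M p q lam =
     {h. homeomorphic_map (E_topology M p) (E_topology M p) h \<and> h 0 = 0 \<and>
         (\<forall>u\<in>E_space M p. h (- u) = - h u) \<and> h ` unit_ball M p \<subseteq> A0 M p q lam}"

text \<open>The library's \<open>dim\<close> is also 0 for infinite-dimensional spaces, hence the explicit finite basis.\<close>

definition has_dimension :: "'a::real_vector set \<Rightarrow> nat \<Rightarrow> bool" where
  "has_dimension V m \<longleftrightarrow> (\<exists>b. finite b \<and> independent b \<and> span b = V \<and> card b = m)"

definition complement_in :: "'a::real_vector topology \<Rightarrow> 'a set \<Rightarrow> 'a set \<Rightarrow> bool" where
  "complement_in T V W \<longleftrightarrow>
     subspace W \<and> V \<inter> W = {0} \<and> {v + w |v w. v \<in> V \<and> w \<in> W} = topspace T \<and>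
     (\<exists>P. continuous_map T T P \<and> (\<forall>v\<in>V. \<forall>w\<in>W. P (v + w) = v))"

definition minmax_value ::
    "'n::finite pt set \<Rightarrow> real \<Rightarrow> real \<Rightarrow> real \<Rightarrow> 'n pt aefun set \<Rightarrow> ereal" where
  "minmax_value M p q lam W =
     (SUP h\<in>Gamma M p q lam. INF u\<in>unit_sphere M p \<inter> W. energy M p q lam (h u))"

end

theory Submission imports Defs begin

text \<open>Write N for the norm of the energy space E and K for the L^q norm with the weight of the
  nonlinear term, so that J(u) = N(u)^p / p - lam / q K(u)^q. A vector with K <= e N and norm n
  satisfies J >= n^p / (2 p) as long as n is at most a constant times e^(-q/(q-p))
  (\<open>energy_lower_bound\<close>). Hence it is enough to find, for every e > 0 and every large
  m, an odd homeomorphism of E that fixes 0 and carries the complement \<open>Fc m\<close> into the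
  cone K <= e N. A radial rescaling then puts the map into \<open>Gamma\<close> and makes J as large
  as desired on the image of the unit sphere of \<open>Fc m\<close>
  (\<open>normalized_homeomorphism\<close>). The complements are arbitrary, so the homeomorphism has
  to move \<open>Fc m\<close> instead of relying on K being small there.

  Such a map exists because the opposite cone K >= eps N has finite genus. The corner is cut into
  cells of size r for the fields x1 d1, x1 x2 d2, d'. Normalised averages x_i over the cells satisfy
  a Bessel inequality, sum |x_i(u)|^p <= Cx N(u)^p, and a local Sobolev-Poincare inequality shows
  that K(u) >= eps N(u) forces |x_i(u)| > eta N(u) for some i (\<open>detection\<close>). At most M
  indices can be that large, so by \<open>vandermonde\<close> the first M power moments of the
  soft-thresholded sequence do not vanish together: they map the cone, away from 0, into R^M without
  the origin, continuously and homogeneously. Next, R^M is identified with the span V of M vectors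
  on which K is much smaller than N; these are dilates of one bump in x2, since dilations preserve N
  and shrink K (\<open>flat_directions\<close>). Adding a long multiple of the resulting vector of V
  to z, for z in the kernel of the projection onto V, drowns K(z) in the norm of the V-part
  (\<open>graph_small\<close>). Before this, a linear shear takes the kernel of the projection along
  \<open>Fc m\<close> to the kernel of the projection onto V; it exists once \<open>F m\<close>
  contains vectors dual to the functionals that define the latter (\<open>dual_in_dense\<close>).
  \<open>minimax_values_large\<close> composes the pieces.

  The analytic input comes out of the data. Since c 1 is a real number, \<open>Gamma\<close> is not
  empty; a member of \<open>Gamma\<close> maps the unit ball onto a neighbourhood of 0 where J >= 0,
  and by scaling this is a bound K <= CK N (\<open>Gamma_embedding\<close>). Testing that bound with
  functions concentrated at x1 = 0 gives q <= p (p + 1) (\<open>exponent_bound\<close>), which keeps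
  the cell constants bounded up to the faces x1 = 0 and x2 = 0. A bump function is obtained from a
  nonzero element of E (\<open>bump_exists\<close>).\<close>

section \<open>Subspaces with a norm, their neighbourhood filters and continuous self-maps\<close>

definition linear_fun_on :: "'a::real_vector set \<Rightarrow> ('a \<Rightarrow> 'b::real_vector) \<Rightarrow> bool" where
  "linear_fun_on E f \<longleftrightarrow>
     (\<forall>u\<in>E. \<forall>v\<in>E. f (u + v) = f u + f v) \<and> (\<forall>c. \<forall>u\<in>E. f (c *\<^sub>R u) = c *\<^sub>R f u)"

definition homogeneous_on :: "'a::real_vector set \<Rightarrow> ('a \<Rightarrow> 'b::real_vector) \<Rightarrow> bool" where
  "homogeneous_on E f \<longleftrightarrow> (\<forall>c. \<forall>u\<in>E. f (c *\<^sub>R u) = c *\<^sub>R f u)"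

text \<open>The type of classes modulo null sets carries no norm, so the norm is a function
  \<open>N\<close> on a subspace of a bare vector space. Nonnegativity and evenness are asked of all
  vectors, which spares membership conditions in \<open>N_commute\<close> and in the filter
  arguments.\<close>

locale normed_subspace =
  fixes E :: "'a::real_vector set" and N :: "'a \<Rightarrow> real"
  assumes sub: "subspace E"
    and N_ge0: "N u \<ge> 0"
    and N_zero: "u \<in> E \<Longrightarrow> N u = 0 \<Longrightarrow> u = 0"
    and N_minus: "N (- u) = N u"
    and N_scale: "u \<in> E \<Longrightarrow> N (c *\<^sub>R u) = \<bar>c\<bar> * N u"
    and N_tri: "u \<in> E \<Longrightarrow> v \<in> E \<Longrightarrow> N (u + v) \<le> N u + N v"
begin

lemma mem [simp, intro]:
  "0 \<in> E" "u \<in> E \<Longrightarrow> v \<in> E \<Longrightarrow> u + v \<in> E" "u \<in> E \<Longrightarrow> v \<in> E \<Longrightarrow> u - v \<in> E"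
  "u \<in> E \<Longrightarrow> c *\<^sub>R u \<in> E" "u \<in> E \<Longrightarrow> - u \<in> E"
  using sub by (auto simp: subspace_0 subspace_add subspace_diff subspace_mul subspace_neg)

lemma mem_sum [intro]: "(\<And>i. i \<in> I \<Longrightarrow> f i \<in> E) \<Longrightarrow> (\<Sum>i\<in>I. f i) \<in> E"
  using sub by (rule subspace_sum)

lemma N_0 [simp]: "N 0 = 0"
  using N_scale[of 0 0] by simp

lemma N_commute: "N (u - v) = N (v - u)"
  using N_minus[of "u - v"] by simp

lemma N_diff: "u \<in> E \<Longrightarrow> v \<in> E \<Longrightarrow> N (u - v) \<le> N u + N v"
  using N_tri[of u "- v"] N_minus[of v] by simp

lemma N_rev: "u \<in> E \<Longrightarrow> v \<in> E \<Longrightarrow> \<bar>N u - N v\<bar> \<le> N (u - v)"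
  using N_tri[of "u - v" v] N_tri[of "v - u" u] N_commute[of u v] by simp

lemma N_pos: "u \<in> E \<Longrightarrow> u \<noteq> 0 \<Longrightarrow> N u > 0"
  using N_zero[of u] N_ge0[of u] by fastforce

lemma N_sum: "finite I \<Longrightarrow> (\<And>i. i \<in> I \<Longrightarrow> f i \<in> E) \<Longrightarrow> N (\<Sum>i\<in>I. f i) \<le> (\<Sum>i\<in>I. N (f i))"
proof (induction I rule: finite_induct)
  case (insert i I)
  then show ?case using N_tri[of "f i" "\<Sum>i\<in>I. f i"] mem_sum[of I f] by force
qed simp

text \<open>The neighbourhood filter of \<open>u\<close> in the metric space \<open>E\<close>,
  written with filters so that continuity becomes \<open>filterlim\<close> and the usual limit rules
  apply.\<close>

definition nb :: "'a \<Rightarrow> 'a filter" where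
  "nb u = inf (filtercomap (\<lambda>v. N (v - u)) (nhds 0)) (principal E)"

lemma filterlim_nb:
  "filterlim f (nb l) F \<longleftrightarrow> eventually (\<lambda>x. f x \<in> E) F \<and> ((\<lambda>x. N (f x - l)) \<longlongrightarrow> 0) F"
  unfolding nb_def filterlim_inf filterlim_principal filterlim_filtercomap_iff
  by (auto simp: o_def)

lemma nb_id: "eventually (\<lambda>x. x \<in> E) (nb l)" "((\<lambda>x. N (x - l)) \<longlongrightarrow> 0) (nb l)"
  using filterlim_nb[of "\<lambda>x. x" l "nb l"] filterlim_ident[of "nb l"] by auto

lemma eventually_nb: "eventually P (nb u) \<longleftrightarrow> (\<exists>d>0. \<forall>v\<in>E. N (v - u) < d \<longrightarrow> P v)"
proof
  assume "eventually P (nb u)"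
  then have "eventually (\<lambda>v. v \<in> E \<longrightarrow> P v) (filtercomap (\<lambda>v. N (v - u)) (nhds 0))"
    unfolding nb_def eventually_inf_principal .
  then obtain d where "d > 0" "\<And>v. dist (N (v - u)) 0 < d \<Longrightarrow> v \<in> E \<Longrightarrow> P v"
    unfolding eventually_filtercomap eventually_nhds_metric by blast
  then show "\<exists>d>0. \<forall>v\<in>E. N (v - u) < d \<longrightarrow> P v"
    using N_ge0 by (auto intro!: exI[of _ d])
next
  assume "\<exists>d>0. \<forall>v\<in>E. N (v - u) < d \<longrightarrow> P v"
  then obtain d where d: "d > 0" "\<And>v. v \<in> E \<Longrightarrow> N (v - u) < d \<Longrightarrow> P v" by blast
  have "eventually (\<lambda>v. N (v - u) < d) (nb u)"
    using order_tendstoD(2)[OF nb_id(2) d(1)] .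
  with nb_id(1) show "eventually P (nb u)"
    by eventually_elim (use d in auto)
qed

text \<open>Norms, seminorms and bounded functionals are all Lipschitz for \<open>N\<close>; their
  continuity is derived from here.\<close>

lemma tendsto_lip:
  assumes "filterlim f (nb a) F" "a \<in> E"
    and "\<And>u v. u \<in> E \<Longrightarrow> v \<in> E \<Longrightarrow> \<bar>s u - s v :: real\<bar> \<le> C * N (u - v)"
  shows "((\<lambda>x. s (f x)) \<longlongrightarrow> s a) F"
proof -
  have "((\<lambda>x. s (f x) - s a) \<longlongrightarrow> 0) F"
  proof (rule Lim_null_comparison)
    show "\<forall>\<^sub>F x in F. norm (s (f x) - s a) \<le> C * N (f x - a)"
      using assms(1) unfolding filterlim_nb
      by (auto elim!: eventually_mono intro: assms)
    show "((\<lambda>x. C * N (f x - a)) \<longlongrightarrow> 0) F"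
      using assms(1) unfolding filterlim_nb by (auto intro: tendsto_mult_right_zero)
  qed
  then show ?thesis by (simp add: LIM_zero_iff)
qed

lemma tendsto_N: "filterlim f (nb a) F \<Longrightarrow> a \<in> E \<Longrightarrow> ((\<lambda>x. N (f x)) \<longlongrightarrow> N a) F"
  by (rule tendsto_lip[where C = 1]) (auto intro: N_rev)

lemma nb_add:
  assumes "filterlim f (nb a) F" "filterlim g (nb b) F" "a \<in> E" "b \<in> E"
  shows "filterlim (\<lambda>x. f x + g x) (nb (a + b)) F"
  unfolding filterlim_nb
proof
  show "\<forall>\<^sub>F x in F. f x + g x \<in> E"
    using assms(1,2) unfolding filterlim_nb by (auto elim: eventually_elim2)
  have ev: "\<forall>\<^sub>F x in F. f x \<in> E \<and> g x \<in> E"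
    using assms(1,2) unfolding filterlim_nb by (auto elim: eventually_elim2)
  show "((\<lambda>x. N (f x + g x - (a + b))) \<longlongrightarrow> 0) F"
  proof (rule Lim_null_comparison)
    show "\<forall>\<^sub>F x in F. norm (N (f x + g x - (a + b))) \<le> N (f x - a) + N (g x - b)"
      using ev
    proof eventually_elim
      case (elim x)
      have "N (f x + g x - (a + b)) \<le> N (f x - a) + N (g x - b)"
        using N_tri[of "f x - a" "g x - b"] elim assms unfolding add_diff_add by auto
      then show ?case using N_ge0 by simp
    qed
    show "((\<lambda>x. N (f x - a) + N (g x - b)) \<longlongrightarrow> 0) F"
      using assms(1,2) unfolding filterlim_nb by (auto intro: tendsto_add_zero)
  qed
qed

lemma nb_scale:
  assumes "filterlim f (nb a) F" "(r \<longlongrightarrow> c) F" "a \<in> E"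
  shows "filterlim (\<lambda>x. r x *\<^sub>R f x) (nb (c *\<^sub>R a)) F"
  unfolding filterlim_nb
proof
  have ev: "\<forall>\<^sub>F x in F. f x \<in> E" and lim: "((\<lambda>x. N (f x - a)) \<longlongrightarrow> 0) F"
    using assms(1) unfolding filterlim_nb by auto
  then show "\<forall>\<^sub>F x in F. r x *\<^sub>R f x \<in> E" by (auto elim: eventually_mono)
  show "((\<lambda>x. N (r x *\<^sub>R f x - c *\<^sub>R a)) \<longlongrightarrow> 0) F"
  proof (rule Lim_null_comparison)
    show "\<forall>\<^sub>F x in F. norm (N (r x *\<^sub>R f x - c *\<^sub>R a)) \<le> \<bar>r x\<bar> * N (f x - a) + \<bar>r x - c\<bar> * N a"
      using ev
    proof eventually_elim
      case (elim x)
      have "r x *\<^sub>R f x - c *\<^sub>R a = r x *\<^sub>R (f x - a) + (r x - c) *\<^sub>R a" by (simp add: algebra_simps)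
      then show ?case
        using N_tri[of "r x *\<^sub>R (f x - a)" "(r x - c) *\<^sub>R a"] elim assms N_ge0 by (auto simp: N_scale)
    qed
    have "((\<lambda>x. \<bar>r x\<bar> * N (f x - a) + \<bar>r x - c\<bar> * N a) \<longlongrightarrow> \<bar>c\<bar> * 0 + \<bar>c - c\<bar> * N a) F"
      by (intro tendsto_intros assms lim)
    then show "((\<lambda>x. \<bar>r x\<bar> * N (f x - a) + \<bar>r x - c\<bar> * N a) \<longlongrightarrow> 0) F" by simp
  qed
qed

lemma nb_const: "a \<in> E \<Longrightarrow> filterlim (\<lambda>x. a) (nb a) F"
  by (simp add: filterlim_nb)

lemma nb_sum:
  assumes "finite I" "\<And>i. i \<in> I \<Longrightarrow> filterlim (f i) (nb (a i)) F" "\<And>i. i \<in> I \<Longrightarrow> a i \<in> E"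
  shows "filterlim (\<lambda>x. \<Sum>i\<in>I. f i x) (nb (\<Sum>i\<in>I. a i)) F"
  using assms
proof (induction I rule: finite_induct)
  case (insert i I)
  have "filterlim (\<lambda>x. f i x + (\<Sum>i\<in>I. f i x)) (nb (a i + (\<Sum>i\<in>I. a i))) F"
    using insert by (intro nb_add mem_sum) auto
  with insert(1,2) show ?case by simp
qed (simp add: nb_const)

lemma nb_diff:
  assumes "filterlim f (nb a) F" "filterlim g (nb b) F" "a \<in> E" "b \<in> E"
  shows "filterlim (\<lambda>x. f x - g x) (nb (a - b)) F"
  using nb_add[OF assms(1) nb_scale[OF assms(2) tendsto_const[of "-1"] assms(4)]] assms by simp

definition cont_op :: "('a \<Rightarrow> 'a) \<Rightarrow> bool" where
  "cont_op f \<longleftrightarrow> f ` E \<subseteq> E \<and> (\<forall>u\<in>E. filterlim f (nb (f u)) (nb u))"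

lemma cont_op_mem: "cont_op f \<Longrightarrow> u \<in> E \<Longrightarrow> f u \<in> E"
  by (auto simp: cont_op_def)

lemma cont_opD: "cont_op f \<Longrightarrow> u \<in> E \<Longrightarrow> filterlim f (nb (f u)) (nb u)"
  by (auto simp: cont_op_def)

lemma cont_op_id: "cont_op (\<lambda>u. u)"
  by (auto simp: cont_op_def filterlim_ident)

lemma cont_op_compose: "cont_op f \<Longrightarrow> cont_op g \<Longrightarrow> cont_op (\<lambda>u. f (g u))"
  unfolding cont_op_def image_subset_iff by (metis filterlim_compose)

lemma cont_op_add: "cont_op f \<Longrightarrow> cont_op g \<Longrightarrow> cont_op (\<lambda>u. f u + g u)"
  unfolding cont_op_def image_subset_iff by (auto intro!: nb_add)

lemma cont_op_diff: "cont_op f \<Longrightarrow> cont_op g \<Longrightarrow> cont_op (\<lambda>u. f u - g u)"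
  unfolding cont_op_def image_subset_iff by (auto intro!: nb_diff)

lemma metric: "Metric_space E (\<lambda>u v. N (u - v))"
proof
  fix x y z
  show "0 \<le> N (x - y)" by (rule N_ge0)
  assume "x \<in> E" "y \<in> E"
  then show "(N (x - y) = 0) = (x = y)" using N_zero[of "x - y"] by auto
  assume "z \<in> E"
  with \<open>x \<in> E\<close> \<open>y \<in> E\<close> show "N (x - z) \<le> N (x - y) + N (y - z)"
    using N_tri[of "x - y" "y - z"] by simp
qed (rule N_commute)

end

section \<open>Moments of finite sequences and soft thresholds\<close>

text \<open>A Vandermonde system with at most \<open>M\<close> distinct nodes and \<open>M\<close>
  vanishing moments has only the trivial solution. Instead of a determinant, the polynomial
  vanishing at every node except \<open>i0\<close> is paired with \<open>c\<close>.\<close>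

lemma vandermonde:
  fixes c :: "nat \<Rightarrow> real"
  assumes "finite I" "card I \<le> M"
    and z: "\<And>k. k < M \<Longrightarrow> (\<Sum>i\<in>I. real i ^ k * c i) = 0" and "i0 \<in> I"
  shows "c i0 = 0"
proof -
  \<comment> \<open>Multiplying out one linear factor raises the exponent by one, so the statement
    carries a spare power \<open>k\<close> for the induction on the factors.\<close>
  have *: "(\<Sum>i\<in>I. (\<Prod>j\<in>J. real i - real j) * real i ^ k * c i) = 0"
    if "finite J" "card J + k < M" for J k
    using that
  proof (induction J arbitrary: k rule: finite_induct)
    case (insert j J)
    have "(\<Sum>i\<in>I. (\<Prod>j\<in>insert j J. real i - real j) * real i ^ k * c i)
        = (\<Sum>i\<in>I. (\<Prod>j\<in>J. real i - real j) * real i ^ Suc k * c i)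
          - real j * (\<Sum>i\<in>I. (\<Prod>j\<in>J. real i - real j) * real i ^ k * c i)"
      unfolding sum_distrib_left sum_subtractf[symmetric]
      by (rule sum.cong) (use insert(1,2) in \<open>auto simp: algebra_simps\<close>)
    also have "\<dots> = 0" using insert.IH[of "Suc k"] insert.IH[of k] insert.prems insert.hyps by simp
    finally show ?case .
  qed (use z in auto)
  have "card (I - {i0}) + 0 < M"
    using assms by (metis add.right_neutral card_Diff1_less order_less_le_trans)
  from *[OF _ this] have "(\<Sum>i\<in>I. (\<Prod>j\<in>I - {i0}. real i - real j) * c i) = 0"
    using assms by simp
  moreover have "(\<Prod>j\<in>I - {i0}. real i - real j) * c i = 0" if "i \<in> I - {i0}" for i
    using that assms(1) by (simp add: prod_zero_iff) 
  ultimately have "(\<Prod>j\<in>I - {i0}. real i0 - real j) * c i0 = 0"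
    using assms(1,4) by (simp add: sum.remove[of I i0])
  moreover have "(\<Prod>j\<in>I - {i0}. real i0 - real j) \<noteq> 0"
    using assms(1) by (auto simp: prod_zero_iff)
  ultimately show ?thesis by simp
qed

text \<open>For \<open>s >= 0\<close> this moves \<open>y\<close> towards 0 by \<open>s\<close> and
  is 0 when \<open>|y| <= s\<close>. Unlike a hard cut-off it is jointly continuous, so a coordinate
  enters the moments below without a jump.\<close>

definition soft_threshold :: "real \<Rightarrow> real \<Rightarrow> real" where
  "soft_threshold s y = y - max (- s) (min s y)"

lemma soft_threshold_eq_0: "s \<ge> 0 \<Longrightarrow> soft_threshold s y = 0 \<longleftrightarrow> \<bar>y\<bar> \<le> s"
  unfolding soft_threshold_def by linarith

lemma soft_threshold_scale: "s \<ge> 0 \<Longrightarrow> soft_threshold (\<bar>c\<bar> * s) (c * y) = c * soft_threshold s y"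
proof -
  assume s: "s \<ge> 0"
  consider "c > 0" | "c = 0" | "c < 0" by linarith
  then show ?thesis
  proof cases
    case 1
    have "c * y \<le> - (c * s) \<longleftrightarrow> y \<le> - s" "c * s \<le> c * y \<longleftrightarrow> s \<le> y"
      "- (c * s) \<le> c * y \<longleftrightarrow> - s \<le> y" "c * y \<le> c * s \<longleftrightarrow> y \<le> s" "- (c * s) \<le> c * s"
      using 1 s mult_le_cancel_left_pos[OF 1, of y "- s"] mult_le_cancel_left_pos[OF 1, of "- s" y] by auto
    with 1 s show ?thesis unfolding soft_threshold_def max_def min_def by (auto simp: algebra_simps)
  next
    case 3
    have "c * s \<le> 0" using 3 s by (simp add: mult_nonpos_nonneg)
    then have "c * y \<le> - (c * s) \<longleftrightarrow> - s \<le> y" "c * s \<le> c * y \<longleftrightarrow> y \<le> s"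
      "- (c * s) \<le> c * y \<longleftrightarrow> y \<le> - s" "c * y \<le> c * s \<longleftrightarrow> s \<le> y" "c * s \<le> - (c * s)"
      using 3 mult_le_cancel_left_neg[OF 3, of y "- s"] mult_le_cancel_left_neg[OF 3, of "- s" y] by auto
    with 3 s show ?thesis unfolding soft_threshold_def max_def min_def by (auto simp: algebra_simps)
  qed (simp add: soft_threshold_def)
qed

section \<open>Shears, radial maps and dual systems\<close>

context normed_subspace
begin

lemma cont_op_iff:
  "cont_op f \<longleftrightarrow> f ` E \<subseteq> E \<and>
     (\<forall>u\<in>E. \<forall>e>0. \<exists>d>0. \<forall>v\<in>E. N (v - u) < d \<longrightarrow> N (f v - f u) < e)"
proof -
  have "filterlim f (nb (f u)) (nb u) \<longleftrightarrow>
      (\<forall>e>0. \<exists>d>0. \<forall>v\<in>E. N (v - u) < d \<longrightarrow> N (f v - f u) < e)" if "f ` E \<subseteq> E" "u \<in> E" for u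
  proof -
    have "eventually (\<lambda>x. f x \<in> E) (nb u)"
      using nb_id(1) by eventually_elim (use that in auto)
    then show ?thesis
      unfolding filterlim_nb tendsto_iff eventually_nb using N_ge0 by auto
  qed
  note * = this
  show ?thesis unfolding cont_op_def by (rule conj_cong[OF refl], rule ball_cong[OF refl], rule *)
qed

lemma continuous_map_iff:
  "continuous_map (Metric_space.mtopology E (\<lambda>u v. N (u - v))) (Metric_space.mtopology E (\<lambda>u v. N (u - v))) f
    \<longleftrightarrow> cont_op f"
proof -
  have "(\<forall>x. x \<in> E \<and> N (a - x) < d \<longrightarrow> N (f a - f x) < e) \<longleftrightarrow>
      (\<forall>v\<in>E. N (v - a) < d \<longrightarrow> N (f v - f a) < e)" for a d e
    unfolding N_commute[of a] N_commute[of "f a"] by blast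
  then show ?thesis unfolding Metric_space.metric_continuous_map[OF metric metric] cont_op_iff by simp
qed

lemma linear_fun_onD:
  assumes "linear_fun_on E f" "u \<in> E" "v \<in> E"
  shows "f (u + v) = f u + f v" "f (c *\<^sub>R u) = c *\<^sub>R f u" "f (u - v) = f u - f v" "f 0 = 0"
proof -
  have add: "f (x + y) = f x + f y" and sc: "f (c *\<^sub>R x) = c *\<^sub>R f x" if "x \<in> E" "y \<in> E" for x y c
    using assms(1) that unfolding linear_fun_on_def by auto
  show "f (u + v) = f u + f v" "f (c *\<^sub>R u) = c *\<^sub>R f u" using add sc assms by auto
  show "f (u - v) = f u - f v"
    using add[of u "(-1) *\<^sub>R v"] sc[of v v "-1"] assms by simp
  show "f 0 = 0" using sc[of u u 0] assms by simp
qed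

lemma linear_fun_on_sum:
  assumes "linear_fun_on E f" "finite J" "\<And>j. j \<in> J \<Longrightarrow> g j \<in> E"
  shows "f (\<Sum>j\<in>J. g j) = (\<Sum>j\<in>J. f (g j))"
  using assms(2,3)
proof (induction J rule: finite_induct)
  case empty
  show ?case using linear_fun_onD(4)[OF assms(1) mem(1) mem(1)] by simp
next
  case (insert j J)
  then have "f (g j + (\<Sum>j\<in>J. g j)) = f (g j) + f (\<Sum>j\<in>J. g j)"
    by (intro linear_fun_onD(1)[OF assms(1)] mem_sum) auto
  with insert show ?case by simp
qed

lemma homogeneous_on_0: "homogeneous_on E f \<Longrightarrow> f 0 = 0"
proof -
  assume "homogeneous_on E f"
  then have "f (0 *\<^sub>R 0) = 0 *\<^sub>R f 0" unfolding homogeneous_on_def using mem(1) by blast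
  then show ?thesis by simp
qed

lemma tendsto_lin:
  assumes "linear_fun_on E f" "\<And>u. u \<in> E \<Longrightarrow> \<bar>f u :: real\<bar> \<le> C * N u"
    and "filterlim g (nb a) F" "a \<in> E"
  shows "((\<lambda>x. f (g x)) \<longlongrightarrow> f a) F"
proof (rule tendsto_lip[OF assms(3,4)])
  fix u v assume uv: "u \<in> E" "v \<in> E"
  have "f u - f v = f (u - v)" using linear_fun_onD(3)[OF assms(1)] uv by simp
  with uv show "\<bar>f u - f v\<bar> \<le> C * N (u - v)" using assms(2) by auto
qed

text \<open>The inverse exists since the shear does not change \<open>u - B u\<close>.\<close>

lemma shear:
  assumes A: "cont_op A" and B: "cont_op B" and linB: "linear_fun_on E B"
    and BA: "\<And>u. u \<in> E \<Longrightarrow> B (A u) = A u"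
  defines "S \<equiv> \<lambda>u. u + A (u - B u)" and "S' \<equiv> \<lambda>u. u - A (u - B u)"
  shows "cont_op S" "cont_op S'" "\<And>u. u \<in> E \<Longrightarrow> S' (S u) = u" "\<And>u. u \<in> E \<Longrightarrow> S (S' u) = u"
    and "homogeneous_on E A \<Longrightarrow> homogeneous_on E S \<and> homogeneous_on E S'"
proof -
  have c: "cont_op (\<lambda>u. A (u - B u))"
    by (intro cont_op_compose[OF A] cont_op_diff cont_op_id B)
  show "cont_op S" "cont_op S'" unfolding S_def S'_def
    by (intro cont_op_add cont_op_diff cont_op_id c)+
  note mems = cont_op_mem[OF A] cont_op_mem[OF B]
  have BD: "B (u + v) = B u + B v" "B (c *\<^sub>R u) = c *\<^sub>R B u" if "u \<in> E" "v \<in> E" for u v c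
    using linB that unfolding linear_fun_on_def by auto
  have Bm: "B (u - v) = B u - B v" if "u \<in> E" "v \<in> E" for u v
    using BD(1)[of u "(-1) *\<^sub>R v"] BD(2)[of v v "-1"] that by auto
  fix u assume u: "u \<in> E"
  then have Au: "A (u - B u) \<in> E" using mems by auto
  have "S u - B (S u) = u - B u" "S' u - B (S' u) = u - B u"
    unfolding S_def S'_def using u Au BA[of "u - B u"] mems(2)[of u] by (auto simp: BD Bm)
  note e = this
  have "S' (S u) = S u - A (S u - B (S u))" by (simp only: S'_def)
  also have "\<dots> = u" unfolding e(1) by (simp add: S_def)
  finally show "S' (S u) = u" .
  have "S (S' u) = S' u + A (S' u - B (S' u))" by (simp only: S_def)
  also have "\<dots> = u" unfolding e(2) by (simp add: S'_def)
  finally show "S (S' u) = u" .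
next
  assume hA: "homogeneous_on E A"
  have "A (c *\<^sub>R u - B (c *\<^sub>R u)) = c *\<^sub>R A (u - B u)" if u: "u \<in> E" for c u
  proof -
    have "c *\<^sub>R u - B (c *\<^sub>R u) = c *\<^sub>R (u - B u)"
      using linB u unfolding linear_fun_on_def by (simp add: algebra_simps)
    then show ?thesis using hA u cont_op_mem[OF B] unfolding homogeneous_on_def by auto
  qed
  then show "homogeneous_on E S \<and> homogeneous_on E S'"
    unfolding homogeneous_on_def S_def S'_def by (auto simp: algebra_simps)
qed

text \<open>The factor \<open>r\<close> is constant along lines through 0, so it can be read off
  again from \<open>g (h u)\<close>, a multiple of \<open>u\<close>, and divided out. At 0 the
  factor has no limit in general; its bounds are what gives continuity there.\<close>

lemma radial:
  assumes f: "cont_op f" and g: "cont_op g"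
    and gf: "\<And>u. u \<in> E \<Longrightarrow> g (f u) = u" and fg: "\<And>u. u \<in> E \<Longrightarrow> f (g u) = u"
    and hf: "homogeneous_on E f" and hg: "homogeneous_on E g"
    and r0: "\<And>u c. u \<in> E \<Longrightarrow> c \<noteq> 0 \<Longrightarrow> r (c *\<^sub>R u) = r u"
    and rc: "\<And>u. u \<in> E \<Longrightarrow> u \<noteq> 0 \<Longrightarrow> (r \<longlongrightarrow> r u) (nb u)"
    and rb: "\<And>u. u \<in> E \<Longrightarrow> u \<noteq> 0 \<Longrightarrow> a \<le> r u \<and> r u \<le> b" and a: "0 < (a::real)"
  defines "h \<equiv> \<lambda>u. r u *\<^sub>R f u" and "h' \<equiv> \<lambda>w. (1 / r (g w)) *\<^sub>R g w"
  shows "cont_op h" "cont_op h'" "\<And>u. u \<in> E \<Longrightarrow> h' (h u) = u" "\<And>u. u \<in> E \<Longrightarrow> h (h' u) = u"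
    "homogeneous_on E h"
proof -
  have f0: "f 0 = 0" "g 0 = 0"
    using hf hg homogeneous_on_0 by auto
  have *: "cont_op (\<lambda>u. s u *\<^sub>R k u)"
    if k: "cont_op k" "k 0 = 0" and sb: "\<And>u. u \<in> E \<Longrightarrow> u \<noteq> 0 \<Longrightarrow> \<bar>s u\<bar> \<le> b'"
      and sc: "\<And>u. u \<in> E \<Longrightarrow> u \<noteq> 0 \<Longrightarrow> (s \<longlongrightarrow> s u) (nb u)" for k and s :: "'a \<Rightarrow> real" and b'
    unfolding cont_op_def
  proof (intro conjI ballI)
    show "(\<lambda>u. s u *\<^sub>R k u) ` E \<subseteq> E" using cont_op_mem[OF k(1)] by auto
    fix u assume u: "u \<in> E"
    show "filterlim (\<lambda>u. s u *\<^sub>R k u) (nb (s u *\<^sub>R k u)) (nb u)"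
    proof (cases "u = 0")
      case False
      then show ?thesis using u by (intro nb_scale cont_opD k sc cont_op_mem[OF k(1)])
    next
      \<comment> \<open>At 0 the factor is only bounded, and \<open>k 0 = 0\<close> forces the
        product to 0.\<close>
      case True
      have "((\<lambda>v. N (s v *\<^sub>R k v)) \<longlongrightarrow> 0) (nb 0)"
      proof (rule Lim_null_comparison)
        show "\<forall>\<^sub>F v in nb 0. norm (N (s v *\<^sub>R k v)) \<le> \<bar>b'\<bar> * N (k v)"
          using nb_id(1)
        proof eventually_elim
          case (elim v)
          show ?case
          proof (cases "v = 0")
            case False
            then have "\<bar>s v\<bar> \<le> \<bar>b'\<bar>" using sb[OF elim False] by linarith
            then show ?thesis
              using elim N_ge0 cont_op_mem[OF k(1)] by (auto simp: N_scale mult_right_mono)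
          qed (use k in auto)
        qed
        have "((\<lambda>v. N (k v)) \<longlongrightarrow> N (k 0)) (nb 0)"
          using cont_opD[OF k(1) mem(1)] k(2) by (intro tendsto_N) auto
        then show "((\<lambda>v. \<bar>b'\<bar> * N (k v)) \<longlongrightarrow> 0) (nb 0)"
          using k by (auto intro: tendsto_mult_right_zero)
      qed
      moreover have "\<forall>\<^sub>F v in nb 0. s v *\<^sub>R k v \<in> E"
        using nb_id(1) by eventually_elim (use cont_op_mem[OF k(1)] in auto)
      ultimately show ?thesis using True k by (auto simp: filterlim_nb)
    qed
  qed
  have g_nz: "g w \<noteq> 0" if "w \<in> E" "w \<noteq> 0" for w
    using fg[OF that(1)] f0 that by auto
  show "cont_op h" unfolding h_def
  proof (rule *[OF f f0(1) _ rc, where b' = b])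
    fix u assume "u \<in> E" "u \<noteq> 0"
    from rb[OF this] a show "\<bar>r u\<bar> \<le> b" by linarith
  qed
  show "cont_op h'" unfolding h'_def
  proof (rule *[OF g f0(2), where b' = "1 / a"])
    fix u assume u: "u \<in> E" "u \<noteq> 0"
    have gu: "g u \<in> E" "g u \<noteq> 0" using cont_op_mem[OF g u(1)] g_nz[OF u] by auto
    show "\<bar>1 / r (g u)\<bar> \<le> 1 / a" using rb[OF gu] a by (simp add: frac_le)
    have "((\<lambda>x. r (g x)) \<longlongrightarrow> r (g u)) (nb u)"
      by (rule filterlim_compose[OF rc[OF gu] cont_opD[OF g u(1)]])
    then show "((\<lambda>x. 1 / r (g x)) \<longlongrightarrow> 1 / r (g u)) (nb u)"
      using rb[OF gu] a by (intro tendsto_intros) auto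
  qed
  fix u assume u: "u \<in> E"
  show "h' (h u) = u"
  proof (cases "u = 0")
    case False
    then have "r u \<noteq> 0" using rb[OF u] a by auto
    moreover have "g (r u *\<^sub>R f u) = r u *\<^sub>R u"
      using hg gf[OF u] cont_op_mem[OF f u] unfolding homogeneous_on_def by auto
    ultimately show ?thesis unfolding h_def h'_def using r0[OF u] by auto
  qed (simp add: h_def h'_def f0)
  show "h (h' u) = u"
  proof (cases "u = 0")
    case False
    have gu: "g u \<in> E" "g u \<noteq> 0" using cont_op_mem[OF g u] g_nz[OF u False] by auto
    then have "r (g u) \<noteq> 0" using rb[OF gu] a by auto
    moreover have "f ((1 / r (g u)) *\<^sub>R g u) = (1 / r (g u)) *\<^sub>R u"
      using hf fg[OF u] gu unfolding homogeneous_on_def by auto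
    ultimately show ?thesis unfolding h_def h'_def using r0[OF gu(1)] by auto
  qed (simp add: h_def h'_def f0)
next
  show "homogeneous_on E h" unfolding homogeneous_on_def
  proof (intro allI ballI)
    fix c u assume u: "u \<in> E"
    have "f (c *\<^sub>R u) = c *\<^sub>R f u" using hf u unfolding homogeneous_on_def by auto
    moreover have "f 0 = 0"
      using hf homogeneous_on_0 by auto
    ultimately show "h (c *\<^sub>R u) = c *\<^sub>R h u" unfolding h_def using r0[OF u, of c] by (cases "c = 0") auto
  qed
qed

text \<open>Gram-Schmidt inside \<open>D\<close>: a vector of \<open>D\<close> close to the next
  \<open>v m\<close>, corrected by the earlier \<open>d j\<close>, is annihilated by the earlier
  functionals and still seen by \<open>f m\<close>. This allows a dual system to be taken from the
  union of the finite-dimensional spaces \<open>F m\<close>.\<close>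

lemma dual_in_dense:
  fixes f :: "nat \<Rightarrow> 'a \<Rightarrow> real"
  assumes D: "subspace D" "D \<subseteq> E" and dense: "\<And>u e. u \<in> E \<Longrightarrow> e > 0 \<Longrightarrow> \<exists>w\<in>D. N (w - u) < e"
    and lin: "\<And>i. i < M \<Longrightarrow> linear_fun_on E (f i)"
    and bd: "\<And>i u. i < M \<Longrightarrow> u \<in> E \<Longrightarrow> \<bar>f i u\<bar> \<le> C * N u"
    and v: "\<And>i. i < M \<Longrightarrow> v i \<in> E" "\<And>i j. i < M \<Longrightarrow> j < M \<Longrightarrow> f i (v j) = (if i = j then 1 else 0)"
  shows "\<exists>d. (\<forall>j<M. d j \<in> D) \<and> (\<forall>i<M. \<forall>j<M. f i (d j) = (if i = j then 1 else 0))"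
  using lin bd v
proof (induction M)
  case (Suc m)
  have "\<exists>d. (\<forall>j<m. d j \<in> D) \<and> (\<forall>i<m. \<forall>j<m. f i (d j) = (if i = j then 1 else 0))"
    by (rule Suc.IH) (use Suc.prems in auto)
  then obtain d where d: "\<And>j. j < m \<Longrightarrow> d j \<in> D"
    "\<And>i j. i < m \<Longrightarrow> j < m \<Longrightarrow> f i (d j) = (if i = j then 1 else 0)" by blast
  note linD = linear_fun_onD[OF Suc.prems(1), unfolded real_scaleR_def]
  note fsum = linear_fun_on_sum[OF Suc.prems(1)]
  have dE: "d j \<in> E" if "j < m" for j using d that D by auto
  define P where "P w = w - (\<Sum>j<m. f j w *\<^sub>R d j)" for w
  have PE: "P w \<in> E" if "w \<in> E" for w unfolding P_def using that dE by auto
  have PD: "P w \<in> D" if "w \<in> D" for w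
    unfolding P_def using that d D(1) by (auto intro!: subspace_diff subspace_sum subspace_mul)
  have fP: "f i (P w) = f i w - (\<Sum>j<m. f j w * f i (d j))" if "i < Suc m" "w \<in> E" for i w
  proof -
    have "f i (\<Sum>j<m. f j w *\<^sub>R d j) = (\<Sum>j<m. f i (f j w *\<^sub>R d j))"
      using that dE by (intro fsum) auto
    also have "\<dots> = (\<Sum>j<m. f j w * f i (d j))"
      using that dE by (intro sum.cong refl linD(2)[where v = 0]) auto
    finally show ?thesis unfolding P_def using that dE by (subst linD(3)) auto
  qed
  have fP0: "f i (P w) = 0" if "i < m" "w \<in> E" for i w
    using fP[of i w] that d(2)[of i] by (simp add: if_distrib cong: if_cong)
  have tl: "((\<lambda>w. f i w) \<longlongrightarrow> f i (v m)) (nb (v m))" if "i < Suc m" for i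
    using that Suc.prems
    by (intro tendsto_lin[OF Suc.prems(1) Suc.prems(2), where g = "\<lambda>w. w"]) (auto simp: filterlim_ident)
  have "((\<lambda>w. f m w - (\<Sum>j<m. f j w * f m (d j))) \<longlongrightarrow>
      f m (v m) - (\<Sum>j<m. f j (v m) * f m (d j))) (nb (v m))"
    by (intro tendsto_intros tl) auto
  \<comment> \<open>Duality of \<open>v\<close> makes the sum vanish at \<open>v m\<close> and
    leaves \<open>f m (v m) = 1\<close>; so \<open>f m (P w)\<close> is positive for
    \<open>w\<close> near \<open>v m\<close>.\<close>
  then have "((\<lambda>w. f m w - (\<Sum>j<m. f j w * f m (d j))) \<longlongrightarrow> 1) (nb (v m))"
    using Suc.prems(4) by simp
  from order_tendstoD(1)[OF this zero_less_one] obtain e where e: "e > 0"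
    "\<And>w. w \<in> E \<Longrightarrow> N (w - v m) < e \<Longrightarrow> 0 < f m w - (\<Sum>j<m. f j w * f m (d j))"
    unfolding eventually_nb by blast
  obtain w where w: "w \<in> D" "N (w - v m) < e" using dense[OF Suc.prems(3)[of m] e(1)] by auto
  have wE: "w \<in> E" using w D by auto
  define x where "x = (1 / f m (P w)) *\<^sub>R P w"
  have fmP: "f m (P w) \<noteq> 0" using e(2)[OF wE w(2)] fP[of m w] wE by simp
  have fx: "f i x = (1 / f m (P w)) * f i (P w)" if "i < Suc m" for i
    unfolding x_def using that by (intro linD(2)[where v = 0] PE wE) auto
  have x: "x \<in> D" "x \<in> E" "f m x = 1" "\<And>i. i < m \<Longrightarrow> f i x = 0"
    using PD[OF w(1)] PE[OF wE] fmP fP0 wE D(1) unfolding fx[OF less_SucI] fx[OF lessI]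
    unfolding x_def by (auto simp: subspace_mul)
  \<comment> \<open>The earlier vectors may still pair with \<open>f m\<close>; a multiple of
    \<open>x\<close>, invisible to the earlier functionals, removes this.\<close>
  define d' where "d' j = (if j = m then x else d j - f m (d j) *\<^sub>R x)" for j
  have "d' j \<in> D" if "j < Suc m" for j
    unfolding d'_def using that x d D(1) by (auto intro!: subspace_diff subspace_mul simp: less_Suc_eq)
  moreover have "f i (d' j) = (if i = j then 1 else 0)" if "i < Suc m" "j < Suc m" for i j
  proof (cases "j = m")
    case True
    then show ?thesis using that x by (auto simp: d'_def less_Suc_eq)
  next
    case False
    then have j: "j < m" using that by simp
    have "f i (d' j) = f i (d j) - f m (d j) * f i x"
      using False j x(2) dE[OF j] linD(2)[OF that(1) x(2) x(2)] by (simp add: d'_def linD(3)[OF that(1)])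
    then show ?thesis using that j x d(2) by (auto simp: less_Suc_eq)
  qed
  ultimately show ?case by blast
qed auto

end

section \<open>Bessel families of functionals and their moment maps\<close>

text \<open>\<open>x_sum\<close> is a Bessel inequality with exponent \<open>p\<close>, as satisfied
  by normalised integrals over disjoint sets. It limits how many functionals can be large at one
  vector.\<close>

locale almost_orthogonal_functionals = normed_subspace E N
  for E :: "'a::real_vector set" and N +
  fixes x :: "nat \<Rightarrow> 'a \<Rightarrow> real" and p Cx :: real
  assumes x_lin: "linear_fun_on E (x i)"
    and x_sum: "finite I \<Longrightarrow> u \<in> E \<Longrightarrow> (\<Sum>i\<in>I. \<bar>x i u\<bar> powr p) \<le> Cx * N u powr p"
    and p_pos: "p > 0"
begin

lemma x_bound: "u \<in> E \<Longrightarrow> \<bar>x i u\<bar> \<le> Cx powr (1/p) * N u"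
proof -
  assume u: "u \<in> E"
  have le: "\<bar>x i u\<bar> powr p \<le> Cx * N u powr p" using x_sum[of "{i}" u] u by simp
  have "\<bar>x i u\<bar> = (\<bar>x i u\<bar> powr p) powr (1/p)" using p_pos by (simp add: powr_powr)
  also have "\<dots> \<le> (Cx * N u powr p) powr (1/p)" using le p_pos by (intro powr_mono2) auto
  also have "\<dots> = Cx powr (1/p) * N u"
  proof (cases "u = 0")
    case False
    then have "0 < N u powr p" using N_pos[OF u] by simp
    moreover have "0 \<le> Cx * N u powr p" using le by (rule order_trans[rotated]) simp
    ultimately have "Cx \<ge> 0" by (simp add: zero_le_mult_iff)
    then show ?thesis using p_pos N_ge0 by (simp add: powr_mult powr_powr)
  qed simp
  finally show ?thesis .
qed

text \<open>Chebyshev's counting argument; the bound \<open>M\<close> is the same for all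
  \<open>u\<close>, which makes finitely many moments sufficient.\<close>

lemma large_finite:
  assumes u: "u \<in> E" "u \<noteq> 0" and e: "e > 0" and M: "Cx / e powr p \<le> real M"
  shows "finite {i. \<bar>x i u\<bar> > e * N u} \<and> card {i. \<bar>x i u\<bar> > e * N u} \<le> M"
proof (rule finite_if_finite_subsets_card_bdd)
  fix G assume G: "G \<subseteq> {i. e * N u < \<bar>x i u\<bar>}" "finite G"
  have Nu: "N u > 0" by (rule N_pos[OF u])
  have "real (card G) * (e * N u) powr p = (\<Sum>i\<in>G. (e * N u) powr p)" by simp
  also have "\<dots> \<le> (\<Sum>i\<in>G. \<bar>x i u\<bar> powr p)"
    using G e Nu p_pos by (intro sum_mono powr_mono2) auto
  also have "\<dots> \<le> Cx * N u powr p" by (rule x_sum[OF G(2) u(1)])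
  finally have "real (card G) * (e powr p * N u powr p) \<le> Cx * N u powr p"
    using e Nu by (simp add: powr_mult)
  then have "real (card G) * e powr p \<le> Cx" using Nu by (simp add: mult.assoc[symmetric])
  then have "real (card G) \<le> Cx / e powr p" using e by (simp add: pos_le_divide_eq)
  with M show "card G \<le> M" by linarith
qed

text \<open>Power moments of the thresholded coordinates, with the index as node. They turn a finite
  set of large coordinates, whose position depends on \<open>u\<close>, into a fixed number of
  continuous functions. The threshold is proportional to \<open>N u\<close> for the sake of
  homogeneity.\<close>

definition moment :: "real \<Rightarrow> nat \<Rightarrow> 'a \<Rightarrow> real" where
  "moment e k u = (\<Sum>i | \<bar>x i u\<bar> > e * N u. real i ^ k * soft_threshold (e * N u) (x i u))"

lemma moment_0 [simp]: "moment e k 0 = 0"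
  using linear_fun_onD(4)[OF x_lin mem(1) mem(1)] unfolding moment_def by simp

lemma moment_homogeneous: "e > 0 \<Longrightarrow> homogeneous_on E (moment e k)"
  unfolding homogeneous_on_def
proof (intro allI ballI)
  fix c u assume u: "u \<in> E" and e: "e > 0"
  have eq: "x i (c *\<^sub>R u) = c * x i u" for i using linear_fun_onD(2)[OF x_lin u u] by simp
  show "moment e k (c *\<^sub>R u) = c *\<^sub>R moment e k u"
  proof (cases "c = 0")
    case False
    have "{i. \<bar>x i (c *\<^sub>R u)\<bar> > e * N (c *\<^sub>R u)} = {i. \<bar>x i u\<bar> > e * N u}"
      using False u by (auto simp: eq N_scale abs_mult mult.left_commute[of e])
    moreover have "soft_threshold (e * N (c *\<^sub>R u)) (x i (c *\<^sub>R u)) = c * soft_threshold (e * N u) (x i u)" for i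
      using soft_threshold_scale[of "e * N u" c "x i u"] u e N_ge0[of u]
      by (simp add: eq N_scale mult.left_commute)
    ultimately show ?thesis unfolding moment_def by (simp add: sum_distrib_left mult.left_commute)
  qed simp
qed

text \<open>A nonzero sequence carried by at most \<open>M\<close> indices has a nonzero moment of
  order below \<open>M\<close>, by \<open>vandermonde\<close>. So the vectors having a large
  coordinate are mapped into \<open>M\<close>-space without the origin.\<close>

lemma moment_nonzero:
  assumes u: "u \<in> E" and e: "e > 0" and M: "Cx / e powr p \<le> real M"
    and i: "\<bar>x i u\<bar> > e * N u"
  shows "\<exists>k<M. moment e k u \<noteq> 0"
proof (rule ccontr)
  assume "\<not> ?thesis"
  then have mom: "\<And>k. k < M \<Longrightarrow> moment e k u = 0" by auto
  have "u \<noteq> 0" using i linear_fun_onD(4)[OF x_lin u u] by auto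
  then have fin: "finite {i. \<bar>x i u\<bar> > e * N u}" "card {i. \<bar>x i u\<bar> > e * N u} \<le> M"
    using large_finite[OF u _ e M] by auto
  have "soft_threshold (e * N u) (x i u) = 0"
    using i mom by (intro vandermonde[OF fin, where c = "\<lambda>i. soft_threshold (e * N u) (x i u)"])
      (auto simp: moment_def)
  then show False using i e N_ge0[of u] by (simp add: soft_threshold_eq_0)
qed

text \<open>Near \<open>u\<close> only the finitely many indices in \<open>J\<close>, which pass
  half the threshold at \<open>u\<close>, can pass the full one, so locally the moment is a fixed
  finite sum of continuous functions.\<close>

lemma moment_tendsto:
  assumes u: "u \<in> E" "u \<noteq> 0" and e: "e > 0"
  shows "(moment e k \<longlongrightarrow> moment e k u) (nb u)"
proof -
  define J where "J = {i. \<bar>x i u\<bar> > (e/2) * N u}"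
  have finJ: "finite J"
    using large_finite[OF u, of "e/2" "nat \<lceil>Cx / (e/2) powr p\<rceil>", OF _ real_nat_ceiling_ge] e
    unfolding J_def by auto
  define C where "C = Cx powr (1/p)"
  have Nu: "N u > 0" by (rule N_pos[OF u])
  \<comment> \<open>Per unit of distance a coordinate moves by at most \<open>C\<close> and the
    threshold by at most \<open>e\<close>; the gap between the two thresholds at \<open>u\<close> is
    \<open>e * N u / 2\<close>.\<close>
  have eq: "moment e k v = (\<Sum>i\<in>J. real i ^ k * soft_threshold (e * N v) (x i v))"
    if v: "v \<in> E" "N (v - u) * (C + e) \<le> e * N u / 2" for v
    unfolding moment_def
  proof (rule sum.mono_neutral_left[OF finJ])
    show "{i. e * N v < \<bar>x i v\<bar>} \<subseteq> J"
    proof (rule ccontr)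
      assume "\<not> ?thesis"
      then obtain i where i: "e * N v < \<bar>x i v\<bar>" "\<bar>x i u\<bar> \<le> e * N u / 2" unfolding J_def by force
      have "x i v - x i u = x i (v - u)" using linear_fun_onD(3)[OF x_lin v(1) u(1)] by simp
      then have "\<bar>x i v\<bar> \<le> \<bar>x i u\<bar> + C * N (v - u)"
        using x_bound[of "v - u" i] v(1) u unfolding C_def by auto
      moreover have "e * N u - e * N (v - u) \<le> e * N v"
        using N_rev[OF v(1) u(1)] e by (simp add: right_diff_distrib[symmetric] mult_left_mono)
      ultimately show False using i v(2) by (simp add: algebra_simps)
    qed
    show "\<forall>i\<in>J - {i. e * N v < \<bar>x i v\<bar>}. real i ^ k * soft_threshold (e * N v) (x i v) = 0"
      using e N_ge0[of v] by (auto simp: soft_threshold_eq_0)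
  qed
  have C: "C \<ge> 0" unfolding C_def by simp
  have "((\<lambda>v. N (v - u) * (C + e)) \<longlongrightarrow> 0 * (C + e)) (nb u)"
    by (intro tendsto_intros nb_id)
  then have "((\<lambda>v. N (v - u) * (C + e)) \<longlongrightarrow> 0) (nb u)" by simp
  from order_tendstoD(2)[OF this, of "e * N u / 2"] Nu e
  have "\<forall>\<^sub>F v in nb u. N (v - u) * (C + e) < e * N u / 2" by simp
  with nb_id(1)
  have ev: "\<forall>\<^sub>F v in nb u. (\<Sum>i\<in>J. real i ^ k * soft_threshold (e * N v) (x i v)) = moment e k v"
    by eventually_elim (use eq in auto)
  have "((\<lambda>v. \<Sum>i\<in>J. real i ^ k * soft_threshold (e * N v) (x i v)) \<longlongrightarrow>
      (\<Sum>i\<in>J. real i ^ k * soft_threshold (e * N u) (x i u))) (nb u)"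
    unfolding soft_threshold_def
    by (intro tendsto_intros tendsto_lin[OF x_lin x_bound] tendsto_N filterlim_ident u(1))
  also have "(\<Sum>i\<in>J. real i ^ k * soft_threshold (e * N u) (x i u)) = moment e k u"
    using eq[OF u(1)] e Nu by simp
  finally show ?thesis using tendsto_cong[OF ev] by simp
qed

end

text \<open>\<open>K\<close> plays the role of the \<open>q\<close>-th root of the nonquadratic term.\<close>

locale seminorm_on = normed_subspace E N
  for E :: "'a::real_vector set" and N +
  fixes K :: "'a \<Rightarrow> real" and C :: real
  assumes K_ge0: "K u \<ge> 0"
    and K_scale: "u \<in> E \<Longrightarrow> K (c *\<^sub>R u) = \<bar>c\<bar> * K u"
    and K_tri: "u \<in> E \<Longrightarrow> v \<in> E \<Longrightarrow> K (u + v) \<le> K u + K v"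
    and K_bound: "u \<in> E \<Longrightarrow> K u \<le> C * N u"
    and C_pos: "C > 0"
begin

lemma K_rev: "u \<in> E \<Longrightarrow> v \<in> E \<Longrightarrow> \<bar>K u - K v\<bar> \<le> C * N (u - v)"
  using K_tri[of "u - v" v] K_tri[of "v - u" u] K_bound[of "u - v"] K_bound[of "v - u"] N_commute[of u v]
  by auto

lemma tendsto_K: "filterlim f (nb a) F \<Longrightarrow> a \<in> E \<Longrightarrow> ((\<lambda>x. K (f x)) \<longlongrightarrow> K a) F"
  by (rule tendsto_lip[where C = C]) (auto intro: K_rev)

end

section \<open>The nonlinear shear into directions where \<open>K\<close> is small\<close>

text \<open>The vectors \<open>v k\<close> span a space on which \<open>K\<close> is at most
  \<open>eps\<close> times the norm, with a projection \<open>P\<close> of norm at most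
  \<open>C0\<close>. There are as many of them as moments, so the moments can be used as coordinates
  in that space.\<close>

locale odd_modification = almost_orthogonal_functionals E N x p Cx + seminorm_on E N K C
  for E :: "'a::real_vector set" and N x p Cx K C +
  fixes eps eta C0 :: real and M :: nat and v :: "nat \<Rightarrow> 'a" and f :: "nat \<Rightarrow> 'a \<Rightarrow> real"
  assumes eps: "eps > 0" and eta: "eta > 0" and C0: "C0 \<ge> 1"
    and M: "Cx / eta powr p \<le> real M"
    and detect: "u \<in> E \<Longrightarrow> u \<noteq> 0 \<Longrightarrow> K u \<ge> eps * N u \<Longrightarrow> \<exists>i. \<bar>x i u\<bar> > eta * N u"
    and v: "k < M \<Longrightarrow> v k \<in> E" "j < M \<Longrightarrow> k < M \<Longrightarrow> f j (v k) = (if j = k then 1 else 0)"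
    and f_lin: "k < M \<Longrightarrow> linear_fun_on E (f k)"
    and P_bound: "u \<in> E \<Longrightarrow> N (\<Sum>k<M. f k u *\<^sub>R v k) \<le> C0 * N u"
    and V_small: "K (\<Sum>k<M. a k *\<^sub>R v k) \<le> eps * N (\<Sum>k<M. a k *\<^sub>R v k)"
begin

definition P :: "'a \<Rightarrow> 'a" where "P u = (\<Sum>k<M. f k u *\<^sub>R v k)"
definition G0 :: "'a \<Rightarrow> 'a" where "G0 u = (\<Sum>k<M. moment eta k u *\<^sub>R v k)"
text \<open>A cut-off in the ratio of \<open>K u\<close> to \<open>eps * N u\<close>: 0 up to ratio
  1 and 1 from ratio 2 on. Where it is positive, \<open>G0\<close> does not vanish by
  \<open>G0_nonzero\<close>, so the division in \<open>G\<close> is harmless.\<close>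

definition chi :: "'a \<Rightarrow> real" where "chi u = max 0 (min 1 (K u / (eps * N u) - 1))"
text \<open>The direction of \<open>G0\<close> with a new length. Where \<open>chi u = 1\<close>,
  the length is \<open>C / eps * N u\<close>, so that \<open>eps * N (G u)\<close> equals the
  general bound \<open>C * N u\<close> for \<open>K u\<close>.\<close>

definition G :: "'a \<Rightarrow> 'a" where "G u = (C / eps * chi u * N u / N (G0 u)) *\<^sub>R G0 u"

lemma P_mem: "u \<in> E \<Longrightarrow> P u \<in> E" and G0_mem: "G0 u \<in> E" and G_mem: "G u \<in> E"
  unfolding P_def G_def G0_def using v by auto

lemma f_sum: "j < M \<Longrightarrow> f j (\<Sum>k<M. a k *\<^sub>R v k) = a j"
proof -
  assume j: "j < M"
  have "f j (\<Sum>k<M. a k *\<^sub>R v k) = (\<Sum>k<M. f j (a k *\<^sub>R v k))"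
    using v j by (intro linear_fun_on_sum f_lin) auto
  also have "\<dots> = (\<Sum>k<M. a k * (if j = k then 1 else 0))"
    using v j linear_fun_onD(2)[OF f_lin[OF j] _ mem(1)] by (intro sum.cong) auto
  also have "\<dots> = a j" using j by (simp add: if_distrib cong: if_cong)
  finally show ?thesis .
qed

lemma P_sum: "P (\<Sum>k<M. a k *\<^sub>R v k) = (\<Sum>k<M. a k *\<^sub>R v k)"
  unfolding P_def by (intro sum.cong refl) (simp add: f_sum)

lemma P_lin: "linear_fun_on E P"
  unfolding linear_fun_on_def P_def
  using linear_fun_onD[OF f_lin] by (auto simp: scaleR_add_left sum.distrib scaleR_sum_right)

lemma cont_linear:
  assumes "linear_fun_on E A" "A ` E \<subseteq> E" "\<And>u. u \<in> E \<Longrightarrow> N (A u) \<le> D * N u"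
  shows "cont_op A"
  unfolding cont_op_def
proof (intro conjI ballI assms(2))
  fix u assume u: "u \<in> E"
  have "((\<lambda>w. N (A w - A u)) \<longlongrightarrow> 0) (nb u)"
  proof (rule Lim_null_comparison)
    show "\<forall>\<^sub>F w in nb u. norm (N (A w - A u)) \<le> D * N (w - u)"
      using nb_id(1)
    proof eventually_elim
      case (elim w)
      then show ?case using assms(3)[of "w - u"] linear_fun_onD(3)[OF assms(1) elim u] u N_ge0 by simp
    qed
    show "((\<lambda>w. D * N (w - u)) \<longlongrightarrow> 0) (nb u)" by (intro tendsto_mult_right_zero nb_id)
  qed
  moreover have "\<forall>\<^sub>F w in nb u. A w \<in> E" using nb_id(1) by eventually_elim (use assms(2) in auto)
  ultimately show "filterlim A (nb (A u)) (nb u)" unfolding filterlim_nb by simp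
qed

lemma P_cont: "cont_op P"
  by (rule cont_linear[OF P_lin, where D = C0]) (use P_mem P_bound in \<open>auto simp: P_def\<close>)

lemma G_P: "P (G u) = G u"
proof -
  have "G u = (\<Sum>k<M. (C / eps * chi u * N u / N (G0 u) * moment eta k u) *\<^sub>R v k)"
    unfolding G_def by (subst (2) G0_def) (simp add: scaleR_sum_right)
  then show ?thesis using P_sum by metis
qed

lemma G0_nonzero: "u \<in> E \<Longrightarrow> u \<noteq> 0 \<Longrightarrow> K u \<ge> eps * N u \<Longrightarrow> G0 u \<noteq> 0"
proof
  assume u: "u \<in> E" "u \<noteq> 0" "K u \<ge> eps * N u" and 0: "G0 u = 0"
  from detect[OF u] moment_nonzero[OF u(1) eta M] obtain k where k: "k < M" "moment eta k u \<noteq> 0" by blast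
  have "moment eta k u = f k (G0 u)" unfolding G0_def using f_sum[OF k(1)] by simp
  also have "\<dots> = 0" using linear_fun_onD(4)[OF f_lin[OF k(1)] mem(1) mem(1)] 0 by simp
  finally show False using k by simp
qed

lemma G0_hom: "homogeneous_on E G0"
  using moment_homogeneous[OF eta] unfolding homogeneous_on_def G0_def by (simp add: scaleR_sum_right)

lemma G_hom: "homogeneous_on E G"
  unfolding homogeneous_on_def
proof (intro allI ballI)
  fix c u assume u: "u \<in> E"
  have G0c: "G0 (c *\<^sub>R u) = c *\<^sub>R G0 u" using G0_hom u unfolding homogeneous_on_def by auto
  show "G (c *\<^sub>R u) = c *\<^sub>R G u"
  proof (cases "c = 0")
    case False
    then have "chi (c *\<^sub>R u) = chi u" unfolding chi_def using u by (simp add: K_scale N_scale)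
    then show ?thesis using False u G0_mem[of u] unfolding G_def G0c by (simp add: N_scale field_simps)
  qed (simp add: G_def)
qed

lemma chi_01: "0 \<le> chi u" "chi u \<le> 1"
  unfolding chi_def by auto

lemma N_G: "u \<in> E \<Longrightarrow> N (G u) \<le> C / eps * N u"
proof -
  assume u: "u \<in> E"
  have "N (G u) = C / eps * chi u * N u / N (G0 u) * N (G0 u)"
    unfolding G_def using C_pos eps chi_01[of u] N_ge0[of u] N_ge0[of "G0 u"] G0_mem[of u] by (simp add: N_scale)
  also have "\<dots> \<le> C / eps * chi u * N u"
    using C_pos eps chi_01[of u] N_ge0[of u] by (cases "N (G0 u) = 0") auto
  also have "\<dots> \<le> C / eps * 1 * N u"
    using C_pos eps chi_01[of u] N_ge0[of u] by (intro mult_right_mono mult_left_mono) auto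
  finally show ?thesis by simp
qed

text \<open>Three regimes: the bound \<open>N_G\<close> at 0, local vanishing of \<open>G\<close>
  where the ratio is below 1, and a nonzero \<open>G0 u\<close> with continuous moments everywhere
  else.\<close>

lemma G_cont: "cont_op G"
  unfolding cont_op_def
proof (intro conjI ballI)
  show "G ` E \<subseteq> E" using G_mem by auto
  fix u assume u: "u \<in> E"
  consider "u = 0" | "u \<noteq> 0" "K u < eps * N u" | "u \<noteq> 0" "K u \<ge> eps * N u" by linarith
  then show "filterlim G (nb (G u)) (nb u)"
  proof cases
    case 1
    have "G u = 0" using 1 by (simp add: G_def)
    moreover have "((\<lambda>w. N (G w)) \<longlongrightarrow> 0) (nb 0)"
    proof (rule Lim_null_comparison)
      show "\<forall>\<^sub>F w in nb 0. norm (N (G w)) \<le> C / eps * N w"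
        using nb_id(1) by eventually_elim (use N_G N_ge0 in auto)
      show "((\<lambda>w. C / eps * N w) \<longlongrightarrow> 0) (nb 0)"
        using nb_id(2)[of 0] by (intro tendsto_mult_right_zero) simp
    qed
    ultimately show ?thesis using 1 G_mem by (simp add: filterlim_nb)
  next
    case 2
    have z: "G w = 0" if "K w < eps * N w" for w
    proof -
      have "0 < eps * N w" using that K_ge0[of w] by linarith
      then have "K w / (eps * N w) < 1" using that by simp
      then show ?thesis by (simp add: G_def chi_def)
    qed
    have "((\<lambda>w. eps * N w - K w) \<longlongrightarrow> eps * N u - K u) (nb u)"
      by (intro tendsto_intros tendsto_N tendsto_K filterlim_ident u)
    from order_tendstoD(1)[OF this, of 0] 2 have "\<forall>\<^sub>F w in nb u. 0 < eps * N w - K w" by simp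
    then have "\<forall>\<^sub>F w in nb u. G w = 0" by eventually_elim (use z in auto)
    then have ev: "\<forall>\<^sub>F w in nb u. 0 = G w" by eventually_elim simp
    have "filterlim (\<lambda>w. 0) (nb 0) (nb u)" by (rule nb_const) simp
    then show ?thesis using filterlim_cong[OF refl refl ev] z[OF 2(2)] by simp
  next
    case 3
    have "N u > 0" using N_pos[OF u 3(1)] .
    moreover have "N (G0 u) > 0" using N_pos[OF G0_mem] G0_nonzero u 3 by auto
    moreover have G0: "filterlim G0 (nb (G0 u)) (nb u)"
      unfolding G0_def[abs_def] using v u 3 eta
      by (intro nb_sum nb_scale nb_const moment_tendsto) auto
    ultimately show ?thesis unfolding G_def[abs_def] chi_def using eps u G0_mem
      by (intro nb_scale tendsto_intros tendsto_N tendsto_K filterlim_ident) auto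
  qed
qed

text \<open>Because \<open>P z = 0\<close>, the projection recovers \<open>G z\<close> from
  \<open>u = z + G z\<close>, so \<open>N (G z)\<close> and \<open>N z\<close> are both controlled
  by \<open>N u\<close>. Either \<open>K z <= 2 * eps * N z\<close> already, or
  \<open>chi z = 1\<close> and the added vector is so long that
  \<open>K z <= C * N z = eps * N (G z)\<close>.\<close>

lemma graph_small:
  assumes z: "z \<in> E" "P z = 0"
  shows "K (z + G z) \<le> 5 * C0 * eps * N (z + G z)"
proof -
  define u where "u = z + G z"
  have uE: "u \<in> E" unfolding u_def using z G_mem by auto
  have Gu: "G z = P u" unfolding u_def using linear_fun_onD(1)[OF P_lin z(1) G_mem] z G_P by simp
  have NG: "N (G z) \<le> C0 * N u" unfolding Gu P_def by (rule P_bound[OF uE])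
  have "z = u - G z" unfolding u_def by simp
  then have "N z \<le> N u + N (G z)" using N_diff[OF uE G_mem, of z] by simp
  also have "\<dots> \<le> 2 * C0 * N u" using NG mult_right_mono[OF C0 N_ge0[of u]] by simp
  finally have Nz: "N z \<le> 2 * C0 * N u" .
  have "K (G z) \<le> eps * N (G z)" unfolding Gu P_def by (rule V_small)
  also have "\<dots> \<le> eps * (C0 * N u)" using NG eps by (intro mult_left_mono) auto
  finally have KG: "K (G z) \<le> eps * C0 * N u" by simp
  have nn: "0 \<le> eps * C0 * N u" using eps C0 N_ge0[of u] by simp
  have "K z \<le> 4 * eps * C0 * N u"
  proof (cases "K z \<le> 2 * eps * N z")
    case True
    also have "2 * eps * N z \<le> 2 * eps * (2 * C0 * N u)" using Nz eps by (intro mult_left_mono) auto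
    finally show ?thesis by simp
  next
    case False
    then have z0: "z \<noteq> 0" using K_scale[of 0 0] by auto
    have Nzp: "N z > 0" by (rule N_pos[OF z(1) z0])
    have "2 \<le> K z / (eps * N z)" using False Nzp eps by (simp add: pos_le_divide_eq)
    then have "chi z = 1" unfolding chi_def by simp
    moreover have "eps * N z \<le> 2 * eps * N z" using Nzp eps by simp
    then have "eps * N z \<le> K z" using False by linarith
    then have "G0 z \<noteq> 0" by (rule G0_nonzero[OF z(1) z0])
    then have "N (G0 z) > 0" using N_pos[OF G0_mem] by auto
    ultimately have "N (G z) = C / eps * N z"
      unfolding G_def using C_pos eps Nzp G0_mem by (simp add: N_scale)
    with NG have "C * N z \<le> eps * C0 * N u" using eps by (simp add: field_simps)
    with K_bound[OF z(1)] nn show ?thesis by linarith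
  qed
  with KG K_tri[OF z(1) G_mem[of z]] have "K u \<le> 4 * eps * C0 * N u + eps * C0 * N u"
    unfolding u_def[symmetric] by linarith
  also have "\<dots> = 5 * C0 * eps * N u" by (simp add: algebra_simps)
  finally show ?thesis unfolding u_def .
qed

end

section \<open>Radial normalisation and the abstract min-max bound\<close>

text \<open>Here \<open>n\<close> is the norm of a vector and \<open>b\<close> its ratio of
  \<open>K\<close> to the norm. The upper bound on \<open>n\<close> says that the term with exponent
  \<open>q\<close> consumes at most half of \<open>n powr p / p\<close>. The summand
  \<open>e\<close> keeps that bound finite for \<open>b = 0\<close>.\<close>

lemma energy_lower_bound:
  fixes p q lam n b e :: real
  assumes p: "0 < p" "p < q" and lam: "lam > 0" and n: "n \<ge> 0" and b: "b \<ge> 0" and e: "e > 0"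
    and n_le: "n \<le> (q / (2 * p * lam)) powr (1 / (q - p)) / (b + e) powr (q / (q - p))"
  shows "n powr p / (2 * p) \<le> n powr p / p - lam / q * (n * b) powr q"
proof -
  define k where "k = q / (2 * p * lam)"
  have k: "k > 0" unfolding k_def using p lam by simp
  have "n powr (q - p) * b powr q \<le>
      (k powr (1 / (q - p)) / (b + e) powr (q / (q - p))) powr (q - p) * b powr q"
    using n_le n p unfolding k_def by (intro mult_right_mono powr_mono2) auto
  also have "\<dots> = k / (b + e) powr q * b powr q"
    using p k by (simp add: powr_divide powr_powr)
  also have "\<dots> = k * (b powr q / (b + e) powr q)" by simp
  also have "\<dots> \<le> k * 1"
    using b e p k by (intro mult_left_mono) (auto simp: divide_le_eq intro!: powr_mono2)
  finally have *: "n powr (q - p) * b powr q \<le> k" by simp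
  have "(n * b) powr q = n powr p * (n powr (q - p) * b powr q)"
    using n b by (simp add: powr_mult powr_add[symmetric] mult.assoc[symmetric])
  also have "\<dots> \<le> n powr p * k" using * by (intro mult_left_mono) auto
  finally have "lam / q * (n * b) powr q \<le> lam / q * (n powr p * k)"
    using lam p by (intro mult_left_mono) auto
  also have "\<dots> = n powr p / (2 * p)" unfolding k_def using p lam by (simp add: field_simps)
  finally show ?thesis by (simp add: field_simps)
qed

context normed_subspace
begin

lemma homogeneous_bounded:
  assumes "cont_op f" "homogeneous_on E f"
  shows "\<exists>B>0. \<forall>u\<in>E. N (f u) \<le> B * N u"
proof -
  have f0: "f 0 = 0" using homogeneous_on_0[OF assms(2)] .
  then obtain d where d: "d > 0" "\<And>v. v \<in> E \<Longrightarrow> N v < d \<Longrightarrow> N (f v) < 1"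
    using assms(1) mem(1) zero_less_one unfolding cont_op_iff by (metis diff_zero)
  have "N (f u) \<le> 2 / d * N u" if u: "u \<in> E" for u
  proof (cases "u = 0")
    case False
    then have Nu: "N u > 0" by (rule N_pos[OF u])
    define c where "c = d / (2 * N u)"
    have c: "c > 0" unfolding c_def using d Nu by simp
    have "N (c *\<^sub>R u) < d" using u c d Nu by (simp add: N_scale c_def)
    then have "N (f (c *\<^sub>R u)) < 1" using d u by auto
    moreover have "f (c *\<^sub>R u) = c *\<^sub>R f u" using assms(2) u unfolding homogeneous_on_def by auto
    ultimately have "c * N (f u) < 1" using c cont_op_mem[OF assms(1) u] by (simp add: N_scale)
    then show ?thesis unfolding c_def using d Nu by (simp add: field_simps)
  qed (simp add: f0)
  then show ?thesis using d(1) by (intro exI[of _ "2/d"]) auto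
qed

lemma homogeneous_on_compose:
  "homogeneous_on E f \<Longrightarrow> homogeneous_on E g \<Longrightarrow> g ` E \<subseteq> E \<Longrightarrow> homogeneous_on E (\<lambda>u. f (g u))"
  unfolding homogeneous_on_def by auto

end

context seminorm_on
begin

lemma normalized_homeomorphism:
  assumes f: "cont_op f" and g: "cont_op g"
    and gf: "\<And>u. u \<in> E \<Longrightarrow> g (f u) = u" and fg: "\<And>u. u \<in> E \<Longrightarrow> f (g u) = u"
    and hf: "homogeneous_on E f" and hg: "homogeneous_on E g"
    and p: "0 < p" "p < q" and lam: "lam > 0" and e: "e > 0"
  shows "\<exists>h h'. cont_op h \<and> cont_op h' \<and> (\<forall>u\<in>E. h' (h u) = u \<and> h (h' u) = u) \<and> homogeneous_on E h \<and>
     (\<forall>u\<in>E. N u \<le> 1 \<longrightarrow> 0 \<le> N (h u) powr p / p - lam / q * K (h u) powr q) \<and>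
     (\<forall>u\<in>E. N u = 1 \<longrightarrow> K (f u) \<le> e * N (f u) \<longrightarrow>
        ((q / (2 * p * lam)) powr (1 / (q - p)) / (2 * e) powr (q / (q - p))) powr p / (2 * p)
          \<le> N (h u) powr p / p - lam / q * K (h u) powr q)"
proof -
  define k where "k = (q / (2 * p * lam)) powr (1 / (q - p))"
  define s where "s = q / (q - p)"
  have k: "k > 0" unfolding k_def using p lam by simp
  have s: "s > 0" unfolding s_def using p by simp
  define rho where "rho w = k / (K w / N w + e) powr s" for w
  \<comment> \<open>The quotient \<open>N u / N (f u)\<close> first gives \<open>f u\<close> the
    length of \<open>u\<close>; this yields \<open>N (h u) = rho (f u) * N u\<close>.\<close>
  define r where "r u = rho (f u) * (N u / N (f u))" for u
  note fE = cont_op_mem[OF f] note gE = cont_op_mem[OF g]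
  have fnz: "f u \<noteq> 0" if "u \<in> E" "u \<noteq> 0" for u
    using gf[OF that(1)] homogeneous_on_0[OF hg] that by auto
  have b0: "0 \<le> K w / N w" for w using K_ge0 N_ge0 by simp
  have bC: "K w / N w \<le> C" if "w \<in> E" "w \<noteq> 0" for w
    using K_bound[OF that(1)] N_pos[OF that] by (simp add: divide_le_eq)
  have rho_pos: "rho w > 0" for w unfolding rho_def using k b0[of w] e by (simp add: add_nonneg_pos)
  have rho_ub: "rho w \<le> k / e powr s" for w
    unfolding rho_def using k b0[of w] e s by (intro divide_left_mono powr_mono2 mult_pos_pos) auto
  have rho_lb: "k / (C + e) powr s \<le> rho w" if "w \<in> E" "w \<noteq> 0" for w
    unfolding rho_def using k b0[of w] e s bC[OF that] by (intro divide_left_mono powr_mono2 mult_pos_pos) auto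
  obtain B where B: "B > 0" "\<And>u. u \<in> E \<Longrightarrow> N (f u) \<le> B * N u"
    using homogeneous_bounded[OF f hf] by blast
  obtain B' where B': "B' > 0" "\<And>u. u \<in> E \<Longrightarrow> N (g u) \<le> B' * N u"
    using homogeneous_bounded[OF g hg] by blast
  \<comment> \<open>A continuous homogeneous map with such an inverse distorts lengths by bounded
    factors only; this supplies the two-sided bound on \<open>r\<close> required by
    \<open>radial\<close>.\<close>
  have q1: "1 / B \<le> N u / N (f u)" "N u / N (f u) \<le> B'" if u: "u \<in> E" "u \<noteq> 0" for u
    using B(2)[OF u(1)] B'(2)[OF fE[OF u(1)]] gf[OF u(1)] N_pos[OF fE[OF u(1)] fnz[OF u]] B(1)
    by (simp_all add: field_simps)
  have hfu: "f (c *\<^sub>R u) = c *\<^sub>R f u" if "u \<in> E" for c u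
    using hf that unfolding homogeneous_on_def by auto
  have r0: "r (c *\<^sub>R u) = r u" if "u \<in> E" "c \<noteq> 0" for c u
    using that fE[OF that(1)] unfolding r_def rho_def by (simp add: hfu N_scale K_scale)
  have rc: "(r \<longlongrightarrow> r u) (nb u)" if u: "u \<in> E" "u \<noteq> 0" for u
  proof -
    have nz: "N (f u) \<noteq> 0" "K (f u) / N (f u) + e \<noteq> 0" "(K (f u) / N (f u) + e) powr s \<noteq> 0"
      using N_pos[OF fE[OF u(1)] fnz[OF u]] b0[of "f u"] e by auto
    show ?thesis unfolding r_def rho_def
      by (intro tendsto_intros tendsto_N tendsto_K cont_opD[OF f] filterlim_ident fE u nz disjI1)
  qed
  define a where "a = k / (C + e) powr s * (1 / B)"
  have a: "a > 0" unfolding a_def using k C_pos e B(1) by simp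
  have rb: "a \<le> r u \<and> r u \<le> k / e powr s * B'" if u: "u \<in> E" "u \<noteq> 0" for u
    unfolding a_def r_def
    using rho_lb[OF fE[OF u(1)] fnz[OF u]] rho_ub[of "f u"] q1[OF u] rho_pos[of "f u"] k C_pos e B(1) B'(1)
    by (intro conjI mult_mono) (auto intro: less_imp_le N_ge0 divide_nonneg_nonneg)
  define h where "h u = r u *\<^sub>R f u" for u
  define h' where "h' w = (1 / r (g w)) *\<^sub>R g w" for w
  note rad = radial[OF f g gf fg hf hg r0 rc rb a, folded h_def h'_def]
  have Nh: "N (h u) = rho (f u) * N u" and Kh: "K (h u) = N (h u) * (K (f u) / N (f u))"
    if u: "u \<in> E" "u \<noteq> 0" for u
  proof -
    have "r u > 0" using rb[OF u] a by linarith
    moreover have "N (f u) > 0" using N_pos[OF fE[OF u(1)] fnz[OF u]] .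
    ultimately show "N (h u) = rho (f u) * N u" "K (h u) = N (h u) * (K (f u) / N (f u))"
      using fE[OF u(1)] rho_pos[of "f u"] N_ge0[of u] unfolding h_def by (simp_all add: N_scale K_scale r_def)
  qed
  have J: "N (h u) powr p / (2 * p) \<le> N (h u) powr p / p - lam / q * K (h u) powr q"
    if u: "u \<in> E" "u \<noteq> 0" "N u \<le> 1" for u
    unfolding Kh[OF u(1,2)]
  proof (rule energy_lower_bound[OF p lam N_ge0 b0 e])
    have "rho (f u) * N u \<le> rho (f u) * 1" using u(3) rho_pos[of "f u"] by (intro mult_left_mono) auto
    then show "N (h u) \<le> (q / (2 * p * lam)) powr (1 / (q - p)) / (K (f u) / N (f u) + e) powr (q / (q - p))"
      unfolding Nh[OF u(1,2)] rho_def k_def s_def by simp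
  qed
  have J0: "0 \<le> N (h u) powr p / p - lam / q * K (h u) powr q" if u: "u \<in> E" "N u \<le> 1" for u
  proof (cases "u = 0")
    case True
    have "h 0 = 0" by (rule homogeneous_on_0[OF rad(5)])
    then show ?thesis using True K_scale[of 0 0] by simp
  next
    case False
    have "0 \<le> N (h u) powr p / (2 * p)" using p by simp
    with J[OF u(1) False u(2)] show ?thesis by linarith
  qed
  have J1: "(k / (2 * e) powr s) powr p / (2 * p) \<le> N (h u) powr p / p - lam / q * K (h u) powr q"
    if u: "u \<in> E" "N u = 1" "K (f u) \<le> e * N (f u)" for u
  proof -
    have u0: "u \<noteq> 0" using u by auto
    have "K (f u) / N (f u) \<le> e"
      using u N_pos[OF fE[OF u(1)] fnz[OF u(1) u0]] by (simp add: divide_le_eq)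
    then have "k / (2 * e) powr s \<le> rho (f u)"
      unfolding rho_def using k e s b0[of "f u"]
      by (intro divide_left_mono powr_mono2 mult_pos_pos) auto
    then have "(k / (2 * e) powr s) powr p / (2 * p) \<le> rho (f u) powr p / (2 * p)"
      using p k by (intro divide_right_mono powr_mono2) auto
    also have "\<dots> = N (h u) powr p / (2 * p)" using Nh[OF u(1) u0] u by simp
    also note J[OF u(1) u0]
    finally show ?thesis using u by simp
  qed
  show ?thesis
    using rad J0 J1 unfolding k_def s_def by (intro exI[of _ h] exI[of _ h']) auto
qed

text \<open>The homeomorphism is the linear shear \<open>T\<close>, then the nonlinear shear
  \<open>S\<close>, then the normalisation. \<open>C0\<close> is fixed before \<open>eps\<close>,
  because \<open>eps\<close> has to be chosen in terms of \<open>C0\<close>; the number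
  \<open>M\<close> of flat directions is determined after \<open>eps\<close>.\<close>

theorem minimax_values_large:
  assumes X: "\<And>eps. eps > 0 \<Longrightarrow> \<exists>x Cx eta. eta > 0 \<and> almost_orthogonal_functionals E N x p Cx \<and>
      (\<forall>u\<in>E. u \<noteq> 0 \<longrightarrow> eps * N u \<le> K u \<longrightarrow> (\<exists>i. \<bar>x i u\<bar> > eta * N u))"
    and C0: "C0 \<ge> 1"
    and V: "\<And>eps (M :: nat). eps > 0 \<Longrightarrow> \<exists>v f D. (\<forall>k<M. v k \<in> E \<and> linear_fun_on E (f k) \<and> (\<forall>u\<in>E. \<bar>f k u\<bar> \<le> D * N u)) \<and>
      (\<forall>j<M. \<forall>k<M. f j (v k) = (if j = k then 1 else 0)) \<and>
      (\<forall>u\<in>E. N (\<Sum>k<M. f k u *\<^sub>R v k) \<le> C0 * N u) \<and>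
      (\<forall>a. K (\<Sum>k<M. a k *\<^sub>R v k) \<le> eps * N (\<Sum>k<M. a k *\<^sub>R v k))"
    and F: "\<And>m. subspace (F m)" "\<And>m. F m \<subseteq> E" "\<And>m. F m \<subseteq> F (Suc m)"
    and dense: "\<And>u e. u \<in> E \<Longrightarrow> e > 0 \<Longrightarrow> \<exists>w\<in>\<Union>m. F m. N (w - u) < e"
    and pr: "\<And>m. cont_op (pr m)" "\<And>m. linear_fun_on E (pr m)" "\<And>m. pr m ` E \<subseteq> F m"
      "\<And>m w. w \<in> F m \<Longrightarrow> pr m w = w"
    and p: "0 < p" "p < q" and lam: "lam > 0"
  shows "\<exists>m0. \<forall>m\<ge>m0. \<exists>h h'. cont_op h \<and> cont_op h' \<and> (\<forall>u\<in>E. h' (h u) = u \<and> h (h' u) = u) \<and>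
     homogeneous_on E h \<and>
     (\<forall>u\<in>E. N u \<le> 1 \<longrightarrow> 0 \<le> N (h u) powr p / p - lam / q * K (h u) powr q) \<and>
     (\<forall>u\<in>E. pr m u = 0 \<longrightarrow> N u = 1 \<longrightarrow> L \<le> N (h u) powr p / p - lam / q * K (h u) powr q)"
proof -
  define kap where "kap = (q / (2 * p * lam)) powr (1 / (q - p))"
  define s where "s = q / (q - p)"
  \<comment> \<open>\<open>R\<close> is a norm at which the energy bound exceeds \<open>L\<close>,
    and \<open>e\<close> solves \<open>kap / (2 * e) powr s = R\<close>.\<close>
  define R where "R = (2 * p * \<bar>L\<bar>) powr (1 / p) + 1"
  define e where "e = (kap / R) powr (1 / s) / 2"
  have kap: "kap > 0" unfolding kap_def using p lam by simp
  have s: "s > 0" unfolding s_def using p by simp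
  have R: "R > 0" unfolding R_def by (simp add: add_nonneg_pos)
  have e: "e > 0" unfolding e_def using kap R by simp
  have "(2 * e) powr s = kap / R" unfolding e_def using s kap R by (simp add: powr_powr)
  then have Re: "kap / (2 * e) powr s = R" using kap R by simp
  have "2 * p * \<bar>L\<bar> = ((2 * p * \<bar>L\<bar>) powr (1 / p)) powr p" using p by (simp add: powr_powr)
  also have "\<dots> \<le> R powr p" unfolding R_def using p by (intro powr_mono2) auto
  finally have "2 * p * \<bar>L\<bar> \<le> R powr p" .
  moreover have "2 * p * L \<le> 2 * p * \<bar>L\<bar>" using p by (intro mult_left_mono) auto
  ultimately have "2 * p * L \<le> R powr p" by (rule order_trans[rotated])
  then have "L \<le> R powr p / (2 * p)" using p by (simp add: pos_le_divide_eq mult.commute)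
  then have L: "L \<le> (kap / (2 * e) powr s) powr p / (2 * p)" unfolding Re .
  \<comment> \<open>Compensates the factor \<open>5 * C0\<close> lost in
    \<open>graph_small\<close>.\<close>
  define eps where "eps = e / (5 * C0)"
  have eps: "eps > 0" unfolding eps_def using e C0 by simp
  obtain x Cx eta where x: "eta > 0" "almost_orthogonal_functionals E N x p Cx"
    "\<And>u. u \<in> E \<Longrightarrow> u \<noteq> 0 \<Longrightarrow> eps * N u \<le> K u \<Longrightarrow> \<exists>i. \<bar>x i u\<bar> > eta * N u"
    using X[OF eps] by blast
  define M where "M = nat \<lceil>Cx / eta powr p\<rceil>"
  obtain v f D where v: "\<And>k. k < M \<Longrightarrow> v k \<in> E" and f: "\<And>k. k < M \<Longrightarrow> linear_fun_on E (f k)"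
      "\<And>k u. k < M \<Longrightarrow> u \<in> E \<Longrightarrow> \<bar>f k u\<bar> \<le> D * N u"
    and fv: "\<And>j k. j < M \<Longrightarrow> k < M \<Longrightarrow> f j (v k) = (if j = k then 1 else 0)"
    and PV: "\<And>u. u \<in> E \<Longrightarrow> N (\<Sum>k<M. f k u *\<^sub>R v k) \<le> C0 * N u"
      "\<And>a. K (\<Sum>k<M. a k *\<^sub>R v k) \<le> eps * N (\<Sum>k<M. a k *\<^sub>R v k)"
    using V[OF eps, where M = M] by blast
  interpret A: almost_orthogonal_functionals E N x p Cx by (rule x(2))
  interpret O: odd_modification E N x p Cx K C eps eta C0 M v f
    by unfold_locales (use eps x C0 v f fv PV in \<open>auto simp: M_def real_nat_ceiling_ge\<close>)
  have Fmono: "F m \<subseteq> F m'" if "m \<le> m'" for m m' using F(3) that by (rule lift_Suc_mono_le)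
  define D' where "D' = (\<Union>m. F m)"
  have subD: "subspace D'" unfolding subspace_def D'_def
  proof (intro conjI ballI allI)
    show "0 \<in> (\<Union>m. F m)" using subspace_0[OF F(1)] by auto
    fix a b c assume "a \<in> (\<Union>m. F m)"
    then obtain i where i: "a \<in> F i" by auto
    then show "c *\<^sub>R a \<in> (\<Union>m. F m)" using subspace_mul[OF F(1)] by auto
    assume "b \<in> (\<Union>m. F m)"
    then obtain j where j: "b \<in> F j" by auto
    have "a + b \<in> F (max i j)"
      using i j Fmono[of i "max i j"] Fmono[of j "max i j"] by (intro subspace_add F(1)) auto
    then show "a + b \<in> (\<Union>m. F m)" by auto
  qed
  have "D' \<subseteq> E" unfolding D'_def using F(2) by auto
  \<comment> \<open>Finitely many vectors of the increasing union lie in a single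
    \<open>F m0\<close>. The projection \<open>P'\<close> built from them has the same kernel as
    \<open>O.P\<close>, but its range lies in \<open>F m\<close> for all
    \<open>m >= m0\<close>.\<close>
  from dual_in_dense[where M = M and v = v, OF subD this dense[folded D'_def] f(1) f(2) v fv]
  obtain d where d: "\<And>j. j < M \<Longrightarrow> d j \<in> D'"
    "\<And>i j. i < M \<Longrightarrow> j < M \<Longrightarrow> f i (d j) = (if i = j then 1 else 0)"
    by blast
  have "\<exists>m0. \<forall>j<M'. d j \<in> F m0" if "M' \<le> M" for M'
    using that
  proof (induction M')
    case (Suc m)
    then obtain m0 where m0: "\<forall>j<m. d j \<in> F m0" by auto
    obtain m1 where m1: "d m \<in> F m1" using d(1)[of m] Suc unfolding D'_def by auto
    have "\<forall>j<Suc m. d j \<in> F (max m0 m1)"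
      using m0 m1 Fmono[of m0 "max m0 m1"] Fmono[of m1 "max m0 m1"] by (auto simp: less_Suc_eq)
    then show ?case by blast
  qed auto
  then obtain m0 where m0: "\<And>j. j < M \<Longrightarrow> d j \<in> F m0" by blast
  define P' where "P' u = (\<Sum>k<M. f k u *\<^sub>R d k)" for u
  have dE: "d k \<in> E" if "k < M" for k using d(1)[OF that] \<open>D' \<subseteq> E\<close> by auto
  have P'E: "P' u \<in> E" for u unfolding P'_def using dE by auto
  have P'lin: "linear_fun_on E P'"
    unfolding linear_fun_on_def P'_def
    using linear_fun_onD[OF f(1)] by (auto simp: scaleR_add_left sum.distrib scaleR_sum_right)
  have fP': "f j (P' u) = f j u" if j: "j < M" for j u
  proof -
    have "f j (P' u) = (\<Sum>k<M. f j (f k u *\<^sub>R d k))"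
      unfolding P'_def using dE j by (intro linear_fun_on_sum f) auto
    also have "\<dots> = (\<Sum>k<M. f k u * (if j = k then 1 else 0))"
      using dE j d(2) linear_fun_onD(2)[OF f(1)[OF j] _ mem(1)] by (intro sum.cong) auto
    also have "\<dots> = f j u" using j by (simp add: if_distrib cong: if_cong)
    finally show ?thesis .
  qed
  then have P'P': "P' (P' u) = P' u" for u by (subst (1 3) P'_def) simp
  have P'cont: "cont_op P'"
  proof (rule O.cont_linear[OF P'lin, where D = "\<Sum>k<M. D * N (d k)"])
    fix u assume u: "u \<in> E"
    have "N (P' u) \<le> (\<Sum>k<M. N (f k u *\<^sub>R d k))" unfolding P'_def using dE by (intro N_sum) auto
    also have "\<dots> \<le> (\<Sum>k<M. D * N u * N (d k))"
      using dE f(2)[OF _ u] N_ge0 by (intro sum_mono) (auto simp: N_scale intro!: mult_right_mono)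
    finally show "N (P' u) \<le> (\<Sum>k<M. D * N (d k)) * N u"
      by (simp add: sum_distrib_left sum_distrib_right ac_simps)
  qed (use P'E in auto)
  show ?thesis
  proof (intro exI[of _ m0] allI impI)
    fix m assume m: "m0 \<le> m"
    \<comment> \<open>For \<open>u\<close> in the kernel of \<open>pr m\<close> one gets
      \<open>Q (u - P' u) = - P' u\<close>, so the shear \<open>T\<close> maps \<open>u\<close> to
      \<open>u - P' u\<close>, which is annihilated by all the \<open>f k\<close>.\<close>
    define Q where "Q u = P' (pr m u)" for u
    have Qcont: "cont_op Q" unfolding Q_def[abs_def] by (rule cont_op_compose[OF P'cont pr(1)])
    have Qhom: "homogeneous_on E Q"
      unfolding homogeneous_on_def Q_def
      using linear_fun_onD(2)[OF pr(2)] linear_fun_onD(2)[OF P'lin] cont_op_mem[OF pr(1)] by auto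
    have P'Q: "P' (Q u) = Q u" for u unfolding Q_def P'P' ..
    define T where "T u = u + Q (u - P' u)" for u
    define T' where "T' u = u - Q (u - P' u)" for u
    note T = shear[OF Qcont P'cont P'lin P'Q, folded T_def T'_def]
    define S where "S u = u + O.G (u - O.P u)" for u
    define S' where "S' u = u - O.G (u - O.P u)" for u
    note S = shear[OF O.G_cont O.P_cont O.P_lin O.G_P, folded S_def S'_def]
    have small: "K (S (T u)) \<le> e * N (S (T u))" if u: "u \<in> E" "pr m u = 0" for u
    proof -
      have TE: "T u \<in> E" using cont_op_mem[OF T(1) u(1)] .
      have "P' u \<in> F m"
        unfolding P'_def using m0 Fmono[OF m] by (intro subspace_sum subspace_mul F(1)) auto
      then have pP': "pr m (P' u) = P' u" by (rule pr(4))
      have "pr m (u - P' u) = - P' u" using linear_fun_onD(3)[OF pr(2) u(1) P'E] u pP' by simp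
      then have "Q (u - P' u) = - P' u"
        unfolding Q_def using linear_fun_onD(2)[OF P'lin P'E P'E, of "-1" u] P'P' by simp
      then have Tu: "T u = u - P' u" unfolding T_def by simp
      have "f k (T u) = 0" if "k < M" for k
        unfolding Tu using linear_fun_onD(3)[OF f(1)[OF that] u(1) P'E] fP'[OF that] by simp
      then have PT: "O.P (T u) = 0" unfolding O.P_def by simp
      then have "S (T u) = T u + O.G (T u)" unfolding S_def by simp
      then have "K (S (T u)) \<le> 5 * C0 * eps * N (S (T u))" using O.graph_small[OF TE PT] by simp
      then show ?thesis unfolding eps_def using C0 by simp
    qed
    note TE = cont_op_mem[OF T(1)] cont_op_mem[OF T(2)] cont_op_mem[OF S(1)] cont_op_mem[OF S(2)]
    have c: "cont_op (\<lambda>u. S (T u))" "cont_op (\<lambda>u. T' (S' u))" 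
      by (rule cont_op_compose[OF S(1) T(1)], rule cont_op_compose[OF T(2) S(2)])
    have inv: "T' (S' (S (T u))) = u" "S (T (T' (S' u))) = u" if "u \<in> E" for u
      using that S(3,4) T(3,4) TE by auto
    have hom: "homogeneous_on E (\<lambda>u. S (T u))" "homogeneous_on E (\<lambda>u. T' (S' u))"
      using S(5)[OF O.G_hom] T(5)[OF Qhom] TE
      by (auto intro!: homogeneous_on_compose[of S T] homogeneous_on_compose[of T' S'])
    from normalized_homeomorphism[OF c inv hom p lam e] obtain h h' where hh: "cont_op h" "cont_op h'" "\<forall>u\<in>E. h' (h u) = u \<and> h (h' u) = u"
      "homogeneous_on E h" "\<forall>u\<in>E. N u \<le> 1 \<longrightarrow> 0 \<le> N (h u) powr p / p - lam / q * K (h u) powr q"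
      and hL: "\<And>u. u \<in> E \<Longrightarrow> N u = 1 \<Longrightarrow> K (S (T u)) \<le> e * N (S (T u)) \<Longrightarrow>
        ((q / (2 * p * lam)) powr (1 / (q - p)) / (2 * e) powr (q / (q - p))) powr p / (2 * p)
          \<le> N (h u) powr p / p - lam / q * K (h u) powr q" by blast
    have "L \<le> N (h u) powr p / p - lam / q * K (h u) powr q" if "u \<in> E" "pr m u = 0" "N u = 1" for u
      using order_trans[OF L[unfolded kap_def s_def] hL[OF that(1,3) small[OF that(1,2)]]] .
    with hh show "\<exists>h h'. cont_op h \<and> cont_op h' \<and> (\<forall>u\<in>E. h' (h u) = u \<and> h (h' u) = u) \<and> homogeneous_on E h \<and>
     (\<forall>u\<in>E. N u \<le> 1 \<longrightarrow> 0 \<le> N (h u) powr p / p - lam / q * K (h u) powr q) \<and>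
     (\<forall>u\<in>E. pr m u = 0 \<longrightarrow> N u = 1 \<longrightarrow> L \<le> N (h u) powr p / p - lam / q * K (h u) powr q)"
      by (intro exI[of _ h] exI[of _ h'] conjI) auto
  qed
qed

end

section \<open>Jensen, Minkowski and Sobolev-Poincare inequalities for extended integrals\<close>

text \<open>The convex function \<open>f powr p\<close> lies above its tangent line at
  \<open>a\<close>.\<close>

lemma young_powr:
  fixes a f p :: real
  assumes "p \<ge> 1" "a \<ge> 0" "f \<ge> 0"
  shows "p * a powr (p - 1) * f \<le> f powr p + (p - 1) * a powr p"
proof (cases "a = 0 \<or> f = 0")
  case True
  then show ?thesis using assms by auto
next
  case False
  have "(f powr p) powr (1/p) * (a powr p) powr ((p - 1)/p) \<le> (1/p) * f powr p + ((p - 1)/p) * a powr p"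
    using assms False by (intro Youngs_inequality_0) (auto simp: field_simps)
  then have "f * a powr (p - 1) \<le> (1/p) * f powr p + ((p - 1)/p) * a powr p"
    using assms by (simp add: powr_powr)
  then have "p * (f * a powr (p - 1)) \<le> p * ((1/p) * f powr p + ((p - 1)/p) * a powr p)"
    using assms by (intro mult_left_mono) auto
  also have "\<dots> = f powr p + (p - 1) * a powr p" using assms by (simp add: field_simps)
  finally show ?thesis by (simp add: ac_simps)
qed

text \<open>The tangent line at the mean \<open>c / m\<close> is integrated. The formulation with a
  lower bound \<open>c\<close> for the integral of \<open>f\<close> and a right-hand side that may
  be infinite requires no integrability.\<close>

lemma jensen_nn:
  fixes f :: "'a \<Rightarrow> real"
  assumes f[measurable]: "f \<in> borel_measurable M" and f0: "\<And>x. f x \<ge> 0"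
    and m: "emeasure M (space M) \<le> ennreal m" "m > 0" and p: "p \<ge> 1"
    and c: "c \<ge> 0" "ennreal c \<le> (\<integral>\<^sup>+x. ennreal (f x) \<partial>M)"
  shows "ennreal (c powr p) \<le> ennreal (m powr (p - 1)) * (\<integral>\<^sup>+x. ennreal (f x powr p) \<partial>M)"
proof (cases "c = 0 \<or> (\<integral>\<^sup>+x. ennreal (f x powr p) \<partial>M) = \<infinity>")
  case True
  then show ?thesis
  proof
    assume "(\<integral>\<^sup>+x. ennreal (f x powr p) \<partial>M) = \<infinity>"
    moreover have "ennreal (m powr (p - 1)) \<noteq> 0" using m by simp
    ultimately show ?thesis by (simp add: ennreal_mult_top)
  qed (use p in auto)
next
  case False
  define a where "a = c / m"
  have a: "a > 0" unfolding a_def using False c m by simp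
  have "ennreal (p * a powr (p - 1)) * ennreal c \<le> ennreal (p * a powr (p - 1)) * (\<integral>\<^sup>+x. ennreal (f x) \<partial>M)"
    by (intro mult_left_mono c) auto
  also have "\<dots> = (\<integral>\<^sup>+x. ennreal (p * a powr (p - 1) * f x) \<partial>M)"
    using p f0 by (subst nn_integral_cmult[symmetric]) (auto simp: ennreal_mult)
  also have "\<dots> \<le> (\<integral>\<^sup>+x. ennreal (f x powr p) + ennreal ((p - 1) * a powr p) \<partial>M)"
    using young_powr[OF p, of a] f0 a p
    by (intro nn_integral_mono) (auto simp: ennreal_plus[symmetric] simp del: ennreal_plus intro!: ennreal_leI)
  also have "\<dots> = (\<integral>\<^sup>+x. ennreal (f x powr p) \<partial>M) + ennreal ((p - 1) * a powr p) * emeasure M (space M)"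
    by (subst nn_integral_add) auto
  also have "\<dots> \<le> (\<integral>\<^sup>+x. ennreal (f x powr p) \<partial>M) + ennreal ((p - 1) * a powr p) * ennreal m"
    by (intro add_left_mono mult_left_mono m) auto
  finally have le: "ennreal (p * a powr (p - 1)) * ennreal c
      \<le> (\<integral>\<^sup>+x. ennreal (f x powr p) \<partial>M) + ennreal ((p - 1) * a powr p) * ennreal m" .
  obtain I where I: "(\<integral>\<^sup>+x. ennreal (f x powr p) \<partial>M) = ennreal I" "I \<ge> 0"
    using False by (cases "\<integral>\<^sup>+x. ennreal (f x powr p) \<partial>M") auto
  have "p * a powr (p - 1) * c \<le> I + (p - 1) * a powr p * m"
    using le I a c m p by (simp add: ennreal_mult[symmetric] ennreal_plus[symmetric] del: ennreal_plus)
  moreover have "a powr (p - 1) * c = a powr p * m"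
    using a m unfolding powr_diff a_def by (simp add: field_simps)
  then have "p * a powr (p - 1) * c = p * (a powr p * m)" by (simp only: mult.assoc)
  moreover have "(p - 1) * a powr p * m = p * (a powr p * m) - a powr p * m" by (simp add: algebra_simps)
  ultimately have "a powr p * m \<le> I" by linarith
  then have "m powr (p - 1) * (a powr p * m) \<le> m powr (p - 1) * I" by (intro mult_left_mono) auto
  also have "m powr (p - 1) * (a powr p * m) = c powr p"
    using a m c unfolding a_def powr_diff by (simp add: powr_divide)
  finally show ?thesis using I by (simp add: ennreal_mult[symmetric])
qed

text \<open>Convexity of the power with weights proportional to \<open>a\<close> and
  \<open>b\<close>, applied to \<open>f\<close> and \<open>g\<close> divided by their
  weights.\<close>

lemma powr_convex_comb:
  fixes a b f g p :: real
  assumes p: "p \<ge> 1" and ab: "a > 0" "b > 0" and fg: "f \<ge> 0" "g \<ge> 0"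
  shows "(f + g) powr p \<le> ((a + b) / a) powr (p - 1) * f powr p + ((a + b) / b) powr (p - 1) * g powr p"
proof -
  define s where "s = f + g"
  have s: "s \<ge> 0" using fg s_def by simp
  define A where "A = a / (a + b) * s" define B where "B = b / (a + b) * s"
  have ndiv: "s powr (p - 1) * ((a + b) / a) powr (p - 1) * (a / (a + b)) powr (p - 1) = s powr (p - 1)"
    using ab by (simp add: powr_mult[symmetric] mult.assoc)
  have y: "p * s powr (p - 1) * f \<le> ((a + b) / a) powr (p - 1) * f powr p + (p - 1) * (a / (a + b)) * s powr p"
    if "a > 0" "b > 0" "f \<ge> 0" for a b f
  proof -
    have nz: "0 < (a + b) / a" using that by (simp add: add_pos_pos)
    have "p * (a / (a + b) * s) powr (p - 1) * f \<le> f powr p + (p - 1) * (a / (a + b) * s) powr p"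
      using that s p by (intro young_powr) auto
    then have h1: "((a + b) / a) powr (p - 1) * (p * (a / (a + b) * s) powr (p - 1) * f)
       \<le> ((a + b) / a) powr (p - 1) * (f powr p + (p - 1) * (a / (a + b) * s) powr p)"
      by (intro mult_left_mono) auto
    have h2: "((a + b) / a) powr (p - 1) * (a / (a + b) * s) powr (p - 1) = s powr (p - 1)"
      using that s by (simp add: powr_mult[symmetric])
    have h3: "((a + b) / a) powr (p - 1) * (a / (a + b) * s) powr p = a / (a + b) * s powr p"
    proof -
      have "((a + b) / a) powr (p - 1) * (a / (a + b)) powr p = a / (a + b)"
      proof -
        have "(a / (a + b)) powr p = (a / (a + b)) powr (p - 1) * (a / (a + b))"
          using that powr_mult_base[of "a / (a + b)" "p - 1"] by (simp add: mult.commute)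
        moreover have "((a + b) / a) powr (p - 1) * (a / (a + b)) powr (p - 1) = 1"
          using that by (simp add: powr_mult[symmetric])
        ultimately show ?thesis by (metis mult.assoc mult_1)
      qed
      moreover have "(a / (a + b) * s) powr p = (a / (a + b)) powr p * s powr p"
        by (rule powr_mult)
      ultimately show ?thesis by (metis mult.assoc)
    qed
    have "p * s powr (p - 1) * f = ((a + b) / a) powr (p - 1) * (p * (a / (a + b) * s) powr (p - 1) * f)"
      unfolding h2[symmetric] by (simp only: ac_simps)
    also note h1
    also have "((a + b) / a) powr (p - 1) * (f powr p + (p - 1) * (a / (a + b) * s) powr p)
      = ((a + b) / a) powr (p - 1) * f powr p + (p - 1) * (((a + b) / a) powr (p - 1) * (a / (a + b) * s) powr p)"
      by (simp only: distrib_left ac_simps)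
    also note h3
    finally show ?thesis by (simp only: mult.assoc)
  qed
  have sp: "s powr (p - 1) * s = s powr p" using s by (cases "s = 0") (use p in \<open>auto simp: powr_diff\<close>)
  have "p * s powr p = p * s powr (p - 1) * s" by (simp only: sp mult.assoc)
  also have "\<dots> = p * s powr (p - 1) * f + p * s powr (p - 1) * g"
    by (subst (2) s_def) (simp add: distrib_left)
  also have "\<dots> \<le> (((a + b) / a) powr (p - 1) * f powr p + (p - 1) * (a / (a + b)) * s powr p) +
      (((b + a) / b) powr (p - 1) * g powr p + (p - 1) * (b / (b + a)) * s powr p)"
    using ab fg by (intro add_mono y) auto
  also have "\<dots> = ((a + b) / a) powr (p - 1) * f powr p + ((a + b) / b) powr (p - 1) * g powr p
      + (p - 1) * ((a / (a + b)) + (b / (a + b))) * s powr p"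
    by (simp add: algebra_simps add.commute)
  also have "(a / (a + b)) + (b / (a + b)) = 1" using ab by (simp add: add_divide_distrib[symmetric])
  finally show ?thesis unfolding s_def by (simp add: algebra_simps)
qed

text \<open>With weights proportional to the two norms, \<open>powr_convex_comb\<close> produces the
  sharp constant. The weights must be positive, so slightly larger numbers are used and a limit is
  taken at the end.\<close>

lemma minkowski_nn:
  fixes f g h :: "'a \<Rightarrow> real"
  assumes [measurable]: "f \<in> borel_measurable M" "g \<in> borel_measurable M"
    and fg0: "\<And>x. f x \<ge> 0" "\<And>x. g x \<ge> 0"
    and h: "AE x in M. 0 \<le> h x \<and> h x \<le> f x + g x" and p: "p \<ge> 1" and ab: "a \<ge> 0" "b \<ge> 0"
    and f: "(\<integral>\<^sup>+x. ennreal (f x powr p) \<partial>M) \<le> ennreal (a powr p)"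
    and g: "(\<integral>\<^sup>+x. ennreal (g x powr p) \<partial>M) \<le> ennreal (b powr p)"
  shows "(\<integral>\<^sup>+x. ennreal (h x powr p) \<partial>M) \<le> ennreal ((a + b) powr p)"
proof -
  have *: "(\<integral>\<^sup>+x. ennreal (h x powr p) \<partial>M) \<le> ennreal ((a' + b') powr p)"
    if ab': "a < a'" "b < b'" for a' b'
  proof -
    have pos: "a' > 0" "b' > 0" using ab ab' by auto
    define A where "A = ((a' + b') / a') powr (p - 1)"
    define B where "B = ((a' + b') / b') powr (p - 1)"
    have "(\<integral>\<^sup>+x. ennreal (h x powr p) \<partial>M) \<le> (\<integral>\<^sup>+x. ennreal A * ennreal (f x powr p) + ennreal B * ennreal (g x powr p) \<partial>M)"
    proof (rule nn_integral_mono_AE)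
      show "AE x in M. ennreal (h x powr p) \<le> ennreal A * ennreal (f x powr p) + ennreal B * ennreal (g x powr p)"
        using h
      proof eventually_elim
        case (elim x)
        have "h x powr p \<le> (f x + g x) powr p" using elim p by (intro powr_mono2) auto
        also have "\<dots> \<le> A * f x powr p + B * g x powr p"
          unfolding A_def B_def by (rule powr_convex_comb[OF p pos fg0])
        finally show ?case
          by (simp add: ennreal_mult[symmetric] ennreal_plus[symmetric] A_def B_def ennreal_leI del: ennreal_plus)
      qed
    qed
    also have "\<dots> = ennreal A * (\<integral>\<^sup>+x. ennreal (f x powr p) \<partial>M) + ennreal B * (\<integral>\<^sup>+x. ennreal (g x powr p) \<partial>M)"
      by (subst nn_integral_add) (auto simp: nn_integral_cmult)
    also have "\<dots> \<le> ennreal A * ennreal (a' powr p) + ennreal B * ennreal (b' powr p)"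
    proof (intro add_mono mult_left_mono)
      show "(\<integral>\<^sup>+x. ennreal (f x powr p) \<partial>M) \<le> ennreal (a' powr p)"
        using f ab ab' p by (elim order_trans) (auto intro!: ennreal_leI powr_mono2)
      show "(\<integral>\<^sup>+x. ennreal (g x powr p) \<partial>M) \<le> ennreal (b' powr p)"
        using g ab ab' p by (elim order_trans) (auto intro!: ennreal_leI powr_mono2)
    qed auto
    also have "\<dots> = ennreal (A * a' powr p + B * b' powr p)"
      by (simp add: ennreal_mult[symmetric] ennreal_plus[symmetric] A_def B_def del: ennreal_plus)
    also have "A * a' powr p + B * b' powr p = (a' + b') powr p"
    proof -
      have "A * a' powr p = (a' + b') powr (p - 1) * a'" "B * b' powr p = (a' + b') powr (p - 1) * b'"
        unfolding A_def B_def using pos by (simp_all add: powr_divide powr_diff)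
      then have "A * a' powr p + B * b' powr p = (a' + b') * (a' + b') powr (p - 1)"
        by (simp add: algebra_simps)
      then show ?thesis using pos by (simp add: powr_mult_base)
    qed
    finally show ?thesis .
  qed
  have lim: "((\<lambda>e. ennreal (((a + e) + (b + e)) powr p)) \<longlongrightarrow> ennreal (((a + 0) + (b + 0)) powr p)) (at_right 0)"
  proof (cases "a + b = 0")
    case True
    have "((\<lambda>e::real. (2 * e) powr p) \<longlongrightarrow> (2 * 0) powr p) (at_right 0)"
      using p by (intro tendsto_powr' tendsto_intros disjI2) (auto intro: eventually_mono[OF eventually_at_right_less[of 0]])
    with True ab show ?thesis by (intro tendsto_ennrealI) (simp add: ac_simps flip: mult_2)
  next
    case False
    then show ?thesis by (intro tendsto_ennrealI tendsto_intros) auto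
  qed
  have "\<forall>\<^sub>F e in at_right 0. (\<integral>\<^sup>+x. ennreal (h x powr p) \<partial>M) \<le> ennreal (((a + e) + (b + e)) powr p)"
    using eventually_at_right_less[of 0] by eventually_elim (intro *, auto)
  from tendsto_lowerbound[OF lim this] show ?thesis by simp
qed

lemma nn_integral_lborel_affine:
  fixes f :: "'a::euclidean_space \<Rightarrow> ennreal"
  assumes [measurable]: "f \<in> borel_measurable borel" and c: "c \<noteq> 0"
  shows "(\<integral>\<^sup>+x. f x \<partial>lborel) = ennreal (\<bar>c\<bar> ^ DIM('a)) * (\<integral>\<^sup>+x. f (t + c *\<^sub>R x) \<partial>lborel)"
  by (subst lborel_affine[OF c, of t])
     (simp add: nn_integral_density nn_integral_distr nn_integral_cmult)

lemma nn_integral_powr_0_1: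
  fixes k :: real
  assumes k: "k < 1"
  shows "(\<integral>\<^sup>+t\<in>{0<..<1}. ennreal (t powr (- k)) \<partial>lborel) = ennreal (1 / (1 - k))"
proof -
  have "((\<lambda>x. x powr (- k)) has_integral (1 powr (- k + 1) / (- k + 1))) {0..1}"
    using has_integral_powr_from_0[of "- k" 1] k by simp
  then have "((\<lambda>x. x powr (- k)) has_integral (1 / (1 - k))) {0..1}" by (simp add: add.commute)
  then have "((\<lambda>x. x powr (- k)) has_integral (1 / (1 - k))) {0<..<1}"
    by (simp add: has_integral_Icc_iff_Ioo)
  then have "((\<lambda>x. x powr (- k) * indicator {0<..<1} x) has_integral (1 / (1 - k))) UNIV"
    by (subst (asm) has_integral_restrict_UNIV[symmetric])
      (simp add: indicator_def of_bool_def if_distrib cong: if_cong)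
  then have "(\<integral>\<^sup>+x. ennreal (x powr (- k) * indicator {0<..<1} x) \<partial>lborel) = ennreal (1 / (1 - k))"
    using k by (intro nn_integral_has_integral_lborel) auto
  then show ?thesis by (simp add: ennreal_mult' ennreal_indicator)
qed

text \<open>
  Subcritical Sobolev-Poincare inequality in averaged form. At a fixed \<open>t\<close>, averaging \<open>D\<close> over
  \<open>(1 - t) x + t y\<close> in \<open>y\<close> costs \<open>t powr (- d / p)\<close> in the supremum and a constant in \<open>L\<^sup>p\<close>;
  interpolation gives the integrable singularity \<open>t powr (- k)\<close>.
\<close>

lemma sobolev_poincare_average:
  fixes B :: "'a::euclidean_space set" and D g :: "'a \<Rightarrow> real"
  defines "d \<equiv> real DIM('a)"
  assumes B[measurable]: "B \<in> sets borel" and V: "emeasure lborel B = ennreal V" "V > 0"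
    and D[measurable]: "D \<in> borel_measurable borel" and D0: "\<And>x. 0 \<le> D x" and DK: "\<And>x. D x \<le> Kb"
    and p: "1 \<le> p" "p < q" and k: "k = d * (1 / p - 1 / q)" "k < 1"
    and I: "(\<integral>\<^sup>+x. ennreal (D x powr p) \<partial>lborel) \<le> ennreal I" "I \<ge> 0"
    and g: "\<And>x. x \<in> B \<Longrightarrow> 0 \<le> g x"
      "\<And>x. x \<in> B \<Longrightarrow> ennreal (V * g x) \<le>
        (\<integral>\<^sup>+y\<in>B. (\<integral>\<^sup>+t\<in>{0<..<1}. ennreal (D (x + t *\<^sub>R (y - x))) \<partial>lborel) \<partial>lborel)"
  shows "(\<integral>\<^sup>+x\<in>B. ennreal (g x powr q) \<partial>lborel)
     \<le> ennreal ((1 / (1 - k)) powr q * 2 ^ DIM('a) * (V powr (1 - q / p) * I powr (q / p)))"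
proof -
  define m where "m = 1 / (1 - k)"
  have m: "m > 0" unfolding m_def using k by simp
  have q: "q > 0" "q / p - 1 > 0" using p by (auto simp: less_divide_eq)
  have kq: "k * q = d * (q / p - 1)" using q p unfolding k(1) by (simp add: field_simps)
  define BM where "BM = density lborel (indicator B)"
  have emBM: "emeasure BM (space BM) = ennreal V" unfolding BM_def using V by (simp add: emeasure_density)
  have BMi: "(\<integral>\<^sup>+y. f y \<partial>BM) = (\<integral>\<^sup>+y\<in>B. f y \<partial>lborel)" if [measurable]: "f \<in> borel_measurable borel"
    for f :: "'a \<Rightarrow> ennreal"
    unfolding BM_def by (subst nn_integral_density) (auto simp: mult.commute)
  interpret BM: finite_measure BM by standard (simp add: emBM)
  have [measurable_cong]: "sets BM = sets borel" unfolding BM_def by simp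
  define z where "z t x y = x + t *\<^sub>R (y - x)" for t :: real and x y :: 'a
  have zm: "(\<lambda>(x, t, y). z t x y) \<in> borel_measurable (borel \<Otimes>\<^sub>M (borel \<Otimes>\<^sub>M borel))"
    unfolding z_def split_beta by measurable
  have [measurable]: "(\<lambda>w. D (z (t w) (x w) (y w))) \<in> borel_measurable M"
    if [measurable]: "t \<in> borel_measurable M" "x \<in> borel_measurable M" "y \<in> borel_measurable M"
    for t x y and M :: "'c measure"
    unfolding z_def by measurable
  define A where "A t x = (\<integral>\<^sup>+y. ennreal (D (z t x y)) \<partial>BM)" for t x
  define Bt where "Bt t x = (\<integral>\<^sup>+y. ennreal (D (z t x y) powr p) \<partial>BM)" for t x
  have Am[measurable]: "(\<lambda>w. A (t w) (x w)) \<in> borel_measurable M"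
    if [measurable]: "t \<in> borel_measurable M" "x \<in> borel_measurable M" for t x and M :: "'c measure"
    unfolding A_def by measurable
  have Bm[measurable]: "(\<lambda>w. Bt (t w) (x w)) \<in> borel_measurable M"
    if [measurable]: "t \<in> borel_measurable M" "x \<in> borel_measurable M" for t x and M :: "'c measure"
    unfolding Bt_def by measurable
  have Kb: "Kb \<ge> 0" using D0 DK order_trans by blast
  have Afin: "A t x < \<infinity>" for t x
  proof -
    have "A t x \<le> (\<integral>\<^sup>+y. ennreal Kb \<partial>BM)" unfolding A_def by (intro nn_integral_mono ennreal_leI DK)
    also have "\<dots> < \<infinity>" using emBM by (simp add: ennreal_mult_less_top)
    finally show ?thesis .
  qed
  define a where "a t x = enn2real (A t x)" for t x
  have a: "A t x = ennreal (a t x)" "a t x \<ge> 0" for t x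
    unfolding a_def using Afin[of t x] by (auto simp: less_top)
  have am[measurable]: "(\<lambda>w. a (t w) (x w)) \<in> borel_measurable M"
    if [measurable]: "t \<in> borel_measurable M" "x \<in> borel_measurable M" for t x and M :: "'c measure"
    unfolding a_def by measurable
  have sub: "(\<integral>\<^sup>+y. ennreal (D (w + s *\<^sub>R y) powr p) \<partial>lborel) \<le> ennreal (s powr (- d) * I)" if "s > 0" for s w
  proof -
    have "ennreal (s ^ DIM('a)) * (\<integral>\<^sup>+y. ennreal (D (w + s *\<^sub>R y) powr p) \<partial>lborel) \<le> ennreal I"
      using nn_integral_lborel_affine[of "\<lambda>x. ennreal (D x powr p)" s w] I that by simp
    then have "ennreal (s powr (- d)) * (ennreal (s ^ DIM('a)) * (\<integral>\<^sup>+y. ennreal (D (w + s *\<^sub>R y) powr p) \<partial>lborel))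
        \<le> ennreal (s powr (- d)) * ennreal I" by (intro mult_left_mono) auto
    moreover have "s powr (- d) * s ^ DIM('a) = 1"
      using that unfolding d_def by (simp add: powr_realpow[symmetric] powr_add[symmetric])
    then have "ennreal (s powr (- d)) * ennreal (s ^ DIM('a)) = 1"
      using that by (simp add: ennreal_mult[symmetric])
    ultimately show ?thesis using I(2) by (simp add: mult.assoc[symmetric] ennreal_mult[symmetric])
  qed
  have z1: "z t x y = (1 - t) *\<^sub>R x + t *\<^sub>R y" for t x y unfolding z_def by (simp add: algebra_simps)
  have BtI: "Bt t x \<le> ennreal (t powr (- d) * I)" if "t > 0" for t x
  proof -
    have "Bt t x \<le> (\<integral>\<^sup>+y. ennreal (D ((1 - t) *\<^sub>R x + t *\<^sub>R y) powr p) \<partial>lborel)"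
      unfolding Bt_def by (subst BMi) (auto simp: z1 intro!: nn_integral_mono split: split_indicator)
    also note sub[OF that]
    finally show ?thesis .
  qed
  have pown: "s powr (- d) \<le> 2 ^ DIM('a)" if "s \<ge> 1/2" for s
  proof -
    have "s powr (- d) \<le> (1/2) powr (- d)" using that unfolding d_def by (intro powr_mono2') auto
    also have "\<dots> = 2 powr d" by (simp add: powr_minus powr_divide)
    finally show ?thesis unfolding d_def by (simp add: powr_realpow)
  qed
  \<comment> \<open>One of \<open>t\<close> and \<open>1 - t\<close> is at least 1/2, so integrating
    over \<open>y\<close> or over \<open>x\<close> first loses at most the factor
    \<open>2 ^ DIM('a)\<close>.\<close>
  have Btx: "(\<integral>\<^sup>+x. Bt t x \<partial>BM) \<le> ennreal (V * (2 ^ DIM('a) * I))" if t: "0 < t" "t < 1" for t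
  proof (cases "t \<ge> 1/2")
    case True
    have "(\<integral>\<^sup>+x. Bt t x \<partial>BM) \<le> (\<integral>\<^sup>+x. ennreal (2 ^ DIM('a) * I) \<partial>BM)"
      by (intro nn_integral_mono order_trans[OF BtI[OF t(1)]] ennreal_leI mult_right_mono pown True I)
    then show ?thesis using emBM V I by (simp add: ennreal_mult[symmetric] mult.commute)
  next
    case False
    have "(\<integral>\<^sup>+x. Bt t x \<partial>BM) = (\<integral>\<^sup>+y. (\<integral>\<^sup>+x. ennreal (D (z t x y) powr p) \<partial>BM) \<partial>BM)"
      unfolding Bt_def by (rule pair_sigma_finite.Fubini') (auto simp: pair_sigma_finite_def BM.sigma_finite_measure_axioms)
    also have "\<dots> \<le> (\<integral>\<^sup>+y. ennreal (2 ^ DIM('a) * I) \<partial>BM)"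
    proof (rule nn_integral_mono)
      fix y
      have "(\<integral>\<^sup>+x. ennreal (D (z t x y) powr p) \<partial>BM) \<le> (\<integral>\<^sup>+x. ennreal (D (t *\<^sub>R y + (1 - t) *\<^sub>R x) powr p) \<partial>lborel)"
        by (subst BMi) (auto simp: z1 add.commute intro!: nn_integral_mono split: split_indicator)
      also have "\<dots> \<le> ennreal ((1 - t) powr (- d) * I)" using t by (intro sub) auto
      also have "\<dots> \<le> ennreal (2 ^ DIM('a) * I)"
        using False by (intro ennreal_leI mult_right_mono pown I) auto
      finally show "(\<integral>\<^sup>+x. ennreal (D (z t x y) powr p) \<partial>BM) \<le> ennreal (2 ^ DIM('a) * I)" .
    qed
    also have "\<dots> \<le> ennreal (V * (2 ^ DIM('a) * I))"
      using emBM V I by (simp add: ennreal_mult[symmetric] mult.commute)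
    finally show ?thesis .
  qed
  \<comment> \<open>Of the \<open>q / p\<close> powers of \<open>Bt t x\<close>, all but one are
    estimated by the supremum bound \<open>BtI\<close>; the last one remains to be integrated over
    \<open>x\<close>.\<close>
  have aq: "ennreal (a t x powr q) \<le> ennreal (V powr (q - q / p) * (t powr (- d) * I) powr (q / p - 1)) * Bt t x"
    if t: "0 < t" "t < 1" for t x
  proof -
    have J: "ennreal (a t x powr p) \<le> ennreal (V powr (p - 1)) * Bt t x"
      unfolding Bt_def
      by (rule jensen_nn[where f = "\<lambda>y. D (z t x y)"])
        (use a[of t x] emBM V p D0 in \<open>auto simp: A_def\<close>)
    obtain b where b: "Bt t x = ennreal b" "b \<ge> 0"
      using BtI[OF t(1), of x] by (cases "Bt t x") (auto simp: top_unique)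
    have bI: "b \<le> t powr (- d) * I"
      using BtI[OF t(1), of x] b(1) I(2) by (simp add: ennreal_le_iff)
    have "a t x powr p \<le> V powr (p - 1) * b" using J b by (simp add: ennreal_mult[symmetric])
    then have "(a t x powr p) powr (q / p) \<le> (V powr (p - 1) * b) powr (q / p)"
      using q p by (intro powr_mono2) auto
    moreover have "(p - 1) * (q / p) = q - q / p" using p by (simp add: field_simps)
    ultimately have "a t x powr q \<le> V powr (q - q / p) * b powr (q / p)"
      using p V b by (simp add: powr_powr powr_mult)
    also have "b powr (q / p) = b powr (q / p - 1) * b"
      using b powr_mult_base[of b "q / p - 1"] by (simp add: mult.commute)
    also have "V powr (q - q / p) * (b powr (q / p - 1) * b) \<le> V powr (q - q / p) * ((t powr (- d) * I) powr (q / p - 1) * b)"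
      using q b bI by (intro mult_left_mono mult_right_mono powr_mono2) auto
    finally show ?thesis unfolding b(1) using b(2) by (simp add: ennreal_mult[symmetric] mult.assoc)
  qed
  \<comment> \<open>This measure has mass \<open>1 / (1 - k)\<close>. Jensen's inequality is applied
    to \<open>t powr k * a t x\<close>, where the power of \<open>t\<close> exactly cancels the
    singularity in \<open>aq\<close>, because \<open>k * q = d * (q / p - 1)\<close>.\<close>
  define nu where "nu = density lborel (\<lambda>t::real. ennreal (t powr (- k)) * indicator {0<..<1} t)"
  have nui: "(\<integral>\<^sup>+t. f t \<partial>nu) = (\<integral>\<^sup>+t. (ennreal (t powr (- k)) * indicator {0<..<1} t) * f t \<partial>lborel)"
    if [measurable]: "f \<in> borel_measurable borel" for f :: "real \<Rightarrow> ennreal"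
    unfolding nu_def by (subst nn_integral_density) auto
  have emnu: "emeasure nu (space nu) = ennreal m"
    unfolding nu_def m_def using nn_integral_powr_0_1[OF k(2)] by (simp add: emeasure_density)
  interpret nu: finite_measure nu by standard (simp add: emnu)
  have [measurable_cong]: "sets nu = sets borel" unfolding nu_def by simp
  have gq: "ennreal ((V * g x) powr q) \<le> ennreal (m powr (q - 1)) * (\<integral>\<^sup>+t. ennreal ((t powr k * a t x) powr q) \<partial>nu)"
    if x: "x \<in> B" for x
  proof (rule jensen_nn[where f = "\<lambda>t. t powr k * a t x"])
    have "ennreal (V * g x) \<le> (\<integral>\<^sup>+y. (\<integral>\<^sup>+t\<in>{0<..<1}. ennreal (D (z t x y)) \<partial>lborel) \<partial>BM)"
      using g(2)[OF x] by (subst BMi) (auto simp: z_def)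
    also have "\<dots> = (\<integral>\<^sup>+t. (\<integral>\<^sup>+y. ennreal (D (z t x y)) * indicator {0<..<1} t \<partial>BM) \<partial>lborel)"
      by (rule pair_sigma_finite.Fubini')
        (auto simp: pair_sigma_finite_def BM.sigma_finite_measure_axioms sigma_finite_lborel)
    also have "\<dots> = (\<integral>\<^sup>+t. ennreal (a t x) * indicator {0<..<1} t \<partial>lborel)"
      by (subst nn_integral_multc) (auto simp: A_def[symmetric] a)
    also have "\<dots> = (\<integral>\<^sup>+t. ennreal (t powr k * a t x) \<partial>nu)"
      using a(2) by (subst nui) (auto intro!: nn_integral_cong split: split_indicator
        simp: ennreal_mult[symmetric] mult.assoc[symmetric] powr_add[symmetric])
    finally show "ennreal (V * g x) \<le> (\<integral>\<^sup>+t. ennreal (t powr k * a t x) \<partial>nu)" .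
  qed (use emnu m a(2) p V g(1)[OF x] in auto)
  define cc where "cc = m powr (q - 1) * (V powr (q - q / p) * I powr (q / p - 1))"
  have step: "ennreal ((V * g x) powr q) \<le> ennreal cc * (\<integral>\<^sup>+t. Bt t x \<partial>nu)" if x: "x \<in> B" for x
  proof -
    have "(\<integral>\<^sup>+t. ennreal ((t powr k * a t x) powr q) \<partial>nu)
       \<le> (\<integral>\<^sup>+t. ennreal (V powr (q - q / p) * I powr (q / p - 1)) * Bt t x \<partial>nu)"
    proof (subst (1 2) nui)
      show "(\<integral>\<^sup>+t. ennreal (t powr (- k)) * indicator {0<..<1} t * ennreal ((t powr k * a t x) powr q) \<partial>lborel)
        \<le> (\<integral>\<^sup>+t. ennreal (t powr (- k)) * indicator {0<..<1} t *
            (ennreal (V powr (q - q / p) * I powr (q / p - 1)) * Bt t x) \<partial>lborel)"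
      proof (rule nn_integral_mono)
        fix t :: real
        have "ennreal ((t powr k * a t x) powr q) \<le> ennreal (V powr (q - q / p) * I powr (q / p - 1)) * Bt t x"
          if t: "0 < t" "t < 1"
        proof -
          have "ennreal ((t powr k * a t x) powr q) = ennreal (t powr (k * q)) * ennreal (a t x powr q)"
            using a(2) t by (simp add: powr_mult powr_powr ennreal_mult)
          also have "\<dots> \<le> ennreal (t powr (k * q)) *
              (ennreal (V powr (q - q / p) * (t powr (- d) * I) powr (q / p - 1)) * Bt t x)"
            by (intro mult_left_mono aq t) auto
          also have "\<dots> = ennreal (t powr (k * q) * (V powr (q - q / p) * (t powr (- d) * I) powr (q / p - 1))) * Bt t x"
            by (simp add: ennreal_mult mult.assoc)
          also have "t powr (k * q) * (V powr (q - q / p) * (t powr (- d) * I) powr (q / p - 1))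
              = V powr (q - q / p) * I powr (q / p - 1)"
          proof -
            have "(t powr (- d) * I) powr (q / p - 1) = t powr (- (k * q)) * I powr (q / p - 1)"
              by (simp add: powr_mult powr_powr kq)
            moreover have "t powr (k * q) * t powr (- (k * q)) = 1"
              using t by (simp add: powr_add[symmetric])
            ultimately show ?thesis by (simp add: mult.left_commute[of "t powr (k * q)"] mult.assoc[symmetric])
          qed
          finally show ?thesis .
        qed
        then show "ennreal (t powr (- k)) * indicator {0<..<1} t * ennreal ((t powr k * a t x) powr q)
          \<le> ennreal (t powr (- k)) * indicator {0<..<1} t *
            (ennreal (V powr (q - q / p) * I powr (q / p - 1)) * Bt t x)"
          by (cases "t \<in> {0<..<1}") (auto intro!: mult_left_mono)
      qed
    qed auto
    also have "\<dots> = ennreal (V powr (q - q / p) * I powr (q / p - 1)) * (\<integral>\<^sup>+t. Bt t x \<partial>nu)"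
      by (subst nn_integral_cmult) auto
    finally have "ennreal (m powr (q - 1)) * (\<integral>\<^sup>+t. ennreal ((t powr k * a t x) powr q) \<partial>nu)
      \<le> ennreal (m powr (q - 1)) * (ennreal (V powr (q - q / p) * I powr (q / p - 1)) * (\<integral>\<^sup>+t. Bt t x \<partial>nu))"
      by (intro mult_left_mono) auto
    also have "\<dots> = ennreal cc * (\<integral>\<^sup>+t. Bt t x \<partial>nu)"
      unfolding cc_def by (simp add: ennreal_mult mult.assoc)
    finally show ?thesis using gq[OF x] by (rule order_trans[rotated])
  qed
  have "(\<integral>\<^sup>+x\<in>B. ennreal (g x powr q) \<partial>lborel) \<le> (\<integral>\<^sup>+x\<in>B. ennreal (V powr (- q)) * (ennreal cc * (\<integral>\<^sup>+t. Bt t x \<partial>nu)) \<partial>lborel)"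
  proof (rule nn_integral_mono)
    fix x
    have "ennreal (g x powr q) \<le> ennreal (V powr (- q)) * (ennreal cc * (\<integral>\<^sup>+t. Bt t x \<partial>nu))" if x: "x \<in> B"
    proof -
      have "g x powr q = V powr (- q) * (V * g x) powr q"
        using V g(1)[OF x] by (simp add: powr_mult mult.assoc[symmetric] powr_add[symmetric])
      then have "ennreal (g x powr q) = ennreal (V powr (- q)) * ennreal ((V * g x) powr q)"
        by (simp add: ennreal_mult)
      also have "\<dots> \<le> ennreal (V powr (- q)) * (ennreal cc * (\<integral>\<^sup>+t. Bt t x \<partial>nu))"
        by (intro mult_left_mono step x) auto
      finally show ?thesis .
    qed
    then show "ennreal (g x powr q) * indicator B x
      \<le> ennreal (V powr (- q)) * (ennreal cc * (\<integral>\<^sup>+t. Bt t x \<partial>nu)) * indicator B x"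
      by (auto split: split_indicator)
  qed
  also have "\<dots> = (\<integral>\<^sup>+x. ennreal (V powr (- q)) * (ennreal cc * (\<integral>\<^sup>+t. Bt t x \<partial>nu)) \<partial>BM)"
    by (subst BMi) auto
  also have "\<dots> = ennreal (V powr (- q)) * (ennreal cc * (\<integral>\<^sup>+x. (\<integral>\<^sup>+t. Bt t x \<partial>nu) \<partial>BM))"
    by (simp add: nn_integral_cmult)
  also have "(\<integral>\<^sup>+x. (\<integral>\<^sup>+t. Bt t x \<partial>nu) \<partial>BM) = (\<integral>\<^sup>+t. (\<integral>\<^sup>+x. Bt t x \<partial>BM) \<partial>nu)"
    by (rule pair_sigma_finite.Fubini')
      (auto simp: pair_sigma_finite_def BM.sigma_finite_measure_axioms nu.sigma_finite_measure_axioms)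
  also have "ennreal (V powr (- q)) * (ennreal cc * (\<integral>\<^sup>+t. (\<integral>\<^sup>+x. Bt t x \<partial>BM) \<partial>nu))
      \<le> ennreal (V powr (- q)) * (ennreal cc * (ennreal (V * (2 ^ DIM('a) * I)) * ennreal m))"
  proof (intro mult_left_mono)
    have "(\<integral>\<^sup>+t. (\<integral>\<^sup>+x. Bt t x \<partial>BM) \<partial>nu) \<le> (\<integral>\<^sup>+t. ennreal (V * (2 ^ DIM('a) * I)) \<partial>nu)"
      unfolding nu_def by (intro nn_integral_mono_AE) (auto simp: AE_density Btx split: split_indicator)
    then show "(\<integral>\<^sup>+t. (\<integral>\<^sup>+x. Bt t x \<partial>BM) \<partial>nu) \<le> ennreal (V * (2 ^ DIM('a) * I)) * ennreal m"
      using emnu by simp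
  qed auto
  also have "\<dots> = ennreal (V powr (- q) * (cc * ((V * (2 ^ DIM('a) * I)) * m)))"
    using V I m by (simp add: ennreal_mult cc_def)
  also have "V powr (- q) * (cc * ((V * (2 ^ DIM('a) * I)) * m)) = m powr q * 2 ^ DIM('a) * (V powr (1 - q / p) * I powr (q / p))"
  proof -
    have "m powr (q - 1) * m = m powr q" using m powr_mult_base[of m "q - 1"] by (simp add: mult.commute)
    moreover have "V powr (- q) * V powr (q - q / p) * V = V powr (1 - q / p)"
      using V powr_mult_base[of V "- (q / p)"] by (simp add: powr_add[symmetric] mult.commute)
    moreover have "I powr (q / p - 1) * I = I powr (q / p)"
      using I powr_mult_base[of I "q / p - 1"] by (simp add: mult.commute)
    moreover have "V powr (- q) * (cc * ((V * (2 ^ DIM('a) * I)) * m)) = (m powr (q - 1) * m) * 2 ^ DIM('a) *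
       ((V powr (- q) * V powr (q - q / p) * V) * (I powr (q / p - 1) * I))"
      unfolding cc_def by (simp only: ac_simps)
    ultimately show ?thesis by simp
  qed
  finally show ?thesis unfolding m_def .
qed

section \<open>Test functions\<close>

definition smooth :: "('a::euclidean_space \<Rightarrow> real) \<Rightarrow> bool" where
  "smooth f \<longleftrightarrow> (\<forall>k. Ck k f)"

lemma Ck_SucD: "Ck (Suc k) f \<Longrightarrow> Ck k f"
proof (induction k arbitrary: f)
  case 0
  then show ?case
    by (auto intro!: continuous_at_imp_continuous_on differentiable_imp_continuous_within)
next
  case (Suc k)
  then show ?case by simp
qed

lemma frechet_derivative_add:
  assumes "f differentiable at x" "g differentiable at x"
  shows "frechet_derivative (\<lambda>x. f x + g x) (at x) = (\<lambda>v. frechet_derivative f (at x) v + frechet_derivative g (at x) v)"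
  using has_derivative_add[OF assms[unfolded frechet_derivative_works]]
  by (rule frechet_derivative_at[symmetric])

lemma frechet_derivative_mult:
  fixes f g :: "'a::real_normed_vector \<Rightarrow> real"
  assumes "f differentiable at x" "g differentiable at x"
  shows "frechet_derivative (\<lambda>x. f x * g x) (at x) =
    (\<lambda>v. f x * frechet_derivative g (at x) v + frechet_derivative f (at x) v * g x)"
  using has_derivative_mult[OF assms[unfolded frechet_derivative_works]]
  by (rule frechet_derivative_at[symmetric])

lemma has_derivative_affine_compose:
  assumes "f differentiable at (t + L x)" "bounded_linear L"
  shows "((\<lambda>x. f (t + L x)) has_derivative (\<lambda>v. frechet_derivative f (at (t + L x)) (L v))) (at x)"
proof -
  have "((\<lambda>x. t + L x) has_derivative L) (at x)"
    using has_derivative_add[OF has_derivative_const bounded_linear.has_derivative[OF assms(2) has_derivative_ident]]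
    by simp
  from diff_chain_at[OF this assms(1)[unfolded frechet_derivative_works]]
  show ?thesis by (simp add: o_def)
qed

lemma Ck_add: "Ck k f \<Longrightarrow> Ck k g \<Longrightarrow> Ck k (\<lambda>x. f x + g x)"
proof (induction k arbitrary: f g)
  case (Suc k)
  then show ?case by (simp add: frechet_derivative_add)
qed (auto intro: continuous_intros)

lemma Ck_mult: "Ck k f \<Longrightarrow> Ck k g \<Longrightarrow> Ck k (\<lambda>x. f x * g x)"
proof (induction k arbitrary: f g)
  case (Suc k)
  then have "Ck k f" "Ck k g" by (auto intro: Ck_SucD)
  with Suc show ?case by (simp add: frechet_derivative_mult Ck_add)
qed (auto intro: continuous_intros)

lemma Ck_const: "Ck k (\<lambda>x. c)"
  by (induction k arbitrary: c) (auto intro: continuous_intros)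

lemma Ck_affine: "Ck k f \<Longrightarrow> bounded_linear L \<Longrightarrow> Ck k (\<lambda>x. f (t + L x))"
proof (induction k arbitrary: f)
  case 0
  have "continuous_on UNIV (\<lambda>x. t + L x)"
    by (intro continuous_on_add continuous_on_const bounded_linear.continuous_on[OF 0(2)] continuous_on_id)
  then show ?case
    using 0(1) continuous_on_compose2[of UNIV f UNIV "\<lambda>x. t + L x"] by simp
next
  case (Suc k)
  have "frechet_derivative (\<lambda>x. f (t + L x)) (at x) = (\<lambda>v. frechet_derivative f (at (t + L x)) (L v))" for x
    using Suc.prems by (intro frechet_derivative_at[symmetric] has_derivative_affine_compose) auto
  moreover have "(\<lambda>x. f (t + L x)) differentiable at x" for x
    using Suc.prems has_derivative_affine_compose[of f t L x] by (auto simp: differentiable_def)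
  moreover have "Ck k (\<lambda>x. frechet_derivative f (at (t + L x)) (L v))" for v
    using Suc.prems by (intro Suc.IH) auto
  ultimately show ?case by simp
qed

lemma smooth_intros:
  "smooth f \<Longrightarrow> smooth g \<Longrightarrow> smooth (\<lambda>x. f x + g x)"
  "smooth f \<Longrightarrow> smooth g \<Longrightarrow> smooth (\<lambda>x. f x * g x)"
  "smooth (\<lambda>x. c)"
  "smooth f \<Longrightarrow> bounded_linear L \<Longrightarrow> smooth (\<lambda>x. f (t + L x))"
  unfolding smooth_def by (auto intro: Ck_add Ck_mult Ck_const Ck_affine)

lemma smooth_differentiable: "smooth f \<Longrightarrow> f differentiable at x"
  and smooth_continuous: "smooth f \<Longrightarrow> continuous_on S f"
  and smooth_derivative: "smooth f \<Longrightarrow> smooth (\<lambda>x. frechet_derivative f (at x) v)"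
proof -
  assume f: "smooth f"
  then have "Ck (Suc k) f" for k unfolding smooth_def by blast
  then show "f differentiable at x" "smooth (\<lambda>x. frechet_derivative f (at x) v)" 
    by (auto simp: smooth_def)
  show "continuous_on S f"
    using f[unfolded smooth_def, rule_format, of 0] by (auto intro: continuous_on_subset)
qed

lemma smooth_measurable: "smooth f \<Longrightarrow> f \<in> borel_measurable borel"
  using smooth_continuous[of f UNIV] by (rule borel_measurable_continuous_onI)

lemma test_functionsD:
  assumes "\<phi> \<in> test_functions \<Omega>"
  obtains K where "smooth \<phi>" "compact K" "K \<subseteq> \<Omega>" "\<And>x. x \<notin> K \<Longrightarrow> \<phi> x = 0"
    "\<And>x v. x \<notin> K \<Longrightarrow> frechet_derivative \<phi> (at x) v = 0"
proof
  let ?K = "closure {x. \<phi> x \<noteq> 0}"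
  show "smooth \<phi>" "compact ?K" "?K \<subseteq> \<Omega>" using assms by (auto simp: test_functions_def smooth_def)
  show z: "\<phi> x = 0" if "x \<notin> ?K" for x using that closure_subset[of "{x. \<phi> x \<noteq> 0}"] by blast
  fix x v assume x: "x \<notin> ?K"
  have "((\<lambda>x. 0) has_derivative (\<lambda>v. 0)) (at x)" by simp
  then have "(\<phi> has_derivative (\<lambda>v. 0)) (at x)"
  proof (rule has_derivative_transform_within_open)
    show "open (- ?K)" "x \<in> - ?K" using x by auto
    show "0 = \<phi> y" if "y \<in> - ?K" for y using z[of y] that by simp
  qed
  then have "(\<lambda>v. 0) = frechet_derivative \<phi> (at x)" by (rule frechet_derivative_at)
  then show "frechet_derivative \<phi> (at x) v = 0" using fun_cong[of "\<lambda>v. 0" _ v] by metis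
qed

lemma test_functionsI:
  assumes "smooth \<phi>" "compact K" "K \<subseteq> \<Omega>" "\<And>x. x \<notin> K \<Longrightarrow> \<phi> x = 0"
  shows "\<phi> \<in> test_functions \<Omega>"
proof -
  have "closure {x. \<phi> x \<noteq> 0} \<subseteq> K"
    by (rule closure_minimal) (use assms compact_imp_closed in auto)
  moreover from this have "compact (closure {x. \<phi> x \<noteq> 0})"
    using assms(2) compact_Int_closed[OF assms(2) closed_closure] by (metis inf.absorb_iff2)
  ultimately show ?thesis using assms unfolding test_functions_def smooth_def by auto
qed

lemma test_functions_add:
  assumes "f \<in> test_functions \<Omega>" "g \<in> test_functions \<Omega>"
  shows "(\<lambda>x. f x + g x) \<in> test_functions \<Omega>"
proof -
  from assms(1) obtain K where K: "smooth f" "compact K" "K \<subseteq> \<Omega>" "\<And>x. x \<notin> K \<Longrightarrow> f x = 0"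
    by (rule test_functionsD) blast
  from assms(2) obtain L where L: "smooth g" "compact L" "L \<subseteq> \<Omega>" "\<And>x. x \<notin> L \<Longrightarrow> g x = 0"
    by (rule test_functionsD) blast
  show ?thesis
    by (rule test_functionsI[of _ "K \<union> L"]) (use K L in \<open>auto intro: smooth_intros\<close>)
qed

lemma test_functions_mult:
  assumes "f \<in> test_functions \<Omega>" "smooth g"
  shows "(\<lambda>x. g x * f x) \<in> test_functions \<Omega>"
proof -
  from assms(1) obtain K where K: "smooth f" "compact K" "K \<subseteq> \<Omega>" "\<And>x. x \<notin> K \<Longrightarrow> f x = 0"
    by (rule test_functionsD) blast
  show ?thesis
    by (rule test_functionsI[of _ K]) (use K assms(2) in \<open>auto intro: smooth_intros\<close>)
qed

lemma test_functions_zero: "(\<lambda>x. 0) \<in> test_functions \<Omega>"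
  by (rule test_functionsI[of _ "{}"]) (auto intro: smooth_intros)

lemma test_functions_scale: "f \<in> test_functions \<Omega> \<Longrightarrow> (\<lambda>x. c * f x) \<in> test_functions \<Omega>"
  by (rule test_functions_mult) (auto intro: smooth_intros)

lemma test_functions_sum:
  "finite I \<Longrightarrow> (\<And>i. i \<in> I \<Longrightarrow> f i \<in> test_functions \<Omega>) \<Longrightarrow> (\<lambda>x. \<Sum>i\<in>I. f i x) \<in> test_functions \<Omega>"
proof (induction I rule: finite_induct)
  case (insert i I)
  then show ?case using test_functions_add[of "f i" \<Omega> "\<lambda>x. \<Sum>i\<in>I. f i x"] by simp
qed (simp add: test_functions_zero)

lemma test_functions_mono: "\<phi> \<in> test_functions \<Omega> \<Longrightarrow> \<Omega> \<subseteq> \<Omega>' \<Longrightarrow> \<phi> \<in> test_functions \<Omega>'"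
  by (auto simp: test_functions_def)

lemma integrable_compact_support:
  fixes f :: "'a::euclidean_space \<Rightarrow> 'b::{banach, second_countable_topology}"
  assumes "continuous_on UNIV f" "compact K" "\<And>x. x \<notin> K \<Longrightarrow> f x = 0"
  shows "integrable lborel f"
proof -
  have "integrable lborel (\<lambda>x. indicator K x *\<^sub>R f x)"
    using assms by (intro borel_integrable_compact) (auto intro: continuous_on_subset)
  moreover have "(\<lambda>x. indicator K x *\<^sub>R f x) = f" using assms(3) by (auto simp: indicator_def)
  ultimately show ?thesis by simp
qed

lemma smooth_line_integral:
  assumes f: "smooth f"
  shows "((\<lambda>t. frechet_derivative f (at (x + t *\<^sub>R v)) v) has_integral (f (x + v) - f x)) {0..1}"
proof -
  have "((\<lambda>t. frechet_derivative f (at (x + t *\<^sub>R v)) v) has_integral (f (x + 1 *\<^sub>R v) - f (x + 0 *\<^sub>R v))) {0..1}"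
  proof (rule fundamental_theorem_of_calculus)
    fix t :: real
    have "((\<lambda>t. f (x + t *\<^sub>R v)) has_derivative (\<lambda>s. frechet_derivative f (at (x + t *\<^sub>R v)) (s *\<^sub>R v))) (at t)"
    proof (rule has_derivative_compose[where f = "\<lambda>t. x + t *\<^sub>R v"])
      show "((\<lambda>t. x + t *\<^sub>R v) has_derivative (\<lambda>s. s *\<^sub>R v)) (at t)"
        by (auto intro!: derivative_eq_intros)
      show "(f has_derivative frechet_derivative f (at (x + t *\<^sub>R v))) (at (x + t *\<^sub>R v))"
        using smooth_differentiable[OF f] unfolding frechet_derivative_works .
    qed
    moreover have "frechet_derivative f (at (x + t *\<^sub>R v)) (s *\<^sub>R v) = s *\<^sub>R frechet_derivative f (at (x + t *\<^sub>R v)) v" for s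
      by (rule linear_scale[OF linear_frechet_derivative[OF smooth_differentiable[OF f]]])
    ultimately show "((\<lambda>t. f (x + t *\<^sub>R v)) has_vector_derivative frechet_derivative f (at (x + t *\<^sub>R v)) v) (at t within {0..1})"
      unfolding has_vector_derivative_def by (auto intro: has_derivative_at_withinI)
  qed simp
  then show ?thesis by simp
qed

text \<open>By Fubini and translation invariance the integral of the directional derivative equals
  that of the increment \<open>f (x + v) - f x\<close>, and this is 0.\<close>

lemma integral_derivative_zero:
  fixes f :: "'a::euclidean_space \<Rightarrow> real"
  assumes f: "smooth f" and K: "compact K" "\<And>x. x \<notin> K \<Longrightarrow> f x = 0"
    "\<And>x. x \<notin> K \<Longrightarrow> frechet_derivative f (at x) v = 0"
  shows "(\<integral>x. frechet_derivative f (at x) v \<partial>lborel) = 0"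
proof -
  define g where "g x = frechet_derivative f (at x) v" for x
  have gc: "continuous_on UNIV g" unfolding g_def by (intro smooth_continuous smooth_derivative f)
  have fint: "integrable lborel f" by (rule integrable_compact_support[OF smooth_continuous[OF f] K(1,2)])
  \<comment> \<open>All starting points \<open>x\<close> whose segment to \<open>x + v\<close> meets
    \<open>K\<close>; it gives the double integrand compact support.\<close>
  define K' where "K' = (\<lambda>(y, t). y - t *\<^sub>R v) ` (K \<times> {0..1::real})"
  have K': "compact K'" unfolding K'_def split_beta
    by (intro compact_continuous_image compact_Times K continuous_intros) auto
  have int: "integrable (lborel \<Otimes>\<^sub>M lborel) (\<lambda>(x, t). indicator {0..1::real} t *\<^sub>R g (x + t *\<^sub>R v))"
  proof -
    have "integrable lborel (\<lambda>w. indicator (K' \<times> {0..1::real}) w *\<^sub>R g (fst w + snd w *\<^sub>R v))"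
      by (intro borel_integrable_compact compact_Times K' continuous_on_compose2[OF gc] continuous_intros) auto
    moreover have "(\<lambda>w. indicator (K' \<times> {0..1::real}) w *\<^sub>R g (fst w + snd w *\<^sub>R v))
        = (\<lambda>(x, t). indicator {0..1::real} t *\<^sub>R g (x + t *\<^sub>R v))"
    proof (rule ext, clarify)
      fix x and t :: real
      show "indicator (K' \<times> {0..1::real}) (x, t) *\<^sub>R g (fst (x, t) + snd (x, t) *\<^sub>R v)
        = indicator {0..1::real} t *\<^sub>R g (x + t *\<^sub>R v)"
      proof (cases "t \<in> {0..1} \<and> g (x + t *\<^sub>R v) \<noteq> 0")
        case True
        then have "x + t *\<^sub>R v \<in> K" using K(3) unfolding g_def by blast
        then have "x \<in> K'" unfolding K'_def using True by (force simp: image_iff)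
        then show ?thesis using True by simp
      qed auto
    qed
    ultimately show ?thesis unfolding lborel_prod by simp
  qed
  have "(\<integral>x. (\<integral>t. indicator {0..1::real} t *\<^sub>R g (x + t *\<^sub>R v) \<partial>lborel) \<partial>lborel)
      = (\<integral>t. (\<integral>x. indicator {0..1::real} t *\<^sub>R g (x + t *\<^sub>R v) \<partial>lborel) \<partial>lborel)"
    using lborel_pair.Fubini_integral[OF int] by simp
  also have "\<dots> = (\<integral>t. indicator {0..1::real} t *\<^sub>R (\<integral>x. g x \<partial>lborel) \<partial>lborel)"
  proof (intro Bochner_Integration.integral_cong refl)
    fix t :: real
    have "(\<integral>x. g (t *\<^sub>R v + x) \<partial>lborel) = (\<integral>x. g x \<partial>lborel)"
      by (subst (2) lborel_distr_plus[of "t *\<^sub>R v", symmetric], subst integral_distr)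
        (use borel_measurable_continuous_onI[OF gc] in auto)
    then show "(\<integral>x. indicator {0..1::real} t *\<^sub>R g (x + t *\<^sub>R v) \<partial>lborel) = indicator {0..1::real} t *\<^sub>R (\<integral>x. g x \<partial>lborel)"
      by (simp add: add.commute)
  qed
  also have "\<dots> = (\<integral>x. g x \<partial>lborel)" by simp
  finally have 1: "(\<integral>x. (\<integral>t. indicator {0..1::real} t *\<^sub>R g (x + t *\<^sub>R v) \<partial>lborel) \<partial>lborel) = (\<integral>x. g x \<partial>lborel)" .
  have "(\<integral>t. indicator {0..1::real} t *\<^sub>R g (x + t *\<^sub>R v) \<partial>lborel) = f (x + v) - f x" for x
  proof -
    have "set_integrable lborel {0..1} (\<lambda>t. g (x + t *\<^sub>R v))"
      unfolding set_integrable_def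
      by (intro borel_integrable_compact continuous_on_compose2[OF gc] continuous_intros) auto
    from set_borel_integral_eq_integral(2)[OF this] smooth_line_integral[OF f, of x v]
    show ?thesis unfolding g_def set_lebesgue_integral_def by (simp add: integral_unique)
  qed
  then have "(\<integral>x. g x \<partial>lborel) = (\<integral>x. f (x + v) - f x \<partial>lborel)" using 1 by simp
  also have "\<dots> = 0"
  proof -
    have fm: "f \<in> borel_measurable borel" by (rule smooth_measurable[OF f])
    have tr: "(\<integral>x. f (v + x) \<partial>lborel) = (\<integral>x. f x \<partial>lborel)"
      by (subst (2) lborel_distr_plus[of v, symmetric], subst integral_distr) (use fm in auto)
    have "integrable lborel (\<lambda>x. f (v + x))"
      using fint fm by (subst (asm) lborel_distr_plus[of v, symmetric], subst (asm) integrable_distr_eq) auto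
    then have "(\<integral>x. f (x + v) - f x \<partial>lborel) = (\<integral>x. f (x + v) \<partial>lborel) - (\<integral>x. f x \<partial>lborel)"
      using fint by (intro Bochner_Integration.integral_diff) (auto simp: add.commute)
    then show ?thesis using tr by (simp add: add.commute)
  qed
  finally show ?thesis unfolding g_def .
qed

definition gradient :: "('a::euclidean_space \<Rightarrow> real) \<Rightarrow> 'a \<Rightarrow> 'a" where
  "gradient f x = (\<Sum>b\<in>Basis. frechet_derivative f (at x) b *\<^sub>R b)"

lemma gradient_inner: "b \<in> Basis \<Longrightarrow> gradient f x \<bullet> b = frechet_derivative f (at x) b"
  unfolding gradient_def by (simp add: inner_sum_left inner_Basis if_distrib cong: if_cong)

lemma gradient_continuous: "smooth f \<Longrightarrow> continuous_on S (gradient f)"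
  unfolding gradient_def by (intro continuous_intros smooth_continuous smooth_derivative)

lemma locally_Lp_continuous:
  assumes "continuous_on UNIV f" "p > 0"
  shows "locally_Lp p \<Omega> f"
  unfolding locally_Lp_def set_integrable_def
proof (intro conjI allI impI)
  show "f \<in> borel_measurable lborel" using borel_measurable_continuous_onI[OF assms(1)] by simp
  fix K :: "'a set" assume K: "compact K"
  have "continuous_on K (\<lambda>x. norm (f x) powr p)"
    using assms
    by (intro continuous_on_powr' continuous_on_norm continuous_on_const) (auto intro: continuous_on_subset)
  with K show "integrable lborel (\<lambda>x. indicator K x *\<^sub>R norm (f x) powr p)"
    by (rule borel_integrable_compact)
qed

text \<open>Integration by parts: \<open>integral_derivative_zero\<close> for the product of the two
  test functions.\<close>

lemma test_function_weak_gradient: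
  assumes \<phi>: "\<phi> \<in> test_functions \<Omega>"
  shows "has_weak_gradient \<Omega> \<phi> (gradient \<phi>)"
  unfolding has_weak_gradient_def
proof (intro conjI ballI)
  from \<phi> obtain K where K: "smooth \<phi>" "compact K" "K \<subseteq> \<Omega>" "\<And>x. x \<notin> K \<Longrightarrow> \<phi> x = 0"
    "\<And>x v. x \<notin> K \<Longrightarrow> frechet_derivative \<phi> (at x) v = 0"
    by (rule test_functionsD) blast
  show "locally_Lp 1 \<Omega> \<phi>" "locally_Lp 1 \<Omega> (gradient \<phi>)"
    using K(1) by (auto intro!: locally_Lp_continuous smooth_continuous gradient_continuous)
  fix \<psi> b assume \<psi>: "\<psi> \<in> test_functions \<Omega>" and b: "(b :: 'a) \<in> Basis"
  then have s\<psi>: "smooth \<psi>" by (auto simp: test_functions_def smooth_def)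
  have d: "frechet_derivative (\<lambda>x. \<phi> x * \<psi> x) (at x) b =
      \<phi> x * frechet_derivative \<psi> (at x) b + frechet_derivative \<phi> (at x) b * \<psi> x" for x
    by (simp add: frechet_derivative_mult smooth_differentiable K(1) s\<psi>)
  have i: "integrable lborel (\<lambda>x. \<phi> x * frechet_derivative \<psi> (at x) b)"
    "integrable lborel (\<lambda>x. frechet_derivative \<phi> (at x) b * \<psi> x)"
    using K(4,5)
    by (auto intro!: integrable_compact_support[OF _ K(2)] continuous_on_mult
      smooth_continuous[OF K(1)] smooth_continuous[OF s\<psi>]
      smooth_continuous[OF smooth_derivative[OF K(1)]] smooth_continuous[OF smooth_derivative[OF s\<psi>]])
  have "(\<integral>x. frechet_derivative (\<lambda>x. \<phi> x * \<psi> x) (at x) b \<partial>lborel) = 0"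
    by (rule integral_derivative_zero[OF _ K(2)]) (use K s\<psi> d in \<open>auto intro: smooth_intros\<close>)
  then have eq: "(\<integral>x. \<phi> x * frechet_derivative \<psi> (at x) b \<partial>lborel) = - (\<integral>x. frechet_derivative \<phi> (at x) b * \<psi> x \<partial>lborel)"
    unfolding d using Bochner_Integration.integral_add[OF i] by simp
  have s1: "indicator \<Omega> x *\<^sub>R (\<phi> x * frechet_derivative \<psi> (at x) b) = \<phi> x * frechet_derivative \<psi> (at x) b" for x
    using K(3,4) by (cases "x \<in> \<Omega>") auto
  have s2: "indicator \<Omega> x *\<^sub>R (gradient \<phi> x \<bullet> b * \<psi> x) = frechet_derivative \<phi> (at x) b * \<psi> x" for x
    using K(3,5) by (cases "x \<in> \<Omega>") (auto simp: gradient_inner[OF b])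
  show "(LINT x:\<Omega>|lborel. \<phi> x * frechet_derivative \<psi> (at x) b) = - (LINT x:\<Omega>|lborel. gradient \<phi> x \<bullet> b * \<psi> x)"
    unfolding set_lebesgue_integral_def s1 s2 by (rule eq)
qed

section \<open>The fundamental lemma of the calculus of variations\<close>

lemma AE_box_cbox: "AE x in lborel. x \<in> box a b \<longleftrightarrow> x \<in> cbox a (b :: 'a::euclidean_space)"
proof -
  have "cbox a b - box a b \<in> null_sets lborel"
    using negligible_frontier_interval[of a b]
    by (simp add: negligible_iff_null_sets null_sets_completion_iff)
  from AE_not_in[OF this] show ?thesis by eventually_elim (use box_subset_cbox in auto)
qed

text \<open>On a closed box, the positive and the negative part of \<open>g\<close> are densities of
  measures that agree on all open boxes. Open boxes are stable under intersection and generate the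
  Borel sets, so the densities coincide almost everywhere.\<close>

lemma AE_zero_if_box_integrals_zero:
  fixes g :: "'a::euclidean_space \<Rightarrow> real"
  assumes "open \<Omega>" and g[measurable]: "g \<in> borel_measurable lborel"
    and int: "\<And>a b. cbox a b \<subseteq> \<Omega> \<Longrightarrow> set_integrable lborel (cbox a b) g"
    and zero: "\<And>a b. cbox a b \<subseteq> \<Omega> \<Longrightarrow> (LINT x:cbox a b|lborel. g x) = 0"
  shows "AE x in lborel. x \<in> \<Omega> \<longrightarrow> g x = 0"
proof -
  have *: "AE x in lborel. x \<in> cbox a b \<longrightarrow> g x = 0" if sub: "cbox a b \<subseteq> \<Omega>" for a b
  proof -
    let ?f = "\<lambda>x. g x * indicator (cbox a b) x"
    have fi: "integrable lborel ?f" using int[OF sub] unfolding set_integrable_def by (simp add: mult.commute)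
    define M1 where "M1 = density lborel (\<lambda>x. ennreal (?f x))"
    define M2 where "M2 = density lborel (\<lambda>x. ennreal (- ?f x))"
    let ?E = "range (\<lambda>(a, b). box a (b :: 'a))"
    have "M1 = M2"
    proof (rule measure_eqI_generator_eq[where E = ?E and \<Omega> = UNIV
          and A = "\<lambda>i::nat. box (- (real i *\<^sub>R One)) (real i *\<^sub>R One)"])
      show "Int_stable ?E" by (auto simp: Int_stable_def box_Int_box)
      show "?E \<subseteq> Pow UNIV" by simp
      show "sets M1 = sigma_sets UNIV ?E" "sets M2 = sigma_sets UNIV ?E"
        unfolding M1_def M2_def by (simp_all add: borel_eq_box)
      show "range (\<lambda>i::nat. box (- (real i *\<^sub>R One)) (real i *\<^sub>R One)) \<subseteq> ?E"
        by (intro image_subsetI rev_image_eqI[of "(_, _)"]) (rule UNIV_I, simp only: split)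
      show "(\<Union>i::nat. box (- (real i *\<^sub>R One)) (real i *\<^sub>R One)) = (UNIV :: 'a set)"
        by (rule UN_box_eq_UNIV)
      fix X assume "X \<in> ?E"
      then obtain c d where X: "X = box c d" by auto
      obtain c' d' where cd: "cbox c d \<inter> cbox a b = cbox c' d'"
        unfolding Int_interval by blast
      have z: "(\<integral>x. ?f x * indicator X x \<partial>lborel) = 0"
      proof -
        have "(\<integral>x. ?f x * indicator X x \<partial>lborel) = (\<integral>x. indicator (cbox c' d') x *\<^sub>R g x \<partial>lborel)"
        proof (rule integral_cong_AE)
          show "AE x in lborel. ?f x * indicator X x = indicator (cbox c' d') x *\<^sub>R g x"
            using AE_box_cbox[of c d]
          proof eventually_elim
            case (elim x)
            have "x \<in> cbox c' d' \<longleftrightarrow> x \<in> X \<and> x \<in> cbox a b" using cd elim X by blast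
            then show ?case by (auto simp: indicator_def)
          qed
        qed (use X g in \<open>auto simp: borel_open\<close>)
        also have "\<dots> = 0" using zero[of c' d'] cd sub unfolding set_lebesgue_integral_def by auto
        finally show ?thesis .
      qed
      have fX: "integrable lborel (\<lambda>x. ?f x * indicator X x)"
        using integrable_mult_indicator[OF _ fi, of X] X by (simp add: ac_simps)
      define A where "A = (\<integral>\<^sup>+x. ennreal (?f x * indicator X x) \<partial>lborel)"
      define B where "B = (\<integral>\<^sup>+x. ennreal (- (?f x * indicator X x)) \<partial>lborel)"
      have e1: "emeasure M1 X = A"
        unfolding M1_def A_def X by (subst emeasure_density) (auto intro!: nn_integral_cong split: split_indicator)
      have e2: "emeasure M2 X = B"
        unfolding M2_def B_def X by (subst emeasure_density) (auto intro!: nn_integral_cong split: split_indicator)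
      have fin: "A < top" "B < top"
        using fX unfolding real_integrable_def A_def B_def by (auto simp: less_top)
      have eq: "enn2real A = enn2real B"
        using z[unfolded real_lebesgue_integral_def[OF fX]] unfolding A_def B_def by simp
      show "emeasure M1 X = emeasure M2 X"
        unfolding e1 e2 by (metis fin eq ennreal_enn2real)
    next
      fix i :: nat
      have "emeasure M1 (box (- (real i *\<^sub>R One)) (real i *\<^sub>R One)) \<le> (\<integral>\<^sup>+x. ennreal (?f x) \<partial>lborel)"
        unfolding M1_def by (subst emeasure_density) (auto intro!: nn_integral_mono split: split_indicator)
      also have "\<dots> < \<infinity>" using fi unfolding real_integrable_def by (auto simp: less_top)
      finally show "emeasure M1 (box (- (real i *\<^sub>R One)) (real i *\<^sub>R One)) \<noteq> \<infinity>" by simp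
    qed
    then have "AE x in lborel. ennreal (?f x) = ennreal (- ?f x)"
      unfolding M1_def M2_def by (subst (asm) sigma_finite_measure.density_unique_iff[OF sigma_finite_lborel]) auto
    then show ?thesis
    proof eventually_elim
      case (elim x)
      show ?case
      proof
        assume "x \<in> cbox a b"
        with elim have "ennreal (g x) = ennreal (- g x)" by simp
        then show "g x = 0" by (cases "g x \<ge> 0") (auto simp: ennreal_neg ennreal_eq_0_iff not_le)
      qed
    qed
  qed
  obtain \<D> where D: "countable \<D>" "\<D> \<subseteq> Pow \<Omega>" "\<And>X. X \<in> \<D> \<Longrightarrow> \<exists>a b. X = cbox a b" "\<Union>\<D> = \<Omega>"
    using open_countable_Union_open_cbox[OF \<open>open \<Omega>\<close>] by blast
  have "AE x in lborel. \<forall>X\<in>\<D>. x \<in> X \<longrightarrow> g x = 0"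
    unfolding AE_ball_countable[OF D(1)]
  proof
    fix X assume X: "X \<in> \<D>"
    then obtain a b where "X = cbox a b" using D(3) by blast
    with X D(2) show "AE x in lborel. x \<in> X \<longrightarrow> g x = 0" using *[of a b] by blast
  qed
  then show ?thesis by eventually_elim (use D(4) in blast)
qed

text \<open>Only one such function is ever required; it is taken from the energy space by
  \<open>bump_exists\<close>.\<close>

definition bump :: "('a::euclidean_space \<Rightarrow> real) \<Rightarrow> bool" where
  "bump \<psi> \<longleftrightarrow> \<psi> \<in> test_functions UNIV \<and> (\<forall>x. \<psi> x \<ge> 0) \<and> (\<integral>x. \<psi> x \<partial>lborel) > 0"

text \<open>Testing against all translates and dilates of a single bump suffices.\<close>

lemma du_bois_reymond:
  fixes g \<psi> :: "'a::euclidean_space \<Rightarrow> real"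
  assumes op: "open \<Omega>" and g[measurable]: "g \<in> borel_measurable lborel"
    and int: "\<And>K. compact K \<Longrightarrow> K \<subseteq> \<Omega> \<Longrightarrow> set_integrable lborel K g"
    and zero: "\<And>\<phi>. \<phi> \<in> test_functions \<Omega> \<Longrightarrow> (LINT x:\<Omega>|lborel. g x * \<phi> x) = 0"
    and \<psi>: "bump \<psi>"
  shows "AE x in lborel. x \<in> \<Omega> \<longrightarrow> g x = 0"
proof (rule AE_zero_if_box_integrals_zero[OF op g])
  show "set_integrable lborel (cbox a b) g" if "cbox a b \<subseteq> \<Omega>" for a b
    using int[OF compact_cbox that] .
  fix a b assume sub: "cbox a b \<subseteq> \<Omega>"
  show "(LINT x:cbox a b|lborel. g x) = 0"
  proof (cases "cbox a b = {}")
    case False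
    define Q where "Q = cbox a b"
    have Q: "Q \<noteq> {}" "compact Q" "Q \<subseteq> \<Omega>" using False sub unfolding Q_def by auto
    have [measurable]: "Q \<in> sets borel" unfolding Q_def by simp
    obtain e where e: "e > 0" "{x. infdist x Q \<le> e} \<subseteq> \<Omega>"
      using compact_in_open_separated[OF Q(1,2) op Q(3)] by blast
    define Ke where "Ke = {x. infdist x Q \<le> e}"
    have Ke: "compact Ke" "Ke \<subseteq> \<Omega>" unfolding Ke_def using e compact_infdist_le[OF Q(1,2) e(1)] by auto
    have [measurable]: "Ke \<in> sets borel" using Ke(1) by (simp add: borel_compact)
    obtain K where K: "smooth \<psi>" "compact K" "\<And>x. x \<notin> K \<Longrightarrow> \<psi> x = 0"
      using \<psi> unfolding bump_def by (metis test_functionsD)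
    have \<psi>0: "\<psi> x \<ge> 0" for x using \<psi> unfolding bump_def by auto
    have [measurable]: "\<psi> \<in> borel_measurable borel" by (rule smooth_measurable[OF K(1)])
    have \<psi>i: "integrable lborel \<psi>" by (rule integrable_compact_support[OF smooth_continuous[OF K(1)] K(2,3)])
    obtain R where R: "R > 0" "\<And>x. x \<in> K \<Longrightarrow> norm x \<le> R"
      using compact_imp_bounded[OF K(2)] unfolding bounded_pos by auto
    obtain Bd where Bd: "\<And>x. \<psi> x \<le> Bd"
    proof -
      have "bounded (\<psi> ` K)"
        by (intro compact_imp_bounded compact_continuous_image smooth_continuous K)
      then obtain B where "B > 0" "\<forall>y\<in>\<psi> ` K. norm y \<le> B" unfolding bounded_pos by auto
      then have "\<psi> x \<le> B" for x using K(3)[of x] by (cases "x \<in> K") force+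
      then show ?thesis using that by blast
    qed
    define G where "G y = indicator Ke y * g y" for y
    have Gi: "integrable lborel G"
      using int[OF Ke] unfolding set_integrable_def G_def by simp
    have [measurable]: "G \<in> borel_measurable borel" unfolding G_def using g by simp
    \<comment> \<open>The offset \<open>R / e\<close> keeps the support of each dilated bump centred
      in \<open>Q\<close> inside the closed \<open>e\<close>-neighbourhood
      \<open>Ke\<close>.\<close>
    define s where "s n = real n + R / e" for n
    have s: "s n > 0" "R / s n \<le> e" for n
    proof -
      have "R / e > 0" using R e by simp
      then show "s n > 0" unfolding s_def by linarith
      then show "R / s n \<le> e" using e R unfolding s_def by (simp add: field_simps)
    qed
    have orth: "(\<integral>y. G y * \<psi> (s n *\<^sub>R (y - z)) \<partial>lborel) = 0" if z: "z \<in> Q" for n z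
    proof -
      have supp: "\<psi> (s n *\<^sub>R (y - z)) = 0" if y: "y \<notin> Ke" for y
      proof (rule ccontr)
        assume "\<psi> (s n *\<^sub>R (y - z)) \<noteq> 0"
        then have "s n *\<^sub>R (y - z) \<in> K" using K(3) by blast
        from R(2)[OF this] have "s n * norm (y - z) \<le> R" using s(1)[of n] by simp
        then have "norm (y - z) \<le> R / s n" using s(1)[of n] by (simp add: field_simps)
        then have "dist y z \<le> e" using s(2)[of n] by (simp add: dist_norm)
        then have "infdist y Q \<le> e" using infdist_le[OF z, of y] by linarith
        then show False using y unfolding Ke_def by simp
      qed
      have "smooth (\<lambda>y. \<psi> ((- s n *\<^sub>R z) + s n *\<^sub>R y))"
        by (intro smooth_intros K bounded_linear_scaleR_right)
      then have "smooth (\<lambda>y. \<psi> (s n *\<^sub>R (y - z)))" by (simp add: algebra_simps)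
      then have "(\<lambda>y. \<psi> (s n *\<^sub>R (y - z))) \<in> test_functions \<Omega>"
        by (rule test_functionsI[OF _ Ke]) (use supp in auto)
      from zero[OF this] have A: "(LINT y:\<Omega>|lborel. g y * \<psi> (s n *\<^sub>R (y - z))) = 0" .
      have eq: "indicator \<Omega> y *\<^sub>R (g y * \<psi> (s n *\<^sub>R (y - z))) = G y * \<psi> (s n *\<^sub>R (y - z))" for y
        using supp[of y] Ke(2) unfolding G_def by (cases "y \<in> Ke") auto
      show ?thesis using A unfolding set_lebesgue_integral_def eq .
    qed
    \<comment> \<open>Integrating the orthogonality relations over centres \<open>z\<close> in
      \<open>Q\<close> and substituting \<open>w = s n *\<^sub>R (y - z)\<close> shows that the mean
      of \<open>h n w\<close> with weight \<open>\<psi>\<close> is 0. As \<open>n\<close> grows,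
      \<open>h n w\<close> tends to the integral of \<open>g\<close> over the box, for every
      \<open>w\<close>.\<close>
    define h where "h n w = (\<integral>y. G y * indicator Q (y - (1 / s n) *\<^sub>R w) \<partial>lborel)" for n w
    have h0: "(\<integral>w. \<psi> w * h n w \<partial>lborel) = 0" for n
    proof -
      have i1: "integrable (lborel \<Otimes>\<^sub>M lborel) (\<lambda>(w, y). \<psi> w * (G y * indicator Q (y - (1 / s n) *\<^sub>R w)))"
      proof (rule lborel_pair.Fubini_integrable)
        show "AE w in lborel. integrable lborel (\<lambda>y. case (w, y) of (w, y) \<Rightarrow> \<psi> w * (G y * indicator Q (y - (1 / s n) *\<^sub>R w)))"
        proof (intro AE_I2)
          fix w
          have "integrable lborel (\<lambda>y. G y * indicator Q (y - (1 / s n) *\<^sub>R w))"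
            by (rule Bochner_Integration.integrable_bound[OF Gi]) (auto split: split_indicator)
          then show "integrable lborel (\<lambda>y. case (w, y) of (w, y) \<Rightarrow> \<psi> w * (G y * indicator Q (y - (1 / s n) *\<^sub>R w)))"
            by simp
        qed
        show "integrable lborel (\<lambda>w. \<integral>y. norm (case (w, y) of (w, y) \<Rightarrow> \<psi> w * (G y * indicator Q (y - (1 / s n) *\<^sub>R w))) \<partial>lborel)"
        proof (rule Bochner_Integration.integrable_bound)
          show "integrable lborel (\<lambda>w. \<psi> w * (\<integral>y. \<bar>G y\<bar> \<partial>lborel))" using \<psi>i by simp
          show "AE w in lborel. norm (\<integral>y. norm (case (w, y) of (w, y) \<Rightarrow> \<psi> w * (G y * indicator Q (y - (1 / s n) *\<^sub>R w))) \<partial>lborel)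
            \<le> norm (\<psi> w * (\<integral>y. \<bar>G y\<bar> \<partial>lborel))"
          proof (intro AE_I2)
            fix w
            have "(\<integral>y. norm (\<psi> w * (G y * indicator Q (y - (1 / s n) *\<^sub>R w))) \<partial>lborel)
               = \<psi> w * (\<integral>y. \<bar>G y\<bar> * indicator Q (y - (1 / s n) *\<^sub>R w) \<partial>lborel)"
              using \<psi>0 by (simp add: abs_mult)
            also have "\<dots> \<le> \<psi> w * (\<integral>y. \<bar>G y\<bar> \<partial>lborel)"
              using Gi \<psi>0 by (intro mult_left_mono integral_mono' integrable_abs) (auto split: split_indicator)
            finally show "norm (\<integral>y. norm (case (w, y) of (w, y) \<Rightarrow> \<psi> w * (G y * indicator Q (y - (1 / s n) *\<^sub>R w))) \<partial>lborel)
              \<le> norm (\<psi> w * (\<integral>y. \<bar>G y\<bar> \<partial>lborel))" by simp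
          qed
        qed measurable
      qed measurable
      have i2: "integrable (lborel \<Otimes>\<^sub>M lborel) (\<lambda>(z, y). indicator Q z * (G y * \<psi> (s n *\<^sub>R (y - z))))"
      proof (rule Bochner_Integration.integrable_bound)
        have "integrable lborel (indicator Q :: 'a \<Rightarrow> real)" 
          unfolding Q_def 
          by (intro integrable_real_indicator emeasure_lborel_cbox_finite) simp
        then show "integrable (lborel \<Otimes>\<^sub>M lborel) (\<lambda>(z, y). (Bd * indicator Q z) * G y)"
        proof (intro lborel_pair.Fubini_integrable)
          show "AE z in lborel. integrable lborel (\<lambda>y. case (z, y) of (z, y) \<Rightarrow> (Bd * indicator Q z) * G y)"
            using Gi by simp
          show "integrable lborel (\<lambda>z. \<integral>y. norm (case (z, y) of (z, y) \<Rightarrow> (Bd * indicator Q z) * G y) \<partial>lborel)"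
            using \<open>integrable lborel (indicator Q :: 'a \<Rightarrow> real)\<close> by (simp add: abs_mult)
        qed measurable
        show "AE x in lborel \<Otimes>\<^sub>M lborel. norm (case x of (z, y) \<Rightarrow> indicator Q z * (G y * \<psi> (s n *\<^sub>R (y - z))))
           \<le> norm (case x of (z, y) \<Rightarrow> (Bd * indicator Q z) * G y)"
        proof (intro AE_I2, clarify)
          fix z y :: 'a
          have "\<bar>\<psi> (s n *\<^sub>R (y - z))\<bar> \<le> \<bar>Bd\<bar>" using Bd[of "s n *\<^sub>R (y - z)"] \<psi>0[of "s n *\<^sub>R (y - z)"] by simp
          then show "norm (indicator Q z * (G y * \<psi> (s n *\<^sub>R (y - z)))) \<le> norm ((Bd * indicator Q z) * G y)"
            by (auto simp: abs_mult mult_right_mono mult.commute[of "\<bar>G y\<bar>"] split: split_indicator)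
        qed
      qed measurable
      have "(\<integral>w. \<psi> w * h n w \<partial>lborel) = (\<integral>w. (\<integral>y. \<psi> w * (G y * indicator Q (y - (1 / s n) *\<^sub>R w)) \<partial>lborel) \<partial>lborel)"
        unfolding h_def by simp
      also have "\<dots> = (\<integral>y. (\<integral>w. \<psi> w * (G y * indicator Q (y - (1 / s n) *\<^sub>R w)) \<partial>lborel) \<partial>lborel)"
        using lborel_pair.Fubini_integral[OF i1] by simp
      also have "\<dots> = (\<integral>y. \<bar>s n\<bar> ^ DIM('a) * (\<integral>z. indicator Q z * (G y * \<psi> (s n *\<^sub>R (y - z))) \<partial>lborel) \<partial>lborel)"
      proof (rule Bochner_Integration.integral_cong[OF refl])
        fix y :: 'a
        have sn: "- s n \<noteq> 0" using s(1)[of n] by simp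
        have "(\<integral>w. \<psi> w * (G y * indicator Q (y - (1 / s n) *\<^sub>R w)) \<partial>lborel)
          = (\<integral>z. \<bar>- s n\<bar> ^ DIM('a) * (\<psi> (s n *\<^sub>R y + (- s n) *\<^sub>R z) * (G y * indicator Q (y - (1 / s n) *\<^sub>R (s n *\<^sub>R y + (- s n) *\<^sub>R z)))) \<partial>lborel)"
          by (subst lborel_affine[OF sn, of "s n *\<^sub>R y"])
            (simp add: integral_density integral_distr)
        also have "\<dots> = \<bar>s n\<bar> ^ DIM('a) * (\<integral>z. indicator Q z * (G y * \<psi> (s n *\<^sub>R (y - z))) \<partial>lborel)"
        proof -
          have arg: "s n *\<^sub>R y + (- s n) *\<^sub>R z = s n *\<^sub>R (y - z)"
            "y - (1 / s n) *\<^sub>R (s n *\<^sub>R (y - z)) = z" for z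
            using s(1)[of n] by (simp_all add: algebra_simps)
          have "(\<integral>z. \<bar>- s n\<bar> ^ DIM('a) * (\<psi> (s n *\<^sub>R (y - z)) * (G y * indicator Q z)) \<partial>lborel)
            = (\<integral>z. \<bar>s n\<bar> ^ DIM('a) * (indicator Q z * (G y * \<psi> (s n *\<^sub>R (y - z)))) \<partial>lborel)"
            by (simp only: abs_minus_cancel ac_simps)
          then show ?thesis unfolding arg Bochner_Integration.integral_mult_right_zero abs_minus_cancel .
        qed
        finally show "(\<integral>w. \<psi> w * (G y * indicator Q (y - (1 / s n) *\<^sub>R w)) \<partial>lborel)
          = \<bar>s n\<bar> ^ DIM('a) * (\<integral>z. indicator Q z * (G y * \<psi> (s n *\<^sub>R (y - z))) \<partial>lborel)" .
      qed
      also have "\<dots> = \<bar>s n\<bar> ^ DIM('a) * (\<integral>z. (\<integral>y. indicator Q z * (G y * \<psi> (s n *\<^sub>R (y - z))) \<partial>lborel) \<partial>lborel)"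
        using lborel_pair.Fubini_integral[OF i2] by simp
      also have "(\<lambda>z. (\<integral>y. indicator Q z * (G y * \<psi> (s n *\<^sub>R (y - z))) \<partial>lborel)) = (\<lambda>z. 0)"
        using orth by (auto simp: fun_eq_iff split: split_indicator)
      finally show ?thesis by simp
    qed
    have sinf: "(\<lambda>n. 1 / s n) \<longlonglongrightarrow> 0"
    proof (rule tendsto_sandwich[of "\<lambda>_. 0" _ _ "\<lambda>n. 1 / real n"])
      show "\<forall>\<^sub>F n in sequentially. 1 / s n \<le> 1 / real n"
        using eventually_gt_at_top[of 0]
        by eventually_elim (use R e in \<open>auto simp: s_def frac_le\<close>)
    qed (use s in \<open>auto simp: less_imp_le lim_1_over_n\<close>)
    \<comment> \<open>Off the boundary of the box, a null set, the shifted indicator is eventually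
      constant.\<close>
    have h_lim: "(\<lambda>n. h n w) \<longlonglongrightarrow> (\<integral>y. G y * indicator Q y \<partial>lborel)" for w
      unfolding h_def
    proof (rule integral_dominated_convergence[where w = "\<lambda>y. \<bar>G y\<bar>"])
      show "AE y in lborel. (\<lambda>n. G y * indicator Q (y - (1 / s n) *\<^sub>R w)) \<longlonglongrightarrow> G y * indicator Q y"
        using AE_box_cbox[of a b]
      proof eventually_elim
        case (elim y)
        have "(\<lambda>n. y - (1 / s n) *\<^sub>R w) \<longlonglongrightarrow> y - 0 *\<^sub>R w" by (intro tendsto_intros sinf)
        then have lim: "(\<lambda>n. y - (1 / s n) *\<^sub>R w) \<longlonglongrightarrow> y" by simp
        have "\<forall>\<^sub>F n in sequentially. indicator Q (y - (1 / s n) *\<^sub>R w) = (indicator Q y :: real)"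
        proof (cases "y \<in> box a b")
          case True
          from topological_tendstoD[OF lim open_box True] show ?thesis
            by eventually_elim (use True box_subset_cbox[of a b] in \<open>auto simp: Q_def indicator_def\<close>)
        next
          case False
          then have "y \<in> - Q" using elim unfolding Q_def by simp
          from topological_tendstoD[OF lim _ this] show ?thesis
            by (rule eventually_mono) (use False elim in \<open>auto simp: Q_def indicator_def\<close>)
        qed
        then have "\<forall>\<^sub>F n in sequentially. G y * indicator Q y = G y * indicator Q (y - (1 / s n) *\<^sub>R w)"
          by eventually_elim simp
        then show ?case by (rule Lim_transform_eventually[OF tendsto_const])
      qed
    qed (use Gi in \<open>auto split: split_indicator\<close>)
    have "(\<lambda>n. \<integral>w. \<psi> w * h n w \<partial>lborel) \<longlonglongrightarrow> (\<integral>w. \<psi> w * (\<integral>y. G y * indicator Q y \<partial>lborel) \<partial>lborel)"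
    proof (rule integral_dominated_convergence[where w = "\<lambda>w. \<psi> w * (\<integral>y. \<bar>G y\<bar> \<partial>lborel)"])
      show "AE w in lborel. (\<lambda>n. \<psi> w * h n w) \<longlonglongrightarrow> \<psi> w * (\<integral>y. G y * indicator Q y \<partial>lborel)"
        by (intro AE_I2 tendsto_intros h_lim)
      show "AE w in lborel. norm (\<psi> w * h n w) \<le> \<psi> w * (\<integral>y. \<bar>G y\<bar> \<partial>lborel)" for n
      proof (intro AE_I2)
        fix w
        have "\<bar>h n w\<bar> \<le> (\<integral>y. \<bar>G y * indicator Q (y - (1 / s n) *\<^sub>R w)\<bar> \<partial>lborel)"
          unfolding h_def by (rule integral_abs_bound)
        also have "\<dots> \<le> (\<integral>y. \<bar>G y\<bar> \<partial>lborel)"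
          using Gi by (intro integral_mono' integrable_abs) (auto split: split_indicator)
        finally show "norm (\<psi> w * h n w) \<le> \<psi> w * (\<integral>y. \<bar>G y\<bar> \<partial>lborel)"
          using \<psi>0[of w] by (simp add: abs_mult mult_left_mono)
      qed
    qed (use \<psi>i in \<open>auto simp: h_def\<close>)
    then have "(\<integral>w. \<psi> w * (\<integral>y. G y * indicator Q y \<partial>lborel) \<partial>lborel) = 0"
      unfolding h0 by (simp add: LIMSEQ_const_iff)
    then have "(\<integral>y. G y * indicator Q y \<partial>lborel) = 0" using \<psi> unfolding bump_def by simp
    moreover have "G y * indicator Q y = indicator (cbox a b) y *\<^sub>R g y" for y
    proof -
      have "y \<in> Ke" if "y \<in> Q" using that e(1) unfolding Ke_def by simp
      then show ?thesis unfolding G_def Q_def by (auto split: split_indicator)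
    qed
    ultimately show ?thesis unfolding set_lebesgue_integral_def by simp
  qed (simp add: set_lebesgue_integral_def)
qed

section \<open>Representatives of classes modulo null sets\<close>

lemma rep_aefun_measurable [measurable, simp]: "rep_aefun u \<in> borel_measurable borel"
  using Quotient_rep_reflp[OF Quotient_aefun, of u] by (auto simp: ae_eq_def)

lemma rep_abs_aefun: "f \<in> borel_measurable borel \<Longrightarrow> AE x in lborel. rep_aefun (abs_aefun f) x = f x"
  using Quotient_rep_abs[OF Quotient_aefun, of f] by (auto simp: ae_eq_def)

lemma abs_rep_aefun: "abs_aefun (rep_aefun u) = u"
  by (rule Quotient_abs_rep[OF Quotient_aefun])

lemma abs_aefun_eqI:
  "f \<in> borel_measurable borel \<Longrightarrow> g \<in> borel_measurable borel \<Longrightarrow> (AE x in lborel. f x = g x) \<Longrightarrow> abs_aefun f = abs_aefun g"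
  using Quotient_rel_abs[OF Quotient_aefun, of f g] by (auto simp: ae_eq_def)

lemma aefun_eqI: "(AE x in lborel. rep_aefun u x = rep_aefun v x) \<Longrightarrow> u = v"
  using abs_aefun_eqI[of "rep_aefun u" "rep_aefun v"] by (simp add: abs_rep_aefun)

lemma abs_aefun_add:
  "f \<in> borel_measurable borel \<Longrightarrow> g \<in> borel_measurable borel \<Longrightarrow>
    abs_aefun f + abs_aefun g = abs_aefun (\<lambda>x. f x + g x)"
  by (rule plus_aefun.abs_eq) (auto simp: ae_eq_def)

lemma abs_aefun_scale:
  "f \<in> borel_measurable borel \<Longrightarrow> c *\<^sub>R abs_aefun f = abs_aefun (\<lambda>x. c * f x)"
  by (rule scaleR_aefun.abs_eq) (auto simp: ae_eq_def)

lemma abs_aefun_zero: "abs_aefun (\<lambda>x. 0) = 0"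
  unfolding zero_aefun_def by simp

lemma abs_aefun_sum:
  "finite I \<Longrightarrow> (\<And>i. i \<in> I \<Longrightarrow> f i \<in> borel_measurable borel) \<Longrightarrow>
    (\<Sum>i\<in>I. abs_aefun (f i)) = abs_aefun (\<lambda>x. \<Sum>i\<in>I. f i x)"
  by (induction I rule: finite_induct) (auto simp: abs_aefun_zero abs_aefun_add)

lemma rep_aefun_add: "AE x in lborel. rep_aefun (u + v) x = rep_aefun u x + rep_aefun v x"
proof -
  have "u + v = abs_aefun (\<lambda>x. rep_aefun u x + rep_aefun v x)"
    using abs_aefun_add[of "rep_aefun u" "rep_aefun v"] by (simp add: abs_rep_aefun)
  then show ?thesis using rep_abs_aefun[of "\<lambda>x. rep_aefun u x + rep_aefun v x"] by simp
qed

lemma rep_aefun_scale: "AE x in lborel. rep_aefun (c *\<^sub>R u) x = c * rep_aefun u x"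
proof -
  have "c *\<^sub>R u = abs_aefun (\<lambda>x. c * rep_aefun u x)"
    using abs_aefun_scale[of "rep_aefun u" c] by (simp add: abs_rep_aefun)
  then show ?thesis using rep_abs_aefun[of "\<lambda>x. c * rep_aefun u x"] by simp
qed

lemma rep_aefun_zero: "AE x in lborel. rep_aefun 0 x = 0"
  using rep_abs_aefun[of "\<lambda>x. 0"] by (simp add: abs_aefun_zero)

section \<open>Weak gradients\<close>

lemma locally_Lp_cong:
  assumes "locally_Lp p \<Omega> f" "g \<in> borel_measurable lborel" "AE x in lborel. f x = g x"
  shows "locally_Lp p \<Omega> g"
  unfolding locally_Lp_def
proof (intro conjI allI impI assms(2))
  fix K assume K: "compact K" "K \<subseteq> \<Omega>"
  then have i: "integrable lborel (\<lambda>x. indicator K x *\<^sub>R norm (f x) powr p)" and f: "f \<in> borel_measurable lborel"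
    using assms(1) unfolding locally_Lp_def set_integrable_def by auto
  have [measurable]: "K \<in> sets borel" using K by (simp add: borel_compact)
  show "set_integrable lborel K (\<lambda>x. norm (g x) powr p)"
    unfolding set_integrable_def
  proof (rule Bochner_Integration.integrable_cong_AE[THEN iffD1, OF _ _ _ i])
    show "AE x in lborel. indicator K x *\<^sub>R norm (f x) powr p = indicator K x *\<^sub>R norm (g x) powr p"
      using assms(3) by eventually_elim simp
  qed (use f assms(2) in measurable)
qed

lemma norm_add_powr_le:
  fixes a b :: "'b::real_normed_vector"
  assumes "p \<ge> 0"
  shows "norm (a + b) powr p \<le> 2 powr p * (norm a powr p + norm b powr p)"
proof -
  have "norm (a + b) powr p \<le> (2 * max (norm a) (norm b)) powr p"
    using norm_triangle_ineq[of a b] assms by (intro powr_mono2) auto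
  also have "\<dots> = 2 powr p * max (norm a) (norm b) powr p" by (simp add: powr_mult)
  also have "max (norm a) (norm b) powr p \<le> norm a powr p + norm b powr p" by (simp add: max_def)
  finally show ?thesis by simp
qed

lemma locally_Lp_add:
  assumes "locally_Lp p \<Omega> f" "locally_Lp p \<Omega> g" "p \<ge> 0"
  shows "locally_Lp p \<Omega> (\<lambda>x. f x + g x)"
  unfolding locally_Lp_def
proof (intro conjI allI impI)
  have m[measurable]: "f \<in> borel_measurable lborel" "g \<in> borel_measurable lborel"
    using assms unfolding locally_Lp_def by auto
  then show "(\<lambda>x. f x + g x) \<in> borel_measurable lborel" by simp
  fix K assume K: "compact K" "K \<subseteq> \<Omega>"
  have [measurable]: "K \<in> sets borel" using K by (simp add: borel_compact)
  have i: "integrable lborel (\<lambda>x. indicator K x * norm (f x) powr p)" "integrable lborel (\<lambda>x. indicator K x * norm (g x) powr p)"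
    using assms K unfolding locally_Lp_def set_integrable_def by auto
  show "set_integrable lborel K (\<lambda>x. norm (f x + g x) powr p)"
    unfolding set_integrable_def
  proof (rule Bochner_Integration.integrable_bound)
    show "integrable lborel (\<lambda>x. 2 powr p * (indicator K x * norm (f x) powr p + indicator K x * norm (g x) powr p))"
      using i by simp
    show "AE x in lborel. norm (indicator K x *\<^sub>R norm (f x + g x) powr p)
      \<le> norm (2 powr p * (indicator K x * norm (f x) powr p + indicator K x * norm (g x) powr p))"
      using norm_add_powr_le[OF assms(3)] by (auto split: split_indicator)
  qed simp
qed

lemma locally_Lp_scale:
  fixes f :: "'a::euclidean_space \<Rightarrow> 'b::euclidean_space"
  assumes "locally_Lp p \<Omega> f"
  shows "locally_Lp p \<Omega> (\<lambda>x. c *\<^sub>R f x)"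
  unfolding locally_Lp_def
proof (intro conjI allI impI)
  have m[measurable]: "f \<in> borel_measurable lborel" using assms unfolding locally_Lp_def by auto
  then show "(\<lambda>x. c *\<^sub>R f x) \<in> borel_measurable lborel" by simp
  fix K assume K: "compact K" "K \<subseteq> \<Omega>"
  then have "integrable lborel (\<lambda>x. \<bar>c\<bar> powr p * (indicator K x * norm (f x) powr p))"
    using assms unfolding locally_Lp_def set_integrable_def by auto
  then show "set_integrable lborel K (\<lambda>x. norm (c *\<^sub>R f x) powr p)"
    unfolding set_integrable_def by (simp add: powr_mult mult.left_commute)
qed

lemma locally_L1_integrable:
  fixes f :: "'a::euclidean_space \<Rightarrow> 'b::euclidean_space"
  assumes "locally_Lp 1 \<Omega> f" "compact K" "K \<subseteq> \<Omega>"
  shows "set_integrable lborel K f"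
proof -
  have [measurable]: "K \<in> sets borel" using assms by (simp add: borel_compact)
  have [measurable]: "f \<in> borel_measurable borel" using assms unfolding locally_Lp_def by auto
  have "integrable lborel (\<lambda>x. indicator K x *\<^sub>R norm (f x) powr 1)"
    using assms unfolding locally_Lp_def set_integrable_def by auto
  then have "integrable lborel (\<lambda>x. norm (indicator K x *\<^sub>R f x))" by simp
  then show ?thesis unfolding set_integrable_def by (subst (asm) integrable_norm_iff) auto
qed

lemma locally_L1_times_test:
  fixes f :: "'a::euclidean_space \<Rightarrow> real"
  assumes f: "locally_Lp 1 \<Omega> f" and g: "continuous_on UNIV g" and K: "compact K" "K \<subseteq> \<Omega>"
    and g0: "\<And>x. x \<notin> K \<Longrightarrow> g x = 0"
  shows "set_integrable lborel \<Omega> (\<lambda>x. f x * g x)"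
proof -
  have [measurable]: "K \<in> sets borel" using K by (simp add: borel_compact)
  have [measurable]: "f \<in> borel_measurable borel" using f unfolding locally_Lp_def by auto
  have [measurable]: "g \<in> borel_measurable borel" by (rule borel_measurable_continuous_onI[OF g])
  have "bounded (g ` K)" by (intro compact_imp_bounded compact_continuous_image continuous_on_subset[OF g] K) auto
  then obtain B where B: "B > 0" "\<And>x. x \<in> K \<Longrightarrow> \<bar>g x\<bar> \<le> B" unfolding bounded_pos by auto
  have "integrable lborel (\<lambda>x. indicator K x *\<^sub>R (f x * g x))"
  proof (rule Bochner_Integration.integrable_bound)
    show "integrable lborel (\<lambda>x. B * (indicator K x *\<^sub>R f x))"
      using locally_L1_integrable[OF f K] unfolding set_integrable_def by simp
    show "AE x in lborel. norm (indicator K x *\<^sub>R (f x * g x)) \<le> norm (B * (indicator K x *\<^sub>R f x))"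
      using B by (auto simp: abs_mult mult.commute[of B] intro!: mult_left_mono split: split_indicator)
  qed measurable
  moreover have "indicator K x *\<^sub>R (f x * g x) = indicator \<Omega> x *\<^sub>R (f x * g x)" for x
    using g0[of x] K(2) by (auto split: split_indicator)
  ultimately show ?thesis unfolding set_integrable_def by (simp only:)
qed

lemma locally_L1_inner:
  fixes G :: "'a::euclidean_space \<Rightarrow> 'a"
  assumes "locally_Lp 1 \<Omega> G"
  shows "locally_Lp 1 \<Omega> (\<lambda>x. G x \<bullet> b)"
  unfolding locally_Lp_def
proof (intro conjI allI impI)
  have [measurable]: "G \<in> borel_measurable borel" using assms unfolding locally_Lp_def by auto
  show "(\<lambda>x. G x \<bullet> b) \<in> borel_measurable lborel" by simp
  fix K assume K: "compact K" "K \<subseteq> \<Omega>"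
  have "integrable lborel (\<lambda>x. (indicator K x *\<^sub>R G x) \<bullet> b)"
    using locally_L1_integrable[OF assms K] unfolding set_integrable_def by (intro integrable_inner_left)
  then have "integrable lborel (\<lambda>x. norm ((indicator K x *\<^sub>R G x) \<bullet> b))" by (rule integrable_norm)
  then show "set_integrable lborel K (\<lambda>x. norm (G x \<bullet> b) powr 1)"
    unfolding set_integrable_def by (simp add: abs_mult)
qed

context
  fixes \<Omega> :: "'a::euclidean_space set"
begin

lemma weak_gradient_pairing_integrable:
  assumes "has_weak_gradient \<Omega> u G" "\<phi> \<in> test_functions \<Omega>"
  shows "set_integrable lborel \<Omega> (\<lambda>x. u x * frechet_derivative \<phi> (at x) b)"
    "set_integrable lborel \<Omega> (\<lambda>x. (G x \<bullet> b) * \<phi> x)"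
proof -
  from assms(2) obtain K where K: "smooth \<phi>" "compact K" "K \<subseteq> \<Omega>" "\<And>x. x \<notin> K \<Longrightarrow> \<phi> x = 0"
    "\<And>x v. x \<notin> K \<Longrightarrow> frechet_derivative \<phi> (at x) v = 0"
    by (rule test_functionsD) blast
  show "set_integrable lborel \<Omega> (\<lambda>x. u x * frechet_derivative \<phi> (at x) b)"
    using assms(1) unfolding has_weak_gradient_def
    by (intro locally_L1_times_test[OF _ smooth_continuous[OF smooth_derivative[OF K(1)]] K(2,3) K(5)]) auto
  show "set_integrable lborel \<Omega> (\<lambda>x. (G x \<bullet> b) * \<phi> x)"
    using assms(1) unfolding has_weak_gradient_def
    by (intro locally_L1_times_test[OF _ smooth_continuous[OF K(1)] K(2,3) K(4)] locally_L1_inner) auto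
qed

lemma has_weak_gradient_add:
  assumes u: "has_weak_gradient \<Omega> u G" and v: "has_weak_gradient \<Omega> v H"
  shows "has_weak_gradient \<Omega> (\<lambda>x. u x + v x) (\<lambda>x. G x + H x)"
  unfolding has_weak_gradient_def
proof (intro conjI ballI)
  show "locally_Lp 1 \<Omega> (\<lambda>x. u x + v x)" "locally_Lp 1 \<Omega> (\<lambda>x. G x + H x)"
    using u v unfolding has_weak_gradient_def by (auto intro: locally_Lp_add)
  fix \<phi> b assume \<phi>: "\<phi> \<in> test_functions \<Omega>" and b: "(b :: 'a) \<in> Basis"
  note iu = weak_gradient_pairing_integrable[OF u \<phi>] note iv = weak_gradient_pairing_integrable[OF v \<phi>]
  have "(LINT x:\<Omega>|lborel. (u x + v x) * frechet_derivative \<phi> (at x) b)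
     = (LINT x:\<Omega>|lborel. u x * frechet_derivative \<phi> (at x) b) + (LINT x:\<Omega>|lborel. v x * frechet_derivative \<phi> (at x) b)"
    unfolding distrib_right by (rule set_integral_add(2)[OF iu(1) iv(1)])
  also have "\<dots> = - ((LINT x:\<Omega>|lborel. (G x \<bullet> b) * \<phi> x) + (LINT x:\<Omega>|lborel. (H x \<bullet> b) * \<phi> x))"
    using u v \<phi> b unfolding has_weak_gradient_def by simp
  also have "(LINT x:\<Omega>|lborel. (G x \<bullet> b) * \<phi> x) + (LINT x:\<Omega>|lborel. (H x \<bullet> b) * \<phi> x)
      = (LINT x:\<Omega>|lborel. ((G x + H x) \<bullet> b) * \<phi> x)"
    unfolding inner_add_left distrib_right by (rule set_integral_add(2)[OF iu(2) iv(2), symmetric])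
  finally show "(LINT x:\<Omega>|lborel. (u x + v x) * frechet_derivative \<phi> (at x) b)
     = - (LINT x:\<Omega>|lborel. ((G x + H x) \<bullet> b) * \<phi> x)" .
qed

lemma has_weak_gradient_scale:
  assumes u: "has_weak_gradient \<Omega> u G"
  shows "has_weak_gradient \<Omega> (\<lambda>x. c * u x) (\<lambda>x. c *\<^sub>R G x)"
  unfolding has_weak_gradient_def
proof (intro conjI ballI)
  show "locally_Lp 1 \<Omega> (\<lambda>x. c * u x)" "locally_Lp 1 \<Omega> (\<lambda>x. c *\<^sub>R G x)"
    using u locally_Lp_scale[of 1 \<Omega> u c] locally_Lp_scale[of 1 \<Omega> G c] unfolding has_weak_gradient_def by auto
  fix \<phi> b assume \<phi>: "\<phi> \<in> test_functions \<Omega>" and b: "(b :: 'a) \<in> Basis"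
  have "(LINT x:\<Omega>|lborel. u x * frechet_derivative \<phi> (at x) b) = - (LINT x:\<Omega>|lborel. (G x \<bullet> b) * \<phi> x)"
    using u \<phi> b unfolding has_weak_gradient_def by simp
  then show "(LINT x:\<Omega>|lborel. (c * u x) * frechet_derivative \<phi> (at x) b)
     = - (LINT x:\<Omega>|lborel. ((c *\<^sub>R G x) \<bullet> b) * \<phi> x)"
    by (simp add: mult.assoc)
qed

lemma has_weak_gradient_cong:
  assumes u: "has_weak_gradient \<Omega> u G" and v: "v \<in> borel_measurable borel" "AE x in lborel. u x = v x"
    and "open \<Omega>"
  shows "has_weak_gradient \<Omega> v G"
  unfolding has_weak_gradient_def
proof (intro conjI ballI)
  show "locally_Lp 1 \<Omega> v" "locally_Lp 1 \<Omega> G"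
    using u v locally_Lp_cong[of 1 \<Omega> u v] unfolding has_weak_gradient_def by auto
  have [measurable]: "u \<in> borel_measurable borel" "v \<in> borel_measurable borel" "\<Omega> \<in> sets borel"
    using u v \<open>open \<Omega>\<close> unfolding has_weak_gradient_def locally_Lp_def by auto
  fix \<phi> b assume \<phi>: "\<phi> \<in> test_functions \<Omega>" and b: "(b :: 'a) \<in> Basis"
  then have "smooth \<phi>" by (auto simp: test_functions_def smooth_def)
  then have [measurable]: "(\<lambda>x. frechet_derivative \<phi> (at x) b) \<in> borel_measurable borel"
    by (intro smooth_measurable smooth_derivative)
  have "(LINT x:\<Omega>|lborel. v x * frechet_derivative \<phi> (at x) b) = (LINT x:\<Omega>|lborel. u x * frechet_derivative \<phi> (at x) b)"
    unfolding set_lebesgue_integral_def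
  proof (rule integral_cong_AE)
    show "AE x in lborel. indicator \<Omega> x *\<^sub>R (v x * frechet_derivative \<phi> (at x) b)
       = indicator \<Omega> x *\<^sub>R (u x * frechet_derivative \<phi> (at x) b)"
      using v(2) by eventually_elim simp
  qed measurable
  then show "(LINT x:\<Omega>|lborel. v x * frechet_derivative \<phi> (at x) b) = - (LINT x:\<Omega>|lborel. (G x \<bullet> b) * \<phi> x)"
    using u \<phi> b unfolding has_weak_gradient_def by simp
qed

text \<open>Each component of the difference of two weak gradients integrates to 0 against all test
  functions.\<close>

lemma has_weak_gradient_unique:
  assumes u: "has_weak_gradient \<Omega> u G" and v: "has_weak_gradient \<Omega> u H"
    and op: "open \<Omega>" and \<psi>: "bump (\<psi> :: 'a \<Rightarrow> real)"
  shows "AE x in lborel. x \<in> \<Omega> \<longrightarrow> G x = H x"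
proof -
  have *: "AE x in lborel. x \<in> \<Omega> \<longrightarrow> G x \<bullet> b - H x \<bullet> b = 0" if b: "b \<in> Basis" for b
  proof (rule du_bois_reymond[OF op _ _ _ \<psi>])
    have lG: "locally_Lp 1 \<Omega> (\<lambda>x. G x \<bullet> b)" "locally_Lp 1 \<Omega> (\<lambda>x. H x \<bullet> b)"
      using u v unfolding has_weak_gradient_def by (auto intro: locally_L1_inner)
    then show "(\<lambda>x. G x \<bullet> b - H x \<bullet> b) \<in> borel_measurable lborel"
      unfolding locally_Lp_def by (auto intro!: borel_measurable_diff)
    show "set_integrable lborel K (\<lambda>x. G x \<bullet> b - H x \<bullet> b)" if "compact K" "K \<subseteq> \<Omega>" for K
      using lG that by (intro set_integral_diff(1) locally_L1_integrable) auto
    fix \<phi> assume \<phi>: "\<phi> \<in> test_functions \<Omega>"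
    have "(LINT x:\<Omega>|lborel. (G x \<bullet> b) * \<phi> x) = (LINT x:\<Omega>|lborel. (H x \<bullet> b) * \<phi> x)"
    proof -
      have "- (LINT x:\<Omega>|lborel. (G x \<bullet> b) * \<phi> x) = - (LINT x:\<Omega>|lborel. (H x \<bullet> b) * \<phi> x)"
        using u v \<phi> b unfolding has_weak_gradient_def by metis
      then show ?thesis by simp
    qed
    then show "(LINT x:\<Omega>|lborel. (G x \<bullet> b - H x \<bullet> b) * \<phi> x) = 0"
      unfolding left_diff_distrib
      using set_integral_diff(2)[OF weak_gradient_pairing_integrable(2)[OF u \<phi>, of b] weak_gradient_pairing_integrable(2)[OF v \<phi>, of b]]
      by simp
  qed
  have "AE x in lborel. \<forall>b\<in>Basis. x \<in> \<Omega> \<longrightarrow> G x \<bullet> b - H x \<bullet> b = 0"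
    by (intro AE_finite_allI) (use * in auto)
  then show ?thesis by eventually_elim (auto intro: euclidean_eqI)
qed

end

section \<open>Weighted norms\<close>

definition Lfin :: "'a measure \<Rightarrow> real \<Rightarrow> ('a \<Rightarrow> 'b::{real_normed_vector, second_countable_topology}) \<Rightarrow> bool" where
  "Lfin \<mu> p f \<longleftrightarrow> f \<in> borel_measurable \<mu> \<and> (\<integral>\<^sup>+x. ennreal (norm (f x) powr p) \<partial>\<mu>) < \<infinity>"

text \<open>\<open>enn2real\<close> sends an infinite integral to 0, so this is an
  \<open>L^p\<close> norm only together with \<open>Lfin\<close>.\<close>

definition Lnorm :: "'a measure \<Rightarrow> real \<Rightarrow> ('a \<Rightarrow> 'b::{real_normed_vector, second_countable_topology}) \<Rightarrow> real" where
  "Lnorm \<mu> p f = enn2real (\<integral>\<^sup>+x. ennreal (norm (f x) powr p) \<partial>\<mu>) powr (1 / p)"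

lemma Lnorm_ge0 [simp]: "Lnorm \<mu> p f \<ge> 0"
  by (simp add: Lnorm_def)

lemma Lnorm_nn: "Lfin \<mu> p f \<Longrightarrow> p > 0 \<Longrightarrow> (\<integral>\<^sup>+x. ennreal (norm (f x) powr p) \<partial>\<mu>) = ennreal (Lnorm \<mu> p f powr p)"
  unfolding Lfin_def Lnorm_def by (simp add: powr_powr less_top)

lemma Lnorm_le_iff:
  assumes "f \<in> borel_measurable \<mu>" "p > 0" "a \<ge> 0"
  shows "(\<integral>\<^sup>+x. ennreal (norm (f x) powr p) \<partial>\<mu>) \<le> ennreal (a powr p) \<longleftrightarrow> Lfin \<mu> p f \<and> Lnorm \<mu> p f \<le> a"
proof
  assume le: "(\<integral>\<^sup>+x. ennreal (norm (f x) powr p) \<partial>\<mu>) \<le> ennreal (a powr p)"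
  then have fin: "Lfin \<mu> p f" unfolding Lfin_def using assms(1) by (auto intro: le_less_trans)
  with le assms(2) have "Lnorm \<mu> p f powr p \<le> a powr p" by (simp add: Lnorm_nn)
  then have "(Lnorm \<mu> p f powr p) powr (1 / p) \<le> (a powr p) powr (1 / p)"
    using assms(2) by - (rule powr_mono2, auto)
  moreover have "(z powr p) powr (1 / p) = z" if "z \<ge> 0" for z using that assms(2) by (simp add: powr_powr)
  ultimately show "Lfin \<mu> p f \<and> Lnorm \<mu> p f \<le> a" using fin assms(3) by (metis Lnorm_ge0)
next
  assume "Lfin \<mu> p f \<and> Lnorm \<mu> p f \<le> a"
  then show "(\<integral>\<^sup>+x. ennreal (norm (f x) powr p) \<partial>\<mu>) \<le> ennreal (a powr p)"
    using assms by (auto simp: Lnorm_nn intro!: ennreal_leI powr_mono2)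
qed

lemma Lnorm_cong:
  assumes "AE x in \<mu>. norm (f x) = norm (g x)"
  shows "Lnorm \<mu> p f = Lnorm \<mu> p g"
proof -
  have "(\<integral>\<^sup>+x. ennreal (norm (f x) powr p) \<partial>\<mu>) = (\<integral>\<^sup>+x. ennreal (norm (g x) powr p) \<partial>\<mu>)"
    by (rule nn_integral_cong_AE) (use assms in eventually_elim, simp)
  then show ?thesis unfolding Lnorm_def by simp
qed

lemma Lnorm_mono:
  assumes "Lfin \<mu> p g" "f \<in> borel_measurable \<mu>" "AE x in \<mu>. norm (f x) \<le> norm (g x)" "p > 0"
  shows "Lfin \<mu> p f" "Lnorm \<mu> p f \<le> Lnorm \<mu> p g"
proof -
  have "(\<integral>\<^sup>+x. ennreal (norm (f x) powr p) \<partial>\<mu>) \<le> (\<integral>\<^sup>+x. ennreal (norm (g x) powr p) \<partial>\<mu>)"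
    by (rule nn_integral_mono_AE) (use assms(3) in eventually_elim, use assms(4) in \<open>auto intro!: ennreal_leI powr_mono2\<close>)
  also have "\<dots> = ennreal (Lnorm \<mu> p g powr p)" by (rule Lnorm_nn[OF assms(1,4)])
  finally show "Lfin \<mu> p f" "Lnorm \<mu> p f \<le> Lnorm \<mu> p g"
    using Lnorm_le_iff[OF assms(2,4), of "Lnorm \<mu> p g"] by auto
qed

lemma Lnorm_tri_AE:
  assumes "Lfin \<mu> p f" "Lfin \<mu> p g" "p \<ge> 1" "h \<in> borel_measurable \<mu>"
    and "AE x in \<mu>. norm (h x) \<le> norm (f x) + norm (g x)"
  shows "Lfin \<mu> p h" "Lnorm \<mu> p h \<le> Lnorm \<mu> p f + Lnorm \<mu> p g"
proof -
  have [measurable]: "f \<in> borel_measurable \<mu>" "g \<in> borel_measurable \<mu>" using assms unfolding Lfin_def by auto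
  have "(\<integral>\<^sup>+x. ennreal (norm (h x) powr p) \<partial>\<mu>) \<le> ennreal ((Lnorm \<mu> p f + Lnorm \<mu> p g) powr p)"
    using assms by (intro minkowski_nn[where f = "\<lambda>x. norm (f x)" and g = "\<lambda>x. norm (g x)"]) (auto simp: Lnorm_nn)
  then show "Lfin \<mu> p h" "Lnorm \<mu> p h \<le> Lnorm \<mu> p f + Lnorm \<mu> p g"
    using Lnorm_le_iff[OF assms(4), of p "Lnorm \<mu> p f + Lnorm \<mu> p g"] assms(3) by auto
qed

lemma Lnorm_tri:
  assumes "Lfin \<mu> p f" "Lfin \<mu> p g" "p \<ge> 1"
  shows "Lfin \<mu> p (\<lambda>x. f x + g x)" "Lnorm \<mu> p (\<lambda>x. f x + g x) \<le> Lnorm \<mu> p f + Lnorm \<mu> p g"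
  by (rule Lnorm_tri_AE[OF assms]; use assms in \<open>auto simp: Lfin_def norm_triangle_ineq\<close>)+

lemma Lnorm_scale:
  assumes "Lfin \<mu> p f" "p > 0"
  shows "Lfin \<mu> p (\<lambda>x. c *\<^sub>R f x)" "Lnorm \<mu> p (\<lambda>x. c *\<^sub>R f x) = \<bar>c\<bar> * Lnorm \<mu> p f"
proof -
  have [measurable]: "f \<in> borel_measurable \<mu>" using assms unfolding Lfin_def by auto
  have "(\<integral>\<^sup>+x. ennreal (norm (c *\<^sub>R f x) powr p) \<partial>\<mu>) = ennreal (\<bar>c\<bar> powr p) * (\<integral>\<^sup>+x. ennreal (norm (f x) powr p) \<partial>\<mu>)"
    by (simp add: powr_mult ennreal_mult nn_integral_cmult)
  also have "\<dots> = ennreal ((\<bar>c\<bar> * Lnorm \<mu> p f) powr p)"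
    by (simp add: Lnorm_nn[OF assms] ennreal_mult[symmetric] powr_mult)
  finally have eq: "(\<integral>\<^sup>+x. ennreal (norm (c *\<^sub>R f x) powr p) \<partial>\<mu>) = ennreal ((\<bar>c\<bar> * Lnorm \<mu> p f) powr p)" .
  then show "Lfin \<mu> p (\<lambda>x. c *\<^sub>R f x)" unfolding Lfin_def by simp
  show "Lnorm \<mu> p (\<lambda>x. c *\<^sub>R f x) = \<bar>c\<bar> * Lnorm \<mu> p f"
    unfolding Lnorm_def eq using assms(2) by (simp add: powr_powr Lnorm_def)
qed

lemma Lnorm_zero: "AE x in \<mu>. f x = 0 \<Longrightarrow> p > 0 \<Longrightarrow> f \<in> borel_measurable \<mu> \<Longrightarrow> Lfin \<mu> p f \<and> Lnorm \<mu> p f = 0"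
proof -
  assume "AE x in \<mu>. f x = 0" "p > 0" "f \<in> borel_measurable \<mu>"
  then have "(\<integral>\<^sup>+x. ennreal (norm (f x) powr p) \<partial>\<mu>) = (\<integral>\<^sup>+x. 0 \<partial>\<mu>)"
    by (intro nn_integral_cong_AE) (auto elim!: eventually_mono)
  then show ?thesis using \<open>f \<in> borel_measurable \<mu>\<close> \<open>p > 0\<close> unfolding Lfin_def Lnorm_def by simp
qed

lemma Lnorm_eq_0:
  assumes "Lfin \<mu> p f" "Lnorm \<mu> p f = 0" "p > 0"
  shows "AE x in \<mu>. f x = 0"
proof -
  have [measurable]: "f \<in> borel_measurable \<mu>" using assms unfolding Lfin_def by auto
  have "(\<integral>\<^sup>+x. ennreal (norm (f x) powr p) \<partial>\<mu>) = 0" using Lnorm_nn[OF assms(1,3)] assms by simp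
  then have "AE x in \<mu>. ennreal (norm (f x) powr p) = 0" by (subst (asm) nn_integral_0_iff_AE) auto
  then show ?thesis by eventually_elim (auto simp: ennreal_eq_0_iff)
qed

lemma Lnorm_Basis_sum:
  fixes f :: "'a \<Rightarrow> 'b::euclidean_space"
  assumes "\<And>b. b \<in> Basis \<Longrightarrow> Lfin \<mu> p (\<lambda>x. f x \<bullet> b)" "p \<ge> 1" and [measurable]: "f \<in> borel_measurable \<mu>"
  shows "Lfin \<mu> p f" "Lnorm \<mu> p f \<le> (\<Sum>b\<in>Basis. Lnorm \<mu> p (\<lambda>x. f x \<bullet> b))"
proof -
  have *: "Lfin \<mu> p (\<lambda>x. \<Sum>b\<in>I. \<bar>f x \<bullet> b\<bar>) \<and> Lnorm \<mu> p (\<lambda>x. \<Sum>b\<in>I. \<bar>f x \<bullet> b\<bar>) \<le> (\<Sum>b\<in>I. Lnorm \<mu> p (\<lambda>x. f x \<bullet> b))"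
    if "finite I" "I \<subseteq> Basis" for I
    using that
  proof (induction I rule: finite_induct)
    case empty
    show ?case using Lnorm_zero[where \<mu> = \<mu> and f = "\<lambda>x. 0::real" and p = p] assms(2) by simp
  next
    case (insert b I)
    have 1: "Lfin \<mu> p (\<lambda>x. \<bar>f x \<bullet> b\<bar>)" "Lnorm \<mu> p (\<lambda>x. \<bar>f x \<bullet> b\<bar>) = Lnorm \<mu> p (\<lambda>x. f x \<bullet> b)"
      using assms(1)[of b] insert by (auto simp: Lfin_def Lnorm_def)
    have 2: "Lfin \<mu> p (\<lambda>x. \<Sum>b\<in>I. \<bar>f x \<bullet> b\<bar>)" using insert by auto
    from Lnorm_tri[OF 1(1) 2 assms(2)] 1(2) insert show ?case by auto
  qed
  note * = *[OF finite_Basis order_refl]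
  have "AE x in \<mu>. norm (f x) \<le> norm (\<Sum>b\<in>Basis. \<bar>f x \<bullet> b\<bar>)"
    using norm_le_l1 by (auto intro: order_trans)
  from Lnorm_mono[OF _ assms(3) this, of p] * assms(2)
  show "Lfin \<mu> p f" "Lnorm \<mu> p f \<le> (\<Sum>b\<in>Basis. Lnorm \<mu> p (\<lambda>x. f x \<bullet> b))" by auto
qed

section \<open>The corner space\<close>

lemma borel_measurable_fst_borel [measurable]:
  "(fst :: 'a::second_countable_topology \<times> 'b::second_countable_topology \<Rightarrow> 'a) \<in> borel_measurable borel"
  and borel_measurable_snd_borel [measurable]:
  "(snd :: 'a \<times> 'b \<Rightarrow> 'b) \<in> borel_measurable borel"
  by (intro borel_measurable_continuous_onI continuous_intros)+

text \<open>The measure x1 d sigma on \<open>M\<close>. With the weights that define the energy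
  space, the norm of \<open>L_p\<close> becomes the unweighted \<open>L^p\<close> norm of this
  measure (\<open>Lp_norm_eq\<close>).\<close>

definition mu :: "'n::finite pt set \<Rightarrow> 'n pt measure" where
  "mu M = density lborel (\<lambda>x. ennreal (indicator M x / (fst x * fst (snd x))))"

text \<open>Turns a Euclidean gradient at \<open>x\<close> into the corner gradient.\<close>

definition scaled :: "'n::finite pt \<Rightarrow> 'n pt \<Rightarrow> 'n pt" where
  "scaled x g = (fst x * fst g, fst x * fst (snd x) * fst (snd g), snd (snd g))"

lemma grad_M_scaled: "grad_M M u x = scaled x (weak_gradient M u x)"
  unfolding grad_M_def scaled_def by (simp add: split_beta)

lemma scaled_add: "scaled x (g + h) = scaled x g + scaled x h"
  and scaled_scale: "scaled x (c *\<^sub>R g) = c *\<^sub>R scaled x g"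
  and scaled_0 [simp]: "scaled x 0 = 0"
  unfolding scaled_def by (simp_all add: algebra_simps zero_prod_def)

lemma scaled_measurable [measurable (raw)]:
  "g \<in> borel_measurable N \<Longrightarrow> h \<in> borel_measurable N \<Longrightarrow> (\<lambda>x. scaled (g x) (h x)) \<in> borel_measurable N"
  unfolding scaled_def by (intro borel_measurable_Pair) (auto intro!: measurable_compose[OF _ borel_measurable_continuous_onI] continuous_intros borel_measurable_times)

locale corner_domain =
  fixes X :: "(real ^ 'n::finite) set" and \<delta> p :: real and M :: "'n pt set"
  assumes \<delta>: "\<delta> > 0" and X: "open X" "bounded X" and M: "M = corner \<delta> X" and p: "p > 1"
begin

lemma M_iff: "x \<in> M \<longleftrightarrow> 0 < fst x \<and> fst x < \<delta> \<and> 0 < fst (snd x) \<and> fst (snd x) < \<delta> \<and> snd (snd x) \<in> X"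
  unfolding M corner_def by (cases x) auto

lemma open_M: "open M"
  unfolding M corner_def by (intro open_Times X) auto

lemma M_meas [measurable]: "M \<in> sets borel"
  using open_M by simp

lemma sets_mu [measurable_cong, simp]: "sets (mu M) = sets borel" "space (mu M) = UNIV"
  unfolding mu_def by auto

lemma borel_mu: "borel_measurable (mu M) = borel_measurable borel"
  by (rule measurable_cong_sets) auto

lemma nn_integral_mu:
  assumes [measurable]: "f \<in> borel_measurable borel"
  shows "(\<integral>\<^sup>+x. f x \<partial>mu M) = (\<integral>\<^sup>+x. ennreal (indicator M x / (fst x * fst (snd x))) * f x \<partial>lborel)"
  unfolding mu_def by (subst nn_integral_density) auto

lemma AE_mu: "(AE x in lborel. x \<in> M \<longrightarrow> P x) \<Longrightarrow> AE x in mu M. P x"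
  unfolding mu_def
  by (subst AE_density) (auto elim!: eventually_mono split: split_indicator simp: indicator_def)

lemma AE_mu_iff: "(AE x in mu M. P x) \<longleftrightarrow> (AE x in lborel. x \<in> M \<longrightarrow> P x)"
proof -
  have "0 < ennreal (indicator M x / (fst x * fst (snd x))) \<longleftrightarrow> x \<in> M" for x
    using M_iff[of x] by (auto split: split_indicator)
  then show ?thesis unfolding mu_def by (subst AE_density) auto
qed

lemma nn_integral_sigma:
  assumes [measurable]: "f \<in> borel_measurable borel" and f: "\<And>x. x \<in> M \<Longrightarrow> f x = fst x * g x"
    "\<And>x. g x \<ge> 0" and [measurable]: "g \<in> borel_measurable borel"
  shows "(\<integral>\<^sup>+x. ennreal (f x) \<partial>sigma_measure M) = (\<integral>\<^sup>+x. ennreal (g x) \<partial>mu M)"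
proof -
  have "(\<integral>\<^sup>+x. ennreal (f x) \<partial>sigma_measure M)
    = (\<integral>\<^sup>+x. ennreal (indicator M x / (fst x * (fst x * fst (snd x)))) * ennreal (f x) \<partial>lborel)"
    unfolding sigma_measure_def by (subst nn_integral_density) (auto simp: split_beta)
  also have "\<dots> = (\<integral>\<^sup>+x. ennreal (indicator M x / (fst x * fst (snd x))) * ennreal (g x) \<partial>lborel)"
  proof (rule nn_integral_cong)
    fix x
    show "ennreal (indicator M x / (fst x * (fst x * fst (snd x)))) * ennreal (f x) =
       ennreal (indicator M x / (fst x * fst (snd x))) * ennreal (g x)"
    proof (cases "x \<in> M")
      case True
      then have "0 < fst x" "0 < fst (snd x)" using M_iff by auto
      then show ?thesis using True f by (simp add: ennreal_mult[symmetric])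
    qed simp
  qed
  also have "\<dots> = (\<integral>\<^sup>+x. ennreal (g x) \<partial>mu M)" by (subst nn_integral_mu) auto
  finally show ?thesis .
qed

lemma sets_sigma [measurable_cong, simp]: "sets (sigma_measure M) = sets borel" "space (sigma_measure M) = UNIV"
  unfolding sigma_measure_def by auto

lemma AE_sigma: "AE x in sigma_measure M. x \<in> M"
  unfolding sigma_measure_def
  by (subst AE_density) (auto simp: split_beta split: split_indicator)

lemma integral_sigma:
  assumes "f \<in> borel_measurable borel" "\<And>x. x \<in> M \<Longrightarrow> f x = fst x * g x"
    "\<And>x. g x \<ge> 0" "g \<in> borel_measurable borel"
  shows "(\<integral>x. f x \<partial>sigma_measure M) = enn2real (\<integral>\<^sup>+x. ennreal (g x) \<partial>mu M)"
    "integrable (sigma_measure M) f \<longleftrightarrow> (\<integral>\<^sup>+x. ennreal (g x) \<partial>mu M) < \<infinity>"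
proof -
  have f0: "AE x in sigma_measure M. 0 \<le> f x"
    using AE_sigma by eventually_elim (use assms M_iff in auto)
  have fm: "f \<in> borel_measurable (sigma_measure M)" using assms(1) by simp
  show "(\<integral>x. f x \<partial>sigma_measure M) = enn2real (\<integral>\<^sup>+x. ennreal (g x) \<partial>mu M)"
    using integral_eq_nn_integral[OF fm f0] nn_integral_sigma[OF assms] by simp
  show "integrable (sigma_measure M) f \<longleftrightarrow> (\<integral>\<^sup>+x. ennreal (g x) \<partial>mu M) < \<infinity>"
  proof -
    have "(\<integral>\<^sup>+x. ennreal (norm (f x)) \<partial>sigma_measure M) = (\<integral>\<^sup>+x. ennreal (f x) \<partial>sigma_measure M)"
      by (rule nn_integral_cong_AE) (use f0 in eventually_elim, simp)
    then show ?thesis using fm nn_integral_sigma[OF assms] by (simp add: integrable_iff_bounded)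
  qed
qed

lemma Lp_integrand_eq:
  "x \<in> M \<Longrightarrow> Lp_integrand p ((real CARD('n) + 2 - 1) / p) ((real CARD('n) + 2) / p) f x = fst x * (norm (f x) powr p)"
proof -
  assume x: "x \<in> M"
  have e: "(real CARD('n) + 2) / p - (real CARD('n) + 2 - 1) / p = 1 / p" using p by (simp add: diff_divide_distrib[symmetric])
  have "\<bar>fst x powr (1 / p) * f x\<bar> powr p = fst x * norm (f x) powr p"
    using x M_iff[of x] p by (simp add: abs_mult powr_mult powr_powr)
  then show ?thesis unfolding Lp_integrand_def e using x M_iff[of x] by (simp add: split_beta)
qed

lemma Lp_integrand_measurable: "f \<in> borel_measurable borel \<Longrightarrow> Lp_integrand p ((real CARD('n) + 2 - 1) / p) ((real CARD('n) + 2) / p) f \<in> borel_measurable borel"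
  unfolding Lp_integrand_def split_beta by simp

lemma Lp_space_iff: "f \<in> Lp_space M p ((real CARD('n) + 2 - 1) / p) ((real CARD('n) + 2) / p) \<longleftrightarrow> Lfin (mu M) p f"
proof (cases "f \<in> borel_measurable borel")
  case True
  then show ?thesis unfolding Lp_space_def Lfin_def borel_mu
    using integral_sigma(2)[OF Lp_integrand_measurable[OF True] Lp_integrand_eq] by simp
qed (simp add: Lp_space_def Lfin_def borel_mu)

lemma Lp_norm_eq: "f \<in> borel_measurable borel \<Longrightarrow> Lp_norm M p ((real CARD('n) + 2 - 1) / p) ((real CARD('n) + 2) / p) f = Lnorm (mu M) p f"
  unfolding Lp_norm_def Lnorm_def
  by (subst integral_sigma(1)[OF Lp_integrand_measurable Lp_integrand_eq]) auto

end

context corner_domain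
begin

lemma p0: "p > 0"
  using p by simp

abbreviation "W \<equiv> W1p_loc p M"
abbreviation "HH \<equiv> H1 M p ((real CARD('n) + 2 - 1) / p) ((real CARD('n) + 2) / p)"
abbreviation "Hnorm \<equiv> H1_norm M p ((real CARD('n) + 2 - 1) / p) ((real CARD('n) + 2) / p)"
abbreviation "E \<equiv> E_space M p"

lemma weak_gradient_works:
  "has_weak_gradient M (rep_aefun u) G \<Longrightarrow> has_weak_gradient M (rep_aefun u) (weak_gradient M u)"
  unfolding weak_gradient_def by (rule someI[where P = "has_weak_gradient M (rep_aefun u)"])

lemma weak_gradient_W: "u \<in> W \<Longrightarrow> has_weak_gradient M (rep_aefun u) (weak_gradient M u)"
  unfolding W1p_loc_def using weak_gradient_works by blast

lemma weak_gradient_measurable: "u \<in> W \<Longrightarrow> weak_gradient M u \<in> borel_measurable borel"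
  using weak_gradient_W unfolding has_weak_gradient_def locally_Lp_def by auto

lemma grad_M_measurable: "u \<in> W \<Longrightarrow> grad_M M u \<in> borel_measurable borel"
  unfolding grad_M_scaled[abs_def] using weak_gradient_measurable[of u] by measurable

lemma HH_iff:
  "u \<in> HH \<longleftrightarrow> u \<in> W \<and> Lfin (mu M) p (rep_aefun u) \<and> (\<forall>b\<in>Basis. Lfin (mu M) p (\<lambda>x. grad_M M u x \<bullet> b))"
  unfolding H1_def Lp_space_iff by simp

lemma Hnorm_eq:
  "u \<in> W \<Longrightarrow> Hnorm u = Lnorm (mu M) p (rep_aefun u) + (\<Sum>b\<in>Basis. Lnorm (mu M) p (\<lambda>x. grad_M M u x \<bullet> b))"
  unfolding H1_norm_def using grad_M_measurable[of u]
  by (intro arg_cong2[where f = "(+)"] sum.cong refl Lp_norm_eq) auto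

lemma E_iff: "u \<in> E \<longleftrightarrow> u \<in> HH \<and> (\<forall>\<epsilon>>0. \<exists>\<phi>\<in>test_functions M. Hnorm (u - abs_aefun \<phi>) < \<epsilon>)"
  unfolding E_space_def H10_def by simp

text \<open>If all test functions were 0, membership in the closure would make the norm of
  \<open>u\<close> smaller than every positive number, so \<open>u\<close> would be 0. Hence some
  test function is nonzero, and its square is nonnegative with positive integral.\<close>

lemma bump_exists:
  assumes u: "u \<in> E" "u \<noteq> 0"
  shows "\<exists>\<psi> :: 'n pt \<Rightarrow> real. bump \<psi> \<and> \<psi> \<in> test_functions M"
proof (cases "\<exists>\<phi>\<in>test_functions M. \<exists>x. \<phi> x \<noteq> 0")
  case True
  then obtain \<phi> x0 where \<phi>: "\<phi> \<in> test_functions M" "\<phi> x0 \<noteq> 0" by blast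
  from \<phi>(1) obtain K where K: "smooth \<phi>" "compact K" "K \<subseteq> M" "\<And>x. x \<notin> K \<Longrightarrow> \<phi> x = 0"
    by (rule test_functionsD) blast
  define \<psi> where "\<psi> x = \<phi> x * \<phi> x" for x
  have \<psi>: "\<psi> \<in> test_functions M" unfolding \<psi>_def by (rule test_functions_mult[OF \<phi>(1) K(1)])
  have c: "continuous_on UNIV \<psi>" unfolding \<psi>_def by (intro continuous_intros smooth_continuous K)
  have i: "integrable lborel \<psi>"
    by (rule integrable_compact_support[OF c K(2)]) (simp add: \<psi>_def K(4))
  have \<psi>0: "0 \<le> \<psi> x" for x by (simp add: \<psi>_def)
  have "(\<integral>x. \<psi> x \<partial>lborel) \<noteq> 0"
  proof
    assume "(\<integral>x. \<psi> x \<partial>lborel) = 0"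
    then have "AE x in lborel. \<psi> x = 0"
      using integral_nonneg_eq_0_iff_AE[OF i] \<psi>0 by auto
    moreover have op: "open {x. \<psi> x \<noteq> 0}"
      using open_Collect_neq[OF c continuous_on_const[of UNIV 0]] by simp
    then have "{x. \<psi> x \<noteq> 0} \<in> sets lborel" by simp
    ultimately have "{x. \<psi> x \<noteq> 0} \<in> null_sets lborel" by (simp add: AE_iff_null_sets)
    then have "negligible {x. \<psi> x \<noteq> 0}"
      by (simp add: negligible_iff_null_sets null_sets_completionI)
    moreover note op
    moreover have "x0 \<in> {x. \<psi> x \<noteq> 0}" using \<phi>(2) by (simp add: \<psi>_def)
    ultimately show False using open_not_negligible by blast
  qed
  moreover have "(\<integral>x. \<psi> x \<partial>lborel) \<ge> 0" by (rule integral_nonneg_AE) (simp add: \<psi>0)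
  ultimately have "0 < (\<integral>x. \<psi> x \<partial>lborel)" by linarith
  then have "bump \<psi>"
    unfolding bump_def using test_functions_mono[OF \<psi>] \<psi>0 by auto
  then show ?thesis using \<psi> by blast
next
  case False
  have uW: "u \<in> W" and uL: "Lfin (mu M) p (rep_aefun u)" using u(1) unfolding E_iff HH_iff by auto
  have "Lnorm (mu M) p (rep_aefun u) < e" if "e > 0" for e
  proof -
    obtain \<phi> where \<phi>: "\<phi> \<in> test_functions M" "Hnorm (u - abs_aefun \<phi>) < e"
      using u(1) \<open>e > 0\<close> unfolding E_iff by blast
    have "\<phi> = (\<lambda>x. 0)" using False \<phi>(1) by auto
    then have "Hnorm u < e" using \<phi>(2) by (simp add: abs_aefun_zero)
    moreover have "Lnorm (mu M) p (rep_aefun u) \<le> Hnorm u"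
      unfolding Hnorm_eq[OF uW] by (simp add: sum_nonneg)
    ultimately show ?thesis by linarith
  qed
  then have "Lnorm (mu M) p (rep_aefun u) = 0"
    using Lnorm_ge0[of "mu M" p "rep_aefun u"] by (metis less_irrefl not_le order_antisym)
  then have "AE x in lborel. x \<in> M \<longrightarrow> rep_aefun u x = 0"
    using Lnorm_eq_0[OF uL] p by (simp add: AE_mu_iff)
  moreover have "AE x in lborel. x \<notin> M \<longrightarrow> rep_aefun u x = 0" using uW unfolding W1p_loc_def by auto
  ultimately have "AE x in lborel. rep_aefun u x = 0" by eventually_elim auto
  with rep_aefun_zero have "AE x in lborel. rep_aefun u x = rep_aefun 0 x" by eventually_elim simp
  then show ?thesis using u(2) aefun_eqI by blast
qed

end

text \<open>A bump makes weak gradients unique up to null sets, and thereby the chosen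
  \<open>grad_M\<close> additive and homogeneous almost everywhere.\<close>

locale corner_bump = corner_domain X \<delta> p M for X :: "(real ^ 'n::finite) set" and \<delta> p M +
  assumes bump_ex: "\<exists>\<psi> :: 'n pt \<Rightarrow> real. bump \<psi>"
begin

lemma weak_gradient_AE:
  assumes "has_weak_gradient M (rep_aefun u) G"
  shows "AE x in mu M. grad_M M u x = scaled x (G x)"
proof -
  have "has_weak_gradient M (rep_aefun u) (weak_gradient M u)"
    by (rule weak_gradient_works[OF assms])
  moreover obtain \<psi> :: "'n pt \<Rightarrow> real" where "bump \<psi>" using bump_ex by blast
  ultimately have "AE x in lborel. x \<in> M \<longrightarrow> weak_gradient M u x = G x"
    using has_weak_gradient_unique[OF _ assms open_M] by blast
  then have "AE x in mu M. weak_gradient M u x = G x" by (rule AE_mu)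
  then show ?thesis by eventually_elim (simp add: grad_M_scaled)
qed

lemma weak_gradient_add:
  assumes "has_weak_gradient M (rep_aefun u) G" "has_weak_gradient M (rep_aefun v) H"
  shows "has_weak_gradient M (rep_aefun (u + v)) (\<lambda>x. G x + H x)"
proof -
  have "AE x in lborel. rep_aefun u x + rep_aefun v x = rep_aefun (u + v) x"
    using rep_aefun_add[of u v] by eventually_elim simp
  from has_weak_gradient_cong[OF has_weak_gradient_add[OF assms] _ this open_M] show ?thesis by simp
qed

lemma weak_gradient_scale:
  assumes "has_weak_gradient M (rep_aefun u) G"
  shows "has_weak_gradient M (rep_aefun (c *\<^sub>R u)) (\<lambda>x. c *\<^sub>R G x)"
proof -
  have "AE x in lborel. c * rep_aefun u x = rep_aefun (c *\<^sub>R u) x"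
    using rep_aefun_scale[of c u] by eventually_elim simp
  from has_weak_gradient_cong[OF has_weak_gradient_scale[OF assms] _ this open_M] show ?thesis by simp
qed

lemma W_add: "u \<in> W \<Longrightarrow> v \<in> W \<Longrightarrow> u + v \<in> W"
proof -
  assume u: "u \<in> W" and v: "v \<in> W"
  obtain G where G: "has_weak_gradient M (rep_aefun u) G" "locally_Lp p M G"
    using u unfolding W1p_loc_def by auto
  obtain H where H: "has_weak_gradient M (rep_aefun v) H" "locally_Lp p M H"
    using v unfolding W1p_loc_def by auto
  have "AE x in lborel. x \<notin> M \<longrightarrow> rep_aefun u x = 0" "AE x in lborel. x \<notin> M \<longrightarrow> rep_aefun v x = 0"
    using u v unfolding W1p_loc_def by auto
  with rep_aefun_add[of u v] have "AE x in lborel. x \<notin> M \<longrightarrow> rep_aefun (u + v) x = 0"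
    by eventually_elim simp
  moreover have "locally_Lp p M (rep_aefun (u + v))"
  proof (rule locally_Lp_cong)
    show "locally_Lp p M (\<lambda>x. rep_aefun u x + rep_aefun v x)"
      using u v p unfolding W1p_loc_def by (intro locally_Lp_add) auto
    show "AE x in lborel. rep_aefun u x + rep_aefun v x = rep_aefun (u + v) x"
      using rep_aefun_add[of u v] by eventually_elim simp
  qed simp
  moreover have "has_weak_gradient M (rep_aefun (u + v)) (\<lambda>x. G x + H x)" by (rule weak_gradient_add[OF G(1) H(1)])
  moreover have "locally_Lp p M (\<lambda>x. G x + H x)" using G H p by (intro locally_Lp_add) auto
  ultimately show "u + v \<in> W" unfolding W1p_loc_def by blast
qed

lemma W_scale: "u \<in> W \<Longrightarrow> c *\<^sub>R u \<in> W"
proof -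
  assume u: "u \<in> W"
  obtain G where G: "has_weak_gradient M (rep_aefun u) G" "locally_Lp p M G"
    using u unfolding W1p_loc_def by auto
  have "AE x in lborel. x \<notin> M \<longrightarrow> rep_aefun u x = 0" using u unfolding W1p_loc_def by auto
  with rep_aefun_scale[of c u] have "AE x in lborel. x \<notin> M \<longrightarrow> rep_aefun (c *\<^sub>R u) x = 0"
    by eventually_elim simp
  moreover have "locally_Lp p M (rep_aefun (c *\<^sub>R u))"
  proof (rule locally_Lp_cong)
    show "locally_Lp p M (\<lambda>x. c *\<^sub>R rep_aefun u x)"
      using u unfolding W1p_loc_def by (intro locally_Lp_scale) auto
    show "AE x in lborel. c *\<^sub>R rep_aefun u x = rep_aefun (c *\<^sub>R u) x"
      using rep_aefun_scale[of c u] by eventually_elim simp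
  qed simp
  moreover have "has_weak_gradient M (rep_aefun (c *\<^sub>R u)) (\<lambda>x. c *\<^sub>R G x)" by (rule weak_gradient_scale[OF G(1)])
  moreover have "locally_Lp p M (\<lambda>x. c *\<^sub>R G x)" using G by (intro locally_Lp_scale) auto
  ultimately show "c *\<^sub>R u \<in> W" unfolding W1p_loc_def by blast
qed

lemma grad_M_add:
  assumes "u \<in> W" "v \<in> W"
  shows "AE x in mu M. grad_M M (u + v) x = grad_M M u x + grad_M M v x"
  using weak_gradient_AE[OF weak_gradient_add[OF weak_gradient_W[OF assms(1)] weak_gradient_W[OF assms(2)]]]
  by eventually_elim (simp add: scaled_add grad_M_scaled)

lemma grad_M_scale:
  assumes "u \<in> W"
  shows "AE x in mu M. grad_M M (c *\<^sub>R u) x = c *\<^sub>R grad_M M u x"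
  using weak_gradient_AE[OF weak_gradient_scale[OF weak_gradient_W[OF assms(1)]], of c]
  by eventually_elim (simp add: scaled_scale grad_M_scaled)

lemma rep_add_mu: "AE x in mu M. rep_aefun (u + v) x = rep_aefun u x + rep_aefun v x"
  and rep_scale_mu: "AE x in mu M. rep_aefun (c *\<^sub>R u) x = c * rep_aefun u x"
proof -
  show "AE x in mu M. rep_aefun (u + v) x = rep_aefun u x + rep_aefun v x"
    by (rule AE_mu) (use rep_aefun_add[of u v] in eventually_elim, simp)
  show "AE x in mu M. rep_aefun (c *\<^sub>R u) x = c * rep_aefun u x"
    by (rule AE_mu) (use rep_aefun_scale[of c u] in eventually_elim, simp)
qed

text \<open>This holds for every class: if there is no weak gradient, the choice operator is applied
  to the same empty predicate for \<open>u\<close> and for \<open>- u\<close>, and both get the same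
  function.\<close>

lemma E_norm_minus: "E_norm M p (- u) = E_norm M p u"
proof (cases "\<exists>G. has_weak_gradient M (rep_aefun u) G")
  case True
  then have wu: "has_weak_gradient M (rep_aefun u) (weak_gradient M u)"
    using weak_gradient_works by blast
  have wm: "has_weak_gradient M (rep_aefun (- u)) (\<lambda>x. - weak_gradient M u x)"
    using weak_gradient_scale[OF wu, of "-1"] by simp
  then have wmu: "has_weak_gradient M (rep_aefun (- u)) (weak_gradient M (- u))"
    by (rule weak_gradient_works)
  have m: "grad_M M v \<in> borel_measurable borel" if "has_weak_gradient M (rep_aefun v) (weak_gradient M v)" for v
  proof -
    have [measurable]: "weak_gradient M v \<in> borel_measurable borel"
      using that unfolding has_weak_gradient_def locally_Lp_def by auto
    show ?thesis unfolding grad_M_scaled[abs_def] by measurable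
  qed
  have "AE x in mu M. grad_M M (- u) x = - grad_M M u x"
    using weak_gradient_AE[OF wm]
    by eventually_elim (use scaled_scale[of _ "-1"] in \<open>simp add: grad_M_scaled\<close>)
  then have "Lnorm (mu M) p (grad_M M (- u)) = Lnorm (mu M) p (grad_M M u)"
    by (intro Lnorm_cong) (auto elim!: eventually_mono)
  moreover have "E_norm M p v = Lnorm (mu M) p (grad_M M v)"
    if "has_weak_gradient M (rep_aefun v) (weak_gradient M v)" for v
  proof -
    have [measurable]: "grad_M M v \<in> borel_measurable borel" by (rule m[OF that])
    show ?thesis unfolding E_norm_def Lnorm_def
      by (subst integral_sigma(1)[where g = "\<lambda>x. norm (grad_M M v x) powr p"]) auto
  qed
  ultimately show ?thesis using wu wmu by simp
next
  case False
  have "\<nexists>G. has_weak_gradient M (rep_aefun (- u)) G"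
  proof
    assume "\<exists>G. has_weak_gradient M (rep_aefun (- u)) G"
    then obtain G where "has_weak_gradient M (rep_aefun (- u)) G" by blast
    from weak_gradient_scale[OF this, of "-1"] False show False by auto
  qed
  with False have "has_weak_gradient M (rep_aefun (- u)) = has_weak_gradient M (rep_aefun u)"
    by (intro ext) blast
  then have "weak_gradient M (- u) = weak_gradient M u" unfolding weak_gradient_def by simp
  then show ?thesis unfolding E_norm_def by (simp add: grad_M_scaled[abs_def])
qed

lemma E_norm_eq: "u \<in> W \<Longrightarrow> E_norm M p u = Lnorm (mu M) p (grad_M M u)"
proof -
  assume u: "u \<in> W"
  have [measurable]: "grad_M M u \<in> borel_measurable borel" by (rule grad_M_measurable[OF u])
  show ?thesis unfolding E_norm_def Lnorm_def
    by (subst integral_sigma(1)[where g = "\<lambda>x. norm (grad_M M u x) powr p"]) auto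
qed

lemma HH_add: "u \<in> HH \<Longrightarrow> v \<in> HH \<Longrightarrow> u + v \<in> HH \<and> Hnorm (u + v) \<le> Hnorm u + Hnorm v"
proof -
  assume u: "u \<in> HH" and v: "v \<in> HH"
  then have W: "u \<in> W" "v \<in> W" "u + v \<in> W" unfolding HH_iff by (auto intro: W_add)
  have fl: "Lfin (mu M) p (rep_aefun u)" "Lfin (mu M) p (rep_aefun v)" using u v unfolding HH_iff by auto
  have m: "rep_aefun (u + v) \<in> borel_measurable (mu M)" unfolding borel_mu by simp
  have "AE x in mu M. norm (rep_aefun (u + v) x) \<le> norm (rep_aefun u x) + norm (rep_aefun v x)"
    using rep_add_mu[of u v] by eventually_elim (simp add: abs_triangle_ineq)
  note 1 = Lnorm_tri_AE[OF fl less_imp_le[OF p] m this]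
  have 2: "Lfin (mu M) p (\<lambda>x. grad_M M (u + v) x \<bullet> b) \<and>
    Lnorm (mu M) p (\<lambda>x. grad_M M (u + v) x \<bullet> b) \<le> Lnorm (mu M) p (\<lambda>x. grad_M M u x \<bullet> b) + Lnorm (mu M) p (\<lambda>x. grad_M M v x \<bullet> b)"
    if b: "b \<in> Basis" for b
  proof -
    have m: "(\<lambda>x. grad_M M (u + v) x \<bullet> b) \<in> borel_measurable (mu M)"
      using grad_M_measurable[OF W(3)] unfolding borel_mu by simp
    have "AE x in mu M. norm (grad_M M (u + v) x \<bullet> b) \<le> norm (grad_M M u x \<bullet> b) + norm (grad_M M v x \<bullet> b)"
      using grad_M_add[OF W(1,2)] by eventually_elim (simp add: inner_add_left abs_triangle_ineq)
    moreover have "Lfin (mu M) p (\<lambda>x. grad_M M u x \<bullet> b)" "Lfin (mu M) p (\<lambda>x. grad_M M v x \<bullet> b)"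
      using u v b unfolding HH_iff by auto
    ultimately show ?thesis using Lnorm_tri_AE[OF _ _ less_imp_le[OF p] m] by blast
  qed
  show ?thesis
  proof
    show "u + v \<in> HH" using W 1 2 unfolding HH_iff by auto
    have "(\<Sum>b\<in>Basis. Lnorm (mu M) p (\<lambda>x. grad_M M (u + v) x \<bullet> b)) \<le>
       (\<Sum>b\<in>Basis. Lnorm (mu M) p (\<lambda>x. grad_M M u x \<bullet> b) + Lnorm (mu M) p (\<lambda>x. grad_M M v x \<bullet> b))"
      using 2 by (intro sum_mono) auto
    then show "Hnorm (u + v) \<le> Hnorm u + Hnorm v"
      unfolding Hnorm_eq[OF W(1)] Hnorm_eq[OF W(2)] Hnorm_eq[OF W(3)] using 1(2) by (simp add: sum.distrib)
  qed
qed

lemma HH_scale: "u \<in> HH \<Longrightarrow> c *\<^sub>R u \<in> HH \<and> Hnorm (c *\<^sub>R u) = \<bar>c\<bar> * Hnorm u"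
proof -
  assume u: "u \<in> HH"
  then have W: "u \<in> W" "c *\<^sub>R u \<in> W" unfolding HH_iff by (auto intro: W_scale)
  have 1: "Lfin (mu M) p (rep_aefun (c *\<^sub>R u))" "Lnorm (mu M) p (rep_aefun (c *\<^sub>R u)) = \<bar>c\<bar> * Lnorm (mu M) p (rep_aefun u)"
  proof -
    have f: "Lfin (mu M) p (\<lambda>x. c *\<^sub>R rep_aefun u x)" "Lnorm (mu M) p (\<lambda>x. c *\<^sub>R rep_aefun u x) = \<bar>c\<bar> * Lnorm (mu M) p (rep_aefun u)"
      using u p Lnorm_scale[of "mu M" p "rep_aefun u" c] unfolding HH_iff by auto
    have eq: "AE x in mu M. norm (rep_aefun (c *\<^sub>R u) x) = norm (c *\<^sub>R rep_aefun u x)"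
      using rep_scale_mu[of c u] by eventually_elim simp
    have m: "rep_aefun (c *\<^sub>R u) \<in> borel_measurable (mu M)" unfolding borel_mu by simp
    have "AE x in mu M. norm (rep_aefun (c *\<^sub>R u) x) \<le> norm (c *\<^sub>R rep_aefun u x)"
      using eq by eventually_elim simp
    from Lnorm_mono(1)[OF f(1) m this p0] show "Lfin (mu M) p (rep_aefun (c *\<^sub>R u))" .
    show "Lnorm (mu M) p (rep_aefun (c *\<^sub>R u)) = \<bar>c\<bar> * Lnorm (mu M) p (rep_aefun u)"
      using Lnorm_cong[OF eq] f(2) by simp
  qed
  have 2: "Lfin (mu M) p (\<lambda>x. grad_M M (c *\<^sub>R u) x \<bullet> b) \<and>
    Lnorm (mu M) p (\<lambda>x. grad_M M (c *\<^sub>R u) x \<bullet> b) = \<bar>c\<bar> * Lnorm (mu M) p (\<lambda>x. grad_M M u x \<bullet> b)"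
    if b: "b \<in> Basis" for b
  proof -
    have f: "Lfin (mu M) p (\<lambda>x. c *\<^sub>R (grad_M M u x \<bullet> b))" "Lnorm (mu M) p (\<lambda>x. c *\<^sub>R (grad_M M u x \<bullet> b)) = \<bar>c\<bar> * Lnorm (mu M) p (\<lambda>x. grad_M M u x \<bullet> b)"
      using u p b Lnorm_scale[of "mu M" p "\<lambda>x. grad_M M u x \<bullet> b" c] unfolding HH_iff by auto
    have eq: "AE x in mu M. norm (grad_M M (c *\<^sub>R u) x \<bullet> b) = norm (c *\<^sub>R (grad_M M u x \<bullet> b))"
      using grad_M_scale[OF W(1), of c] by eventually_elim simp
    have m: "(\<lambda>x. grad_M M (c *\<^sub>R u) x \<bullet> b) \<in> borel_measurable (mu M)"
      using grad_M_measurable[OF W(2)] unfolding borel_mu by simp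
    have "AE x in mu M. norm (grad_M M (c *\<^sub>R u) x \<bullet> b) \<le> norm (c *\<^sub>R (grad_M M u x \<bullet> b))"
      using eq by eventually_elim simp
    from Lnorm_mono(1)[OF f(1) m this p0] have "Lfin (mu M) p (\<lambda>x. grad_M M (c *\<^sub>R u) x \<bullet> b)" .
    then show ?thesis using Lnorm_cong[OF eq] f(2) by simp
  qed
  show ?thesis
    unfolding Hnorm_eq[OF W(1)] Hnorm_eq[OF W(2)] using W 1 2 unfolding HH_iff
    by (auto simp: distrib_left sum_distrib_left)
qed

lemma test_function_W:
  assumes \<phi>: "\<phi> \<in> test_functions M"
  shows "abs_aefun \<phi> \<in> W" "AE x in mu M. grad_M M (abs_aefun \<phi>) x = scaled x (gradient \<phi> x)"
    "AE x in mu M. rep_aefun (abs_aefun \<phi>) x = \<phi> x"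
proof -
  from \<phi> obtain K where K: "smooth \<phi>" "compact K" "K \<subseteq> M" "\<And>x. x \<notin> K \<Longrightarrow> \<phi> x = 0"
    by (rule test_functionsD) blast
  have m: "\<phi> \<in> borel_measurable borel" by (rule smooth_measurable[OF K(1)])
  have ae: "AE x in lborel. \<phi> x = rep_aefun (abs_aefun \<phi>) x"
    using rep_abs_aefun[OF m] by eventually_elim simp
  have wg: "has_weak_gradient M (rep_aefun (abs_aefun \<phi>)) (gradient \<phi>)"
    by (rule has_weak_gradient_cong[OF test_function_weak_gradient[OF \<phi>] _ ae open_M]) simp
  then show "AE x in mu M. grad_M M (abs_aefun \<phi>) x = scaled x (gradient \<phi> x)" by (rule weak_gradient_AE)
  show "AE x in mu M. rep_aefun (abs_aefun \<phi>) x = \<phi> x"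
    by (rule AE_mu) (use ae in eventually_elim, simp)
  have "AE x in lborel. x \<notin> M \<longrightarrow> rep_aefun (abs_aefun \<phi>) x = 0"
    using ae
  proof eventually_elim
    case (elim x)
    have "\<phi> x = 0" if "x \<notin> M" using K(3,4) that by blast
    then show ?case using elim by simp
  qed
  moreover have "locally_Lp p M (rep_aefun (abs_aefun \<phi>))"
    by (rule locally_Lp_cong[OF locally_Lp_continuous[OF smooth_continuous[OF K(1)]] _ ae]) (use p in auto)
  moreover have "locally_Lp p M (gradient \<phi>)"
    by (rule locally_Lp_continuous[OF gradient_continuous[OF K(1)]]) (use p in auto)
  ultimately show "abs_aefun \<phi> \<in> W" using wg unfolding W1p_loc_def by blast
qed

text \<open>On a compact subset of \<open>M\<close> the product x1 x2 is continuous and nonzero, so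
  the singular density does no harm.\<close>

lemma mu_compact_support_finite:
  fixes f :: "'n pt \<Rightarrow> 'b::euclidean_space"
  assumes f: "continuous_on UNIV f" and K: "compact K" "K \<subseteq> M" "\<And>x. x \<notin> K \<Longrightarrow> f x = 0" and q: "q > 0"
  shows "Lfin (mu M) q f"
proof -
  have [measurable]: "f \<in> borel_measurable borel" by (rule borel_measurable_continuous_onI[OF f])
  have "continuous_on K (\<lambda>x. norm (f x) powr q / (fst x * fst (snd x)))"
  proof (rule continuous_on_divide)
    have "continuous_on K f" using continuous_on_subset[OF f] by auto
    then show "continuous_on K (\<lambda>x. norm (f x) powr q)"
      using q by (intro continuous_on_powr' continuous_on_norm continuous_on_const) auto
    show "continuous_on K (\<lambda>x. fst x * fst (snd x))" by (intro continuous_intros)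
    show "\<forall>x\<in>K. fst x * fst (snd x) \<noteq> 0"
    proof
      fix x assume "x \<in> K"
      then have "x \<in> M" using K(2) by blast
      then show "fst x * fst (snd x) \<noteq> 0" unfolding M_iff by simp
    qed
  qed
  then have i: "integrable lborel (\<lambda>x. indicator K x *\<^sub>R (norm (f x) powr q / (fst x * fst (snd x))))"
    by (rule borel_integrable_compact[OF K(1)])
  have "(\<integral>\<^sup>+x. ennreal (norm (f x) powr q) \<partial>mu M) = (\<integral>\<^sup>+x. ennreal (indicator K x *\<^sub>R (norm (f x) powr q / (fst x * fst (snd x)))) \<partial>lborel)"
  proof (subst nn_integral_mu)
    show "(\<integral>\<^sup>+x. ennreal (indicator M x / (fst x * fst (snd x))) * ennreal (norm (f x) powr q) \<partial>lborel)
      = (\<integral>\<^sup>+x. ennreal (indicator K x *\<^sub>R (norm (f x) powr q / (fst x * fst (snd x)))) \<partial>lborel)"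
    proof (rule nn_integral_cong)
      fix x
      show "ennreal (indicator M x / (fst x * fst (snd x))) * ennreal (norm (f x) powr q)
        = ennreal (indicator K x *\<^sub>R (norm (f x) powr q / (fst x * fst (snd x))))"
      proof (cases "x \<in> K")
        case True
        then show ?thesis using K(2) M_iff[of x] by (auto simp: ennreal_mult[symmetric])
      next
        case False
        then show ?thesis using K(3) q by simp
      qed
    qed
  qed measurable
  also have "\<dots> < \<infinity>" using i unfolding real_integrable_def by (auto simp: less_top)
  finally show ?thesis unfolding Lfin_def borel_mu by simp
qed

lemma scaled_gradient_continuous: "smooth \<phi> \<Longrightarrow> continuous_on S (\<lambda>x. scaled x (gradient \<phi> x))"
  unfolding scaled_def by (intro continuous_intros gradient_continuous)

lemma test_function_HH:
  assumes \<phi>: "\<phi> \<in> test_functions M"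
  shows "abs_aefun \<phi> \<in> HH" "Lfin (mu M) p \<phi>" "Lfin (mu M) p (\<lambda>x. scaled x (gradient \<phi> x))"
proof -
  from \<phi> obtain K where K: "smooth \<phi>" "compact K" "K \<subseteq> M" "\<And>x. x \<notin> K \<Longrightarrow> \<phi> x = 0"
    "\<And>x v. x \<notin> K \<Longrightarrow> frechet_derivative \<phi> (at x) v = 0"
    by (rule test_functionsD) blast
  have g0: "gradient \<phi> x = 0" if "x \<notin> K" for x unfolding gradient_def using K(5)[OF that] by simp
  show 1: "Lfin (mu M) p \<phi>"
    by (rule mu_compact_support_finite[OF smooth_continuous[OF K(1)] K(2,3,4)]) (use p in auto)
  show 2: "Lfin (mu M) p (\<lambda>x. scaled x (gradient \<phi> x))"
    by (rule mu_compact_support_finite[OF scaled_gradient_continuous[OF K(1)] K(2,3)]) (use p g0 in auto)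
  note t = test_function_W[OF \<phi>]
  have "AE x in mu M. norm (rep_aefun (abs_aefun \<phi>) x) \<le> norm (\<phi> x)"
    using t(3) by eventually_elim simp
  then have "Lfin (mu M) p (rep_aefun (abs_aefun \<phi>))"
    by (intro Lnorm_mono(1)[OF 1 _ _ p0]) (simp_all add: borel_mu)
  moreover have "Lfin (mu M) p (\<lambda>x. grad_M M (abs_aefun \<phi>) x \<bullet> b)" if "b \<in> Basis" for b
  proof (rule Lnorm_mono(1)[OF 2])
    show "(\<lambda>x. grad_M M (abs_aefun \<phi>) x \<bullet> b) \<in> borel_measurable (mu M)"
      using grad_M_measurable[OF t(1)] unfolding borel_mu by simp
    show "AE x in mu M. norm (grad_M M (abs_aefun \<phi>) x \<bullet> b) \<le> norm (scaled x (gradient \<phi> x))"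
      using t(2) by eventually_elim (use Basis_le_norm[OF that] in simp)
  qed (use p in auto)
  ultimately show "abs_aefun \<phi> \<in> HH" using t(1) unfolding HH_iff by auto
qed

lemma test_function_E: "\<phi> \<in> test_functions M \<Longrightarrow> abs_aefun \<phi> \<in> E"
proof -
  assume \<phi>: "\<phi> \<in> test_functions M"
  have "Hnorm 0 = 0" using HH_scale[OF test_function_HH(1)[OF \<phi>], of 0] by simp
  then have "\<exists>\<psi>\<in>test_functions M. Hnorm (abs_aefun \<phi> - abs_aefun \<psi>) < \<epsilon>" if "\<epsilon> > 0" for \<epsilon>
    using that \<phi> by (intro bexI[of _ \<phi>]) auto
  then show ?thesis using test_function_HH(1)[OF \<phi>] unfolding E_iff by auto
qed

lemma test_borel: "\<phi> \<in> test_functions M \<Longrightarrow> \<phi> \<in> borel_measurable borel"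
  by (rule smooth_measurable) (auto simp: test_functions_def smooth_def)

lemma E_subspace: "subspace E"
  unfolding subspace_def
proof (intro conjI ballI allI)
  show "0 \<in> E" using test_function_E[OF test_functions_zero] by (simp add: abs_aefun_zero)
  fix u c assume u: "u \<in> E"
  show "c *\<^sub>R u \<in> E" unfolding E_iff
  proof (intro conjI allI impI)
    show "c *\<^sub>R u \<in> HH" using u HH_scale unfolding E_iff by auto
    fix \<epsilon> :: real assume e: "\<epsilon> > 0"
    then obtain \<phi> where \<phi>: "\<phi> \<in> test_functions M" "Hnorm (u - abs_aefun \<phi>) < \<epsilon> / (\<bar>c\<bar> + 1)"
      using u unfolding E_iff by (metis abs_ge_zero add_nonneg_pos divide_pos_pos zero_less_one)
    have "u - abs_aefun \<phi> \<in> HH"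
      using HH_add[of u "-1 *\<^sub>R abs_aefun \<phi>"] HH_scale[OF test_function_HH(1)[OF \<phi>(1)], of "-1"] u unfolding E_iff by auto
    from HH_scale[OF this, of c] have "Hnorm (c *\<^sub>R u - abs_aefun (\<lambda>x. c * \<phi> x)) = \<bar>c\<bar> * Hnorm (u - abs_aefun \<phi>)"
      using abs_aefun_scale[OF test_borel[OF \<phi>(1)], of c] by (simp add: algebra_simps)
    also have "\<dots> \<le> \<bar>c\<bar> * (\<epsilon> / (\<bar>c\<bar> + 1))" using \<phi>(2) by (intro mult_left_mono) auto
    also have "\<dots> < \<epsilon>" using e by (simp add: field_simps)
    finally show "\<exists>\<phi>\<in>test_functions M. Hnorm (c *\<^sub>R u - abs_aefun \<phi>) < \<epsilon>"
      using test_functions_scale[OF \<phi>(1)] by blast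
  qed
  fix v assume v: "v \<in> E"
  show "u + v \<in> E" unfolding E_iff
  proof (intro conjI allI impI)
    show "u + v \<in> HH" using u v HH_add unfolding E_iff by auto
    fix \<epsilon> :: real assume e: "\<epsilon> > 0"
    then have e2: "\<epsilon> / 2 > 0" by simp
    obtain \<phi> where \<phi>: "\<phi> \<in> test_functions M" "Hnorm (u - abs_aefun \<phi>) < \<epsilon> / 2"
      using u e2 unfolding E_iff by blast
    obtain \<psi> where \<psi>: "\<psi> \<in> test_functions M" "Hnorm (v - abs_aefun \<psi>) < \<epsilon> / 2"
      using v e2 unfolding E_iff by blast
    have H: "u - abs_aefun \<phi> \<in> HH" "v - abs_aefun \<psi> \<in> HH"
      using HH_add[of u "-1 *\<^sub>R abs_aefun \<phi>"] HH_scale[OF test_function_HH(1)[OF \<phi>(1)], of "-1"]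
        HH_add[of v "-1 *\<^sub>R abs_aefun \<psi>"] HH_scale[OF test_function_HH(1)[OF \<psi>(1)], of "-1"] u v
      unfolding E_iff by auto
    have eq: "(u + v) - abs_aefun (\<lambda>x. \<phi> x + \<psi> x) = (u - abs_aefun \<phi>) + (v - abs_aefun \<psi>)"
      using abs_aefun_add[OF test_borel[OF \<phi>(1)] test_borel[OF \<psi>(1)]] by (simp add: algebra_simps)
    have "Hnorm ((u + v) - abs_aefun (\<lambda>x. \<phi> x + \<psi> x)) < \<epsilon>"
      unfolding eq using HH_add[OF H] \<phi>(2) \<psi>(2) by linarith
    then show "\<exists>\<phi>\<in>test_functions M. Hnorm (u + v - abs_aefun \<phi>) < \<epsilon>"
      using test_functions_add[OF \<phi>(1) \<psi>(1)] by blast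
  qed
qed

end

section \<open>The Poincare inequality and the norm of the energy space\<close>

lemma AE_Ioo_Icc: "AE t in lborel. t \<in> {0<..<1::real} \<longleftrightarrow> t \<in> {0..1}"
  using AE_box_cbox[of "0::real" 1] by (simp add: box_real)

lemma smooth_increment_le:
  assumes f: "smooth f"
  shows "ennreal \<bar>f (x + v) - f x\<bar> \<le> (\<integral>\<^sup>+t\<in>{0<..<1}. ennreal \<bar>frechet_derivative f (at (x + t *\<^sub>R v)) v\<bar> \<partial>lborel)"
proof -
  define g where "g t = frechet_derivative f (at (x + t *\<^sub>R v)) v" for t
  have c: "continuous_on {0..1} g"
    unfolding g_def
    by (intro continuous_on_compose2[OF smooth_continuous[OF smooth_derivative[OF f], of UNIV]] continuous_intros) auto
  then have i: "integrable lborel (\<lambda>t. indicator {0..1} t *\<^sub>R g t)"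
    by (intro borel_integrable_compact) auto
  then have "set_integrable lborel {0..1} g" unfolding set_integrable_def .
  from set_borel_integral_eq_integral(2)[OF this] smooth_line_integral[OF f, of x v]
  have "(\<integral>t. indicator {0..1} t *\<^sub>R g t \<partial>lborel) = f (x + v) - f x"
    unfolding g_def set_lebesgue_integral_def by (simp add: integral_unique)
  then have "ennreal \<bar>f (x + v) - f x\<bar> \<le> (\<integral>\<^sup>+t. ennreal (norm (indicator {0..1} t *\<^sub>R g t)) \<partial>lborel)"
    using integral_norm_bound_ennreal[OF i] by simp
  also have "\<dots> = (\<integral>\<^sup>+t\<in>{0<..<1}. ennreal \<bar>g t\<bar> \<partial>lborel)"
  proof (rule nn_integral_cong_AE)
    show "AE t in lborel. ennreal (norm (indicator {0..1} t *\<^sub>R g t)) = ennreal \<bar>g t\<bar> * indicator {0<..<1} t"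
      using AE_Ioo_Icc by eventually_elim (auto simp: indicator_def abs_mult)
  qed
  finally show ?thesis unfolding g_def .
qed

context corner_bump
begin

abbreviation "N \<equiv> E_norm M p"
abbreviation "LP \<equiv> Lnorm (mu M) p"

lemma E_W: "u \<in> E \<Longrightarrow> u \<in> W"
  unfolding E_iff HH_iff by auto

lemma E_rep: "u \<in> E \<Longrightarrow> Lfin (mu M) p (rep_aefun u)"
  unfolding E_iff HH_iff by auto

lemma HH_grad:
  assumes "u \<in> HH"
  shows "Lfin (mu M) p (grad_M M u)" "N u \<le> Hnorm u" "LP (rep_aefun u) \<le> Hnorm u"
proof -
  have W: "u \<in> W" using assms unfolding HH_iff by auto
  have m: "grad_M M u \<in> borel_measurable (mu M)" using grad_M_measurable[OF W] unfolding borel_mu .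
  have "\<And>b. b \<in> Basis \<Longrightarrow> Lfin (mu M) p (\<lambda>x. grad_M M u x \<bullet> b)" using assms unfolding HH_iff by blast
  note B = Lnorm_Basis_sum[OF this less_imp_le[OF p] m]
  show "Lfin (mu M) p (grad_M M u)" by (rule B(1))
  show "N u \<le> Hnorm u" unfolding E_norm_eq[OF W] Hnorm_eq[OF W] using B(2) Lnorm_ge0[of "mu M" p "rep_aefun u"] by linarith
  show "LP (rep_aefun u) \<le> Hnorm u" unfolding Hnorm_eq[OF W] by (simp add: sum_nonneg)
qed

lemma E_grad: "u \<in> E \<Longrightarrow> Lfin (mu M) p (grad_M M u)"
  using HH_grad(1) unfolding E_iff by auto

lemma E_approx:
  assumes "u \<in> E" "e > 0"
  shows "\<exists>\<phi>\<in>test_functions M. N (u - abs_aefun \<phi>) < e \<and> LP (rep_aefun (u - abs_aefun \<phi>)) < e"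
proof -
  obtain \<phi> where \<phi>: "\<phi> \<in> test_functions M" "Hnorm (u - abs_aefun \<phi>) < e"
    using assms unfolding E_iff by blast
  have "u - abs_aefun \<phi> \<in> E" using assms(1) test_function_E[OF \<phi>(1)] E_subspace by (simp add: subspace_diff)
  then have "u - abs_aefun \<phi> \<in> HH" unfolding E_iff by simp
  from HH_grad(2,3)[OF this] \<phi> show ?thesis by (intro bexI[of _ \<phi>]) auto
qed

lemma N_scale':
  assumes "u \<in> E"
  shows "N (c *\<^sub>R u) = \<bar>c\<bar> * N u"
proof -
  have "LP (grad_M M (c *\<^sub>R u)) = LP (\<lambda>x. c *\<^sub>R grad_M M u x)"
    by (rule Lnorm_cong) (use grad_M_scale[OF E_W[OF assms], of c] in eventually_elim, simp)
  then show ?thesis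
    using E_W[OF assms] Lnorm_scale(2)[OF E_grad[OF assms] p0] by (simp add: E_norm_eq W_scale)
qed

lemma N_tri':
  assumes "u \<in> E" "v \<in> E"
  shows "N (u + v) \<le> N u + N v"
proof -
  have W: "u \<in> W" "v \<in> W" "u + v \<in> W" using assms E_W W_add by auto
  have m: "grad_M M (u + v) \<in> borel_measurable (mu M)" using grad_M_measurable[OF W(3)] unfolding borel_mu .
  have "AE x in mu M. norm (grad_M M (u + v) x) \<le> norm (grad_M M u x) + norm (grad_M M v x)"
    using grad_M_add[OF W(1,2)] by eventually_elim (simp add: norm_triangle_ineq)
  from Lnorm_tri_AE(2)[OF E_grad[OF assms(1)] E_grad[OF assms(2)] less_imp_le[OF p] m this]
  show ?thesis using W by (simp add: E_norm_eq)
qed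

lemma N_test: "\<phi> \<in> test_functions M \<Longrightarrow> N (abs_aefun \<phi>) = LP (\<lambda>x. scaled x (gradient \<phi> x))"
  and LP_test: "\<phi> \<in> test_functions M \<Longrightarrow> LP (rep_aefun (abs_aefun \<phi>)) = LP \<phi>"
proof -
  assume \<phi>: "\<phi> \<in> test_functions M"
  note t = test_function_W[OF \<phi>]
  show "N (abs_aefun \<phi>) = LP (\<lambda>x. scaled x (gradient \<phi> x))"
    unfolding E_norm_eq[OF t(1)] by (rule Lnorm_cong) (use t(2) in eventually_elim, simp)
  show "LP (rep_aefun (abs_aefun \<phi>)) = LP \<phi>"
    by (rule Lnorm_cong) (use t(3) in eventually_elim, simp)
qed

lemma nn_integral_translate:
  assumes [measurable]: "f \<in> borel_measurable borel"
  shows "(\<integral>\<^sup>+x. f (x + t) \<partial>lborel) = (\<integral>\<^sup>+x. f (x :: 'a::euclidean_space) \<partial>lborel)"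
  using nn_integral_lborel_affine[of f 1 t] by (simp add: add.commute)

text \<open>A translation by \<open>v\<close> in one coordinate of x', longer than the diameter of
  \<open>X\<close>, leaves \<open>M\<close>; so a test function equals minus its increment along
  \<open>v\<close>. The density of \<open>mu\<close> is independent of x', and Jensen, Fubini and
  translation invariance give the bound.\<close>

lemma poincare_test:
  "\<exists>C>0. \<forall>\<phi>\<in>test_functions M. LP \<phi> \<le> C * LP (\<lambda>x. scaled x (gradient \<phi> x))"
proof -
  obtain R where R: "R > 0" "\<And>y. y \<in> X \<Longrightarrow> norm y \<le> R" using X(2) unfolding bounded_pos by auto
  define L where "L = 2 * R + 1"
  have L: "L > 0" unfolding L_def using R by simp
  \<comment> \<open>Any coordinate of x' will do; one exists because index types are
    nonempty.\<close>
  fix i :: 'n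
  define b :: "'n pt" where "b = (0, 0, axis i 1)"
  have b: "b \<in> Basis" unfolding b_def by (auto simp: Basis_prod_def axis_in_Basis_iff)
  define v where "v = L *\<^sub>R b"
  have vout: "x + v \<notin> M" if "x \<in> M" for x
  proof
    assume "x + v \<in> M"
    then have "snd (snd x) + L *\<^sub>R axis i 1 \<in> X" unfolding M_iff v_def b_def by simp
    then have "norm (snd (snd x) + L *\<^sub>R axis i 1) \<le> R" by (rule R)
    moreover have "norm (L *\<^sub>R axis i (1::real)) \<le> norm (snd (snd x) + L *\<^sub>R axis i 1) + norm (snd (snd x))"
      using norm_triangle_ineq4[of "snd (snd x) + L *\<^sub>R axis i 1" "snd (snd x)"] by simp
    moreover have "norm (snd (snd x)) \<le> R" using that R(2) unfolding M_iff by auto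
    ultimately show False using L R(1) unfolding L_def by (simp add: norm_axis_1)
  qed
  have "LP \<phi> \<le> L * LP (\<lambda>x. scaled x (gradient \<phi> x))" if \<phi>: "\<phi> \<in> test_functions M" for \<phi>
  proof -
    from \<phi> obtain K where K: "smooth \<phi>" "compact K" "K \<subseteq> M" "\<And>x. x \<notin> K \<Longrightarrow> \<phi> x = 0"
      "\<And>x v. x \<notin> K \<Longrightarrow> frechet_derivative \<phi> (at x) v = 0"
      by (rule test_functionsD) blast
    define D where "D x = frechet_derivative \<phi> (at x) v" for x
    have Dm[measurable]: "D \<in> borel_measurable borel"
      unfolding D_def by (intro smooth_measurable smooth_derivative K)
    have [measurable]: "\<phi> \<in> borel_measurable borel" by (rule smooth_measurable[OF K(1)])
    have D_le: "\<bar>D x\<bar> \<le> L * norm (scaled x (gradient \<phi> x))" for x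
    proof -
      have "D x = L * frechet_derivative \<phi> (at x) b"
        unfolding D_def v_def using linear_scale[OF linear_frechet_derivative[OF smooth_differentiable[OF K(1)]]] by simp
      also have "frechet_derivative \<phi> (at x) b = scaled x (gradient \<phi> x) \<bullet> b"
        unfolding gradient_inner[OF b, symmetric] by (simp add: scaled_def b_def inner_prod_def)
      finally show ?thesis using Basis_le_norm[OF b, of "scaled x (gradient \<phi> x)"] L by (simp add: abs_mult)
    qed
    define nu where "nu = density lborel (indicator {0<..<1::real})"
    have nui: "(\<integral>\<^sup>+t. f t \<partial>nu) = (\<integral>\<^sup>+t\<in>{0<..<1}. f t \<partial>lborel)" if [measurable]: "f \<in> borel_measurable borel" for f
      unfolding nu_def by (subst nn_integral_density) (auto simp: mult.commute)
    have emnu: "emeasure nu (space nu) = 1" unfolding nu_def by (simp add: emeasure_density)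
    have [measurable_cong]: "sets nu = sets borel" unfolding nu_def by simp
    interpret nu: finite_measure nu by standard (simp add: emnu)
    have pt: "ennreal (\<bar>\<phi> x\<bar> powr p) \<le> (\<integral>\<^sup>+t. ennreal (\<bar>D (x + t *\<^sub>R v)\<bar> powr p) \<partial>nu)" if x: "x \<in> M" for x
    proof -
      have "\<phi> (x + v) = 0" using vout[OF x] K(3,4) by blast
      then have "ennreal \<bar>\<phi> x\<bar> \<le> (\<integral>\<^sup>+t. ennreal \<bar>D (x + t *\<^sub>R v)\<bar> \<partial>nu)"
        using smooth_increment_le[OF K(1), of x v, folded D_def] by (subst nui) auto
      then have "ennreal (\<bar>\<phi> x\<bar> powr p) \<le> ennreal (1 powr (p - 1)) * (\<integral>\<^sup>+t. ennreal (\<bar>D (x + t *\<^sub>R v)\<bar> powr p) \<partial>nu)"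
        using p emnu by (intro jensen_nn) auto
      then show ?thesis by simp
    qed
    \<comment> \<open>The density of \<open>mu\<close> extended beyond \<open>M\<close> to all
      positive x1 and x2 and all x', so that it becomes invariant under translation by
      \<open>v\<close>. Outside \<open>M\<close> the derivative \<open>D\<close> is 0.\<close>
    define w :: "'n pt \<Rightarrow> ennreal" where "w x = ennreal (indicator {0<..} (fst x) * indicator {0<..} (fst (snd x)) / (fst x * fst (snd x)))" for x
    have [measurable]: "w \<in> borel_measurable borel" unfolding w_def by measurable
    have wv: "w (x + t *\<^sub>R v) = w x" for x t unfolding w_def v_def b_def by simp
    have wM: "x \<in> M \<Longrightarrow> ennreal (indicator M x / (fst x * fst (snd x))) = w x" for x
      unfolding w_def M_iff by (simp add: M_iff)
    have D0: "D x = 0" if "x \<notin> M" for x using K(3,5) that unfolding D_def by blast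
    have "(\<integral>\<^sup>+x. ennreal (norm (\<phi> x) powr p) \<partial>mu M) = (\<integral>\<^sup>+x. ennreal (indicator M x / (fst x * fst (snd x))) * ennreal (\<bar>\<phi> x\<bar> powr p) \<partial>lborel)"
      by (subst nn_integral_mu) auto
    also have "\<dots> \<le> (\<integral>\<^sup>+x. w x * (\<integral>\<^sup>+t. ennreal (\<bar>D (x + t *\<^sub>R v)\<bar> powr p) \<partial>nu) \<partial>lborel)"
    proof (rule nn_integral_mono)
      fix x
      show "ennreal (indicator M x / (fst x * fst (snd x))) * ennreal (\<bar>\<phi> x\<bar> powr p)
        \<le> w x * (\<integral>\<^sup>+t. ennreal (\<bar>D (x + t *\<^sub>R v)\<bar> powr p) \<partial>nu)"
      proof (cases "x \<in> M")
        case True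
        then show ?thesis unfolding wM[OF True] by (intro mult_left_mono pt) auto
      qed simp
    qed
    also have "\<dots> = (\<integral>\<^sup>+x. (\<integral>\<^sup>+t. w (x + t *\<^sub>R v) * ennreal (\<bar>D (x + t *\<^sub>R v)\<bar> powr p) \<partial>nu) \<partial>lborel)"
      unfolding wv by (intro nn_integral_cong nn_integral_cmult[symmetric]) auto
    also have "\<dots> = (\<integral>\<^sup>+t. (\<integral>\<^sup>+x. w (x + t *\<^sub>R v) * ennreal (\<bar>D (x + t *\<^sub>R v)\<bar> powr p) \<partial>lborel) \<partial>nu)"
      by (rule pair_sigma_finite.Fubini')
        (auto simp: pair_sigma_finite_def nu.sigma_finite_measure_axioms sigma_finite_lborel)
    also have "\<dots> = (\<integral>\<^sup>+t. (\<integral>\<^sup>+x. w x * ennreal (\<bar>D x\<bar> powr p) \<partial>lborel) \<partial>nu)"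
      by (intro nn_integral_cong nn_integral_translate[of "\<lambda>x. w x * ennreal (\<bar>D x\<bar> powr p)"]) auto
    also have "\<dots> = (\<integral>\<^sup>+x. w x * ennreal (\<bar>D x\<bar> powr p) \<partial>lborel)" using emnu by simp
    also have "\<dots> = (\<integral>\<^sup>+x. ennreal (\<bar>D x\<bar> powr p) \<partial>mu M)"
    proof (subst nn_integral_mu)
      show "(\<integral>\<^sup>+x. w x * ennreal (\<bar>D x\<bar> powr p) \<partial>lborel) = (\<integral>\<^sup>+x. ennreal (indicator M x / (fst x * fst (snd x))) * ennreal (\<bar>D x\<bar> powr p) \<partial>lborel)"
      proof (rule nn_integral_cong)
        fix x
        show "w x * ennreal (\<bar>D x\<bar> powr p) = ennreal (indicator M x / (fst x * fst (snd x))) * ennreal (\<bar>D x\<bar> powr p)"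
        proof (cases "x \<in> M")
          case True
          then show ?thesis unfolding wM[OF True] by simp
        qed (use D0[of x] p in simp)
      qed
    qed measurable
    also have "\<dots> \<le> ennreal ((L * LP (\<lambda>x. scaled x (gradient \<phi> x))) powr p)"
    proof -
      have f: "Lfin (mu M) p (\<lambda>x. scaled x (gradient \<phi> x))" by (rule test_function_HH(3)[OF \<phi>])
      have "(\<integral>\<^sup>+x. ennreal (\<bar>D x\<bar> powr p) \<partial>mu M) \<le> (\<integral>\<^sup>+x. ennreal (norm (L *\<^sub>R scaled x (gradient \<phi> x)) powr p) \<partial>mu M)"
        using D_le L p by (intro nn_integral_mono ennreal_leI powr_mono2) auto
      also have "\<dots> = ennreal ((L * LP (\<lambda>x. scaled x (gradient \<phi> x))) powr p)"
        using Lnorm_nn[OF Lnorm_scale(1)[OF f p0, of L] p0] Lnorm_scale(2)[OF f p0, of L] L by simp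
      finally show ?thesis .
    qed
    finally have "(\<integral>\<^sup>+x. ennreal (norm (\<phi> x) powr p) \<partial>mu M) \<le> ennreal ((L * LP (\<lambda>x. scaled x (gradient \<phi> x))) powr p)" .
    then show ?thesis
      using Lnorm_le_iff[of \<phi> "mu M" p "L * LP (\<lambda>x. scaled x (gradient \<phi> x))"] p0 L by (simp add: borel_mu)
  qed
  then show ?thesis using L by blast
qed

lemma E_Lnorm_add: "u \<in> E \<Longrightarrow> v \<in> E \<Longrightarrow> LP (rep_aefun (u + v)) \<le> LP (rep_aefun u) + LP (rep_aefun v)"
proof -
  assume uv: "u \<in> E" "v \<in> E"
  have "AE x in mu M. norm (rep_aefun (u + v) x) \<le> norm (rep_aefun u x) + norm (rep_aefun v x)"
    using rep_add_mu[of u v] by eventually_elim (simp add: abs_triangle_ineq)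
  from Lnorm_tri_AE(2)[OF E_rep[OF uv(1)] E_rep[OF uv(2)] less_imp_le[OF p] _ this]
  show ?thesis by (simp add: borel_mu)
qed

lemma poincare: "\<exists>C>0. \<forall>u\<in>E. LP (rep_aefun u) \<le> C * N u"
proof -
  obtain C where C: "C > 0" "\<And>\<phi>. \<phi> \<in> test_functions M \<Longrightarrow> LP \<phi> \<le> C * LP (\<lambda>x. scaled x (gradient \<phi> x))"
    using poincare_test by blast
  have "LP (rep_aefun u) \<le> C * N u" if u: "u \<in> E" for u
  proof (rule field_le_epsilon)
    fix e :: real assume e: "e > 0"
    define d where "d = e / (C + 1)"
    have d: "d > 0" unfolding d_def using e C by simp
    obtain \<phi> where \<phi>: "\<phi> \<in> test_functions M" "N (u - abs_aefun \<phi>) < d" "LP (rep_aefun (u - abs_aefun \<phi>)) < d"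
      using E_approx[OF u d] by blast
    have \<phi>E: "abs_aefun \<phi> \<in> E" by (rule test_function_E[OF \<phi>(1)])
    have dE: "u - abs_aefun \<phi> \<in> E" using u \<phi>E E_subspace by (simp add: subspace_diff)
    have "LP (rep_aefun u) \<le> LP (rep_aefun (u - abs_aefun \<phi>)) + LP (rep_aefun (abs_aefun \<phi>))"
      using E_Lnorm_add[OF dE \<phi>E] by simp
    also have "LP (rep_aefun (abs_aefun \<phi>)) \<le> C * N (abs_aefun \<phi>)"
      using C(2)[OF \<phi>(1)] by (simp add: N_test[OF \<phi>(1)] LP_test[OF \<phi>(1)])
    also have "N (abs_aefun \<phi>) \<le> N u + N (u - abs_aefun \<phi>)"
    proof -
      have "N (abs_aefun \<phi> - u) = N (u - abs_aefun \<phi>)" using E_norm_minus[of "u - abs_aefun \<phi>"] by simp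
      moreover have "abs_aefun \<phi> - u \<in> E" using u \<phi>E E_subspace by (simp add: subspace_diff)
      ultimately show ?thesis using N_tri'[of u "abs_aefun \<phi> - u"] u by simp
    qed
    finally have "LP (rep_aefun u) \<le> d + C * (N u + d)"
      using \<phi>(2,3) C(1) by (smt (verit) mult_left_mono)
    also have "\<dots> = C * N u + (C + 1) * d" by (simp add: algebra_simps)
    also have "(C + 1) * d = e" unfolding d_def using C by simp
    finally show "LP (rep_aefun u) \<le> C * N u + e" .
  qed
  then show ?thesis using C(1) by blast
qed

text \<open>Definiteness is the nontrivial axiom: by \<open>poincare\<close> a class with vanishing
  norm is 0 on \<open>M\<close>, and classes in \<open>W\<close> are 0 outside
  \<open>M\<close>.\<close>

lemma normed_E: "normed_subspace E N"
proof
  show "subspace E" by (rule E_subspace)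
  show "0 \<le> N u" for u unfolding E_norm_def by simp
  show "N (- u) = N u" for u by (rule E_norm_minus)
  show "N (c *\<^sub>R u) = \<bar>c\<bar> * N u" if "u \<in> E" for u c by (rule N_scale'[OF that])
  show "N (u + v) \<le> N u + N v" if "u \<in> E" "v \<in> E" for u v by (rule N_tri'[OF that])
  fix u assume u: "u \<in> E" "N u = 0"
  obtain C where "LP (rep_aefun u) \<le> C * N u" using poincare u by blast
  then have "LP (rep_aefun u) = 0" using u(2) Lnorm_ge0[of "mu M" p "rep_aefun u"] by simp
  then have "AE x in lborel. x \<in> M \<longrightarrow> rep_aefun u x = 0"
    using Lnorm_eq_0[OF E_rep[OF u(1)] _ p0] by (simp add: AE_mu_iff)
  moreover have "AE x in lborel. x \<notin> M \<longrightarrow> rep_aefun u x = 0" using E_W[OF u(1)] unfolding W1p_loc_def by auto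
  ultimately have "AE x in lborel. rep_aefun u x = rep_aefun 0 x"
    using rep_aefun_zero by eventually_elim auto
  then show "u = 0" by (rule aefun_eqI)
qed

end

sublocale corner_bump \<subseteq> normed_subspace E N
  by (rule normed_E)

section \<open>The two terms of the energy as norms, and integrals over disjoint sets\<close>

text \<open>The measure x1 (x1 x2)^p d sigma of the nonlinear term, as a density with respect to
  Lebesgue measure.\<close>

definition muK :: "real \<Rightarrow> 'n::finite pt set \<Rightarrow> 'n pt measure" where
  "muK p M = density lborel (\<lambda>x. ennreal (indicator M x * (fst x * fst (snd x)) powr (p - 1)))"

context corner_bump
begin

lemma sets_muK [measurable_cong, simp]: "sets (muK p M) = sets borel" "space (muK p M) = UNIV"
  unfolding muK_def by auto

lemma borel_muK: "borel_measurable (muK p M) = borel_measurable borel"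
  by (rule measurable_cong_sets) auto

lemma nn_integral_muK:
  assumes [measurable]: "f \<in> borel_measurable borel"
  shows "(\<integral>\<^sup>+x. f x \<partial>muK p M) = (\<integral>\<^sup>+x. ennreal (indicator M x * (fst x * fst (snd x)) powr (p - 1)) * f x \<partial>lborel)"
  unfolding muK_def by (subst nn_integral_density) auto

lemma AE_muK: "(AE x in mu M. P x) \<Longrightarrow> AE x in muK p M. P x"
  unfolding AE_mu_iff unfolding muK_def
  by (subst AE_density) (auto elim!: eventually_mono split: split_indicator simp: indicator_def)

lemma energy_eq:
  assumes u: "u \<in> E"
  shows "energy M p q lam u = ereal (1 / p * N u powr p) -
    ereal (lam / q) * enn2ereal (\<integral>\<^sup>+x. ennreal (norm (rep_aefun u x) powr q) \<partial>muK p M)"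
proof -
  have [measurable]: "grad_M M u \<in> borel_measurable borel" by (rule grad_M_measurable[OF E_W[OF u]])
  have 1: "(LINT x|sigma_measure M. fst x * norm (grad_M M u x) powr p) = N u powr p"
  proof -
    have "(LINT x|sigma_measure M. fst x * norm (grad_M M u x) powr p) = enn2real (\<integral>\<^sup>+x. ennreal (norm (grad_M M u x) powr p) \<partial>mu M)"
      by (rule integral_sigma(1)) auto
    also have "\<dots> = LP (grad_M M u) powr p" by (simp add: Lnorm_nn[OF E_grad[OF u] p0])
    finally show ?thesis using E_norm_eq[OF E_W[OF u]] by simp
  qed
  have 2: "(\<integral>\<^sup>+x. ennreal (fst x * (fst x * fst (snd x)) powr p * \<bar>rep_aefun u x\<bar> powr q) \<partial>sigma_measure M)
    = (\<integral>\<^sup>+x. ennreal (norm (rep_aefun u x) powr q) \<partial>muK p M)"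
  proof -
    have "(\<integral>\<^sup>+x. ennreal (fst x * (fst x * fst (snd x)) powr p * \<bar>rep_aefun u x\<bar> powr q) \<partial>sigma_measure M)
      = (\<integral>\<^sup>+x. ennreal ((fst x * fst (snd x)) powr p * \<bar>rep_aefun u x\<bar> powr q) \<partial>mu M)"
      by (rule nn_integral_sigma) auto
    also have "\<dots> = (\<integral>\<^sup>+x. ennreal (norm (rep_aefun u x) powr q) \<partial>muK p M)"
    proof (subst nn_integral_mu, measurable, subst nn_integral_muK, measurable, rule nn_integral_cong)
      fix x
      show "ennreal (indicator M x / (fst x * fst (snd x))) * ennreal ((fst x * fst (snd x)) powr p * \<bar>rep_aefun u x\<bar> powr q)
        = ennreal (indicator M x * (fst x * fst (snd x)) powr (p - 1)) * ennreal (norm (rep_aefun u x) powr q)"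
      proof (cases "x \<in> M")
        case True
        then have "0 < fst x * fst (snd x)" unfolding M_iff by simp
        then show ?thesis using True by (simp add: ennreal_mult[symmetric] powr_diff)
      qed simp
    qed
    finally show ?thesis .
  qed
  show ?thesis unfolding energy_def 1 2 ..
qed

definition region_integral :: "'n pt set \<Rightarrow> 'n pt aefun \<Rightarrow> real" where
  "region_integral S u = (\<integral>x. indicator S x * rep_aefun u x \<partial>mu M)"

lemma region_integrable:
  assumes [measurable]: "S \<in> sets borel" and m: "emeasure (mu M) S \<le> ennreal m" and u: "u \<in> E"
  shows "integrable (mu M) (\<lambda>x. indicator S x * rep_aefun u x)"
proof (rule integrableI_bounded)
  have le: "norm (indicator S x * rep_aefun u x) \<le> indicator S x + norm (rep_aefun u x) powr p" for x
  proof (cases "\<bar>rep_aefun u x\<bar> \<le> 1")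
    case True
    then show ?thesis by (auto split: split_indicator intro: order_trans)
  next
    case False
    then have "\<bar>rep_aefun u x\<bar> powr 1 \<le> \<bar>rep_aefun u x\<bar> powr p" using p by (intro powr_mono) auto
    then show ?thesis by (auto split: split_indicator)
  qed
  have "(\<integral>\<^sup>+x. ennreal (norm (indicator S x * rep_aefun u x)) \<partial>mu M)
    \<le> (\<integral>\<^sup>+x. indicator S x + ennreal (norm (rep_aefun u x) powr p) \<partial>mu M)"
  proof (rule nn_integral_mono)
    fix x
    show "ennreal (norm (indicator S x * rep_aefun u x)) \<le> indicator S x + ennreal (norm (rep_aefun u x) powr p)"
      using ennreal_leI[OF le[of x]] by (simp add: ennreal_indicator ennreal_plus)
  qed
  also have "\<dots> = emeasure (mu M) S + ennreal (LP (rep_aefun u) powr p)"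
    by (subst nn_integral_add) (auto simp: Lnorm_nn[OF E_rep[OF u] p0, simplified])
  also have "\<dots> < \<infinity>" using m by (auto intro: le_less_trans)
  finally show "(\<integral>\<^sup>+x. ennreal (norm (indicator S x * rep_aefun u x)) \<partial>mu M) < \<infinity>" .
qed measurable

lemma region_integral_linear:
  assumes S[measurable]: "S \<in> sets borel" and m: "emeasure (mu M) S \<le> ennreal m"
  shows "linear_fun_on E (region_integral S)"
  unfolding linear_fun_on_def
proof (intro conjI ballI allI)
  fix u v c assume u: "u \<in> E"
  have "region_integral S (c *\<^sub>R u) = (\<integral>x. c * (indicator S x * rep_aefun u x) \<partial>mu M)"
    unfolding region_integral_def
    by (rule integral_cong_AE) (use rep_scale_mu[of c u] in \<open>auto simp: borel_mu elim!: eventually_mono\<close>)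
  then show "region_integral S (c *\<^sub>R u) = c *\<^sub>R region_integral S u" unfolding region_integral_def by simp
  assume v: "v \<in> E"
  have "region_integral S (u + v) = (\<integral>x. indicator S x * rep_aefun u x + indicator S x * rep_aefun v x \<partial>mu M)"
    unfolding region_integral_def
    by (rule integral_cong_AE) (use rep_add_mu[of u v] in \<open>auto simp: borel_mu distrib_left elim!: eventually_mono\<close>)
  then show "region_integral S (u + v) = region_integral S u + region_integral S v"
    unfolding region_integral_def using region_integrable[OF S m u] region_integrable[OF S m v] by simp
qed

lemma region_integral_bound:
  assumes S[measurable]: "S \<in> sets borel" and m: "emeasure (mu M) S \<le> ennreal m" "m > 0" and u: "u \<in> E"
  shows "ennreal (\<bar>region_integral S u\<bar> powr p) \<le>
    ennreal (m powr (p - 1)) * (\<integral>\<^sup>+x\<in>S. ennreal (\<bar>rep_aefun u x\<bar> powr p) \<partial>mu M)"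
proof -
  let ?D = "density (mu M) (indicator S)"
  have Di: "(\<integral>\<^sup>+x. f x \<partial>?D) = (\<integral>\<^sup>+x\<in>S. f x \<partial>mu M)" if "f \<in> borel_measurable borel" for f
    using that by (subst nn_integral_density) (auto simp: borel_mu mult.commute)
  have "ennreal (\<bar>region_integral S u\<bar> powr p) \<le> ennreal (m powr (p - 1)) * (\<integral>\<^sup>+x. ennreal (\<bar>rep_aefun u x\<bar> powr p) \<partial>?D)"
  proof (rule jensen_nn[where f = "\<lambda>x. \<bar>rep_aefun u x\<bar>"])
    show "emeasure ?D (space ?D) \<le> ennreal m" using m(1) by (simp add: emeasure_density)
    have "ennreal \<bar>region_integral S u\<bar> \<le> (\<integral>\<^sup>+x. ennreal (norm (indicator S x * rep_aefun u x)) \<partial>mu M)"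
      unfolding region_integral_def using integral_norm_bound_ennreal[OF region_integrable[OF S m(1) u]] by simp
    also have "\<dots> = (\<integral>\<^sup>+x\<in>S. ennreal \<bar>rep_aefun u x\<bar> \<partial>mu M)"
      by (intro nn_integral_cong) (auto split: split_indicator)
    finally show "ennreal \<bar>region_integral S u\<bar> \<le> (\<integral>\<^sup>+x. ennreal \<bar>rep_aefun u x\<bar> \<partial>?D)"
      by (subst Di) auto
  qed (use m p in auto)
  then show ?thesis by (subst (asm) Di) auto
qed

text \<open>Jensen on each set bounds the \<open>p\<close>-th power of the functional by
  \<open>A\<close> times the integral of \<open>|u| powr p\<close> over that set. Disjointness adds
  these up to the full \<open>L^p\<close> norm, which \<open>C\<close> compares with
  \<open>N\<close>.\<close>

lemma region_functionals:
  fixes S :: "nat \<Rightarrow> 'n pt set" and a m :: "nat \<Rightarrow> real"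
  assumes S: "\<And>i. S i \<in> sets borel" "disjoint_family S" and m: "\<And>i. emeasure (mu M) (S i) \<le> ennreal (m i)" "\<And>i. m i > 0"
    and a: "\<And>i. \<bar>a i\<bar> powr p * m i powr (p - 1) \<le> A"
    and C: "C > 0" "\<And>u. u \<in> E \<Longrightarrow> LP (rep_aefun u) \<le> C * N u"
  shows "almost_orthogonal_functionals E N (\<lambda>i u. a i * region_integral (S i) u) p (A * C powr p)"
proof (intro almost_orthogonal_functionals.intro almost_orthogonal_functionals_axioms.intro normed_E p0)
  fix i
  show "linear_fun_on E (\<lambda>u. a i * region_integral (S i) u)"
    using region_integral_linear[OF S(1) m(1), of i] unfolding linear_fun_on_def by (simp add: distrib_left)
next
  fix I u assume I: "finite (I :: nat set)" and u: "u \<in> E"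
  have A: "A \<ge> 0" using a[of 0] by (rule order_trans[rotated]) simp
  have [measurable]: "S i \<in> sets borel" for i by (rule S)
  have "ennreal (\<Sum>i\<in>I. \<bar>a i * region_integral (S i) u\<bar> powr p) = (\<Sum>i\<in>I. ennreal (\<bar>a i * region_integral (S i) u\<bar> powr p))"
    by (rule sum_ennreal[symmetric]) simp
  also have "\<dots> \<le> (\<Sum>i\<in>I. ennreal A * (\<integral>\<^sup>+x\<in>S i. ennreal (\<bar>rep_aefun u x\<bar> powr p) \<partial>mu M))"
  proof (rule sum_mono)
    fix i
    have "ennreal (\<bar>a i * region_integral (S i) u\<bar> powr p) = ennreal (\<bar>a i\<bar> powr p) * ennreal (\<bar>region_integral (S i) u\<bar> powr p)"
      by (simp add: abs_mult powr_mult ennreal_mult)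
    also have "\<dots> \<le> ennreal (\<bar>a i\<bar> powr p) * (ennreal (m i powr (p - 1)) * (\<integral>\<^sup>+x\<in>S i. ennreal (\<bar>rep_aefun u x\<bar> powr p) \<partial>mu M))"
      by (intro mult_left_mono region_integral_bound S m u) auto
    also have "\<dots> = ennreal (\<bar>a i\<bar> powr p * m i powr (p - 1)) * (\<integral>\<^sup>+x\<in>S i. ennreal (\<bar>rep_aefun u x\<bar> powr p) \<partial>mu M)"
      by (simp add: ennreal_mult mult.assoc)
    also have "\<dots> \<le> ennreal A * (\<integral>\<^sup>+x\<in>S i. ennreal (\<bar>rep_aefun u x\<bar> powr p) \<partial>mu M)"
      by (intro mult_right_mono ennreal_leI a) auto
    finally show "ennreal (\<bar>a i * region_integral (S i) u\<bar> powr p) \<le> ennreal A * (\<integral>\<^sup>+x\<in>S i. ennreal (\<bar>rep_aefun u x\<bar> powr p) \<partial>mu M)" .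
  qed
  also have "\<dots> = ennreal A * (\<integral>\<^sup>+x. (\<Sum>i\<in>I. ennreal (\<bar>rep_aefun u x\<bar> powr p) * indicator (S i) x) \<partial>mu M)"
    by (subst nn_integral_sum) (auto simp: sum_distrib_left borel_mu)
  also have "\<dots> \<le> ennreal A * (\<integral>\<^sup>+x. ennreal (norm (rep_aefun u x) powr p) \<partial>mu M)"
  proof (intro mult_left_mono nn_integral_mono)
    fix x
    have "(\<Sum>i\<in>I. indicator (S i) x :: ennreal) = indicator (\<Union>i\<in>I. S i) x"
      using S(2) I by (intro indicator_UN_disjoint[symmetric]) (auto simp: disjoint_family_on_def)
    then have "(\<Sum>i\<in>I. ennreal (\<bar>rep_aefun u x\<bar> powr p) * indicator (S i) x) = ennreal (\<bar>rep_aefun u x\<bar> powr p) * indicator (\<Union>i\<in>I. S i) x"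
      by (simp add: sum_distrib_left[symmetric])
    also have "\<dots> \<le> ennreal (norm (rep_aefun u x) powr p)" by (auto split: split_indicator)
    finally show "(\<Sum>i\<in>I. ennreal (\<bar>rep_aefun u x\<bar> powr p) * indicator (S i) x) \<le> ennreal (norm (rep_aefun u x) powr p)" .
  qed auto
  also have "\<dots> = ennreal (A * LP (rep_aefun u) powr p)"
    using A by (simp add: Lnorm_nn[OF E_rep[OF u] p0, simplified] ennreal_mult)
  also have "\<dots> \<le> ennreal (A * (C * N u) powr p)"
    using A C(2)[OF u] p by (intro ennreal_leI mult_left_mono powr_mono2) auto
  finally have "(\<Sum>i\<in>I. \<bar>a i * region_integral (S i) u\<bar> powr p) \<le> A * (C * N u) powr p"
    using A by (simp add: ennreal_le_iff)
  then show "(\<Sum>i\<in>I. \<bar>a i * region_integral (S i) u\<bar> powr p) \<le> A * C powr p * N u powr p"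
    by (simp add: powr_mult mult.assoc)
qed

end

text \<open>The continuous embedding into the \<open>L^q\<close> space of \<open>muK\<close> is an
  assumption of the locale; \<open>Gamma_embedding\<close> provides it.\<close>

locale corner_embedding = corner_bump X \<delta> p M for X :: "(real ^ 'n::finite) set" and \<delta> p M +
  fixes q CK :: real
  assumes q: "q > p" and CK: "CK > 0"
    and embed: "u \<in> E \<Longrightarrow> Lfin (muK p M) q (rep_aefun u) \<and> Lnorm (muK p M) q (rep_aefun u) \<le> CK * N u"
begin

definition KK :: "'n pt aefun \<Rightarrow> real" where
  "KK u = Lnorm (muK p M) q (rep_aefun u)"

lemma q0: "q > 0" "q \<ge> 1"
  using q p by auto

lemma seminorm_KK: "seminorm_on E N KK CK"
proof
  show "0 \<le> KK u" for u unfolding KK_def by simp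
  show "KK (c *\<^sub>R u) = \<bar>c\<bar> * KK u" if u: "u \<in> E" for u c
  proof -
    have "KK (c *\<^sub>R u) = Lnorm (muK p M) q (\<lambda>x. c *\<^sub>R rep_aefun u x)"
      unfolding KK_def by (rule Lnorm_cong) (use AE_muK[OF rep_scale_mu[of c u]] in eventually_elim, simp)
    then show ?thesis using Lnorm_scale(2)[of "muK p M" q "rep_aefun u" c] embed[OF u] q0 unfolding KK_def by simp
  qed
  show "KK (u + v) \<le> KK u + KK v" if u: "u \<in> E" and v: "v \<in> E" for u v
  proof -
    have "AE x in muK p M. norm (rep_aefun (u + v) x) \<le> norm (rep_aefun u x) + norm (rep_aefun v x)"
      using AE_muK[OF rep_add_mu[of u v]] by eventually_elim (simp add: abs_triangle_ineq)
    from Lnorm_tri_AE(2)[OF _ _ q0(2) _ this] embed[OF u] embed[OF v] show ?thesis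
      unfolding KK_def by (simp add: borel_muK)
  qed
  show "KK u \<le> CK * N u" if "u \<in> E" for u using embed[OF that] unfolding KK_def by simp
  show "0 < CK" by (rule CK)
qed

lemma energy_KK:
  assumes u: "u \<in> E"
  shows "energy M p q lam u = ereal (N u powr p / p - lam / q * KK u powr q)"
proof -
  have "(\<integral>\<^sup>+x. ennreal (norm (rep_aefun u x) powr q) \<partial>muK p M) = ennreal (KK u powr q)"
    unfolding KK_def using embed[OF u] q0 by (intro Lnorm_nn) auto
  then show ?thesis unfolding energy_eq[OF u] by simp
qed

end

sublocale corner_embedding \<subseteq> seminorm_on E N KK CK
  by (rule seminorm_KK)

section \<open>Cells adapted to the corner vector fields and the local estimate\<close>

text \<open>A convex set of size about \<open>r\<close> for the fields x1 d1, x1 x2 d2, d' near the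
  point with x1 = \<open>l1\<close>, x2 = \<open>l2\<close>. Its extents are of order r l1, r l1 l2
  and r, which explains the volume r^(n+2) l1^2 l2 up to constants, and x1 and x2 vary by at most a
  factor 2.\<close>

definition cell :: "real \<Rightarrow> real \<Rightarrow> real \<Rightarrow> real \<Rightarrow> real \<Rightarrow> 'n::finite pt set \<Rightarrow> bool" where
  "cell \<delta> r l1 l2 V S \<longleftrightarrow>
     0 < l1 \<and> l1 \<le> \<delta> \<and> 0 < l2 \<and> l2 \<le> \<delta> \<and> S \<in> sets borel \<and> convex S \<and> emeasure lborel S = ennreal V \<and>
     r ^ (CARD('n) + 2) * (l1\<^sup>2 * l2) / \<delta> \<le> V \<and>
     V \<le> 2 / \<delta> * (r ^ (CARD('n) + 2) * (l1\<^sup>2 * l2)) \<and>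
     (\<forall>x\<in>S. l1 \<le> fst x \<and> fst x \<le> 2 * l1 \<and> l2 \<le> fst (snd x) \<and> fst (snd x) \<le> 2 * l2) \<and>
     (\<forall>x\<in>S. \<forall>y\<in>S. \<bar>fst x - fst y\<bar> \<le> r * l1 \<and> \<bar>fst (snd x) - fst (snd y)\<bar> \<le> 2 / \<delta> * r * (l1 * l2) \<and>
        norm (snd (snd x) - snd (snd y)) \<le> r * CARD('n))"

text \<open>The powers of \<open>l1\<close> and \<open>l2\<close> combine to
  \<open>l1 powr (p + 1 - q / p) * l2 powr p\<close>. Both exponents are nonnegative because
  \<open>q <= p * (p + 1)\<close>, so the constant stays bounded for cells close to the faces x1 = 0
  and x2 = 0.\<close>

lemma cell_constant_bound:
  fixes p q \<delta> r l1 l2 V Ei c0 Cs :: real and n :: nat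
  assumes p: "p > 1" "q > p" "q \<le> p * (p + 1)" and \<delta>: "\<delta> > 0" and r: "0 < r" and l: "0 < l1" "l1 \<le> \<delta>" "0 < l2" "l2 \<le> \<delta>"
    and V: "r ^ n * (l1\<^sup>2 * l2) / \<delta> \<le> V" and E: "Ei \<ge> 0" and c: "c0 \<ge> 0" "Cs \<ge> 0"
  shows "(4 * l1 * l2) powr (p - 1) * (4 powr q * (Cs * (V powr (1 - q / p) * ((r * c0) powr p * (4 * l1 * l2) * Ei) powr (q / p))))
    \<le> 4 powr (p - 1 + q / p) * 4 powr q * Cs * c0 powr q * (1 / \<delta>) powr (1 - q / p) * \<delta> powr (p + 1 - q / p) * \<delta> powr p
      * r powr (q + real n - real n * q / p) * Ei powr (q / p)"
proof -
  have e: "1 - q / p \<le> 0" using p by simp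
  have "0 < r ^ n * (l1\<^sup>2 * l2) / \<delta>" using r l \<delta> by simp
  then have "V powr (1 - q / p) \<le> (r ^ n * (l1\<^sup>2 * l2) / \<delta>) powr (1 - q / p)"
    using V e by (intro powr_mono2') auto
  also have "\<dots> = r powr (real n * (1 - q / p)) * (l1 powr (2 * (1 - q / p)) * l2 powr (1 - q / p)) * (1 / \<delta>) powr (1 - q / p)"
  proof -
    have "r ^ n * (l1\<^sup>2 * l2) / \<delta> = (r powr real n * (l1 powr 2 * l2)) * (1 / \<delta>)"
      using r l by (simp add: powr_realpow)
    then show ?thesis by (simp only: powr_mult powr_powr)
  qed
  finally have Vb: "V powr (1 - q / p) \<le> r powr (real n * (1 - q / p)) * (l1 powr (2 * (1 - q / p)) * l2 powr (1 - q / p)) * (1 / \<delta>) powr (1 - q / p)" .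
  have Ib: "((r * c0) powr p * (4 * l1 * l2) * Ei) powr (q / p) = r powr q * c0 powr q * 4 powr (q / p) * (l1 powr (q / p) * l2 powr (q / p)) * Ei powr (q / p)"
    using p r l c E by (simp add: powr_mult powr_powr)
  have Lb: "(4 * l1 * l2) powr (p - 1) = 4 powr (p - 1) * (l1 powr (p - 1) * l2 powr (p - 1))"
    using l by (simp add: powr_mult)
  have "(4 * l1 * l2) powr (p - 1) * (4 powr q * (Cs * (V powr (1 - q / p) * ((r * c0) powr p * (4 * l1 * l2) * Ei) powr (q / p))))
    \<le> (4 * l1 * l2) powr (p - 1) * (4 powr q * (Cs * ((r powr (real n * (1 - q / p)) * (l1 powr (2 * (1 - q / p)) * l2 powr (1 - q / p)) * (1 / \<delta>) powr (1 - q / p)) * ((r * c0) powr p * (4 * l1 * l2) * Ei) powr (q / p))))"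
    using c by (intro mult_left_mono mult_right_mono Vb) auto
  also have "\<dots> = (4 powr (p - 1) * 4 powr (q / p)) * 4 powr q * Cs * c0 powr q * (1 / \<delta>) powr (1 - q / p) *
      (l1 powr (p - 1) * l1 powr (2 * (1 - q / p)) * l1 powr (q / p)) * (l2 powr (p - 1) * l2 powr (1 - q / p) * l2 powr (q / p))
      * (r powr q * r powr (real n * (1 - q / p))) * Ei powr (q / p)"
    unfolding Ib Lb by (simp only: ac_simps)
  also have "l1 powr (p - 1) * l1 powr (2 * (1 - q / p)) * l1 powr (q / p) = l1 powr (p + 1 - q / p)"
    by (simp add: powr_add[symmetric] algebra_simps)
  also have "l2 powr (p - 1) * l2 powr (1 - q / p) * l2 powr (q / p) = l2 powr p"
    by (simp add: powr_add[symmetric])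
  also have "4 powr (p - 1) * 4 powr (q / p) = 4 powr (p - 1 + q / p)" by (simp add: powr_add[symmetric])
  also have "r powr q * r powr (real n * (1 - q / p)) = r powr (q + real n - real n * q / p)"
    by (simp add: powr_add[symmetric] algebra_simps)
  also have "4 powr (p - 1 + q / p) * 4 powr q * Cs * c0 powr q * (1 / \<delta>) powr (1 - q / p) * l1 powr (p + 1 - q / p) * l2 powr p
      * r powr (q + real n - real n * q / p) * Ei powr (q / p)
    \<le> 4 powr (p - 1 + q / p) * 4 powr q * Cs * c0 powr q * (1 / \<delta>) powr (1 - q / p) * \<delta> powr (p + 1 - q / p) * \<delta> powr p
      * r powr (q + real n - real n * q / p) * Ei powr (q / p)"
  proof -
    have "q / p \<le> p + 1" using p by (simp add: divide_le_eq mult.commute)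
    then have "l1 powr (p + 1 - q / p) \<le> \<delta> powr (p + 1 - q / p)" "l2 powr p \<le> \<delta> powr p"
      using l p by (auto intro!: powr_mono2)
    then show ?thesis using c by (intro mult_right_mono mult_mono) auto
  qed
  finally show ?thesis .
qed

context corner_bump
begin

text \<open>The test function is split into its weighted mean \<open>c\<close> over the cell and the
  oscillation. The oscillation is handled by \<open>sobolev_poincare_average\<close> and gains a
  power of \<open>r\<close>; the mean contributes its \<open>q\<close>-th power times a bound for
  the mass of the cell.\<close>

lemma cell_estimate:
  fixes q :: real
  defines "n \<equiv> CARD('n) + 2"
  defines "k \<equiv> real n * (1 / p - 1 / q)"
  defines "c0 \<equiv> 1 + 2 / \<delta> + real CARD('n)"
  defines "Cs \<equiv> (1 / (1 - k)) powr q * 2 ^ n"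
  assumes q: "p < q" "q \<le> p * (p + 1)" "k < 1" and r: "0 < r" "r \<le> 1"
    and S: "cell \<delta> r l1 l2 V (S :: 'n pt set)" and \<phi>: "\<phi> \<in> test_functions M"
    and m: "(\<integral>\<^sup>+x\<in>S. ennreal (1 / (fst x * fst (snd x))) \<partial>lborel) = ennreal m" "V / (4 * l1 * l2) \<le> m"
    and Ei: "(\<integral>\<^sup>+x\<in>S. ennreal (norm (scaled x (gradient \<phi> x)) powr p) \<partial>mu M) \<le> ennreal Ei" "Ei \<ge> 0"
    and c: "c = (\<integral>x. indicator S x * \<phi> x \<partial>mu M) / m"
  shows "(\<integral>\<^sup>+x\<in>S. ennreal (\<bar>\<phi> x\<bar> powr q) \<partial>muK p M) \<le>
    ennreal (2 powr q * (4 powr (p - 1 + q / p) * 4 powr q * Cs * c0 powr q * (1 / \<delta>) powr (1 - q / p) * \<delta> powr (p + 1 - q / p) * \<delta> powr p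
      * r powr (q + real n - real n * q / p) * Ei powr (q / p) + (4 * l1 * l2) powr (p - 1) * V * \<bar>c\<bar> powr q))"
proof -
  have l: "0 < l1" "l1 \<le> \<delta>" "0 < l2" "l2 \<le> \<delta>" and S_meas[measurable]: "S \<in> sets borel" and conv: "convex S"
    and V: "emeasure lborel S = ennreal V" and Vl: "r ^ n * (l1\<^sup>2 * l2) / \<delta> \<le> V"
    and Sx: "\<And>x. x \<in> S \<Longrightarrow> l1 \<le> fst x \<and> fst x \<le> 2 * l1 \<and> l2 \<le> fst (snd x) \<and> fst (snd x) \<le> 2 * l2"
    and Sd: "\<And>x y. x \<in> S \<Longrightarrow> y \<in> S \<Longrightarrow> \<bar>fst x - fst y\<bar> \<le> r * l1 \<and> \<bar>fst (snd x) - fst (snd y)\<bar> \<le> 2 / \<delta> * r * (l1 * l2) \<and>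
        norm (snd (snd x) - snd (snd y)) \<le> r * CARD('n)"
    using S unfolding cell_def n_def by auto
  have "0 < r ^ n * (l1\<^sup>2 * l2) / \<delta>" using r l \<delta> by simp
  then have V0: "V > 0" using Vl by linarith
  have m0: "m > 0" using m(2) V0 l by (smt (verit) divide_pos_pos mult_pos_pos)
  have c0: "c0 \<ge> 0" unfolding c0_def using \<delta> by simp
  have Cs0: "Cs \<ge> 0" unfolding Cs_def by simp
  from \<phi> obtain K where K: "smooth \<phi>" "compact K" "K \<subseteq> M" "\<And>x. x \<notin> K \<Longrightarrow> \<phi> x = 0"
    "\<And>x v. x \<notin> K \<Longrightarrow> frechet_derivative \<phi> (at x) v = 0"
    by (rule test_functionsD) blast
  have [measurable]: "\<phi> \<in> borel_measurable borel" by (rule smooth_measurable[OF K(1)])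
  define Dg where "Dg z = norm (scaled z (gradient \<phi> z))" for z
  have Dgc: "continuous_on A Dg" for A unfolding Dg_def by (intro continuous_intros scaled_gradient_continuous K)
  have [measurable]: "Dg \<in> borel_measurable borel" by (rule borel_measurable_continuous_onI[OF Dgc])
  have Dg0: "Dg z = 0" if "z \<notin> K" for z unfolding Dg_def gradient_def using K(5)[OF that] by simp
  obtain B where B: "\<And>z. Dg z \<le> B"
  proof -
    have "bounded (Dg ` K)" by (intro compact_imp_bounded compact_continuous_image Dgc K)
    then obtain b where "b > 0" "\<forall>y\<in>Dg ` K. norm y \<le> b" unfolding bounded_pos by auto
    then have "Dg z \<le> b" for z using Dg0[of z] by (cases "z \<in> K") force+
    then show ?thesis using that by blast
  qed
  \<comment> \<open>Bounds the derivative along every chord of the cell. The components of a chord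
    are of the same order as \<open>r\<close> times the coefficients in \<open>scaled\<close>, so
    \<open>r * c0\<close> times the corner gradient suffices.\<close>
  define D where "D z = indicator S z * (r * c0 * Dg z)" for z
  have [measurable]: "D \<in> borel_measurable borel" unfolding D_def by measurable
  have D0: "D z \<ge> 0" for z unfolding D_def Dg_def using r c0 by simp
  have DB: "D z \<le> r * c0 * \<bar>B\<bar>" for z
  proof -
    have "r * c0 * Dg z \<le> r * c0 * \<bar>B\<bar>" using B[of z] r c0 by (intro mult_left_mono) auto
    then show ?thesis unfolding D_def using r c0 by (auto split: split_indicator)
  qed
  have deriv: "\<bar>frechet_derivative \<phi> (at z) (y - x)\<bar> \<le> D z" if x: "x \<in> S" and y: "y \<in> S" and z: "z \<in> S" for x y z
  proof -
    define g where "g = gradient \<phi> z"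
    define v where "v = y - x"
    have "frechet_derivative \<phi> (at z) v = (\<Sum>b\<in>Basis. frechet_derivative \<phi> (at z) ((v \<bullet> b) *\<^sub>R b))"
      using linear_sum[OF linear_frechet_derivative[OF smooth_differentiable[OF K(1), of z]], where g = "\<lambda>b. (v \<bullet> b) *\<^sub>R b" and S = Basis]
      by (simp add: euclidean_representation)
    also have "\<dots> = (\<Sum>b\<in>Basis. (v \<bullet> b) * (g \<bullet> b))"
      using linear_scale[OF linear_frechet_derivative[OF smooth_differentiable[OF K(1)]]]
      by (intro sum.cong) (auto simp: g_def gradient_inner)
    also have "\<dots> = v \<bullet> g" by (rule euclidean_inner[symmetric])
    also have "\<dots> = fst v * fst g + fst (snd v) * fst (snd g) + snd (snd v) \<bullet> snd (snd g)"
      by (simp add: inner_prod_def)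
    finally have "\<bar>frechet_derivative \<phi> (at z) v\<bar> \<le> \<bar>fst v\<bar> * \<bar>fst g\<bar> + \<bar>fst (snd v)\<bar> * \<bar>fst (snd g)\<bar> + norm (snd (snd v)) * norm (snd (snd g))"
      using Cauchy_Schwarz_ineq2[of "snd (snd v)" "snd (snd g)"] by (simp add: abs_mult[symmetric])
    also have "\<dots> \<le> r * Dg z + 2 / \<delta> * r * Dg z + r * CARD('n) * Dg z"
    proof (intro add_mono)
      have zz: "l1 \<le> fst z" "l2 \<le> fst (snd z)" using Sx[OF z] by auto
      have sc: "scaled z g = (fst z * fst g, fst z * fst (snd z) * fst (snd g), snd (snd g))" by (rule scaled_def)
      have n1: "fst z * \<bar>fst g\<bar> \<le> Dg z"
        using norm_fst_le[of "fst z * fst g" "(fst z * fst (snd z) * fst (snd g), snd (snd g))"] zz l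
        unfolding Dg_def g_def[symmetric] sc by (simp add: abs_mult)
      have n23: "norm (fst z * fst (snd z) * fst (snd g), snd (snd g)) \<le> Dg z"
        using norm_snd_le[of "(fst z * fst (snd z) * fst (snd g), snd (snd g))" "fst z * fst g"]
        unfolding Dg_def g_def[symmetric] sc by simp
      have n2: "fst z * fst (snd z) * \<bar>fst (snd g)\<bar> \<le> Dg z"
        using order_trans[OF norm_fst_le n23] zz l by (simp add: abs_mult)
      have n3: "norm (snd (snd g)) \<le> Dg z" using order_trans[OF norm_snd_le n23] .
      have dv: "\<bar>fst v\<bar> \<le> r * l1" "\<bar>fst (snd v)\<bar> \<le> 2 / \<delta> * r * (l1 * l2)" "norm (snd (snd v)) \<le> r * CARD('n)"
        using Sd[OF y x] unfolding v_def by auto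
      have "\<bar>fst v\<bar> * \<bar>fst g\<bar> \<le> (r * l1) * \<bar>fst g\<bar>" using dv by (intro mult_right_mono) auto
      also have "\<dots> \<le> (r * fst z) * \<bar>fst g\<bar>" using zz r by (intro mult_right_mono mult_left_mono) auto
      also have "\<dots> \<le> r * Dg z" using n1 r by (simp add: mult.assoc mult_left_mono)
      finally show "\<bar>fst v\<bar> * \<bar>fst g\<bar> \<le> r * Dg z" .
      have "\<bar>fst (snd v)\<bar> * \<bar>fst (snd g)\<bar> \<le> (2 / \<delta> * r * (l1 * l2)) * \<bar>fst (snd g)\<bar>" using dv by (intro mult_right_mono) auto
      also have "\<dots> \<le> (2 / \<delta> * r * (fst z * fst (snd z))) * \<bar>fst (snd g)\<bar>"
        using zz r l \<delta> by (intro mult_right_mono mult_left_mono mult_mono) auto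
      also have "\<dots> = 2 / \<delta> * r * (fst z * fst (snd z) * \<bar>fst (snd g)\<bar>)" by simp
      also have "\<dots> \<le> 2 / \<delta> * r * Dg z" using n2 r \<delta> by (intro mult_left_mono) auto
      finally show "\<bar>fst (snd v)\<bar> * \<bar>fst (snd g)\<bar> \<le> 2 / \<delta> * r * Dg z" .
      show "norm (snd (snd v)) * norm (snd (snd g)) \<le> r * CARD('n) * Dg z"
        using dv n3 r by (intro mult_mono) auto
    qed
    also have "\<dots> = D z" unfolding D_def c0_def using z by (simp add: algebra_simps)
    finally show ?thesis unfolding v_def .
  qed
  have seg: "x + t *\<^sub>R (y - x) \<in> S" if "x \<in> S" "y \<in> S" "t \<in> {0<..<1}" for x y t
  proof -
    have "(1 - t) *\<^sub>R x + t *\<^sub>R y \<in> S" using conv that unfolding convex_alt by auto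
    then show ?thesis by (simp add: algebra_simps)
  qed
  have incr: "ennreal \<bar>\<phi> y - \<phi> x\<bar> \<le> (\<integral>\<^sup>+t\<in>{0<..<1}. ennreal (D (x + t *\<^sub>R (y - x))) \<partial>lborel)"
    if x: "x \<in> S" and y: "y \<in> S" for x y
  proof -
    have "ennreal \<bar>\<phi> (x + (y - x)) - \<phi> x\<bar> \<le> (\<integral>\<^sup>+t\<in>{0<..<1}. ennreal \<bar>frechet_derivative \<phi> (at (x + t *\<^sub>R (y - x))) (y - x)\<bar> \<partial>lborel)"
      by (rule smooth_increment_le[OF K(1)])
    also have "\<dots> \<le> (\<integral>\<^sup>+t\<in>{0<..<1}. ennreal (D (x + t *\<^sub>R (y - x))) \<partial>lborel)"
      using deriv[OF x y seg[OF x y]] by (intro nn_integral_mono) (auto intro!: ennreal_leI split: split_indicator)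
    finally show ?thesis by simp
  qed
  have \<phi>M: "\<phi> x = 0" if "x \<notin> M" for x using K(3,4) that by blast
  \<comment> \<open>On a cell x1 and x2 vary by at most a factor 2 each, hence \<open>w\<close> by
    at most a factor 4.\<close>
  define w where "w x = 1 / (fst x * fst (snd x))" for x :: "'n pt"
  have [measurable]: "w \<in> borel_measurable borel" unfolding w_def by measurable
  have w_up: "w x \<le> 1 / (l1 * l2)" and w_low: "1 / (4 * l1 * l2) \<le> w x" and w0: "w x \<ge> 0" if x: "x \<in> S" for x
  proof -
    note xx = Sx[OF x]
    show "w x \<le> 1 / (l1 * l2)" unfolding w_def using xx l by (intro divide_left_mono mult_mono mult_pos_pos) auto
    have "fst x * fst (snd x) \<le> (2 * l1) * (2 * l2)" using xx l by (intro mult_mono) auto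
    then show "1 / (4 * l1 * l2) \<le> w x" unfolding w_def using xx l by (intro divide_left_mono mult_pos_pos) auto
    show "w x \<ge> 0" unfolding w_def using xx l by simp
  qed
  have wm: "(\<integral>\<^sup>+x. ennreal (indicator S x * w x) \<partial>lborel) = ennreal m"
    unfolding m(1)[symmetric] w_def by (intro nn_integral_cong) (simp split: split_indicator)
  have wi: "integrable lborel (\<lambda>x. indicator S x * w x)"
    using wm w0 by (intro integrableI_nn_integral_finite[where x = m]) (auto simp: m0 less_imp_le split: split_indicator)
  have wint: "(\<integral>x. indicator S x * w x \<partial>lborel) = m"
    using wm w0 m0 by (intro integral_eq_nn_integral[THEN trans]) (auto split: split_indicator)
  obtain Pb where Pb: "\<And>x. \<bar>\<phi> x\<bar> \<le> Pb"
  proof -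
    have "bounded (\<phi> ` K)" by (intro compact_imp_bounded compact_continuous_image smooth_continuous K)
    then obtain b where "b > 0" "\<forall>y\<in>\<phi> ` K. norm y \<le> b" unfolding bounded_pos by auto
    then have "\<bar>\<phi> z\<bar> \<le> b" for z using K(4)[of z] by (cases "z \<in> K") force+
    then show ?thesis using that by blast
  qed
  have w\<phi>: "integrable lborel (\<lambda>x. indicator S x * w x * \<phi> x)"
  proof (rule Bochner_Integration.integrable_bound)
    show "integrable lborel (\<lambda>x. indicator S x * w x * Pb)" using wi by simp
    show "AE x in lborel. norm (indicator S x * w x * \<phi> x) \<le> norm (indicator S x * w x * Pb)"
    proof (rule AE_I2)
      fix x
      have "\<bar>\<phi> x\<bar> \<le> \<bar>Pb\<bar>" using Pb[of x] by simp
      then show "norm (indicator S x * w x * \<phi> x) \<le> norm (indicator S x * w x * Pb)"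
        by (simp add: abs_mult mult_left_mono)
    qed
  qed measurable
  \<comment> \<open>The mass \<open>m\<close> also counts the part of the cell outside
    \<open>M\<close>, where the test function is 0; so \<open>c\<close> is a weighted mean over the
    whole convex cell.\<close>
  have cm: "(\<integral>x. indicator S x * w x * \<phi> x \<partial>lborel) = c * m"
  proof -
    have "(\<integral>x. indicator S x * \<phi> x \<partial>mu M) = (\<integral>x. indicator M x / (fst x * fst (snd x)) * (indicator S x * \<phi> x) \<partial>lborel)"
      unfolding mu_def by (subst integral_density) (auto simp: M_iff split: split_indicator)
    also have "\<dots> = (\<integral>x. indicator S x * w x * \<phi> x \<partial>lborel)"
    proof (rule Bochner_Integration.integral_cong[OF refl])
      fix x
      show "indicator M x / (fst x * fst (snd x)) * (indicator S x * \<phi> x) = indicator S x * w x * \<phi> x"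
        using \<phi>M[of x] unfolding w_def by (cases "x \<in> M") auto
    qed
    finally show ?thesis unfolding c using m0 by simp
  qed
  \<comment> \<open>The factor 4 pays for the weight in the mean: \<open>w\<close> is at most
    \<open>1 / (l1 * l2)\<close>, while \<open>m\<close> is at least
    \<open>V / (4 * l1 * l2)\<close>.\<close>
  define g where "g x = \<bar>\<phi> x - c\<bar> / 4" for x
  have gS: "ennreal (V * g x) \<le> (\<integral>\<^sup>+y\<in>S. (\<integral>\<^sup>+t\<in>{0<..<1}. ennreal (D (x + t *\<^sub>R (y - x))) \<partial>lborel) \<partial>lborel)" if x: "x \<in> S" for x
  proof -
    have i: "integrable lborel (\<lambda>y. indicator S y * w y * \<phi> x - indicator S y * w y * \<phi> y)"
      using wi w\<phi> by simp
    have "m * (\<phi> x - c) = (\<integral>y. indicator S y * w y * \<phi> x - indicator S y * w y * \<phi> y \<partial>lborel)"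
      using wi w\<phi> cm wint by (simp add: algebra_simps)
    from this[symmetric] have "ennreal (m * \<bar>\<phi> x - c\<bar>) \<le> (\<integral>\<^sup>+y. ennreal (norm (indicator S y * w y * \<phi> x - indicator S y * w y * \<phi> y)) \<partial>lborel)"
      using integral_norm_bound_ennreal[OF i] m0 by (simp add: abs_mult)
    also have "\<dots> \<le> (\<integral>\<^sup>+y. ennreal (1 / (l1 * l2)) * (ennreal \<bar>\<phi> y - \<phi> x\<bar> * indicator S y) \<partial>lborel)"
    proof (rule nn_integral_mono)
      fix y
      show "ennreal (norm (indicator S y * w y * \<phi> x - indicator S y * w y * \<phi> y)) \<le> ennreal (1 / (l1 * l2)) * (ennreal \<bar>\<phi> y - \<phi> x\<bar> * indicator S y)"
      proof (cases "y \<in> S")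
        case True
        have "norm (w y * \<phi> x - w y * \<phi> y) = w y * \<bar>\<phi> y - \<phi> x\<bar>"
          using w0[OF True] by (simp add: right_diff_distrib[symmetric] abs_mult abs_minus_commute)
        also have "\<dots> \<le> 1 / (l1 * l2) * \<bar>\<phi> y - \<phi> x\<bar>" using w_up[OF True] by (intro mult_right_mono) auto
        finally show ?thesis using True l by (simp add: ennreal_mult[symmetric] ennreal_leI)
      qed simp
    qed
    also have "\<dots> = ennreal (1 / (l1 * l2)) * (\<integral>\<^sup>+y\<in>S. ennreal \<bar>\<phi> y - \<phi> x\<bar> \<partial>lborel)"
      by (rule nn_integral_cmult) measurable
    finally have 1: "ennreal (m * \<bar>\<phi> x - c\<bar>) \<le> ennreal (1 / (l1 * l2)) * (\<integral>\<^sup>+y\<in>S. ennreal \<bar>\<phi> y - \<phi> x\<bar> \<partial>lborel)" .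
    have "V / (4 * l1 * l2) * \<bar>\<phi> x - c\<bar> \<le> m * \<bar>\<phi> x - c\<bar>" using m(2) by (intro mult_right_mono) auto
    then have "l1 * l2 * (V / (4 * l1 * l2) * \<bar>\<phi> x - c\<bar>) \<le> l1 * l2 * (m * \<bar>\<phi> x - c\<bar>)"
      using l by (intro mult_left_mono) auto
    moreover have "l1 * l2 * (V / (4 * l1 * l2) * \<bar>\<phi> x - c\<bar>) = V * g x" unfolding g_def using l by simp
    ultimately have "V * g x \<le> l1 * l2 * (m * \<bar>\<phi> x - c\<bar>)" by metis
    then have "ennreal (V * g x) \<le> ennreal (l1 * l2 * (m * \<bar>\<phi> x - c\<bar>))" by (rule ennreal_leI)
    also have "\<dots> = ennreal (l1 * l2) * ennreal (m * \<bar>\<phi> x - c\<bar>)" using l m0 by (intro ennreal_mult) auto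
    finally have "ennreal (V * g x) \<le> ennreal (l1 * l2) * ennreal (m * \<bar>\<phi> x - c\<bar>)" .
    also have "\<dots> \<le> ennreal (l1 * l2) * (ennreal (1 / (l1 * l2)) * (\<integral>\<^sup>+y\<in>S. ennreal \<bar>\<phi> y - \<phi> x\<bar> \<partial>lborel))"
      by (intro mult_left_mono 1) auto
    also have "\<dots> = (\<integral>\<^sup>+y\<in>S. ennreal \<bar>\<phi> y - \<phi> x\<bar> \<partial>lborel)"
      using l by (simp add: mult.assoc[symmetric] ennreal_mult[symmetric])
    also have "\<dots> \<le> (\<integral>\<^sup>+y\<in>S. (\<integral>\<^sup>+t\<in>{0<..<1}. ennreal (D (x + t *\<^sub>R (y - x))) \<partial>lborel) \<partial>lborel)"
      using incr[OF x] by (intro nn_integral_mono) (auto split: split_indicator)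
    finally show ?thesis .
  qed
  define I where "I = (r * c0) powr p * (4 * l1 * l2) * Ei"
  have I0: "I \<ge> 0" unfolding I_def using l Ei by simp
  have DI: "(\<integral>\<^sup>+x. ennreal (D x powr p) \<partial>lborel) \<le> ennreal I"
  proof -
    have "(\<integral>\<^sup>+x. ennreal (D x powr p) \<partial>lborel)
      \<le> (\<integral>\<^sup>+x. ennreal ((r * c0) powr p * (4 * l1 * l2)) * (ennreal (indicator M x / (fst x * fst (snd x))) * (ennreal (norm (scaled x (gradient \<phi> x)) powr p) * indicator S x)) \<partial>lborel)"
    proof (rule nn_integral_mono)
      fix x
      show "ennreal (D x powr p) \<le> ennreal ((r * c0) powr p * (4 * l1 * l2)) * (ennreal (indicator M x / (fst x * fst (snd x))) * (ennreal (norm (scaled x (gradient \<phi> x)) powr p) * indicator S x))"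
      proof (cases "x \<in> S \<and> x \<in> M")
        case True
        have "D x powr p = (r * c0) powr p * (1 * Dg x powr p)"
          unfolding D_def using True r c0 by (simp add: powr_mult Dg_def)
        also have "\<dots> \<le> (r * c0) powr p * ((4 * l1 * l2 * w x) * Dg x powr p)"
        proof -
          have "1 \<le> 4 * l1 * l2 * w x" using w_low[of x] True l by (simp add: field_simps)
          then show ?thesis by (intro mult_left_mono mult_right_mono) auto
        qed
        also have "\<dots> = (r * c0) powr p * (4 * l1 * l2) * (w x * Dg x powr p)" by simp
        finally have "ennreal (D x powr p) \<le> ennreal ((r * c0) powr p * (4 * l1 * l2) * (w x * Dg x powr p))" by (rule ennreal_leI)
        also have "\<dots> = ennreal ((r * c0) powr p * (4 * l1 * l2)) * (ennreal (w x) * ennreal (Dg x powr p))"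
          using l w0[of x] True by (simp add: ennreal_mult)
        finally show ?thesis using True unfolding w_def Dg_def by simp
      next
        case False
        then have "D x = 0" using Dg0[of x] K(3) unfolding D_def by (auto split: split_indicator)
        then show ?thesis using p by simp
      qed
    qed
    also have "\<dots> = ennreal ((r * c0) powr p * (4 * l1 * l2)) * (\<integral>\<^sup>+x\<in>S. ennreal (norm (scaled x (gradient \<phi> x)) powr p) \<partial>mu M)"
    proof -
      have [measurable]: "(\<lambda>x. norm (scaled x (gradient \<phi> x))) \<in> borel_measurable borel"
        using \<open>Dg \<in> borel_measurable borel\<close> unfolding Dg_def[abs_def] .
      show ?thesis by (subst nn_integral_mu) (auto intro: nn_integral_cmult)
    qed
    also have "\<dots> \<le> ennreal ((r * c0) powr p * (4 * l1 * l2)) * ennreal Ei" by (intro mult_left_mono Ei) auto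
    also have "\<dots> = ennreal I" unfolding I_def using l Ei by (simp add: ennreal_mult[symmetric])
    finally show ?thesis .
  qed
  have dimn: "DIM('n pt) = n" unfolding n_def by simp
  have sob: "(\<integral>\<^sup>+x\<in>S. ennreal (g x powr q) \<partial>lborel) \<le> ennreal (Cs * (V powr (1 - q / p) * I powr (q / p)))"
  proof -
    have "(\<integral>\<^sup>+x\<in>S. ennreal (g x powr q) \<partial>lborel)
     \<le> ennreal ((1 / (1 - k)) powr q * 2 ^ DIM('n pt) * (V powr (1 - q / p) * I powr (q / p)))"
      by (rule sobolev_poincare_average[OF S_meas V V0 _ D0 DB _ q(1) _ q(3) DI I0 _ gS])
        (use p dimn in \<open>auto simp: k_def g_def\<close>)
    then show ?thesis unfolding dimn Cs_def .
  qed
  have "(\<integral>\<^sup>+x\<in>S. ennreal (\<bar>\<phi> x\<bar> powr q) \<partial>muK p M) \<le> (\<integral>\<^sup>+x. ennreal ((4 * l1 * l2) powr (p - 1) * 2 powr q) *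
      (ennreal (4 powr q) * (ennreal (g x powr q) * indicator S x) + ennreal (\<bar>c\<bar> powr q) * indicator S x) \<partial>lborel)"
  proof (subst nn_integral_muK, measurable, rule nn_integral_mono)
    fix x
    show "ennreal (indicator M x * (fst x * fst (snd x)) powr (p - 1)) * (ennreal (\<bar>\<phi> x\<bar> powr q) * indicator S x)
      \<le> ennreal ((4 * l1 * l2) powr (p - 1) * 2 powr q) *
      (ennreal (4 powr q) * (ennreal (g x powr q) * indicator S x) + ennreal (\<bar>c\<bar> powr q) * indicator S x)"
    proof (cases "x \<in> S \<and> x \<in> M")
      case True
      then have xx: "l1 \<le> fst x" "fst x \<le> 2 * l1" "l2 \<le> fst (snd x)" "fst (snd x) \<le> 2 * l2" using Sx by auto
      have "fst x * fst (snd x) \<le> (2 * l1) * (2 * l2)" using xx l by (intro mult_mono) auto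
      then have 1: "(fst x * fst (snd x)) powr (p - 1) \<le> (4 * l1 * l2) powr (p - 1)"
        using xx l p by (intro powr_mono2) auto
      have "\<bar>\<phi> x\<bar> powr q = norm ((\<phi> x - c) + c) powr q" by simp
      also have "\<dots> \<le> 2 powr q * (norm (\<phi> x - c) powr q + norm c powr q)" using q p by (intro norm_add_powr_le) auto
      also have "norm (\<phi> x - c) powr q = 4 powr q * g x powr q" unfolding g_def by (simp add: powr_divide)
      finally have 2: "\<bar>\<phi> x\<bar> powr q \<le> 2 powr q * (4 powr q * g x powr q + \<bar>c\<bar> powr q)" by simp
      have "(fst x * fst (snd x)) powr (p - 1) * \<bar>\<phi> x\<bar> powr q \<le> (4 * l1 * l2) powr (p - 1) * (2 powr q * (4 powr q * g x powr q + \<bar>c\<bar> powr q))"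
        by (intro mult_mono 1 2) auto
      then have "ennreal ((fst x * fst (snd x)) powr (p - 1) * \<bar>\<phi> x\<bar> powr q) \<le> ennreal ((4 * l1 * l2) powr (p - 1) * 2 powr q * (4 powr q * g x powr q + \<bar>c\<bar> powr q))"
        by (intro ennreal_leI) (simp add: mult.assoc)
      then show ?thesis using True by (simp add: ennreal_mult ennreal_plus)
    next
      case False
      then show ?thesis using \<phi>M[of x] q p by (auto split: split_indicator)
    qed
  qed
  also have "\<dots> = ennreal ((4 * l1 * l2) powr (p - 1) * 2 powr q) *
      (ennreal (4 powr q) * (\<integral>\<^sup>+x\<in>S. ennreal (g x powr q) \<partial>lborel) + ennreal (\<bar>c\<bar> powr q) * ennreal V)"
    unfolding V[symmetric] g_def
    by (subst nn_integral_cmult, measurable, subst nn_integral_add, measurable, subst nn_integral_cmult, measurable)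
       (simp add: nn_integral_cmult)
  also have "\<dots> \<le> ennreal ((4 * l1 * l2) powr (p - 1) * 2 powr q) *
      (ennreal (4 powr q) * ennreal (Cs * (V powr (1 - q / p) * I powr (q / p))) + ennreal (\<bar>c\<bar> powr q) * ennreal V)"
    by (intro mult_left_mono add_mono sob) auto
  also have "\<dots> = ennreal (2 powr q * ((4 * l1 * l2) powr (p - 1) * (4 powr q * (Cs * (V powr (1 - q / p) * I powr (q / p)))) + (4 * l1 * l2) powr (p - 1) * V * \<bar>c\<bar> powr q))"
    using Cs0 V0 by (simp add: ennreal_mult[symmetric] ennreal_plus[symmetric] algebra_simps del: ennreal_plus)
  also have "\<dots> \<le> ennreal (2 powr q * (4 powr (p - 1 + q / p) * 4 powr q * Cs * c0 powr q * (1 / \<delta>) powr (1 - q / p) * \<delta> powr (p + 1 - q / p) * \<delta> powr p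
      * r powr (q + real n - real n * q / p) * Ei powr (q / p) + (4 * l1 * l2) powr (p - 1) * V * \<bar>c\<bar> powr q))"
    unfolding I_def
    by (intro ennreal_leI mult_left_mono add_right_mono cell_constant_bound p q \<delta> r l Vl Ei c0 Cs0) auto
  finally show ?thesis .
qed

end

section \<open>A countable cell decomposition of the corner\<close>

lemma geometric_interval:
  fixes x \<delta> \<beta> :: real
  assumes "0 < x" "x < \<delta>" "\<beta> > 1"
  shows "\<exists>k::nat. \<delta> / \<beta> ^ Suc k \<le> x \<and> x < \<delta> / \<beta> ^ k"
proof -
  obtain n0 where "\<delta> / x < \<beta> ^ n0" using real_arch_pow[OF assms(3)] by blast
  then have ex: "\<exists>n. \<delta> / x \<le> \<beta> ^ n" by (auto intro: less_imp_le)
  define n where "n = (LEAST n. \<delta> / x \<le> \<beta> ^ n)"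
  have n: "\<delta> / x \<le> \<beta> ^ n" unfolding n_def by (rule LeastI_ex[OF ex])
  have "n \<noteq> 0" using n assms by (intro notI) (simp add: divide_le_eq)
  then obtain k where k: "n = Suc k" by (cases n) auto
  have "\<not> \<delta> / x \<le> \<beta> ^ k" using not_less_Least[of k "\<lambda>n. \<delta> / x \<le> \<beta> ^ n"] k unfolding n_def by auto
  moreover have "0 < \<beta> ^ k" "0 < \<beta> ^ Suc k" using assms by (auto intro: zero_less_power)
  ultimately show ?thesis using n assms unfolding k by (intro exI[of _ k]) (simp add: field_simps)
qed

lemma geometric_interval_unique:
  fixes x \<delta> \<beta> :: real
  assumes "\<delta> > 0" "\<beta> > 1" "\<delta> / \<beta> ^ Suc k \<le> x" "x < \<delta> / \<beta> ^ k" "\<delta> / \<beta> ^ Suc j \<le> x" "x < \<delta> / \<beta> ^ j"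
  shows "k = j"
proof -
  have *: False if "k < j" "\<delta> / \<beta> ^ Suc k \<le> x" "x < \<delta> / \<beta> ^ j" for k j
  proof -
    have "\<beta> ^ Suc k \<le> \<beta> ^ j" using that assms by (intro power_increasing) auto
    then have "\<delta> / \<beta> ^ j \<le> \<delta> / \<beta> ^ Suc k" using assms by (intro divide_left_mono mult_pos_pos zero_less_power) auto
    then show False using that by linarith
  qed
  show ?thesis using *[of k j] *[of j k] assms by (cases k j rule: linorder_cases) auto
qed

lemma prod_Basis_Pair:
  "(\<Prod>i\<in>Basis. (a :: 'a::euclidean_space, b :: 'b::euclidean_space) \<bullet> i) = (\<Prod>i\<in>Basis. a \<bullet> i) * (\<Prod>i\<in>Basis. b \<bullet> i)"
proof -
  have "(\<Prod>i\<in>Basis. (a, b) \<bullet> i) =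
      (\<Prod>i\<in>(\<lambda>u. (u, 0)) ` (Basis :: 'a set). (a, b) \<bullet> i) * (\<Prod>i\<in>(\<lambda>u. (0, u)) ` (Basis :: 'b set). (a, b) \<bullet> i)"
    unfolding Basis_prod_def by (rule prod.union_disjoint) (auto simp: nonzero_Basis)
  also have "(\<Prod>i\<in>(\<lambda>u. (u, 0)) ` (Basis :: 'a set). (a, b) \<bullet> i) = (\<Prod>i\<in>Basis. a \<bullet> i)"
    by (subst prod.reindex) (auto simp: inj_on_def)
  also have "(\<Prod>i\<in>(\<lambda>u. (0, u)) ` (Basis :: 'b set). (a, b) \<bullet> i) = (\<Prod>i\<in>Basis. b \<bullet> i)"
    by (subst prod.reindex) (auto simp: inj_on_def)
  finally show ?thesis .
qed

text \<open>Geometric intervals in x1 and x2 times a lattice cube in x'. The ratio in x2 depends on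
  the index of x1: since \<open>(1 + r) ^ a\<close> is of order 1 / x1, the relative step in x2 is
  of order r x1, as the field x1 x2 d2 demands.\<close>

definition cell_set :: "real \<Rightarrow> real \<Rightarrow> nat \<times> nat \<times> (int ^ 'n::finite) \<Rightarrow> 'n pt set" where
  "cell_set \<delta> r i = (case i of (a, b, z) \<Rightarrow>
     {\<delta> / (1 + r) ^ Suc a ..< \<delta> / (1 + r) ^ a} \<times>
     {\<delta> / (1 + r / (1 + r) ^ a) ^ Suc b ..< \<delta> / (1 + r / (1 + r) ^ a) ^ b} \<times>
     {y. \<forall>k. y $ k \<in> {r * of_int (z $ k) ..< r * (of_int (z $ k) + 1)}})"

lemma cell_set_cell:
  assumes \<delta>: "\<delta> > 0" and r: "0 < r" "r \<le> 1"
  shows "\<exists>l1 l2 V. cell \<delta> r l1 l2 V (cell_set \<delta> r (a, b, z) :: 'n::finite pt set)"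
proof -
  define s where "s = 1 / (1 + r) ^ a"
  define l1 where "l1 = \<delta> / (1 + r) ^ Suc a"
  define B where "B = 1 + r * s"
  define l2 where "l2 = \<delta> / B ^ Suc b"
  have s: "0 < s" "s \<le> 1" unfolding s_def using r by (auto simp: divide_le_eq one_le_power)
  have B: "1 \<le> B" "B \<le> 2" unfolding B_def using r s mult_mono[of r 1 s 1] by auto
  have l1: "0 < l1" "l1 \<le> \<delta>" unfolding l1_def using \<delta> r by (auto simp: divide_le_eq one_le_power simp del: power_Suc)
  have l2: "0 < l2" "l2 \<le> \<delta>" unfolding l2_def using \<delta> B by (auto simp: divide_le_eq one_le_power simp del: power_Suc)
  have u1: "\<delta> / (1 + r) ^ a = (1 + r) * l1" unfolding l1_def using r by simp
  have u2: "\<delta> / B ^ b = B * l2" unfolding l2_def using B by simp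
  \<comment> \<open>Expresses the relative step in x2 through \<open>l1\<close>; the constants
    \<open>1 / \<delta>\<close> and \<open>2 / \<delta>\<close> of \<open>cell\<close> come from the
    factor \<open>(1 + r) / \<delta>\<close>.\<close>
  have sl: "s = (1 + r) * l1 / \<delta>" unfolding s_def u1[symmetric] using \<delta> by simp
  define zl :: "real ^ 'n" where "zl = (\<chi> k. r * of_int (z $ k))"
  define zu :: "real ^ 'n" where "zu = (\<chi> k. r * (of_int (z $ k) + 1))"
  define Y where "Y = {y :: real ^ 'n. \<forall>k. y $ k \<in> {zl $ k ..< zu $ k}}"
  have S: "cell_set \<delta> r (a, b, z) = {l1 ..< (1 + r) * l1} \<times> {l2 ..< B * l2} \<times> Y"
  proof -
    have e: "\<delta> / (1 + r) ^ Suc a = l1" "1 + r / (1 + r) ^ a = B" "\<delta> / B ^ Suc b = l2"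
      unfolding l1_def B_def s_def l2_def by simp_all
    show ?thesis
      unfolding cell_set_def prod.case e u1 u2 Y_def zl_def zu_def vec_lambda_beta ..
  qed
  define S where "S = {l1 ..< (1 + r) * l1} \<times> {l2 ..< B * l2} \<times> Y"
  define V where "V = (r * l1) * (r * s * l2) * r ^ CARD('n)"
  have convY: "convex Y"
  proof -
    have "Y = (\<Inter>k. (\<lambda>y. y $ k) -` {zl $ k ..< zu $ k})" unfolding Y_def by auto
    moreover have "linear (\<lambda>y :: real ^ 'n. y $ k)" for k by (rule bounded_linear.linear[OF bounded_linear_vec_nth])
    ultimately show ?thesis by (auto intro!: convex_INT convex_linear_vimage)
  qed
  have Yb: "Y \<in> sets borel"
  proof -
    have "Y = (\<Inter>k\<in>UNIV. (\<lambda>y. y $ k) -` {zl $ k ..< zu $ k} \<inter> space borel)" unfolding Y_def by auto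
    also have "\<dots> \<in> sets borel"
      by (intro sets.finite_INT measurable_sets[of _ _ borel] borel_measurable_continuous_onI continuous_intros) auto
    finally show ?thesis .
  qed
  have Sb: "S \<in> sets borel"
    unfolding S_def borel_prod[symmetric] using Yb by (intro pair_measureI) auto
  have Sc: "convex S" unfolding S_def by (intro convex_Times convY) auto
  define lo :: "'n pt" where "lo = (l1, l2, zl)"
  define hi :: "'n pt" where "hi = ((1 + r) * l1, B * l2, zu)"
  have c: "cbox lo hi = {l1 .. (1 + r) * l1} \<times> {l2 .. B * l2} \<times> cbox zl zu"
    unfolding lo_def hi_def by (simp add: cbox_Pair_eq)
  have Sub: "S \<subseteq> cbox lo hi" unfolding S_def Y_def c by (auto simp: mem_box_cart less_imp_le)
  have d: "box lo hi = {l1 <..< (1 + r) * l1} \<times> {l2 <..< B * l2} \<times> box zl zu"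
    unfolding lo_def hi_def box_def by (auto simp: Basis_prod_def ball_Un)
  have sub: "box lo hi \<subseteq> S" unfolding S_def Y_def d by (auto simp: mem_box_cart less_imp_le)
  have bas: "lo \<bullet> i \<le> hi \<bullet> i" if "i \<in> Basis" for i
    using that r l1 l2 B unfolding lo_def hi_def zl_def zu_def
    by (auto simp: Basis_prod_def Basis_vec_def inner_axis)
  have pr: "(\<Prod>i\<in>Basis. (hi - lo) \<bullet> i) = V"
  proof -
    have "(\<Prod>i\<in>Basis. (hi - lo) \<bullet> i) = ((1 + r) * l1 - l1) * ((B * l2 - l2) * (\<Prod>i\<in>Basis. (zu - zl) \<bullet> i))"
      unfolding hi_def lo_def by (simp add: prod_Basis_Pair)
    also have "(\<Prod>i\<in>Basis. (zu - zl) \<bullet> i) = (\<Prod>i\<in>(Basis :: (real ^ 'n) set). r)"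
      by (intro prod.cong) (auto simp: Basis_vec_def inner_axis zu_def zl_def algebra_simps)
    finally show ?thesis unfolding V_def B_def by (simp add: algebra_simps)
  qed
  \<comment> \<open>The half-open product lies between an open and a closed box of equal
    volume.\<close>
  have em: "emeasure lborel S = ennreal V"
  proof (rule antisym)
    have "emeasure lborel S \<le> emeasure lborel (cbox lo hi)" using Sub by (intro emeasure_mono) auto
    then show "emeasure lborel S \<le> ennreal V" using bas by (simp add: emeasure_lborel_cbox pr)
    have "emeasure lborel (box lo hi) \<le> emeasure lborel S" using sub Sb by (intro emeasure_mono) auto
    then show "ennreal V \<le> emeasure lborel S" using bas by (simp add: emeasure_lborel_box pr)
  qed
  have Veq: "V = (1 + r) / \<delta> * (r ^ (CARD('n) + 2) * (l1\<^sup>2 * l2))"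
    unfolding V_def sl using \<delta> by (simp add: power2_eq_square power_add field_simps)
  have pos: "0 \<le> r ^ (CARD('n) + 2) * (l1\<^sup>2 * l2)" using r l1 l2 by simp
  have V1: "r ^ (CARD('n) + 2) * (l1\<^sup>2 * l2) / \<delta> \<le> V"
    using mult_right_mono[of "1 / \<delta>" "(1 + r) / \<delta>", OF _ pos] \<delta> r unfolding Veq by (simp add: divide_right_mono)
  have V2: "V \<le> 2 / \<delta> * (r ^ (CARD('n) + 2) * (l1\<^sup>2 * l2))"
    unfolding Veq using \<delta> r by (intro mult_right_mono pos divide_right_mono) auto
  have rng: "l1 \<le> fst x \<and> fst x \<le> 2 * l1 \<and> l2 \<le> fst (snd x) \<and> fst (snd x) \<le> 2 * l2" if "x \<in> S" for x
  proof -
    have "fst x \<le> (1 + r) * l1" "fst (snd x) \<le> B * l2" "l1 \<le> fst x" "l2 \<le> fst (snd x)" using that unfolding S_def by auto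
    moreover have "(1 + r) * l1 \<le> 2 * l1" "B * l2 \<le> 2 * l2" using r l1 l2 B by (auto intro!: mult_right_mono)
    ultimately show ?thesis by linarith
  qed
  have dist: "\<bar>fst x - fst y\<bar> \<le> r * l1 \<and> \<bar>fst (snd x) - fst (snd y)\<bar> \<le> 2 / \<delta> * r * (l1 * l2) \<and>
        norm (snd (snd x) - snd (snd y)) \<le> r * CARD('n)" if x: "x \<in> S" and y: "y \<in> S" for x y
  proof (intro conjI)
    have "l1 \<le> fst x" "fst x \<le> (1 + r) * l1" "l1 \<le> fst y" "fst y \<le> (1 + r) * l1" using x y unfolding S_def by auto
    then show "\<bar>fst x - fst y\<bar> \<le> r * l1" by (simp add: algebra_simps abs_le_iff)
    have "l2 \<le> fst (snd x)" "fst (snd x) \<le> B * l2" "l2 \<le> fst (snd y)" "fst (snd y) \<le> B * l2" using x y unfolding S_def by auto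
    then have "\<bar>fst (snd x) - fst (snd y)\<bar> \<le> r * s * l2" unfolding B_def by (simp add: algebra_simps abs_le_iff)
    also have "\<dots> = (1 + r) * (r * (l1 * l2) / \<delta>)" unfolding sl by simp
    also have "\<dots> \<le> 2 * (r * (l1 * l2) / \<delta>)" using r l1 l2 \<delta> by (intro mult_right_mono) auto
    finally show "\<bar>fst (snd x) - fst (snd y)\<bar> \<le> 2 / \<delta> * r * (l1 * l2)" by simp
    have "norm (snd (snd x) - snd (snd y)) \<le> (\<Sum>k\<in>UNIV. \<bar>(snd (snd x) - snd (snd y)) $ k\<bar>)" by (rule norm_le_l1_cart)
    also have "\<dots> \<le> (\<Sum>k\<in>(UNIV :: 'n set). r)"
    proof (rule sum_mono)
      fix k :: 'n
      have "snd (snd x) $ k \<in> {zl $ k ..< zu $ k}" "snd (snd y) $ k \<in> {zl $ k ..< zu $ k}"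
        using x y unfolding S_def Y_def by auto
      then show "\<bar>(snd (snd x) - snd (snd y)) $ k\<bar> \<le> r" unfolding zl_def zu_def by (auto simp: algebra_simps abs_le_iff)
    qed
    finally show "norm (snd (snd x) - snd (snd y)) \<le> r * CARD('n)" by (simp add: mult.commute)
  qed
  have "cell \<delta> r l1 l2 V S"
    unfolding cell_def using l1 l2 Sb Sc em V1 V2 rng dist by blast
  then show ?thesis unfolding S S_def by blast
qed

lemma cell_set_disjoint:
  assumes \<delta>: "\<delta> > 0" and r: "0 < r" and x: "x \<in> cell_set \<delta> r i" "x \<in> cell_set \<delta> r j"
  shows "i = j"
proof -
  obtain a b z where i: "i = (a, b, z)" by (cases i)
  obtain a' b' z' where j: "j = (a', b', z')" by (cases j)
  have a: "a = a'"
    using x unfolding i j cell_set_def by (intro geometric_interval_unique[of \<delta> "1 + r" a "fst x" a']) (use \<delta> r in auto)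
  have "1 + r / (1 + r) ^ a > 1" using r by simp
  then have b: "b = b'"
    using x unfolding i j cell_set_def a
    by (intro geometric_interval_unique[of \<delta> "1 + r / (1 + r) ^ a'" b "fst (snd x)" b']) (use \<delta> r a in auto)
  have "z $ k = z' $ k" for k
  proof -
    define y where "y = snd (snd x) $ k / r"
    have "of_int (z $ k) \<le> y" "y < of_int (z $ k) + 1" "of_int (z' $ k) \<le> y" "y < of_int (z' $ k) + 1"
      using x r unfolding i j cell_set_def y_def by (auto simp: field_simps)
    then have "\<lfloor>y\<rfloor> = z $ k" "\<lfloor>y\<rfloor> = z' $ k" by (auto intro: floor_unique)
    then show ?thesis by simp
  qed
  then have "z = z'" by (simp add: vec_eq_iff)
  with a b i j show ?thesis by simp
qed

lemma cell_set_cover: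
  assumes r: "0 < r" and x: "0 < fst x" "fst x < \<delta>" "0 < fst (snd x)" "fst (snd x) < \<delta>"
  shows "\<exists>i. x \<in> cell_set \<delta> r i"
proof -
  obtain a where a: "\<delta> / (1 + r) ^ Suc a \<le> fst x" "fst x < \<delta> / (1 + r) ^ a"
    using geometric_interval[OF x(1,2), of "1 + r"] r by auto
  have "1 + r / (1 + r) ^ a > 1" using r by simp
  from geometric_interval[OF x(3,4) this] obtain b where
    b: "\<delta> / (1 + r / (1 + r) ^ a) ^ Suc b \<le> fst (snd x)" "fst (snd x) < \<delta> / (1 + r / (1 + r) ^ a) ^ b" by auto
  define z where "z = (\<chi> k. \<lfloor>snd (snd x) $ k / r\<rfloor>)"
  have "snd (snd x) $ k \<in> {r * of_int (z $ k) ..< r * (of_int (z $ k) + 1)}" for k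
  proof -
    have "of_int (z $ k) \<le> snd (snd x) $ k / r" "snd (snd x) $ k / r < of_int (z $ k) + 1"
      unfolding z_def by (auto simp: floor_less_iff)
    then show ?thesis using r by (simp add: field_simps)
  qed
  then have "x \<in> cell_set \<delta> r (a, b, z)" unfolding cell_set_def using a b by (cases x) auto
  then show ?thesis by blast
qed

text \<open>The index type is countable, so \<open>to_nat\<close> arranges the cells in a sequence;
  numbers outside its range receive the empty set.\<close>

lemma cells_exist:
  assumes \<delta>: "\<delta> > 0" and r: "0 < r" "r \<le> 1"
  shows "\<exists>(S :: nat \<Rightarrow> 'n::finite pt set) l1 l2 V. (\<forall>j. S j = {} \<or> cell \<delta> r (l1 j) (l2 j) (V j) (S j)) \<and>
    disjoint_family S \<and> {x. 0 < fst x \<and> fst x < \<delta> \<and> 0 < fst (snd x) \<and> fst (snd x) < \<delta>} \<subseteq> (\<Union>j. S j)"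
proof -
  define S :: "nat \<Rightarrow> 'n pt set" where "S j = {x. \<exists>i. to_nat i = j \<and> x \<in> cell_set \<delta> r i}" for j
  have Si: "S (to_nat i) = cell_set \<delta> r i" for i unfolding S_def by auto
  have "\<exists>l1 l2 V. S j = {} \<or> cell \<delta> r l1 l2 V (S j)" for j
  proof (cases "\<exists>i :: nat \<times> nat \<times> (int ^ 'n). to_nat i = j")
    case True
    then obtain a b z where "to_nat ((a, b, z) :: nat \<times> nat \<times> (int ^ 'n)) = j" by (metis prod_cases3)
    then show ?thesis using Si[of "(a, b, z)"] cell_set_cell[OF \<delta> r, of a b z] by auto
  qed (auto simp: S_def)
  then obtain l1 l2 V where "\<forall>j. S j = {} \<or> cell \<delta> r (l1 j) (l2 j) (V j) (S j)" by metis
  moreover have "disjoint_family S"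
    unfolding disjoint_family_on_def S_def using cell_set_disjoint[OF \<delta> r(1)] by blast
  moreover have "{x. 0 < fst x \<and> fst x < \<delta> \<and> 0 < fst (snd x) \<and> fst (snd x) < \<delta>} \<subseteq> (\<Union>j. S j)"
    using cell_set_cover[OF r(1)] unfolding S_def by blast
  ultimately show ?thesis by blast
qed

text \<open>The functional attached to a cell is normalised so that its \<open>q\<close>-th power is
  the mean term of \<open>cell_estimate\<close>. Its Bessel constant has the exponents
  \<open>(p + 1) * p / q - 1\<close> in \<open>l1\<close> and \<open>p * p / q\<close> in
  \<open>l2\<close>, again nonnegative because \<open>q <= p * (p + 1)\<close>.\<close>

lemma functional_constant_bound:
  fixes p q \<delta> r l1 l2 V m :: real and n :: nat
  assumes p: "p > 1" "q > p" "q \<le> p * (p + 1)" and \<delta>: "\<delta> > 0" and r: "0 < r" and l: "0 < l1" "l1 \<le> \<delta>" "0 < l2" "l2 \<le> \<delta>"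
    and V: "r ^ n * (l1\<^sup>2 * l2) / \<delta> \<le> V" and m: "V / (4 * l1 * l2) \<le> m"
  shows "\<bar>((4 * l1 * l2) powr (p - 1) * V) powr (1 / q) / m\<bar> powr p * m powr (p - 1)
    \<le> 4 powr ((p - 1) * p / q + 1) * (r ^ n / \<delta>) powr (p / q - 1) * \<delta> powr ((p + 1) * p / q - 1) * \<delta> powr (p * p / q)"
proof -
  have q: "q > 0" using p by simp
  have V0: "V > 0"
  proof -
    have "0 < r ^ n * (l1\<^sup>2 * l2) / \<delta>" using r l \<delta> by simp
    then show ?thesis using V by linarith
  qed
  have m0: "m > 0" using m V0 l by (smt (verit) divide_pos_pos mult_pos_pos)
  have "\<bar>((4 * l1 * l2) powr (p - 1) * V) powr (1 / q) / m\<bar> powr p * m powr (p - 1)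
    = (((4 * l1 * l2) powr (p - 1) * V) powr (1 / q)) powr p / m powr p * m powr (p - 1)"
    using m0 by (simp add: powr_divide)
  also have "\<dots> = ((4 * l1 * l2) powr (p - 1) * V) powr (p / q) / m"
    using m0 by (simp add: powr_powr powr_diff)
  also have "\<dots> \<le> ((4 * l1 * l2) powr (p - 1) * V) powr (p / q) / (V / (4 * l1 * l2))"
    using m m0 V0 l by (intro divide_left_mono mult_pos_pos) auto
  also have "\<dots> = 4 powr ((p - 1) * p / q + 1) * (l1 powr ((p - 1) * p / q + 1) * l2 powr ((p - 1) * p / q + 1)) * V powr (p / q - 1)"
  proof -
    have "((4 * l1 * l2) powr (p - 1) * V) powr (p / q) / (V / (4 * l1 * l2))
      = ((4 * l1 * l2) * (4 * l1 * l2) powr ((p - 1) * p / q)) * (V powr (p / q) / V)"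
      by (simp add: powr_mult powr_powr)
    also have "(4 * l1 * l2) * (4 * l1 * l2) powr ((p - 1) * p / q) = (4 * l1 * l2) powr ((p - 1) * p / q + 1)"
      using l powr_mult_base[of "4 * l1 * l2" "(p - 1) * p / q"] by (simp add: add.commute)
    also have "V powr (p / q) / V = V powr (p / q - 1)" using V0 by (simp add: powr_diff)
    finally show ?thesis by (simp add: powr_mult)
  qed
  also have "\<dots> \<le> 4 powr ((p - 1) * p / q + 1) * (l1 powr ((p - 1) * p / q + 1) * l2 powr ((p - 1) * p / q + 1)) *
      ((r ^ n / \<delta>) powr (p / q - 1) * (l1 powr (2 * (p / q - 1)) * l2 powr (p / q - 1)))"
  proof (intro mult_left_mono)
    have e: "p / q - 1 \<le> 0" using p q by (simp add: divide_le_eq)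
    have "V powr (p / q - 1) \<le> (r ^ n * (l1\<^sup>2 * l2) / \<delta>) powr (p / q - 1)"
      using V e r l \<delta> by (intro powr_mono2') auto
    also have "r ^ n * (l1\<^sup>2 * l2) / \<delta> = (r ^ n / \<delta>) * (l1 powr 2 * l2)" using l by simp
    also have "\<dots> powr (p / q - 1) = (r ^ n / \<delta>) powr (p / q - 1) * (l1 powr (2 * (p / q - 1)) * l2 powr (p / q - 1))"
      by (simp only: powr_mult powr_powr)
    finally show "V powr (p / q - 1) \<le> (r ^ n / \<delta>) powr (p / q - 1) * (l1 powr (2 * (p / q - 1)) * l2 powr (p / q - 1))" .
  qed auto
  also have "\<dots> = 4 powr ((p - 1) * p / q + 1) * (r ^ n / \<delta>) powr (p / q - 1) *
     (l1 powr ((p - 1) * p / q + 1) * l1 powr (2 * (p / q - 1))) * (l2 powr ((p - 1) * p / q + 1) * l2 powr (p / q - 1))"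
    by (simp only: ac_simps)
  also have "l1 powr ((p - 1) * p / q + 1) * l1 powr (2 * (p / q - 1)) = l1 powr ((p + 1) * p / q - 1)"
  proof -
    have "(p - 1) * p / q + 1 + 2 * (p / q - 1) = (p + 1) * p / q - 1" using q by (simp add: field_simps)
    then show ?thesis by (simp add: powr_add[symmetric])
  qed
  also have "l2 powr ((p - 1) * p / q + 1) * l2 powr (p / q - 1) = l2 powr (p * p / q)"
  proof -
    have "(p - 1) * p / q + 1 + (p / q - 1) = p * p / q" using q by (simp add: field_simps)
    then show ?thesis by (simp add: powr_add[symmetric])
  qed
  also have "4 powr ((p - 1) * p / q + 1) * (r ^ n / \<delta>) powr (p / q - 1) * l1 powr ((p + 1) * p / q - 1) * l2 powr (p * p / q)
    \<le> 4 powr ((p - 1) * p / q + 1) * (r ^ n / \<delta>) powr (p / q - 1) * \<delta> powr ((p + 1) * p / q - 1) * \<delta> powr (p * p / q)"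
  proof -
    have "0 \<le> (p + 1) * p / q - 1" using p q by (simp add: le_divide_eq mult.commute)
    then show ?thesis
      using l p q by (intro mult_mono[OF mult_left_mono] powr_mono2 mult_nonneg_nonneg powr_ge_zero) auto
  qed
  finally show ?thesis .
qed

lemma small_power_exists:
  fixes c e t :: real
  assumes "c \<ge> 0" "e > 0" "t > 0"
  shows "\<exists>r. 0 < r \<and> r \<le> 1 \<and> c * r powr t \<le> e"
proof -
  define r where "r = min 1 ((e / (c + 1)) powr (1 / t))"
  have r: "0 < r" "r \<le> 1" unfolding r_def using assms by auto
  have "r powr t \<le> ((e / (c + 1)) powr (1 / t)) powr t" using r assms by (intro powr_mono2) (auto simp: r_def)
  also have "\<dots> = e / (c + 1)" using assms by (simp add: powr_powr)
  finally have "c * r powr t \<le> c * (e / (c + 1))" using assms by (intro mult_left_mono) auto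
  also have "\<dots> \<le> e" using assms by (simp add: field_simps)
  finally show ?thesis using r by blast
qed

context corner_bump
begin

lemma cell_weight:
  assumes S: "cell \<delta> r l1 l2 V (S :: 'n pt set)" and r: "0 < r"
  shows "\<exists>m>0. emeasure (mu M) S \<le> ennreal m \<and> (\<integral>\<^sup>+x\<in>S. ennreal (1 / (fst x * fst (snd x))) \<partial>lborel) = ennreal m \<and> V / (4 * l1 * l2) \<le> m"
proof -
  have l: "0 < l1" "0 < l2" and S_meas[measurable]: "S \<in> sets borel"
    and V: "emeasure lborel S = ennreal V" and Vl: "r ^ (CARD('n) + 2) * (l1\<^sup>2 * l2) / \<delta> \<le> V"
    and Sx: "\<And>x. x \<in> S \<Longrightarrow> l1 \<le> fst x \<and> fst x \<le> 2 * l1 \<and> l2 \<le> fst (snd x) \<and> fst (snd x) \<le> 2 * l2"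
    using S unfolding cell_def by auto
  have "0 < r ^ (CARD('n) + 2) * (l1\<^sup>2 * l2) / \<delta>" using r l \<delta> by simp
  then have V0: "V > 0" using Vl by linarith
  define I where "I = (\<integral>\<^sup>+x\<in>S. ennreal (1 / (fst x * fst (snd x))) \<partial>lborel)"
  have "I \<le> (\<integral>\<^sup>+x. ennreal (1 / (l1 * l2)) * indicator S x \<partial>lborel)"
    unfolding I_def
  proof (rule nn_integral_mono)
    fix x
    show "ennreal (1 / (fst x * fst (snd x))) * indicator S x \<le> ennreal (1 / (l1 * l2)) * indicator S x"
    proof (cases "x \<in> S")
      case True
      note xx = Sx[OF True]
      have "1 / (fst x * fst (snd x)) \<le> 1 / (l1 * l2)" using xx l by (intro divide_left_mono mult_mono mult_pos_pos) auto
      then show ?thesis by (intro mult_right_mono ennreal_leI) auto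
    qed simp
  qed
  also have "\<dots> = ennreal (1 / (l1 * l2)) * ennreal V" using V by (simp add: nn_integral_cmult_indicator)
  finally have "I < top" by (rule le_less_trans) (simp add: ennreal_mult_less_top)
  then obtain m where m: "I = ennreal m" "m \<ge> 0" by (cases I) auto
  have "ennreal (1 / (4 * l1 * l2)) * ennreal V = (\<integral>\<^sup>+x. ennreal (1 / (4 * l1 * l2)) * indicator S x \<partial>lborel)"
    using V by (simp add: nn_integral_cmult_indicator)
  also have "\<dots> \<le> I" unfolding I_def
  proof (rule nn_integral_mono)
    fix x
    show "ennreal (1 / (4 * l1 * l2)) * indicator S x \<le> ennreal (1 / (fst x * fst (snd x))) * indicator S x"
    proof (cases "x \<in> S")
      case True
      note xx = Sx[OF True]
      have "fst x * fst (snd x) \<le> (2 * l1) * (2 * l2)" using xx l by (intro mult_mono) auto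
      then have "1 / (4 * l1 * l2) \<le> 1 / (fst x * fst (snd x))" using xx l by (intro divide_left_mono mult_pos_pos) auto
      then show ?thesis by (intro mult_right_mono ennreal_leI) auto
    qed simp
  qed
  finally have "1 / (4 * l1 * l2) * V \<le> m"
    using m V0 l by (simp add: ennreal_mult[symmetric])
  then have low: "V / (4 * l1 * l2) \<le> m" by simp
  have "0 < V / (4 * l1 * l2)" using V0 l by simp
  then have m0: "m > 0" using low by linarith
  have "emeasure (mu M) S = (\<integral>\<^sup>+x. indicator S x \<partial>mu M)" by simp
  also have "\<dots> \<le> I" unfolding I_def
    by (subst nn_integral_mu) (auto intro!: nn_integral_mono ennreal_leI split: split_indicator)
  finally show ?thesis using m m0 low I_def by auto
qed

end

section \<open>Detection of a large \<open>L^q\<close> norm by cell averages\<close>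

context corner_embedding
begin

text \<open>Summation of \<open>cell_estimate\<close> over all cells. The energies satisfy
  \<open>Ej powr (q / p) <= Ej * N u powr (q - p)\<close>, and the mean terms
  \<open>|x j u| powr q\<close> are at most the supremum to the power \<open>q - p\<close> times
  \<open>|x j u| powr p\<close>. Small cells and then a small \<open>eta\<close> make both sums at
  most \<open>eps powr q / 4 * N u powr q\<close>, too little for \<open>K\<close>.\<close>

lemma detection:
  assumes qa: "q \<le> p * (p + 1)" and k1: "real (CARD('n) + 2) * (1 / p - 1 / q) < 1" and eps: "eps > 0"
  shows "\<exists>x Cx eta. eta > 0 \<and> almost_orthogonal_functionals E N x p Cx \<and>
      (\<forall>u\<in>E. u \<noteq> 0 \<longrightarrow> eps * N u \<le> KK u \<longrightarrow> (\<exists>i. \<bar>x i u\<bar> > eta * N u))"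
proof -
  define n where "n = CARD('n) + 2"
  define Cs where "Cs = (1 / (1 - real n * (1 / p - 1 / q))) powr q * 2 ^ n"
  define C1 where "C1 = 4 powr (p - 1 + q / p) * 4 powr q * Cs * (1 + 2 / \<delta> + real CARD('n)) powr q *
     (1 / \<delta>) powr (1 - q / p) * \<delta> powr (p + 1 - q / p) * \<delta> powr p"
  define th where "th = q + real n - real n * q / p"
  have C1: "C1 \<ge> 0" unfolding C1_def Cs_def by simp
  have th: "th > 0"
  proof -
    have "th = q * (1 - real n * (1 / p - 1 / q))" unfolding th_def using q0 p0 by (simp add: field_simps)
    then show ?thesis using k1 q0 unfolding n_def by simp
  qed
  have eq4: "eps powr q / 4 > 0" using eps by simp
  \<comment> \<open>The exponent \<open>th\<close> is positive because \<open>q\<close> is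
    subcritical, so fine cells make the oscillation terms small.\<close>
  obtain r where r: "0 < r" "r \<le> 1" "(2 powr q * C1) * r powr th \<le> eps powr q / 4"
    using small_power_exists[of "2 powr q * C1" "eps powr q / 4" th] C1 th eq4 by auto
  obtain S :: "nat \<Rightarrow> 'n pt set" and l1 l2 V where S: "\<And>j. S j = {} \<or> cell \<delta> r (l1 j) (l2 j) (V j) (S j)"
    and dS: "disjoint_family S" and cS: "{x. 0 < fst x \<and> fst x < \<delta> \<and> 0 < fst (snd x) \<and> fst (snd x) < \<delta>} \<subseteq> (\<Union>j. S j)"
    using cells_exist[OF \<delta> r(1,2)] by blast
  have MS: "M \<subseteq> (\<Union>j. S j)" using cS M_iff by blast
  have Sb[measurable]: "S j \<in> sets borel" for j using S[of j] unfolding cell_def by auto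
  have "\<exists>m>0. emeasure (mu M) (S j) \<le> ennreal m \<and> (S j \<noteq> {} \<longrightarrow>
     (\<integral>\<^sup>+x\<in>S j. ennreal (1 / (fst x * fst (snd x))) \<partial>lborel) = ennreal m \<and> V j / (4 * l1 j * l2 j) \<le> m)"
    (is "\<exists>m>0. ?P j m") for j
  proof (cases "S j = {}")
    case True
    then show ?thesis by (intro exI[of _ 1]) auto
  next
    case False
    then show ?thesis using cell_weight[of r "l1 j" "l2 j" "V j" "S j"] S[of j] r by blast
  qed
  then have "\<forall>j. \<exists>m. m > 0 \<and> ?P j m" by blast
  from choice[OF this] obtain m where "\<forall>j. m j > 0 \<and> ?P j (m j)" by blast
  then have m: "\<And>j. m j > 0" "\<And>j. emeasure (mu M) (S j) \<le> ennreal (m j)"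
    "\<And>j. S j \<noteq> {} \<Longrightarrow> (\<integral>\<^sup>+x\<in>S j. ennreal (1 / (fst x * fst (snd x))) \<partial>lborel) = ennreal (m j)"
    "\<And>j. S j \<noteq> {} \<Longrightarrow> V j / (4 * l1 j * l2 j) \<le> m j" by blast+
  define Wt where "Wt j = (4 * l1 j * l2 j) powr (p - 1) * V j" for j
  \<comment> \<open>Normalised such that \<open>|x j u| powr q = Wt j * |c| powr q\<close>, where
    \<open>c\<close> is the mean over the cell.\<close>
  define a where "a j = (if S j = {} then 0 else Wt j powr (1 / q) / m j)" for j
  define A where "A = 4 powr ((p - 1) * p / q + 1) * (r ^ n / \<delta>) powr (p / q - 1) * \<delta> powr ((p + 1) * p / q - 1) * \<delta> powr (p * p / q)"
  have a_le: "\<bar>a j\<bar> powr p * m j powr (p - 1) \<le> A" for j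
  proof (cases "S j = {}")
    case True
    then show ?thesis unfolding a_def A_def using p0 by simp
  next
    case False
    then have "cell \<delta> r (l1 j) (l2 j) (V j) (S j)" using S[of j] by blast
    then have "0 < l1 j" "l1 j \<le> \<delta>" "0 < l2 j" "l2 j \<le> \<delta>" "r ^ n * ((l1 j)\<^sup>2 * l2 j) / \<delta> \<le> V j"
      unfolding cell_def n_def by auto
    from functional_constant_bound[OF p q qa \<delta> r(1) this m(4)[OF False]]
    show ?thesis unfolding a_def Wt_def A_def using False by simp
  qed
  obtain CP where CP: "CP > 0" "\<And>u. u \<in> E \<Longrightarrow> LP (rep_aefun u) \<le> CP * N u" using poincare by blast
  define Cx where "Cx = A * CP powr p"
  have Cx: "Cx \<ge> 0" unfolding Cx_def A_def by simp
  define x where "x j u = a j * region_integral (S j) u" for j u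
  have fam: "almost_orthogonal_functionals E N x p Cx"
    using region_functionals[OF Sb dS m(2,1) a_le CP] unfolding x_def[abs_def] Cx_def .
  interpret X: almost_orthogonal_functionals E N x p Cx by (rule fam)
  obtain eta where eta: "0 < eta" "(2 powr q * Cx) * eta powr (q - p) \<le> eps powr q / 4"
    using small_power_exists[of "2 powr q * Cx" "eps powr q / 4" "q - p"] Cx q eq4 by auto
  \<comment> \<open>Proved for test functions, for which the local estimate is available. The
    supremum bound \<open>s\<close> is left free, since the functionals of an approximating test
    function may slightly exceed those of \<open>u\<close>.\<close>
  have claim: "KK (abs_aefun \<phi>) powr q \<le> eps powr q / 4 * N (abs_aefun \<phi>) powr q + 2 powr q * s powr (q - p) * Cx * N (abs_aefun \<phi>) powr p"
    if \<phi>: "\<phi> \<in> test_functions M" and s: "\<And>j. \<bar>x j (abs_aefun \<phi>)\<bar> \<le> s" for \<phi> s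
  proof -
    define u where "u = abs_aefun \<phi>"
    have uE: "u \<in> E" unfolding u_def by (rule test_function_E[OF \<phi>])
    have [measurable]: "\<phi> \<in> borel_measurable borel" by (rule test_borel[OF \<phi>])
    have s\<phi>: "smooth \<phi>" using \<phi> by (auto simp: test_functions_def smooth_def)
    have \<phi>M: "\<phi> x = 0" if "x \<notin> M" for x
    proof -
      from \<phi> obtain K where "K \<subseteq> M" "\<And>x. x \<notin> K \<Longrightarrow> \<phi> x = 0" by (rule test_functionsD) blast
      then show ?thesis using that by blast
    qed
    have [measurable]: "(\<lambda>x. scaled x (gradient \<phi> x)) \<in> borel_measurable borel"
      by (rule borel_measurable_continuous_onI[OF scaled_gradient_continuous[OF s\<phi>]])
    have s0: "s \<ge> 0" using s[of 0] by linarith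
    define e where "e j = (\<integral>\<^sup>+x\<in>S j. ennreal (norm (scaled x (gradient \<phi> x)) powr p) \<partial>mu M)" for j
    have tot: "(\<integral>\<^sup>+x. ennreal (norm (scaled x (gradient \<phi> x)) powr p) \<partial>mu M) = ennreal (N u powr p)"
      using Lnorm_nn[OF test_function_HH(3)[OF \<phi>] p0] unfolding u_def N_test[OF \<phi>] .
    have e_le: "e j \<le> ennreal (N u powr p)" for j
      unfolding e_def tot[symmetric] by (intro nn_integral_mono) (auto split: split_indicator)
    have sum_e: "(\<Sum>j. e j) \<le> ennreal (N u powr p)"
    proof -
      have "(\<Sum>j. e j) = (\<integral>\<^sup>+x\<in>(\<Union>j. S j). ennreal (norm (scaled x (gradient \<phi> x)) powr p) \<partial>mu M)"
        unfolding e_def by (rule nn_integral_disjoint_family[symmetric]) (auto simp: dS borel_mu)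
      also have "\<dots> \<le> ennreal (N u powr p)"
        unfolding tot[symmetric] by (intro nn_integral_mono) (auto split: split_indicator)
      finally show ?thesis .
    qed
    have sum_x: "(\<Sum>j. ennreal (\<bar>x j u\<bar> powr p)) \<le> ennreal (Cx * N u powr p)"
      unfolding suminf_eq_SUP
    proof (rule SUP_least)
      fix i
      have "(\<Sum>j<i. ennreal (\<bar>x j u\<bar> powr p)) = ennreal (\<Sum>j<i. \<bar>x j u\<bar> powr p)" by (rule sum_ennreal) simp
      also have "\<dots> \<le> ennreal (Cx * N u powr p)" by (intro ennreal_leI X.x_sum uE) simp
      finally show "(\<Sum>j<i. ennreal (\<bar>x j u\<bar> powr p)) \<le> ennreal (Cx * N u powr p)" .
    qed
    define c1 where "c1 = 2 powr q * (C1 * r powr th) * N u powr (q - p)"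
    define c2 where "c2 = 2 powr q * s powr (q - p)"
    have loc: "(\<integral>\<^sup>+x\<in>S j. ennreal (\<bar>\<phi> x\<bar> powr q) \<partial>muK p M) \<le> ennreal c1 * e j + ennreal c2 * ennreal (\<bar>x j u\<bar> powr p)" for j
    proof (cases "S j = {}")
      case False
      then have cl: "cell \<delta> r (l1 j) (l2 j) (V j) (S j)" using S[of j] by blast
      obtain Ej where Ej: "e j = ennreal Ej" "Ej \<ge> 0" using e_le[of j] by (cases "e j") (auto simp: top_unique)
      have EjN: "Ej \<le> N u powr p" using e_le[of j] Ej by simp
      define c where "c = (\<integral>x. indicator (S j) x * \<phi> x \<partial>mu M) / m j"
      have "region_integral (S j) u = (\<integral>x. indicator (S j) x * \<phi> x \<partial>mu M)"
        unfolding region_integral_def u_def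
      proof (rule integral_cong_AE)
        show "AE x in mu M. indicator (S j) x * rep_aefun (abs_aefun \<phi>) x = indicator (S j) x * \<phi> x"
          using test_function_W(3)[OF \<phi>] by eventually_elim simp
      qed (auto simp: borel_mu)
      then have xc: "x j u = Wt j powr (1 / q) * c" unfolding x_def a_def c_def using False m(1)[of j] by simp
      have "V j \<ge> 0" using cl r \<delta> unfolding cell_def by (smt (verit) divide_nonneg_pos mult_nonneg_nonneg zero_le_power zero_le_power2)
      then have "Wt j \<ge> 0" unfolding Wt_def by simp
      then have xq: "\<bar>x j u\<bar> powr q = Wt j * \<bar>c\<bar> powr q"
        unfolding xc using q0 by (simp add: abs_mult powr_mult powr_powr)
      have "(\<integral>\<^sup>+x\<in>S j. ennreal (\<bar>\<phi> x\<bar> powr q) \<partial>muK p M) \<le> ennreal (2 powr q * (C1 * r powr th * Ej powr (q / p) + Wt j * \<bar>c\<bar> powr q))"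
        unfolding C1_def Cs_def th_def n_def Wt_def
        by (rule cell_estimate[OF q qa k1 r(1,2) cl \<phi> m(3)[OF False] m(4)[OF False] _ Ej(2) c_def])
          (use Ej in \<open>simp add: e_def\<close>)
      also have "\<dots> \<le> ennreal (c1 * Ej + c2 * \<bar>x j u\<bar> powr p)"
      proof (rule ennreal_leI)
        have "Ej powr (q / p) = Ej * Ej powr (q / p - 1)" using Ej powr_mult_base[of Ej "q / p - 1"] by simp
        also have "\<dots> \<le> Ej * (N u powr p) powr (q / p - 1)"
          using Ej EjN q p0 by (intro mult_left_mono powr_mono2) (auto simp: le_divide_eq)
        also have "(N u powr p) powr (q / p - 1) = N u powr (q - p)"
          using p0 by (simp add: powr_powr right_diff_distrib)
        finally have 1: "C1 * r powr th * Ej powr (q / p) \<le> C1 * r powr th * (Ej * N u powr (q - p))"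
          using C1 by (intro mult_left_mono) auto
        have "\<bar>x j u\<bar> powr q = \<bar>x j u\<bar> powr (q - p) * \<bar>x j u\<bar> powr p" by (simp add: powr_add[symmetric])
        also have "\<dots> \<le> s powr (q - p) * \<bar>x j u\<bar> powr p"
          using s[of j] q unfolding u_def by (intro mult_right_mono powr_mono2) auto
        finally have 2: "Wt j * \<bar>c\<bar> powr q \<le> s powr (q - p) * \<bar>x j u\<bar> powr p" unfolding xq .
        have "2 powr q * (C1 * r powr th * Ej powr (q / p) + Wt j * \<bar>c\<bar> powr q)
          \<le> 2 powr q * (C1 * r powr th * (Ej * N u powr (q - p)) + s powr (q - p) * \<bar>x j u\<bar> powr p)"
          by (intro mult_left_mono add_mono 1 2) auto
        also have "\<dots> = c1 * Ej + c2 * \<bar>x j u\<bar> powr p" unfolding c1_def c2_def by (simp add: algebra_simps)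
        finally show "2 powr q * (C1 * r powr th * Ej powr (q / p) + Wt j * \<bar>c\<bar> powr q) \<le> c1 * Ej + c2 * \<bar>x j u\<bar> powr p" .
      qed
      also have "\<dots> = ennreal c1 * e j + ennreal c2 * ennreal (\<bar>x j u\<bar> powr p)"
        unfolding Ej(1) c1_def c2_def using Ej(2) C1 by (simp add: ennreal_mult ennreal_plus)
      finally show ?thesis .
    qed simp
    have "ennreal (KK u powr q) = (\<integral>\<^sup>+x. ennreal (norm (rep_aefun u x) powr q) \<partial>muK p M)"
      unfolding KK_def using embed[OF uE] q0 by (intro Lnorm_nn[symmetric]) auto
    also have "\<dots> = (\<integral>\<^sup>+x\<in>(\<Union>j. S j). ennreal (\<bar>\<phi> x\<bar> powr q) \<partial>muK p M)"
    proof (rule nn_integral_cong_AE)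
      show "AE x in muK p M. ennreal (norm (rep_aefun u x) powr q) = ennreal (\<bar>\<phi> x\<bar> powr q) * indicator (\<Union>j. S j) x"
        using AE_muK[OF test_function_W(3)[OF \<phi>]]
      proof eventually_elim
        case (elim x)
        then show ?case using \<phi>M[of x] MS q0 unfolding u_def by (cases "x \<in> M") (auto simp: indicator_def)
      qed
    qed
    also have "\<dots> = (\<Sum>j. \<integral>\<^sup>+x\<in>S j. ennreal (\<bar>\<phi> x\<bar> powr q) \<partial>muK p M)"
      by (rule nn_integral_disjoint_family) (auto simp: dS borel_muK)
    also have "\<dots> \<le> (\<Sum>j. ennreal c1 * e j + ennreal c2 * ennreal (\<bar>x j u\<bar> powr p))"
      by (intro suminf_le loc) auto
    also have "\<dots> = ennreal c1 * (\<Sum>j. e j) + ennreal c2 * (\<Sum>j. ennreal (\<bar>x j u\<bar> powr p))"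
      by (subst suminf_add[symmetric]) (auto simp: ennreal_suminf_cmult)
    also have "\<dots> \<le> ennreal c1 * ennreal (N u powr p) + ennreal c2 * ennreal (Cx * N u powr p)"
      by (intro add_mono mult_left_mono sum_e sum_x) auto
    also have "\<dots> = ennreal (c1 * N u powr p + c2 * (Cx * N u powr p))"
      using Cx C1 unfolding c1_def c2_def by (simp add: ennreal_mult ennreal_plus)
    finally have "ennreal (KK u powr q) \<le> ennreal (c1 * N u powr p + c2 * (Cx * N u powr p))" .
    moreover have "0 \<le> c1 * N u powr p + c2 * (Cx * N u powr p)"
      using Cx C1 unfolding c1_def c2_def by simp
    ultimately have "KK u powr q \<le> c1 * N u powr p + c2 * (Cx * N u powr p)" by (simp only: ennreal_le_iff)
    also have "c1 * N u powr p = (2 powr q * C1 * r powr th) * N u powr q"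
    proof -
      have "N u powr (q - p) * N u powr p = N u powr q" by (simp add: powr_add[symmetric])
      then show ?thesis unfolding c1_def by (simp add: mult.assoc)
    qed
    also have "\<dots> \<le> eps powr q / 4 * N u powr q" using r(3) by (intro mult_right_mono) auto
    finally show ?thesis unfolding u_def c2_def by (simp add: mult.assoc)
  qed
  have "\<exists>i. \<bar>x i u\<bar> > eta * N u" if u: "u \<in> E" "u \<noteq> 0" and big: "eps * N u \<le> KK u" for u
  proof (rule ccontr)
    assume "\<not> ?thesis"
    then have small: "\<bar>x i u\<bar> \<le> eta * N u" for i by (simp add: not_less)
    define C' where "C' = Cx powr (1 / p)"
    \<comment> \<open>The functionals at \<open>v\<close> exceed the threshold for \<open>u\<close>
      by at most \<open>C' * N (v - u)\<close>, so \<open>claim\<close> makes \<open>F\<close>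
      nonpositive at test functions. At \<open>u\<close> it is positive and continuous, which
      contradicts density.\<close>
    define F where "F v = KK v powr q - (eps powr q / 4 * N v powr q + 2 powr q * (eta * N u + C' * N (v - u)) powr (q - p) * Cx * N v powr p)" for v
    have Nu: "N u > 0" by (rule N_pos[OF u])
    have Ku: "KK u > 0" using big Nu eps by (smt (verit) mult_pos_pos)
    have "(F \<longlongrightarrow> KK u powr q - (eps powr q / 4 * N u powr q + 2 powr q * (eta * N u + C' * 0) powr (q - p) * Cx * N u powr p)) (nb u)"
      unfolding F_def[abs_def]
      using Nu Ku eta by (intro tendsto_intros tendsto_K tendsto_N filterlim_ident nb_id u(1)) auto
    moreover have "0 < KK u powr q - (eps powr q / 4 * N u powr q + 2 powr q * (eta * N u + C' * 0) powr (q - p) * Cx * N u powr p)"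
    proof -
      have "(eps * N u) powr q \<le> KK u powr q" using big eps Nu q0 by (intro powr_mono2) auto
      then have 1: "eps powr q * N u powr q \<le> KK u powr q" by (simp add: powr_mult)
      have "N u powr (q - p) * N u powr p = N u powr q" by (simp add: powr_add[symmetric])
      then have "2 powr q * (eta * N u + C' * 0) powr (q - p) * Cx * N u powr p = (2 powr q * Cx * eta powr (q - p)) * N u powr q"
        by (simp add: powr_mult ac_simps)
      also have "\<dots> \<le> eps powr q / 4 * N u powr q" using eta(2) by (intro mult_right_mono) auto
      finally have 2: "2 powr q * (eta * N u + C' * 0) powr (q - p) * Cx * N u powr p \<le> eps powr q / 4 * N u powr q" .
      have "0 < eps powr q * N u powr q" using eps Nu by simp
      then show ?thesis using 1 2 by linarith
    qed
    ultimately have "\<forall>\<^sub>F v in nb u. F v > 0" by (rule order_tendstoD(1))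
    then obtain d where d: "d > 0" "\<And>v. v \<in> E \<Longrightarrow> N (v - u) < d \<Longrightarrow> F v > 0" unfolding eventually_nb by blast
    obtain \<phi> where \<phi>: "\<phi> \<in> test_functions M" "N (u - abs_aefun \<phi>) < d" using E_approx[OF u(1) d(1)] by blast
    have \<phi>E: "abs_aefun \<phi> \<in> E" by (rule test_function_E[OF \<phi>(1)])
    have "\<bar>x j (abs_aefun \<phi>)\<bar> \<le> eta * N u + C' * N (abs_aefun \<phi> - u)" for j
    proof -
      have "x j (abs_aefun \<phi>) - x j u = x j (abs_aefun \<phi> - u)" using linear_fun_onD(3)[OF X.x_lin \<phi>E u(1)] by simp
      moreover have "\<bar>x j (abs_aefun \<phi> - u)\<bar> \<le> C' * N (abs_aefun \<phi> - u)"
        unfolding C'_def using \<phi>E u(1) by (intro X.x_bound) auto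
      ultimately show ?thesis using small[of j] by linarith
    qed
    from claim[OF \<phi>(1) this] have "F (abs_aefun \<phi>) \<le> 0" unfolding F_def by simp
    moreover have "F (abs_aefun \<phi>) > 0" using d(2)[OF \<phi>E] \<phi>(2) N_commute[of u "abs_aefun \<phi>"] by simp
    ultimately show False by simp
  qed
  then show ?thesis using eta(1) fam by blast
qed

end

section \<open>Affine changes of variables and dilations in x2\<close>

lemma frechet_derivative_gradient:
  assumes "smooth \<phi>"
  shows "frechet_derivative \<phi> (at z) v = v \<bullet> gradient \<phi> z"
proof -
  note lin = linear_frechet_derivative[OF smooth_differentiable[OF assms, of z]]
  have "frechet_derivative \<phi> (at z) v = (\<Sum>b\<in>Basis. frechet_derivative \<phi> (at z) ((v \<bullet> b) *\<^sub>R b))"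
    using linear_sum[OF lin, where g = "\<lambda>b. (v \<bullet> b) *\<^sub>R b" and S = Basis] by (simp add: euclidean_representation)
  also have "\<dots> = (\<Sum>b\<in>Basis. (v \<bullet> b) * (gradient \<phi> z \<bullet> b))"
    using linear_scale[OF lin] by (intro sum.cong) (auto simp: gradient_inner)
  also have "\<dots> = v \<bullet> gradient \<phi> z" by (rule euclidean_inner[symmetric])
  finally show ?thesis .
qed

lemma gradient_linear_combination:
  assumes "finite I" "\<And>i. i \<in> I \<Longrightarrow> smooth (f i)"
  shows "gradient (\<lambda>x. \<Sum>i\<in>I. c i * f i x) x = (\<Sum>i\<in>I. c i *\<^sub>R gradient (f i) x)"
proof -
  have "((\<lambda>x. \<Sum>i\<in>I. c i * f i x) has_derivative (\<lambda>v. \<Sum>i\<in>I. c i * frechet_derivative (f i) (at x) v)) (at x)"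
    using smooth_differentiable[OF assms(2)] unfolding frechet_derivative_works
    by (intro has_derivative_sum has_derivative_mult_right) auto
  then have e: "frechet_derivative (\<lambda>x. \<Sum>i\<in>I. c i * f i x) (at x) = (\<lambda>v. \<Sum>i\<in>I. c i * frechet_derivative (f i) (at x) v)"
    by (rule frechet_derivative_at[symmetric])
  show ?thesis
    by (rule euclidean_eqI) (simp add: gradient_inner e inner_sum_left)
qed

lemma disjoint_sum_powr:
  fixes g :: "nat \<Rightarrow> 'b::real_normed_vector"
  assumes I: "finite I" and S: "disjoint_family S" "\<And>k. k \<in> I \<Longrightarrow> x \<notin> S k \<Longrightarrow> g k = 0" and p: "p > 0"
  shows "norm (\<Sum>k\<in>I. c k *\<^sub>R g k) powr p = (\<Sum>k\<in>I. \<bar>c k\<bar> powr p * norm (g k) powr p)"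
proof (cases "\<exists>k\<in>I. x \<in> S k")
  case True
  then obtain k where k: "k \<in> I" "x \<in> S k" by blast
  have z: "g j = 0" if "j \<in> I - {k}" for j
    using S(2)[of j] S(1) k that unfolding disjoint_family_on_def by blast
  have "(\<Sum>k\<in>I. c k *\<^sub>R g k) = c k *\<^sub>R g k"
    using z by (simp add: sum.remove[OF I k(1)] sum.neutral)
  moreover have "(\<Sum>k\<in>I. \<bar>c k\<bar> powr p * norm (g k) powr p) = \<bar>c k\<bar> powr p * norm (g k) powr p"
    using z p by (simp add: sum.remove[OF I k(1)] sum.neutral)
  ultimately show ?thesis by (simp add: powr_mult)
next
  case False
  then have "g k = 0" if "k \<in> I" for k using S(2) that by blast
  then show ?thesis using p by simp
qed

text \<open>Two uses: \<open>aff 1 s 0\<close> is a dilation in x2, a symmetry of the corner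
  gradient and of the norm; \<open>aff s s t\<close> concentrates functions near the face x1 =
  0.\<close>

definition aff :: "real \<Rightarrow> real \<Rightarrow> real \<Rightarrow> 'n::finite pt \<Rightarrow> 'n pt" where
  "aff s1 s2 t x = (s1 * fst x, t + s2 * fst (snd x), snd (snd x))"

lemma aff_eq: "aff s1 s2 t x = (0, t, 0) + aff s1 s2 0 x"
  unfolding aff_def by simp

lemma aff_linear: "bounded_linear (aff s1 s2 0 :: 'n::finite pt \<Rightarrow> 'n pt)"
  unfolding aff_def[abs_def]
  by (intro bounded_linear_Pair) (auto intro!: bounded_linear_intros)

lemma aff_measurable [measurable]: "aff s1 s2 t \<in> borel_measurable borel"
  unfolding aff_def[abs_def] by (intro borel_measurable_continuous_onI continuous_intros)

lemma smooth_aff: "smooth \<phi> \<Longrightarrow> smooth (\<lambda>x. \<phi> (aff s1 s2 t x))"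
  using smooth_intros(4)[OF _ aff_linear, of \<phi> "(0, t, 0)" s1 s2] unfolding aff_eq[of s1 s2 t] by simp

lemma gradient_aff:
  assumes "smooth \<phi>"
  shows "gradient (\<lambda>x. \<phi> (aff s1 s2 t x)) x = aff s1 s2 0 (gradient \<phi> (aff s1 s2 t x))"
proof (rule euclidean_eqI)
  fix b :: "'a pt" assume b: "b \<in> Basis"
  have "gradient (\<lambda>x. \<phi> (aff s1 s2 t x)) x \<bullet> b = frechet_derivative (\<lambda>x. \<phi> ((0, t, 0) + aff s1 s2 0 x)) (at x) b"
    using gradient_inner[OF b] unfolding aff_eq[of s1 s2 t] by simp
  also have "\<dots> = frechet_derivative \<phi> (at ((0, t, 0) + aff s1 s2 0 x)) (aff s1 s2 0 b)"
    using frechet_derivative_at[OF has_derivative_affine_compose[OF smooth_differentiable[OF assms] aff_linear]] by metis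
  also have "\<dots> = aff s1 s2 0 b \<bullet> gradient \<phi> (aff s1 s2 t x)"
    unfolding aff_eq[of s1 s2 t, symmetric] by (rule frechet_derivative_gradient[OF assms])
  also have "\<dots> = aff s1 s2 0 (gradient \<phi> (aff s1 s2 t x)) \<bullet> b"
    unfolding aff_def by (simp add: inner_prod_def inner_commute)
  finally show "gradient (\<lambda>x. \<phi> (aff s1 s2 t x)) x \<bullet> b = aff s1 s2 0 (gradient \<phi> (aff s1 s2 t x)) \<bullet> b" .
qed

lemma nn_integral_pt:
  fixes F :: "'n::finite pt \<Rightarrow> ennreal"
  assumes [measurable]: "F \<in> borel_measurable borel"
  shows "(\<integral>\<^sup>+x. F x \<partial>lborel) = (\<integral>\<^sup>+a. (\<integral>\<^sup>+b. (\<integral>\<^sup>+y. F (a, b, y) \<partial>lborel) \<partial>lborel) \<partial>lborel)"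
proof -
  have "(\<integral>\<^sup>+x. F x \<partial>lborel) = (\<integral>\<^sup>+a. (\<integral>\<^sup>+w. F (a, w) \<partial>lborel) \<partial>lborel)"
    unfolding lborel_prod[symmetric, where 'a = real and 'b = "real \<times> (real, 'n) vec"]
    by (rule lborel.nn_integral_fst[symmetric]) (simp add: lborel_prod)
  also have "\<dots> = (\<integral>\<^sup>+a. (\<integral>\<^sup>+b. (\<integral>\<^sup>+y. F (a, b, y) \<partial>lborel) \<partial>lborel) \<partial>lborel)"
  proof (rule nn_integral_cong)
    fix a :: real
    have "(\<lambda>w. F (a, w)) \<in> borel_measurable borel" by measurable
    then show "(\<integral>\<^sup>+w. F (a, w) \<partial>lborel) = (\<integral>\<^sup>+b. (\<integral>\<^sup>+y. F (a, b, y) \<partial>lborel) \<partial>lborel)"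
      unfolding lborel_prod[symmetric, where 'a = real and 'b = "(real, 'n) vec"]
      by (intro lborel.nn_integral_fst[symmetric]) (simp add: lborel_prod)
  qed
  finally show ?thesis .
qed

lemma nn_integral_aff:
  fixes F :: "'n::finite pt \<Rightarrow> ennreal"
  assumes F[measurable]: "F \<in> borel_measurable borel" and s: "s1 > 0" "s2 > 0"
  shows "(\<integral>\<^sup>+x. F (aff s1 s2 t x) \<partial>lborel) = ennreal (1 / (s1 * s2)) * (\<integral>\<^sup>+x. F x \<partial>lborel)"
proof -
  have [measurable]: "(\<lambda>w. F (f w, g w, h w)) \<in> borel_measurable N"
    if [measurable]: "f \<in> borel_measurable N" "g \<in> borel_measurable N" "h \<in> borel_measurable N"
    for f g h and N :: "'c measure"
    by measurable
  have "(\<integral>\<^sup>+x. F x \<partial>lborel) = (\<integral>\<^sup>+a. (\<integral>\<^sup>+b. (\<integral>\<^sup>+y. F (a, b, y) \<partial>lborel) \<partial>lborel) \<partial>lborel)"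
    by (rule nn_integral_pt[OF F])
  also have "\<dots> = ennreal \<bar>s1\<bar> * (\<integral>\<^sup>+a. (\<integral>\<^sup>+b. (\<integral>\<^sup>+y. F (0 + s1 * a, b, y) \<partial>lborel) \<partial>lborel) \<partial>lborel)"
    using s by (intro nn_integral_real_affine) auto
  also have "\<dots> = ennreal \<bar>s1\<bar> * (\<integral>\<^sup>+a. ennreal \<bar>s2\<bar> * (\<integral>\<^sup>+b. (\<integral>\<^sup>+y. F (0 + s1 * a, t + s2 * b, y) \<partial>lborel) \<partial>lborel) \<partial>lborel)"
    using s by (intro arg_cong2[where f = "(*)"] nn_integral_cong nn_integral_real_affine refl) auto
  also have "\<dots> = ennreal \<bar>s1\<bar> * (ennreal \<bar>s2\<bar> * (\<integral>\<^sup>+a. (\<integral>\<^sup>+b. (\<integral>\<^sup>+y. F (aff s1 s2 t (a, b, y)) \<partial>lborel) \<partial>lborel) \<partial>lborel))"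
    unfolding aff_def by (subst nn_integral_cmult) auto
  also have "(\<integral>\<^sup>+a. (\<integral>\<^sup>+b. (\<integral>\<^sup>+y. F (aff s1 s2 t (a, b, y)) \<partial>lborel) \<partial>lborel) \<partial>lborel) = (\<integral>\<^sup>+x. F (aff s1 s2 t x) \<partial>lborel)"
    by (rule nn_integral_pt[symmetric]) measurable
  finally have "ennreal (1 / (s1 * s2)) * (\<integral>\<^sup>+x. F x \<partial>lborel) =
    ennreal (1 / (s1 * s2)) * (ennreal s1 * (ennreal s2 * (\<integral>\<^sup>+x. F (aff s1 s2 t x) \<partial>lborel)))"
    using s by simp
  also have "\<dots> = (\<integral>\<^sup>+x. F (aff s1 s2 t x) \<partial>lborel)"
    using s by (simp add: mult.assoc[symmetric] ennreal_mult[symmetric])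
  finally show ?thesis by simp
qed

context corner_bump
begin

lemma test_function_aff:
  assumes \<phi>: "\<phi> \<in> test_functions M" and s: "s1 > 0" "s2 > 0" and pre: "\<And>x. aff s1 s2 t x \<in> M \<Longrightarrow> x \<in> M"
  shows "(\<lambda>x. \<phi> (aff s1 s2 t x)) \<in> test_functions M"
proof -
  from \<phi> obtain K where K: "smooth \<phi>" "compact K" "K \<subseteq> M" "\<And>x. x \<notin> K \<Longrightarrow> \<phi> x = 0"
    by (rule test_functionsD) blast
  define inv :: "'n pt \<Rightarrow> 'n pt" where "inv = aff (1 / s1) (1 / s2) (- t / s2)"
  have inv1: "inv (aff s1 s2 t x) = x" for x
    unfolding inv_def aff_def using s by (simp add: prod_eq_iff add_divide_distrib)
  have inv2: "aff s1 s2 t (inv x) = x" for x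
    unfolding inv_def aff_def using s by (simp add: prod_eq_iff right_diff_distrib)
  show ?thesis
  proof (rule test_functionsI[OF smooth_aff[OF K(1)]])
    show "compact (inv ` K)" unfolding inv_def aff_def[abs_def]
      by (intro compact_continuous_image K continuous_intros)
    show "inv ` K \<subseteq> M"
    proof
      fix x assume "x \<in> inv ` K"
      then have "aff s1 s2 t x \<in> K" using inv2 by auto
      then show "x \<in> M" using K(3) pre by blast
    qed
    show "\<phi> (aff s1 s2 t x) = 0" if "x \<notin> inv ` K" for x
      using K(4)[of "aff s1 s2 t x"] that inv1[of x] by (metis imageI)
  qed
qed

lemma dilation_M: "s \<ge> 1 \<Longrightarrow> aff 1 s 0 x \<in> M \<Longrightarrow> x \<in> M"
proof -
  assume s: "s \<ge> 1" and x: "aff 1 s 0 x \<in> M"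
  then have "0 < s * fst (snd x)" "s * fst (snd x) < \<delta>" unfolding M_iff aff_def by auto
  moreover then have "0 < fst (snd x)" using s by (simp add: zero_less_mult_iff)
  then have "fst (snd x) \<le> s * fst (snd x)" using s by simp
  ultimately have "fst (snd x) < \<delta>" by linarith
  then show "x \<in> M" using x \<open>0 < fst (snd x)\<close> unfolding M_iff aff_def by auto
qed

text \<open>The measure dx2 / x2 is dilation invariant. For \<open>s >= 1\<close> the pulled back
  function still lives on \<open>M\<close>, so nothing is lost at the boundary.\<close>

lemma nn_integral_mu_dilation:
  assumes [measurable]: "F \<in> borel_measurable borel" and s: "s \<ge> 1" and F0: "\<And>x. x \<notin> M \<Longrightarrow> F x = 0"
  shows "(\<integral>\<^sup>+x. F (aff 1 s 0 x) \<partial>mu M) = (\<integral>\<^sup>+x. F x \<partial>mu M)"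
proof -
  define G where "G z = ennreal (s * (indicator M z / (fst z * fst (snd z)))) * F z" for z
  have [measurable]: "G \<in> borel_measurable borel" unfolding G_def by measurable
  have "(\<integral>\<^sup>+x. F (aff 1 s 0 x) \<partial>mu M) = (\<integral>\<^sup>+x. ennreal (indicator M x / (fst x * fst (snd x))) * F (aff 1 s 0 x) \<partial>lborel)"
    by (rule nn_integral_mu) measurable
  also have "\<dots> = (\<integral>\<^sup>+x. G (aff 1 s 0 x) \<partial>lborel)"
  proof (rule nn_integral_cong)
    fix x
    show "ennreal (indicator M x / (fst x * fst (snd x))) * F (aff 1 s 0 x) = G (aff 1 s 0 x)"
    proof (cases "aff 1 s 0 x \<in> M")
      case True
      then have "x \<in> M" by (rule dilation_M[OF s])
      then show ?thesis using True s unfolding G_def by (simp add: aff_def)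
    qed (simp add: F0 G_def)
  qed
  also have "\<dots> = ennreal (1 / (1 * s)) * (\<integral>\<^sup>+x. G x \<partial>lborel)" using s by (intro nn_integral_aff) auto
  also have "(\<integral>\<^sup>+x. G x \<partial>lborel) = (\<integral>\<^sup>+x. ennreal s * (ennreal (indicator M x / (fst x * fst (snd x))) * F x) \<partial>lborel)"
  proof (rule nn_integral_cong)
    fix x
    have "0 \<le> indicator M x / (fst x * fst (snd x))" using M_iff[of x] by (auto split: split_indicator)
    then show "G x = ennreal s * (ennreal (indicator M x / (fst x * fst (snd x))) * F x)"
      unfolding G_def using s by (subst ennreal_mult) (auto simp: mult.assoc)
  qed
  also have "\<dots> = ennreal s * (\<integral>\<^sup>+x. F x \<partial>mu M)"
    by (subst nn_integral_cmult, measurable, subst nn_integral_mu) auto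
  finally show ?thesis using s by (simp add: mult.assoc[symmetric] ennreal_mult[symmetric])
qed

text \<open>The density contributes \<open>s powr (1 - p)\<close> and the change of variables
  \<open>1 / s\<close>. This decay, while \<open>mu\<close> is invariant, makes \<open>K\<close>
  small along dilations.\<close>

lemma nn_integral_muK_dilation:
  assumes [measurable]: "F \<in> borel_measurable borel" and s: "s \<ge> 1" and F0: "\<And>x. x \<notin> M \<Longrightarrow> F x = 0"
  shows "(\<integral>\<^sup>+x. F (aff 1 s 0 x) \<partial>muK p M) = ennreal (s powr (- p)) * (\<integral>\<^sup>+x. F x \<partial>muK p M)"
proof -
  define G where "G z = ennreal (s powr (1 - p)) * (ennreal (indicator M z * (fst z * fst (snd z)) powr (p - 1)) * F z)" for z
  have [measurable]: "G \<in> borel_measurable borel" unfolding G_def by measurable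
  have "(\<integral>\<^sup>+x. F (aff 1 s 0 x) \<partial>muK p M) = (\<integral>\<^sup>+x. ennreal (indicator M x * (fst x * fst (snd x)) powr (p - 1)) * F (aff 1 s 0 x) \<partial>lborel)"
    by (rule nn_integral_muK) measurable
  also have "\<dots> = (\<integral>\<^sup>+x. G (aff 1 s 0 x) \<partial>lborel)"
  proof (rule nn_integral_cong)
    fix x
    show "ennreal (indicator M x * (fst x * fst (snd x)) powr (p - 1)) * F (aff 1 s 0 x) = G (aff 1 s 0 x)"
    proof (cases "aff 1 s 0 x \<in> M")
      case True
      then have x: "x \<in> M" by (rule dilation_M[OF s])
      have "(fst x * fst (snd x)) powr (p - 1) = s powr (1 - p) * (fst x * (s * fst (snd x))) powr (p - 1)"
        using s by (simp add: powr_mult powr_add[symmetric] ac_simps)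
      then show ?thesis using True x unfolding G_def by (simp add: aff_def ennreal_mult mult.assoc)
    qed (simp add: F0 G_def)
  qed
  also have "\<dots> = ennreal (1 / (1 * s)) * (\<integral>\<^sup>+x. G x \<partial>lborel)" using s by (intro nn_integral_aff) auto
  also have "(\<integral>\<^sup>+x. G x \<partial>lborel) = ennreal (s powr (1 - p)) * (\<integral>\<^sup>+x. F x \<partial>muK p M)"
    unfolding G_def by (subst nn_integral_cmult, measurable, subst nn_integral_muK) auto
  also have "ennreal (1 / (1 * s)) * (ennreal (s powr (1 - p)) * (\<integral>\<^sup>+x. F x \<partial>muK p M)) = ennreal (s powr (- p)) * (\<integral>\<^sup>+x. F x \<partial>muK p M)"
  proof -
    have "1 / s * s powr (1 - p) = s powr (- p)" using s by (simp add: powr_diff powr_minus field_simps)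
    then show ?thesis using s by (simp add: mult.assoc[symmetric] ennreal_mult[symmetric])
  qed
  finally show ?thesis .
qed

text \<open>The field x2 d2 commutes with dilations of x2.\<close>

lemma scaled_gradient_dilation:
  assumes "smooth \<phi>"
  shows "scaled x (gradient (\<lambda>x. \<phi> (aff 1 s 0 x)) x) = scaled (aff 1 s 0 x) (gradient \<phi> (aff 1 s 0 x))"
  unfolding gradient_aff[OF assms] by (simp add: scaled_def aff_def)

end

context corner_bump
begin

text \<open>The part of \<open>M\<close> away from the faces x1 = 0 and x2 = 0; it has finite
  \<open>mu\<close> measure and, for small \<alpha>, carries a given test function.\<close>

definition region :: "real \<Rightarrow> 'n pt set" where
  "region \<alpha> = {x \<in> M. \<alpha> \<le> fst x \<and> \<alpha> \<le> fst (snd x)}"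

lemma region_measurable [measurable]: "region \<alpha> \<in> sets borel"
proof -
  have "region \<alpha> = M \<inter> {x. \<alpha> \<le> fst x} \<inter> {x. \<alpha> \<le> fst (snd x)}" unfolding region_def by auto
  moreover have "{x :: 'n pt. \<alpha> \<le> fst x} \<in> sets borel" by measurable
  moreover have "{x :: 'n pt. \<alpha> \<le> fst (snd x)} \<in> sets borel" by measurable
  ultimately show ?thesis by auto
qed

lemma emeasure_M_finite: "emeasure lborel M < \<infinity>"
proof (rule emeasure_bounded_finite)
  have "bounded ({0..\<delta>} \<times> {0..\<delta>} \<times> X)" using X by (intro bounded_Times) auto
  then show "bounded M" by (rule bounded_subset) (auto simp: M corner_def)
qed

lemma region_finite:
  assumes "\<alpha> > 0"
  shows "emeasure (mu M) (region \<alpha>) < \<infinity>"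
proof -
  have "emeasure (mu M) (region \<alpha>) = (\<integral>\<^sup>+x. indicator (region \<alpha>) x \<partial>mu M)" by simp
  also have "\<dots> = (\<integral>\<^sup>+x. ennreal (indicator M x / (fst x * fst (snd x))) * indicator (region \<alpha>) x \<partial>lborel)"
    by (rule nn_integral_mu) measurable
  also have "\<dots> \<le> (\<integral>\<^sup>+x. ennreal (1 / (\<alpha> * \<alpha>)) * indicator M x \<partial>lborel)"
  proof (rule nn_integral_mono)
    fix x
    show "ennreal (indicator M x / (fst x * fst (snd x))) * indicator (region \<alpha>) x \<le> ennreal (1 / (\<alpha> * \<alpha>)) * indicator M x"
    proof (cases "x \<in> region \<alpha>")
      case True
      then have x: "x \<in> M" "\<alpha> \<le> fst x" "\<alpha> \<le> fst (snd x)" unfolding region_def by auto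
      then have "1 / (fst x * fst (snd x)) \<le> 1 / (\<alpha> * \<alpha>)" using assms by (intro frac_le mult_mono) auto
      then show ?thesis using x True by (simp add: ennreal_leI)
    qed simp
  qed
  also have "\<dots> = ennreal (1 / (\<alpha> * \<alpha>)) * emeasure lborel M" by (subst nn_integral_cmult) auto
  also have "\<dots> < \<infinity>" using emeasure_M_finite by (simp add: ennreal_mult_less_top)
  finally show ?thesis .
qed

lemma support_region:
  assumes \<phi>: "\<phi> \<in> test_functions M"
  obtains \<alpha> where "\<alpha> > 0" "\<And>x. x \<notin> region \<alpha> \<Longrightarrow> \<phi> x = 0 \<and> gradient \<phi> x = 0"
proof -
  from \<phi> obtain K where K: "smooth \<phi>" "compact K" "K \<subseteq> M" "\<And>x. x \<notin> K \<Longrightarrow> \<phi> x = 0"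
      "\<And>x v. x \<notin> K \<Longrightarrow> frechet_derivative \<phi> (at x) v = 0"
    by (rule test_functionsD) blast
  have z: "\<phi> x = 0 \<and> gradient \<phi> x = 0" if "x \<notin> K" for x
    using K(4,5)[OF that] by (auto intro!: euclidean_eqI[of _ 0] simp: gradient_inner)
  show ?thesis
  proof (cases "K = {}")
    case True
    then show ?thesis using z that[of 1] by auto
  next
    case False
    have "continuous_on K (\<lambda>x. min (fst x) (fst (snd x)))" by (intro continuous_intros)
    from continuous_attains_inf[OF K(2) False this] obtain y
      where y: "y \<in> K" "\<And>x. x \<in> K \<Longrightarrow> min (fst y) (fst (snd y)) \<le> min (fst x) (fst (snd x))" by blast
    let ?\<alpha> = "min (fst y) (fst (snd y))"
    show ?thesis
    proof (rule that[of ?\<alpha>])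
      have "y \<in> M" using y(1) K(3) by blast
      then show "?\<alpha> > 0" unfolding M_iff by simp
      fix x assume x: "x \<notin> region ?\<alpha>"
      have "x \<notin> K"
      proof
        assume "x \<in> K"
        then have "x \<in> M" "?\<alpha> \<le> fst x" "?\<alpha> \<le> fst (snd x)" using K(3) y(2)[of x] by auto
        then show False using x unfolding region_def by blast
      qed
      then show "\<phi> x = 0 \<and> gradient \<phi> x = 0" by (rule z)
    qed
  qed
qed

lemma bump_integral:
  assumes \<phi>: "bump \<phi>" "\<phi> \<in> test_functions M"
  obtains I0 where "I0 > 0" "(\<integral>\<^sup>+x. ennreal (\<phi> x) \<partial>mu M) = ennreal I0"
proof -
  from \<phi>(2) obtain K where K: "smooth \<phi>" "compact K" "K \<subseteq> M" "\<And>x. x \<notin> K \<Longrightarrow> \<phi> x = 0"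
    by (rule test_functionsD) blast
  have nn: "\<phi> x \<ge> 0" for x using \<phi>(1) unfolding bump_def by blast
  have [measurable]: "\<phi> \<in> borel_measurable borel" by (rule test_borel[OF \<phi>(2)])
  have "continuous_on UNIV \<phi>" by (rule smooth_continuous[OF K(1)])
  then have "Lfin (mu M) 1 \<phi>" by (rule mu_compact_support_finite[OF _ K(2-4)]) auto
  from Lnorm_nn[OF this] have e: "(\<integral>\<^sup>+x. ennreal (\<phi> x) \<partial>mu M) = ennreal (Lnorm (mu M) 1 \<phi>)"
    using nn by simp
  show ?thesis
  proof (rule that[OF _ e])
    have "Lnorm (mu M) 1 \<phi> \<noteq> 0"
    proof
      assume 0: "Lnorm (mu M) 1 \<phi> = 0"
      have "(\<integral>\<^sup>+x. ennreal (\<phi> x) \<partial>mu M) = 0" using e 0 by simp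
      then have "AE x in mu M. \<phi> x = 0"
        using nn by (subst (asm) nn_integral_0_iff_AE) (auto simp: borel_mu elim!: eventually_mono intro: antisym)
      then have "AE x in lborel. x \<in> M \<longrightarrow> \<phi> x = 0" unfolding AE_mu_iff .
      then have "AE x in lborel. \<phi> x = 0" by eventually_elim (use K in blast)
      then have "(\<integral>x. \<phi> x \<partial>lborel) = 0" by (rule integral_eq_zero_AE)
      then show False using \<phi>(1) unfolding bump_def by simp
    qed
    then show "Lnorm (mu M) 1 \<phi> > 0" using Lnorm_ge0[of "mu M" 1 \<phi>] by linarith
  qed
qed

end

section \<open>Subspaces of any finite dimension on which \<open>K\<close> is small\<close>

context corner_embedding
begin

text \<open>The \<open>v k\<close> are dilates in x2 of one bump, with disjoint supports. By
  dilation invariance \<open>N\<close> of a combination is a multiple of the \<open>l^p\<close> norm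
  of its coefficients, while \<open>K powr q\<close> acquires the small factors
  \<open>s k powr (- p)\<close>. The dual functionals are normalised integrals over the dilated
  regions; their Bessel constant, and with it \<open>C0\<close>, depends neither on
  \<open>eps\<close> nor on the number of vectors.\<close>

lemma flat_directions:
  assumes \<phi>: "bump \<phi>" "\<phi> \<in> test_functions M"
  shows "\<exists>C0\<ge>1. \<forall>eps>0. \<forall>n :: nat. \<exists>v f D.
      (\<forall>k<n. v k \<in> E \<and> linear_fun_on E (f k) \<and> (\<forall>u\<in>E. \<bar>f k u\<bar> \<le> D * N u)) \<and>
      (\<forall>j<n. \<forall>k<n. f j (v k) = (if j = k then 1 else 0)) \<and>
      (\<forall>u\<in>E. N (\<Sum>k<n. f k u *\<^sub>R v k) \<le> C0 * N u) \<and>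
      (\<forall>a. KK (\<Sum>k<n. a k *\<^sub>R v k) \<le> eps * N (\<Sum>k<n. a k *\<^sub>R v k))"
proof -
  have nn: "\<phi> x \<ge> 0" for x using \<phi>(1) unfolding bump_def by blast
  have s\<phi>: "smooth \<phi>" using \<phi>(2) unfolding test_functions_def smooth_def by blast
  obtain \<alpha> where \<alpha>: "\<alpha> > 0" "\<And>x. x \<notin> region \<alpha> \<Longrightarrow> \<phi> x = 0 \<and> gradient \<phi> x = 0"
    by (rule support_region[OF \<phi>(2)]) blast
  have out: "\<phi> x = 0 \<and> gradient \<phi> x = 0" if "x \<notin> M" for x
    by (rule \<alpha>(2)) (use that in \<open>auto simp: region_def\<close>)
  obtain I0 where I0: "I0 > 0" "(\<integral>\<^sup>+x. ennreal (\<phi> x) \<partial>mu M) = ennreal I0"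
    by (rule bump_integral[OF \<phi>]) blast
  obtain C where C: "C > 0" "\<And>u. u \<in> E \<Longrightarrow> LP (rep_aefun u) \<le> C * N u" using poincare by blast
  define m where "m = enn2real (emeasure (mu M) (region \<alpha>)) + 1"
  have m: "m > 0" "emeasure (mu M) (region \<alpha>) \<le> ennreal m"
  proof -
    show "m > 0" unfolding m_def by (simp add: add_nonneg_pos)
    have "emeasure (mu M) (region \<alpha>) = ennreal (enn2real (emeasure (mu M) (region \<alpha>)))"
      using region_finite[OF \<alpha>(1)] by simp
    also have "\<dots> \<le> ennreal m" unfolding m_def by (intro ennreal_leI) simp
    finally show "emeasure (mu M) (region \<alpha>) \<le> ennreal m" .
  qed
  define A where "A = \<bar>1 / I0\<bar> powr p * m powr (p - 1)"
  define Cf where "Cf = A * C powr p"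
  have A: "A \<ge> 0" unfolding A_def by simp
  have Cf: "Cf \<ge> 0" unfolding Cf_def using A by simp
  define G0 where "G0 = N (abs_aefun \<phi>)"
  define K0 where "K0 = KK (abs_aefun \<phi>) powr q"
  have G0: "(\<integral>\<^sup>+x. ennreal (norm (scaled x (gradient \<phi> x)) powr p) \<partial>mu M) = ennreal (G0 powr p)"
    unfolding G0_def N_test[OF \<phi>(2)] by (rule Lnorm_nn[OF test_function_HH(3)[OF \<phi>(2)] p0])
  have [measurable]: "\<phi> \<in> borel_measurable borel" by (rule test_borel[OF \<phi>(2)])
  have K0: "(\<integral>\<^sup>+x. ennreal (norm (\<phi> x) powr q) \<partial>muK p M) = ennreal K0"
  proof -
    have "(\<integral>\<^sup>+x. ennreal (norm (\<phi> x) powr q) \<partial>muK p M) = (\<integral>\<^sup>+x. ennreal (norm (rep_aefun (abs_aefun \<phi>) x) powr q) \<partial>muK p M)"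
      by (rule nn_integral_cong_AE, rule AE_muK, rule AE_mu)
        (use rep_abs_aefun[of \<phi>] in \<open>auto elim!: eventually_mono\<close>)
    also have "\<dots> = ennreal K0" unfolding K0_def KK_def
      using embed[OF test_function_E[OF \<phi>(2)]] q0 by (intro Lnorm_nn) auto
    finally show ?thesis .
  qed
  define C1 where "C1 = (Cf * G0 powr p) powr (1 / p)"
  \<comment> \<open>On a dilated region \<open>s k * x2\<close> lies between \<alpha> and \<delta>;
    consecutive dilation factors with quotient at least \<open>\<delta> / \<alpha>\<close> therefore
    give disjoint regions.\<close>
  define \<rho> where "\<rho> = max 2 (\<delta> / \<alpha>)"
  have \<rho>: "\<rho> \<ge> 2" "\<rho> * \<alpha> \<ge> \<delta>" unfolding \<rho>_def using \<alpha>(1) by (auto simp: max_def field_simps)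
  have V: "\<exists>v f D. (\<forall>k<n. v k \<in> E \<and> linear_fun_on E (f k) \<and> (\<forall>u\<in>E. \<bar>f k u\<bar> \<le> D * N u)) \<and>
      (\<forall>j<n. \<forall>k<n. f j (v k) = (if j = k then 1 else 0)) \<and>
      (\<forall>u\<in>E. N (\<Sum>k<n. f k u *\<^sub>R v k) \<le> max 1 C1 * N u) \<and>
      (\<forall>a. KK (\<Sum>k<n. a k *\<^sub>R v k) \<le> eps * N (\<Sum>k<n. a k *\<^sub>R v k))"
    if eps: "eps > 0" for eps and n :: nat
  proof -
    have "((\<lambda>l. K0 * (Cf * (Cf powr (1 / p)) powr (q - p)) * (\<rho> powr (- p)) ^ l) \<longlonglongrightarrow>
        K0 * (Cf * (Cf powr (1 / p)) powr (q - p)) * 0)"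
      using \<rho> p0 by (intro tendsto_mult tendsto_const LIMSEQ_realpow_zero) (auto intro!: powr_less_one)
    moreover have "0 < eps powr q" using eps by simp
    ultimately obtain l0 where l0: "K0 * (Cf * (Cf powr (1 / p)) powr (q - p)) * (\<rho> powr (- p)) ^ l0 \<le> eps powr q"
      using eventually_happens[OF order_tendstoD(2)[of _ _ sequentially "eps powr q"]]
      by (metis (no_types, lifting) less_imp_le mult_zero_right trivial_limit_sequentially)
    \<comment> \<open>The common factor \<open>\<rho> ^ l0\<close> makes \<open>K\<close> small on
      all vectors at once; the further powers separate the supports.\<close>
    define s where "s k = \<rho> ^ (l0 + k)" for k :: nat
    have s: "s k \<ge> 1" for k unfolding s_def using \<rho> by (intro one_le_power) auto
    define S where "S k = aff 1 (s k) 0 -` region \<alpha>" for k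
    have S[measurable]: "S k \<in> sets borel" for k
      unfolding S_def by (rule measurable_sets_borel[OF aff_measurable region_measurable])
    have S_ind: "indicator (S k) x = (indicator (region \<alpha>) (aff 1 (s k) 0 x) :: 'c::zero_neq_one)" for k x
      unfolding S_def indicator_def by simp
    have disj: "disjoint_family S"
    proof -
      have "S j \<inter> S k = {}" if "j < k" for j k
      proof (rule ccontr)
        assume "S j \<inter> S k \<noteq> {}"
        then obtain x where "aff 1 (s j) 0 x \<in> region \<alpha>" "aff 1 (s k) 0 x \<in> region \<alpha>" unfolding S_def by blast
        then have 1: "\<alpha> \<le> s j * fst (snd x)" "s k * fst (snd x) < \<delta>" "0 < s k * fst (snd x)"
          unfolding region_def M_iff aff_def by auto
        have e: "s k = \<rho> ^ (k - j) * s j" unfolding s_def using that by (simp add: power_add[symmetric] add.commute)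
        have "\<rho> ^ 1 \<le> \<rho> ^ (k - j)" using that \<rho> by (intro power_increasing) auto
        then have "\<rho> * \<alpha> \<le> \<rho> ^ (k - j) * (s j * fst (snd x))" using 1 \<rho> \<alpha>(1) by (intro mult_mono) auto
        then show False using 1 \<rho> unfolding e by (simp add: mult.assoc)
      qed
      then show ?thesis unfolding disjoint_family_on_def by (metis inf_commute linorder_neqE_nat)
    qed
    define e where "e k x = \<phi> (aff 1 (s k) 0 x)" for k x
    have e0: "e k x = 0" "gradient (e k) x = 0" if "x \<notin> S k" for k x
    proof -
      have z: "aff 1 (s k) 0 x \<notin> region \<alpha>" using that unfolding S_def by simp
      then show "e k x = 0" unfolding e_def using \<alpha>(2) by blast
      show "gradient (e k) x = 0" using \<alpha>(2)[OF z] gradient_aff[OF s\<phi>, of 1 "s k" 0 x]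
        unfolding e_def[abs_def] by (simp add: aff_def zero_prod_def[symmetric])
    qed
    have eT: "e k \<in> test_functions M" for k
      unfolding e_def[abs_def] by (rule test_function_aff[OF \<phi>(2)]) (use s[of k] dilation_M[OF s[of k]] in simp_all)
    have es: "smooth (e k)" for k using eT[of k] unfolding test_functions_def smooth_def by blast
    have [measurable]: "e k \<in> borel_measurable borel" for k by (rule test_borel[OF eT])
    have Smu: "emeasure (mu M) (S k) \<le> ennreal m" for k
    proof -
      have "emeasure (mu M) (S k) = (\<integral>\<^sup>+x. indicator (region \<alpha>) (aff 1 (s k) 0 x) \<partial>mu M)"
        by (simp add: S_ind[symmetric])
      also have "\<dots> = (\<integral>\<^sup>+x. indicator (region \<alpha>) x \<partial>mu M)"
        by (rule nn_integral_mu_dilation[OF _ s]) (auto simp: region_def)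
      finally show ?thesis using m(2) by simp
    qed
    have eI: "(\<integral>x. e k x \<partial>mu M) = I0" for k
    proof -
      have "(\<integral>\<^sup>+x. ennreal (e k x) \<partial>mu M) = ennreal I0"
        unfolding e_def using nn_integral_mu_dilation[of "\<lambda>x. ennreal (\<phi> x)", OF _ s[of k]] out I0(2) by simp
      then show ?thesis using I0(1) nn
        by (subst integral_eq_nn_integral) (auto simp: e_def borel_mu)
    qed
    define f where "f k u = (1 / I0) * region_integral (S k) u" for k u
    define v where "v k = abs_aefun (e k)" for k
    have vE: "v k \<in> E" for k unfolding v_def by (rule test_function_E[OF eT])
    have fv: "f j (v k) = (if j = k then 1 else 0)" for j k
    proof -
      have "region_integral (S j) (v k) = (\<integral>x. indicator (S j) x * e k x \<partial>mu M)"
        unfolding region_integral_def v_def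
        by (rule integral_cong_AE, measurable, rule AE_mu)
          (use rep_abs_aefun[of "e k"] in \<open>auto elim!: eventually_mono\<close>)
      also have "\<dots> = (\<integral>x. (if j = k then e k x else 0) \<partial>mu M)"
      proof (rule Bochner_Integration.integral_cong[OF refl])
        fix x show "indicator (S j) x * e k x = (if j = k then e k x else 0)"
          using e0(1)[of x k] disj unfolding disjoint_family_on_def by (auto split: split_indicator)
      qed
      also have "\<dots> = (if j = k then I0 else 0)" using eI[of k] by simp
      finally show ?thesis unfolding f_def using I0(1) by simp
    qed
    have ao: "almost_orthogonal_functionals E N f p Cf"
      unfolding f_def[abs_def] Cf_def
      by (rule region_functionals[OF S disj Smu m(1) _ C]) (simp add: A_def)
    interpret ao: almost_orthogonal_functionals E N f p Cf by (rule ao)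
    have comb: "(\<Sum>k<n. a k *\<^sub>R v k) = abs_aefun (\<lambda>x. \<Sum>k<n. a k * e k x)" for a :: "nat \<Rightarrow> real"
      unfolding v_def by (simp add: abs_aefun_scale abs_aefun_sum)
    have combT: "(\<lambda>x. \<Sum>k<n. a k * e k x) \<in> test_functions M" for a :: "nat \<Rightarrow> real"
      by (intro test_functions_sum test_functions_scale eT) simp
    have Ncomb: "N (\<Sum>k<n. a k *\<^sub>R v k) powr p = (\<Sum>k<n. \<bar>a k\<bar> powr p) * G0 powr p" for a
    proof -
      have "ennreal (N (\<Sum>k<n. a k *\<^sub>R v k) powr p) =
          (\<integral>\<^sup>+x. ennreal (norm (scaled x (gradient (\<lambda>x. \<Sum>k<n. a k * e k x) x)) powr p) \<partial>mu M)"
        unfolding comb N_test[OF combT] by (rule Lnorm_nn[OF test_function_HH(3)[OF combT] p0, symmetric])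
      also have "\<dots> = (\<integral>\<^sup>+x. (\<Sum>k<n. ennreal (\<bar>a k\<bar> powr p) * ennreal (norm (scaled x (gradient (e k) x)) powr p)) \<partial>mu M)"
      proof (rule nn_integral_cong)
        fix x :: "'n pt"
        have l: "linear (scaled x)"
          by (rule linearI) (auto simp: scaled_def algebra_simps)
        have "scaled x (gradient (\<lambda>x. \<Sum>k<n. a k * e k x) x) = (\<Sum>k<n. a k *\<^sub>R scaled x (gradient (e k) x))"
          using gradient_linear_combination[of "{..<n}" e a x] es
          by (simp add: linear_sum[OF l] linear_scale[OF l])
        moreover have "norm (\<Sum>k<n. a k *\<^sub>R scaled x (gradient (e k) x)) powr p =
            (\<Sum>k<n. \<bar>a k\<bar> powr p * norm (scaled x (gradient (e k) x)) powr p)"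
          by (rule disjoint_sum_powr[OF _ disj _ p0, of _ x]) (auto simp: e0 linear_0[OF l])
        ultimately show "ennreal (norm (scaled x (gradient (\<lambda>x. \<Sum>k<n. a k * e k x) x)) powr p) =
            (\<Sum>k<n. ennreal (\<bar>a k\<bar> powr p) * ennreal (norm (scaled x (gradient (e k) x)) powr p))"
          by (simp add: ennreal_mult[symmetric] sum_ennreal)
      qed
      also have "\<dots> = (\<Sum>k<n. ennreal (\<bar>a k\<bar> powr p) * (\<integral>\<^sup>+x. ennreal (norm (scaled x (gradient (e k) x)) powr p) \<partial>mu M))"
      proof -
        have [measurable]: "(\<lambda>x. scaled x (gradient (e k) x)) \<in> borel_measurable borel" for k
          by (rule borel_measurable_continuous_onI[OF scaled_gradient_continuous[OF es]])
        show ?thesis by (subst nn_integral_sum) (auto simp: nn_integral_cmult borel_mu)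
      qed
      also have "\<dots> = (\<Sum>k<n. ennreal (\<bar>a k\<bar> powr p) * ennreal (G0 powr p))"
      proof (intro sum.cong refl arg_cong2[where f = "(*)"])
        fix k
        have [measurable]: "(\<lambda>x. scaled x (gradient \<phi> x)) \<in> borel_measurable borel"
          by (rule borel_measurable_continuous_onI[OF scaled_gradient_continuous[OF s\<phi>]])
        have "(\<integral>\<^sup>+x. ennreal (norm (scaled x (gradient (e k) x)) powr p) \<partial>mu M) =
          (\<integral>\<^sup>+x. ennreal (norm (scaled (aff 1 (s k) 0 x) (gradient \<phi> (aff 1 (s k) 0 x))) powr p) \<partial>mu M)"
          unfolding e_def[abs_def] scaled_gradient_dilation[OF s\<phi>] ..
        also have "\<dots> = (\<integral>\<^sup>+x. ennreal (norm (scaled x (gradient \<phi> x)) powr p) \<partial>mu M)"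
        proof (rule nn_integral_mu_dilation[of "\<lambda>x. ennreal (norm (scaled x (gradient \<phi> x)) powr p)", OF _ s])
          show "(\<lambda>x. ennreal (norm (scaled x (gradient \<phi> x)) powr p)) \<in> borel_measurable borel" by measurable
          show "ennreal (norm (scaled x (gradient \<phi> x)) powr p) = 0" if "x \<notin> M" for x
            using out[OF that] p0 by (simp add: scaled_def zero_prod_def[symmetric])
        qed
        finally show "(\<integral>\<^sup>+x. ennreal (norm (scaled x (gradient (e k) x)) powr p) \<partial>mu M) = ennreal (G0 powr p)"
          using G0 by simp
      qed
      also have "\<dots> = ennreal ((\<Sum>k<n. \<bar>a k\<bar> powr p) * G0 powr p)"
        by (simp add: ennreal_mult[symmetric] sum_ennreal sum_distrib_right)
      finally show ?thesis by (simp add: sum_nonneg)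
    qed
    have Kcomb: "KK (\<Sum>k<n. a k *\<^sub>R v k) powr q = (\<Sum>k<n. \<bar>a k\<bar> powr q * s k powr (- p)) * K0" for a
    proof -
      have "ennreal (KK (\<Sum>k<n. a k *\<^sub>R v k) powr q) = (\<integral>\<^sup>+x. ennreal (norm (rep_aefun (\<Sum>k<n. a k *\<^sub>R v k) x) powr q) \<partial>muK p M)"
        unfolding KK_def using embed[OF mem_sum[of "{..<n}" "\<lambda>k. a k *\<^sub>R v k"]] vE q0
        by (intro Lnorm_nn[symmetric]) auto
      also have "\<dots> = (\<integral>\<^sup>+x. (\<Sum>k<n. ennreal (\<bar>a k\<bar> powr q) * ennreal (norm (e k x) powr q)) \<partial>muK p M)"
      proof (rule nn_integral_cong_AE, rule AE_muK, rule AE_mu)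
        have "AE x in lborel. rep_aefun (\<Sum>k<n. a k *\<^sub>R v k) x = (\<Sum>k<n. a k * e k x)"
          unfolding comb by (rule rep_abs_aefun) measurable
        then show "AE x in lborel. x \<in> M \<longrightarrow> ennreal (norm (rep_aefun (\<Sum>k<n. a k *\<^sub>R v k) x) powr q) =
            (\<Sum>k<n. ennreal (\<bar>a k\<bar> powr q) * ennreal (norm (e k x) powr q))"
        proof eventually_elim
          case (elim x)
          have "norm (\<Sum>k<n. a k *\<^sub>R e k x) powr q = (\<Sum>k<n. \<bar>a k\<bar> powr q * norm (e k x) powr q)"
            by (rule disjoint_sum_powr[OF _ disj _ q0(1), of _ x]) (auto simp: e0)
          then show ?case using elim by (simp add: ennreal_mult[symmetric] sum_ennreal)
        qed
      qed
      also have "\<dots> = (\<Sum>k<n. ennreal (\<bar>a k\<bar> powr q) * (\<integral>\<^sup>+x. ennreal (norm (e k x) powr q) \<partial>muK p M))"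
        by (subst nn_integral_sum) (auto simp: nn_integral_cmult borel_muK)
      also have "\<dots> = (\<Sum>k<n. ennreal (\<bar>a k\<bar> powr q) * (ennreal (s k powr (- p)) * ennreal K0))"
      proof (intro sum.cong refl arg_cong2[where f = "(*)"])
        fix k
        show "(\<integral>\<^sup>+x. ennreal (norm (e k x) powr q) \<partial>muK p M) = ennreal (s k powr (- p)) * ennreal K0"
          unfolding e_def K0[symmetric] using out q0
          by (intro nn_integral_muK_dilation[of "\<lambda>x. ennreal (norm (\<phi> x) powr q)", OF _ s]) auto
      qed
      also have "\<dots> = ennreal ((\<Sum>k<n. \<bar>a k\<bar> powr q * s k powr (- p)) * K0)"
        unfolding K0_def by (simp add: ennreal_mult[symmetric] sum_ennreal sum_distrib_right mult.assoc)
      finally show ?thesis unfolding K0_def by (simp add: sum_nonneg)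
    qed
    show ?thesis
    proof (intro exI conjI allI impI ballI)
      show "v k \<in> E" for k by (rule vE)
      show "linear_fun_on E (f k)" for k by (rule ao.x_lin)
      show "\<bar>f k u\<bar> \<le> Cf powr (1 / p) * N u" if "u \<in> E" for k u by (rule ao.x_bound[OF that])
      show "f j (v k) = (if j = k then 1 else 0)" for j k by (rule fv)
    next
      fix u assume u: "u \<in> E"
      have "N (\<Sum>k<n. f k u *\<^sub>R v k) powr p \<le> Cf * N u powr p * G0 powr p"
        unfolding Ncomb using ao.x_sum[OF _ u, of "{..<n}"] by (intro mult_right_mono) auto
      then have "(N (\<Sum>k<n. f k u *\<^sub>R v k) powr p) powr (1 / p) \<le> ((Cf * G0 powr p) * N u powr p) powr (1 / p)"
        using p0 by (intro powr_mono2) (auto simp: mult_ac)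
      then have "\<bar>N (\<Sum>k<n. f k u *\<^sub>R v k)\<bar> \<le> C1 * \<bar>N u\<bar>"
        unfolding C1_def using p0 Cf by (simp add: powr_powr powr_mult)
      then have "N (\<Sum>k<n. f k u *\<^sub>R v k) \<le> C1 * N u" using N_ge0[of u] by simp
      also have "\<dots> \<le> max 1 C1 * N u" using N_ge0[of u] by (intro mult_right_mono) simp_all
      finally show "N (\<Sum>k<n. f k u *\<^sub>R v k) \<le> max 1 C1 * N u" .
    next
      fix a :: "nat \<Rightarrow> real"
      define w where "w = (\<Sum>k<n. a k *\<^sub>R v k)"
      have w: "w \<in> E" unfolding w_def using vE by (intro mem_sum) auto
      have fw: "f j w = a j" if "j < n" for j
      proof -
        have "f j w = (\<Sum>k<n. f j (a k *\<^sub>R v k))" unfolding w_def using vE by (intro linear_fun_on_sum[OF ao.x_lin]) auto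
        also have "\<dots> = (\<Sum>k<n. if j = k then a k else 0)"
          by (intro sum.cong refl) (simp add: linear_fun_onD(2)[OF ao.x_lin vE vE] fv)
        finally show ?thesis using that by simp
      qed
      let ?b = "Cf powr (1 / p) * N w"
      have "(\<Sum>k<n. \<bar>a k\<bar> powr q * s k powr (- p)) \<le> (\<Sum>k<n. (\<bar>f k w\<bar> powr p * ?b powr (q - p)) * (\<rho> powr (- p)) ^ l0)"
      proof (rule sum_mono)
        fix k assume "k \<in> {..<n}"
        then have k: "a k = f k w" using fw by simp
        \<comment> \<open>Of the \<open>q\<close> powers, \<open>q - p\<close> are bounded by the
          norm of a single functional; the other \<open>p\<close> are left for the Bessel
          inequality.\<close>
        have 1: "\<bar>a k\<bar> powr q \<le> \<bar>f k w\<bar> powr p * ?b powr (q - p)"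
        proof -
          have "\<bar>a k\<bar> powr q = \<bar>f k w\<bar> powr p * \<bar>f k w\<bar> powr (q - p)" unfolding k by (simp add: powr_add[symmetric])
          also have "\<dots> \<le> \<bar>f k w\<bar> powr p * ?b powr (q - p)"
            using ao.x_bound[OF w, of k] q by (intro mult_left_mono powr_mono2) auto
          finally show ?thesis .
        qed
        have 2: "s k powr (- p) \<le> (\<rho> powr (- p)) ^ l0"
        proof -
          have "(\<rho> ^ l0) powr (- p) = (\<rho> powr (- p)) ^ l0"
            using \<rho> by (simp add: powr_realpow[symmetric] powr_powr mult.commute)
          moreover have "s k powr (- p) \<le> (\<rho> ^ l0) powr (- p)"
            unfolding s_def using \<rho> p0 by (intro powr_mono2') (auto intro!: power_increasing)
          ultimately show ?thesis by simp
        qed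
        show "\<bar>a k\<bar> powr q * s k powr (- p) \<le> (\<bar>f k w\<bar> powr p * ?b powr (q - p)) * (\<rho> powr (- p)) ^ l0"
          by (rule mult_mono[OF 1 2]) auto
      qed
      also have "\<dots> = (\<Sum>k<n. \<bar>f k w\<bar> powr p) * (?b powr (q - p) * (\<rho> powr (- p)) ^ l0)"
        by (simp add: sum_distrib_right mult.assoc)
      also have "\<dots> \<le> (Cf * N w powr p) * (?b powr (q - p) * (\<rho> powr (- p)) ^ l0)"
        using ao.x_sum[OF _ w, of "{..<n}"] by (intro mult_right_mono) auto
      finally have "(\<Sum>k<n. \<bar>a k\<bar> powr q * s k powr (- p)) * K0 \<le> (Cf * N w powr p) * (?b powr (q - p) * (\<rho> powr (- p)) ^ l0) * K0"
        by (rule mult_right_mono) (simp add: K0_def)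
      also have "\<dots> = (K0 * (Cf * (Cf powr (1 / p)) powr (q - p)) * (\<rho> powr (- p)) ^ l0) * (N w powr p * N w powr (q - p))"
        by (simp add: powr_mult mult_ac)
      also have "\<dots> = (K0 * (Cf * (Cf powr (1 / p)) powr (q - p)) * (\<rho> powr (- p)) ^ l0) * N w powr q"
        by (simp add: powr_add[symmetric])
      also have "\<dots> \<le> eps powr q * N w powr q" using l0 by (intro mult_right_mono) auto
      finally have "KK w powr q \<le> (eps * N w) powr q" using Kcomb[of a] eps unfolding w_def by (simp add: powr_mult)
      then have "KK w \<le> eps * N w"
        using powr_less_mono2[of q "eps * N w" "KK w"] q0(1) eps N_ge0[of w] by (force simp: not_le[symmetric])
      then show "KK (\<Sum>k<n. a k *\<^sub>R v k) \<le> eps * N (\<Sum>k<n. a k *\<^sub>R v k)" unfolding w_def .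
    qed
  qed
  then show ?thesis by (intro exI[of _ "max 1 C1"]) auto
qed

end

section \<open>The restriction on the exponent forced by the embedding\<close>

context corner_embedding
begin

text \<open>A bump compressed by the factor \<open>s\<close> towards x1 = 0 and towards the interior
  value x2 = \<delta>/2 has \<open>N powr p\<close> at most of order 1/s and \<open>K powr q\<close>
  at least of order \<open>s powr (- (p + 1))\<close>. The embedding then compares
  \<open>s powr (- (p + 1))\<close> with \<open>s powr (- (q / p))\<close>, and \<open>s\<close>
  tends to infinity.\<close>

lemma exponent_bound:
  assumes \<phi>: "bump \<phi>" "\<phi> \<in> test_functions M"
  shows "q \<le> p * (p + 1)"
proof -
  have nn: "\<phi> x \<ge> 0" for x using \<phi>(1) unfolding bump_def by blast
  from \<phi>(2) obtain K where K: "smooth \<phi>" "compact K" "K \<subseteq> M" "\<And>x. x \<notin> K \<Longrightarrow> \<phi> x = 0"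
      "\<And>x v. x \<notin> K \<Longrightarrow> frechet_derivative \<phi> (at x) v = 0"
    by (rule test_functionsD) blast
  have gK: "gradient \<phi> x = 0" if "x \<notin> K" for x
    using K(5)[OF that] by (auto intro!: euclidean_eqI[of _ 0] simp: gradient_inner)
  obtain \<alpha> where \<alpha>: "\<alpha> > 0" "\<And>x. x \<notin> region \<alpha> \<Longrightarrow> \<phi> x = 0 \<and> gradient \<phi> x = 0"
    by (rule support_region[OF \<phi>(2)]) blast
  have [measurable]: "\<phi> \<in> borel_measurable borel" by (rule test_borel[OF \<phi>(2)])
  have [measurable]: "gradient \<phi> \<in> borel_measurable borel"
    by (rule borel_measurable_continuous_onI[OF gradient_continuous[OF K(1)]])
  have c\<phi>: "continuous_on UNIV \<phi>" by (rule smooth_continuous[OF K(1)])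
  define G where "G = (\<integral>x. norm (gradient \<phi> x) powr p \<partial>lborel)"
  have G: "(\<integral>\<^sup>+x. ennreal (norm (gradient \<phi> x) powr p) \<partial>lborel) = ennreal G" "G \<ge> 0"
  proof -
    have "integrable lborel (\<lambda>x. norm (gradient \<phi> x) powr p)"
      using p0 gK by (intro integrable_compact_support[OF _ K(2)] continuous_on_powr' continuous_on_norm
        gradient_continuous K(1) continuous_on_const) auto
    then show "(\<integral>\<^sup>+x. ennreal (norm (gradient \<phi> x) powr p) \<partial>lborel) = ennreal G"
      unfolding G_def by (intro nn_integral_eq_integral) auto
    show "G \<ge> 0" unfolding G_def by simp
  qed
  define Q where "Q = (\<integral>x. \<phi> x powr q \<partial>lborel)"
  have Qi: "integrable lborel (\<lambda>x. \<phi> x powr q)"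
    using q0 nn K(4) by (intro integrable_compact_support[OF _ K(2)] continuous_on_powr' c\<phi> continuous_on_const) auto
  have Q: "(\<integral>\<^sup>+x. ennreal (\<phi> x powr q) \<partial>lborel) = ennreal Q"
    unfolding Q_def using Qi by (intro nn_integral_eq_integral) auto
  have Q0: "Q > 0"
  proof -
    have "Q \<noteq> 0"
    proof
      assume "Q = 0"
      then have "AE x in lborel. \<phi> x powr q = 0"
        unfolding Q_def using integral_nonneg_eq_0_iff_AE[OF Qi] by simp
      then have "AE x in lborel. \<phi> x = 0" by eventually_elim simp
      then have "(\<integral>x. \<phi> x \<partial>lborel) = 0" by (rule integral_eq_zero_AE)
      then show False using \<phi>(1) unfolding bump_def by simp
    qed
    moreover have "Q \<ge> 0" unfolding Q_def by simp
    ultimately show ?thesis by simp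
  qed
  define c1 where "c1 = \<delta> + \<delta> * \<delta> + 1"
  define C where "C = 4 / (\<alpha> * \<delta>) * c1 powr p * G"
  define c where "c = (\<alpha> * \<delta> / 4) powr (p - 1) * Q"
  have c1: "c1 > 0" unfolding c1_def using \<delta> by (simp add: add_pos_pos)
  have C0: "C \<ge> 0" unfolding C_def using \<alpha> \<delta> G by simp
  have c0: "c > 0" unfolding c_def using \<alpha> \<delta> Q0 by simp
  have main: "c * s powr (- (p + 1)) \<le> CK powr q * C powr (q / p) * s powr (- (q / p))" if s: "s \<ge> 2" for s
  proof -
    \<comment> \<open>The shift makes x2 = \<delta>/2 a fixed point, so for \<open>s >= 2\<close>
      the preimage of \<open>M\<close> stays in \<open>M\<close>, with x2 at least
      \<delta>/4.\<close>
    define t where "t = \<delta> / 2 - s * (\<delta> / 2)"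
    define T where "T = (aff s s t :: 'n pt \<Rightarrow> 'n pt)"
    have [measurable]: "T \<in> borel_measurable borel" unfolding T_def by measurable
    have T: "x \<in> M \<and> \<delta> / 4 \<le> fst (snd x) \<and> fst x = fst (T x) / s" if "T x \<in> M" for x
    proof -
      have 1: "0 < s * fst x" "s * fst x < \<delta>" "0 < t + s * fst (snd x)" "t + s * fst (snd x) < \<delta>" "snd (snd x) \<in> X"
        using that unfolding M_iff T_def aff_def by auto
      have a: "fst x > 0" using 1(1) s by (simp add: zero_less_mult_iff)
      have "1 * fst x \<le> s * fst x" using a s by (intro mult_right_mono) auto
      then have b: "fst x < \<delta>" using 1(2) by simp
      define d where "d = fst (snd x) - \<delta> / 2"
      have "s * d = t + s * fst (snd x) - \<delta> / 2" unfolding t_def d_def by (simp add: right_diff_distrib)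
      then have sd: "\<bar>s * d\<bar> < \<delta> / 2" using 1(3,4) by linarith
      have "2 * \<bar>d\<bar> \<le> s * \<bar>d\<bar>" using s by (intro mult_right_mono) auto
      then have "2 * \<bar>d\<bar> < \<delta> / 2" using sd s by (simp add: abs_mult)
      then have d: "\<bar>d\<bar> < \<delta> / 4" by simp
      have e: "\<delta> / 4 \<le> fst (snd x)" "fst (snd x) < \<delta>" using d \<delta> unfolding d_def by linarith+
      have "0 < fst (snd x)" using e(1) \<delta> by linarith
      moreover have "fst x = fst (T x) / s" unfolding T_def aff_def using s by simp
      ultimately show ?thesis using a b e 1(5) unfolding M_iff by simp
    qed
    have reg: "x \<in> M \<and> \<delta> / 4 \<le> fst (snd x) \<and> \<alpha> / s \<le> fst x \<and> fst x < \<delta> \<and> fst (snd x) < \<delta>" if "T x \<in> region \<alpha>" for x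
    proof -
      have 1: "T x \<in> M" "\<alpha> \<le> fst (T x)" using that unfolding region_def by auto
      have "\<alpha> / s \<le> fst (T x) / s" using 1(2) s by (intro divide_right_mono) auto
      then show ?thesis using T[OF 1(1)] M_iff[of x] by simp
    qed
    define f where "f x = \<phi> (T x)" for x
    have fT: "f \<in> test_functions M"
      unfolding f_def[abs_def] T_def using T s by (intro test_function_aff \<phi>(2)) (auto simp: T_def)
    have [measurable]: "f \<in> borel_measurable borel" by (rule test_borel[OF fT])
    have fg: "gradient f x = aff s s 0 (gradient \<phi> (T x))" for x
      unfolding f_def[abs_def] T_def by (rule gradient_aff[OF K(1)])
    \<comment> \<open>The factor \<open>s\<close> of the chain rule always comes with x1, and
      \<open>s * x1\<close> is below \<delta> on the support.\<close>
    have fg_bound: "norm (scaled x (gradient f x)) \<le> c1 * norm (gradient \<phi> (T x))" if x: "T x \<in> region \<alpha>" for x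
    proof -
      define g where "g = gradient \<phi> (T x)"
      have x': "0 < fst x" "0 < fst (snd x)" "fst (snd x) < \<delta>" "s * fst x < \<delta>" 
        using reg[OF x] M_iff[of x] x M_iff[of "T x"] unfolding region_def T_def aff_def by auto
      have n: "\<bar>fst g\<bar> \<le> norm g" "\<bar>fst (snd g)\<bar> \<le> norm g" "norm (snd (snd g)) \<le> norm g"
      proof -
        show "\<bar>fst g\<bar> \<le> norm g" using norm_fst_le[of "fst g" "snd g"] by simp
        have 1: "norm (snd g) \<le> norm g" using norm_snd_le[of "snd g" "fst g"] by simp
        show "\<bar>fst (snd g)\<bar> \<le> norm g" using norm_fst_le[of "fst (snd g)" "snd (snd g)"] 1 by simp
        show "norm (snd (snd g)) \<le> norm g" using norm_snd_le[of "snd (snd g)" "fst (snd g)"] 1 by simp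
      qed
      have sc: "scaled x (gradient f x) = (s * fst x * fst g, (s * fst x) * fst (snd x) * fst (snd g), snd (snd g))"
        unfolding fg g_def[symmetric] scaled_def aff_def by (simp add: mult_ac)
      have tri: "norm (a, b, y) \<le> \<bar>a\<bar> + \<bar>b\<bar> + norm y" for a b :: real and y :: "real ^ 'n"
        using norm_Pair_le[of a "(b, y)"] norm_Pair_le[of b y] by simp
      have "norm (scaled x (gradient f x)) \<le> \<bar>s * fst x * fst g\<bar> + \<bar>(s * fst x) * fst (snd x) * fst (snd g)\<bar> + norm (snd (snd g))"
        unfolding sc by (rule tri)
      also have "\<dots> = (s * fst x) * \<bar>fst g\<bar> + ((s * fst x) * fst (snd x)) * \<bar>fst (snd g)\<bar> + norm (snd (snd g))"
        using x' s by (simp add: abs_mult)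
      also have "\<dots> \<le> \<delta> * norm g + (\<delta> * \<delta>) * norm g + norm g"
        using x' s n by (intro add_mono mult_mono) auto
      also have "\<dots> = c1 * norm g" unfolding c1_def by (simp add: distrib_right)
      finally show ?thesis unfolding g_def .
    qed
    define u where "u = abs_aefun f"
    have uE: "u \<in> E" unfolding u_def by (rule test_function_E[OF fT])
    have z: "gradient f x = 0 \<and> f x = 0" if "T x \<notin> region \<alpha>" for x
      using \<alpha>(2)[OF that] unfolding fg by (simp add: f_def aff_def zero_prod_def[symmetric])
    \<comment> \<open>The density of \<open>mu\<close> is at most
      \<open>4 * s / (\<alpha> * \<delta>)\<close> on the support, and the change of variables
      contributes \<open>1 / (s * s)\<close>.\<close>
    have Nu: "N u powr p \<le> C / s"
    proof -
      have "ennreal (N u powr p) = (\<integral>\<^sup>+x. ennreal (norm (scaled x (gradient f x)) powr p) \<partial>mu M)"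
        unfolding u_def N_test[OF fT] by (rule Lnorm_nn[OF test_function_HH(3)[OF fT] p0, symmetric])
      also have "\<dots> = (\<integral>\<^sup>+x. ennreal (indicator M x / (fst x * fst (snd x))) * ennreal (norm (scaled x (gradient f x)) powr p) \<partial>lborel)"
      proof (rule nn_integral_mu)
        have "smooth f" using fT unfolding test_functions_def smooth_def by blast
        then have [measurable]: "(\<lambda>x. scaled x (gradient f x)) \<in> borel_measurable borel"
          by (intro borel_measurable_continuous_onI scaled_gradient_continuous)
        show "(\<lambda>x. ennreal (norm (scaled x (gradient f x)) powr p)) \<in> borel_measurable borel" by measurable
      qed
      also have "\<dots> \<le> (\<integral>\<^sup>+x. ennreal (4 * s / (\<alpha> * \<delta>) * c1 powr p) * ennreal (norm (gradient \<phi> (T x)) powr p) \<partial>lborel)"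
      proof (rule nn_integral_mono)
        fix x
        show "ennreal (indicator M x / (fst x * fst (snd x))) * ennreal (norm (scaled x (gradient f x)) powr p)
          \<le> ennreal (4 * s / (\<alpha> * \<delta>) * c1 powr p) * ennreal (norm (gradient \<phi> (T x)) powr p)"
        proof (cases "T x \<in> region \<alpha>")
          case True
          note r = reg[OF True]
          have pos: "0 < fst x" "0 < fst (snd x)" using r M_iff[of x] by auto
          have "(\<alpha> / s) * (\<delta> / 4) \<le> fst x * fst (snd x)" using r \<alpha> \<delta> s pos by (intro mult_mono) auto
          then have "1 / (fst x * fst (snd x)) \<le> 1 / ((\<alpha> / s) * (\<delta> / 4))" using \<alpha>(1) \<delta> s pos by (intro divide_left_mono) auto
          then have 1: "1 / (fst x * fst (snd x)) \<le> 4 * s / (\<alpha> * \<delta>)" by (simp add: mult.commute)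
          have "norm (scaled x (gradient f x)) powr p \<le> (c1 * norm (gradient \<phi> (T x))) powr p"
            using fg_bound[OF True] p0 by (intro powr_mono2) auto
          then have 2: "norm (scaled x (gradient f x)) powr p \<le> c1 powr p * norm (gradient \<phi> (T x)) powr p"
            using c1 by (simp add: powr_mult)
          have "1 / (fst x * fst (snd x)) * norm (scaled x (gradient f x)) powr p
            \<le> (4 * s / (\<alpha> * \<delta>)) * (c1 powr p * norm (gradient \<phi> (T x)) powr p)"
            using 1 2 \<alpha> \<delta> s by (intro mult_mono) auto
          from ennreal_leI[OF this] show ?thesis using r \<alpha> \<delta> s pos by (simp add: ennreal_mult[symmetric] mult.assoc)
        next
          case False
          then show ?thesis using z[OF False] p0 by (simp add: scaled_def zero_prod_def[symmetric])
        qed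
      qed
      also have "\<dots> = ennreal (4 * s / (\<alpha> * \<delta>) * c1 powr p) * (ennreal (1 / (s * s)) * ennreal G)"
        unfolding T_def
        by (subst nn_integral_cmult, measurable, subst nn_integral_aff[of "\<lambda>y. ennreal (norm (gradient \<phi> y) powr p)"])
          (use s in \<open>auto simp: G\<close>)
      also have "\<dots> = ennreal (C / s)"
        unfolding C_def using s \<alpha> \<delta> G by (simp add: ennreal_mult[symmetric] field_simps)
      finally show ?thesis using C0 s by (simp add: ennreal_le_iff)
    qed
    \<comment> \<open>The density of \<open>muK\<close> is at least of order
      \<open>s powr (1 - p)\<close> on the support, and the change of variables again contributes
      \<open>1 / (s * s)\<close>.\<close>
    have Ku: "c * s powr (- (p + 1)) \<le> KK u powr q"
    proof -
      have "ennreal (c * s powr (- (p + 1))) = ennreal ((\<alpha> * \<delta> / 4) powr (p - 1) * s powr (1 - p)) * (ennreal (1 / (s * s)) * ennreal Q)"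
      proof -
        have "s powr (- (p + 1)) = s powr ((1 - p) + (- 2))" by (rule arg_cong[where f = "\<lambda>r. s powr r"]) simp
        also have "\<dots> = s powr (1 - p) * s powr (- 2)" by (rule powr_add)
        also have "s powr (- 2) = 1 / (s * s)" using s by (simp add: powr_minus_divide power2_eq_square)
        finally have "c * s powr (- (p + 1)) = ((\<alpha> * \<delta> / 4) powr (p - 1) * s powr (1 - p)) * (1 / (s * s) * Q)"
          unfolding c_def by simp
        then show ?thesis using s Q0 by (simp only:) (simp add: ennreal_mult[symmetric])
      qed
      also have "\<dots> = (\<integral>\<^sup>+x. ennreal ((\<alpha> * \<delta> / 4) powr (p - 1) * s powr (1 - p)) * ennreal (\<phi> (T x) powr q) \<partial>lborel)"
        unfolding T_def
        by (subst nn_integral_cmult, measurable, subst nn_integral_aff[of "\<lambda>y. ennreal (\<phi> y powr q)"])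
          (use s in \<open>auto simp: Q\<close>)
      also have "\<dots> \<le> (\<integral>\<^sup>+x. ennreal (indicator M x * (fst x * fst (snd x)) powr (p - 1)) * ennreal (norm (f x) powr q) \<partial>lborel)"
      proof (rule nn_integral_mono)
        fix x
        show "ennreal ((\<alpha> * \<delta> / 4) powr (p - 1) * s powr (1 - p)) * ennreal (\<phi> (T x) powr q)
          \<le> ennreal (indicator M x * (fst x * fst (snd x)) powr (p - 1)) * ennreal (norm (f x) powr q)"
        proof (cases "T x \<in> region \<alpha>")
          case True
          note r = reg[OF True]
          have pos: "0 < fst x" "0 < fst (snd x)" using r M_iff[of x] by auto
          have le: "(\<alpha> / s) * (\<delta> / 4) \<le> fst x * fst (snd x)" using r \<alpha> \<delta> s pos by (intro mult_mono) auto
          have "(\<alpha> * \<delta> / 4) powr (p - 1) * s powr (1 - p) = ((\<alpha> / s) * (\<delta> / 4)) powr (p - 1)"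
            using s \<alpha> \<delta> by (simp add: powr_mult powr_divide powr_diff field_simps)
          also have "\<dots> \<le> (fst x * fst (snd x)) powr (p - 1)"
            using le p s \<alpha> \<delta> by (intro powr_mono2) auto
          finally have "(\<alpha> * \<delta> / 4) powr (p - 1) * s powr (1 - p) \<le> indicator M x * (fst x * fst (snd x)) powr (p - 1)"
            using r by simp
          moreover have "norm (f x) = \<phi> (T x)" using nn[of "T x"] unfolding f_def by simp
          ultimately show ?thesis by (metis mult_right_mono[OF ennreal_leI] zero_le)
        next
          case False
          then show ?thesis using z[OF False] q0 unfolding f_def by simp
        qed
      qed
      also have "\<dots> = (\<integral>\<^sup>+x. ennreal (norm (f x) powr q) \<partial>muK p M)" by (rule nn_integral_muK[symmetric]) measurable
      also have "\<dots> = (\<integral>\<^sup>+x. ennreal (norm (rep_aefun u x) powr q) \<partial>muK p M)" unfolding u_def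
        by (rule nn_integral_cong_AE, rule AE_muK, rule AE_mu)
          (use rep_abs_aefun[of f] in \<open>auto elim!: eventually_mono\<close>)
      also have "\<dots> = ennreal (KK u powr q)" unfolding KK_def using embed[OF uE] q0 by (intro Lnorm_nn) auto
      finally show ?thesis by (simp add: ennreal_le_iff)
    qed
    have "KK u powr q \<le> (CK * N u) powr q" using embed[OF uE] q0 unfolding KK_def by (intro powr_mono2) auto
    also have "\<dots> = CK powr q * (N u powr p) powr (q / p)" using CK p0 by (simp add: powr_mult powr_powr)
    also have "\<dots> \<le> CK powr q * (C / s) powr (q / p)"
      using Nu q0 p0 by (intro mult_left_mono powr_mono2) auto
    also have "\<dots> = CK powr q * C powr (q / p) * s powr (- (q / p))"
      using C0 s by (simp add: powr_divide powr_minus field_simps)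
    finally show ?thesis using Ku by linarith
  qed
  show ?thesis
  proof (rule ccontr)
    assume "\<not> q \<le> p * (p + 1)"
    then have e: "q / p - (p + 1) > 0" using p0 by (simp add: field_simps)
    define B where "B = CK powr q * C powr (q / p) / c"
    have bound: "s powr (q / p - (p + 1)) \<le> B" if s: "s \<ge> 2" for s
    proof -
      have "s powr (q / p) * (c * s powr (- (p + 1))) \<le> s powr (q / p) * (CK powr q * C powr (q / p) * s powr (- (q / p)))"
        using main[OF s] by (intro mult_left_mono) auto
      also have "\<dots> = CK powr q * C powr (q / p) * (s powr (q / p) * s powr (- (q / p)))" by (simp add: mult_ac)
      also have "s powr (q / p) * s powr (- (q / p)) = 1" using s by (simp add: powr_add[symmetric])
      finally have "c * (s powr (q / p) * s powr (- (p + 1))) \<le> CK powr q * C powr (q / p)" by (simp add: mult_ac)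
      also have "s powr (q / p) * s powr (- (p + 1)) = s powr (q / p - (p + 1))" unfolding powr_add[symmetric] by (rule arg_cong[where f = "\<lambda>r. s powr r"]) simp
      finally show ?thesis unfolding B_def using c0 by (simp add: field_simps)
    qed
    define r where "r = max 2 ((\<bar>B\<bar> + 1) powr (1 / (q / p - (p + 1))))"
    have "\<bar>B\<bar> + 1 = ((\<bar>B\<bar> + 1) powr (1 / (q / p - (p + 1)))) powr (q / p - (p + 1))"
      using e by (simp add: powr_powr)
    also have "\<dots> \<le> r powr (q / p - (p + 1))" unfolding r_def using e by (intro powr_mono2) auto
    also have "\<dots> \<le> B" by (rule bound) (simp add: r_def)
    finally show False by simp
  qed
qed

end

section \<open>The embedding and the projections supplied by the min-max data\<close>

context corner_bump
begin

lemma E_topology_N: "E_topology M p = Metric_space.mtopology E (\<lambda>u v. N (u - v))"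
  unfolding E_topology_def ..

text \<open>A homeomorphism is open, so the image of the unit ball under \<open>h\<close> contains a
  ball around 0, and there the energy is nonnegative. On the sphere of half that radius this bounds
  the nonlinear term, in particular makes it finite, and homogeneity extends the bound to all of
  \<open>E\<close>.\<close>

lemma Gamma_embedding:
  assumes h: "h \<in> Gamma M p q lam" and q: "q > p" and lam: "lam > 0"
  shows "\<exists>CK. corner_embedding X \<delta> p M q CK"
proof -
  interpret ms: Metric_space E "\<lambda>u v. N (u - v)" by (rule metric)
  have q0: "q > 0" using q p0 by simp
  have hom: "homeomorphic_map ms.mtopology ms.mtopology h" and h0: "h 0 = 0"
    and hB: "h ` unit_ball M p \<subseteq> A0 M p q lam"
    using h unfolding Gamma_def E_topology_N by auto
  have "openin ms.mtopology (h ` ms.mball 0 1)"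
    using homeomorphic_imp_open_map[OF hom] unfolding open_map_def by simp
  moreover have "0 \<in> h ` ms.mball 0 1" using h0 by (metis imageI ms.centre_in_mball_iff mem(1) zero_less_one)
  ultimately obtain r where r: "r > 0" "ms.mball 0 r \<subseteq> h ` ms.mball 0 1"
    unfolding ms.openin_mtopology by blast
  have A: "0 \<le> energy M p q lam w" if w: "w \<in> E" "N w < r" for w
  proof -
    have "w \<in> ms.mball 0 r" using w by (simp add: N_minus)
    then obtain u where u: "u \<in> ms.mball 0 1" "w = h u" using r(2) by blast
    have "u \<in> unit_ball M p" unfolding unit_ball_def using u(1) by (simp add: N_minus)
    then have "w \<in> A0 M p q lam" using hB u(2) by blast
    then show ?thesis unfolding A0_def by simp
  qed
  \<comment> \<open>Nonnegative energy at norm \<open>r / 2\<close> says precisely that the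
    nonlinear integral is at most \<open>Y\<close>.\<close>
  define Y where "Y = q / (lam * p) * (r / 2) powr p"
  define D where "D = Y powr (1 / q)"
  have Y: "Y > 0" unfolding Y_def using q0 lam p0 r(1) by simp
  have D: "D > 0" "D powr q = Y" unfolding D_def using Y q0 by (simp_all add: powr_powr)
  have Kw: "Lfin (muK p M) q (rep_aefun w) \<and> Lnorm (muK p M) q (rep_aefun w) \<le> D" if w: "w \<in> E" "N w = r / 2" for w
  proof -
    let ?I = "\<integral>\<^sup>+x. ennreal (norm (rep_aefun w x) powr q) \<partial>muK p M"
    have en: "0 \<le> ereal (1 / p * N w powr p) - ereal (lam / q) * enn2ereal ?I"
    proof -
      have "N w < r" unfolding w(2) using r(1) by simp
      from A[OF w(1) this] show ?thesis unfolding energy_eq[OF w(1)] .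
    qed
    have "?I \<le> ennreal (D powr q)"
    proof (cases ?I rule: ennreal_cases)
      case (real i)
      then have "lam / q * i \<le> 1 / p * N w powr p" using en by simp
      then have "i \<le> D powr q" unfolding D Y_def w(2) using lam q0 p0 by (simp add: field_simps)
      then show ?thesis using real by (simp add: ennreal_leI)
    next
      case top
      then show ?thesis using en lam q0 by simp
    qed
    then show ?thesis using Lnorm_le_iff[of "rep_aefun w" "muK p M" q D] q0 D by (simp add: borel_muK)
  qed
  have "corner_embedding X \<delta> p M q (2 * D / r)"
  proof unfold_locales
    show "q > p" by (rule q)
    show "2 * D / r > 0" using D r by simp
    fix u assume u: "u \<in> E"
    show "Lfin (muK p M) q (rep_aefun u) \<and> Lnorm (muK p M) q (rep_aefun u) \<le> 2 * D / r * N u"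
    proof (cases "u = 0")
      case True
      have "AE x in muK p M. rep_aefun u x = 0"
        unfolding True by (rule AE_muK, rule AE_mu) (use rep_aefun_zero in \<open>auto elim!: eventually_mono\<close>)
      then show ?thesis using Lnorm_zero[of "rep_aefun u" "muK p M" q] q0 True by (simp add: borel_muK)
    next
      case False
      then have Nu: "N u > 0" using N_pos[OF u] by simp
      define w where "w = (r / 2 / N u) *\<^sub>R u"
      have w: "w \<in> E" "N w = r / 2" unfolding w_def using u Nu r by (auto simp: N_scale)
      have uw: "u = (N u / (r / 2)) *\<^sub>R w" unfolding w_def using Nu r by simp
      note K = Kw[OF w]
      note sc = Lnorm_scale[OF conjunct1[OF K] q0, of "N u / (r / 2)"]
      have ae: "AE x in muK p M. rep_aefun u x = (N u / (r / 2)) *\<^sub>R rep_aefun w x"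
        using AE_muK[OF rep_scale_mu[of "N u / (r / 2)" w]] uw by simp
      have fin: "Lfin (muK p M) q (rep_aefun u)"
        using ae by (intro Lnorm_mono(1)[OF sc(1)]) (auto simp: borel_muK q0 elim!: eventually_mono)
      have "Lnorm (muK p M) q (rep_aefun u) = Lnorm (muK p M) q (\<lambda>x. (N u / (r / 2)) *\<^sub>R rep_aefun w x)"
        using ae by (intro Lnorm_cong) (auto elim!: eventually_mono)
      also have "\<dots> = \<bar>N u / (r / 2)\<bar> * Lnorm (muK p M) q (rep_aefun w)" by (rule sc(2))
      also have "\<dots> \<le> \<bar>N u / (r / 2)\<bar> * D" using K by (intro mult_left_mono) auto
      also have "\<dots> = 2 * D / r * N u" using Nu r by simp
      finally show ?thesis using fin by simp
    qed
  qed
  then show ?thesis ..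
qed

text \<open>\<open>complement_in\<close> only records a continuous \<open>P\<close> with
  \<open>P (v + w) = v\<close>. Since every element has such a decomposition and both summands are
  subspaces, this determines a linear projection with kernel containing the complement.\<close>

lemma complement_projection:
  assumes F: "subspace F" "F \<subseteq> E" and c: "complement_in (E_topology M p) F Fc"
  shows "\<exists>P. cont_op P \<and> linear_fun_on E P \<and> P ` E \<subseteq> F \<and> (\<forall>w\<in>F. P w = w) \<and> (\<forall>w\<in>Fc. P w = 0)"
proof -
  interpret ms: Metric_space E "\<lambda>u v. N (u - v)" by (rule metric)
  from c obtain P where Fc: "subspace Fc" and dec: "{v + w |v w. v \<in> F \<and> w \<in> Fc} = E"
    and P: "continuous_map ms.mtopology ms.mtopology P" "\<And>v w. v \<in> F \<Longrightarrow> w \<in> Fc \<Longrightarrow> P (v + w) = v"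
    unfolding complement_in_def E_topology_N by auto
  have obt: "\<exists>v w. v \<in> F \<and> w \<in> Fc \<and> u = v + w" if "u \<in> E" for u using dec that by blast
  have "linear_fun_on E P" unfolding linear_fun_on_def
  proof (intro conjI ballI allI)
    fix u u' assume "u \<in> E" "u' \<in> E"
    then obtain v w v' w' where vw: "v \<in> F" "w \<in> Fc" "u = v + w" "v' \<in> F" "w' \<in> Fc" "u' = v' + w'" using obt by meson
    have "u + u' = (v + v') + (w + w')" using vw by simp
    moreover have "v + v' \<in> F" "w + w' \<in> Fc" using vw F(1) Fc by (auto intro: subspace_add)
    ultimately have "P (u + u') = v + v'" using P(2) by metis
    then show "P (u + u') = P u + P u'" using P(2) vw by simp
  next
    fix c u assume "u \<in> E"
    then obtain v w where vw: "v \<in> F" "w \<in> Fc" "u = v + w" using obt by meson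
    have "c *\<^sub>R u = c *\<^sub>R v + c *\<^sub>R w" using vw by (simp add: scaleR_right_distrib)
    moreover have "c *\<^sub>R v \<in> F" "c *\<^sub>R w \<in> Fc" using vw F(1) Fc by (auto intro: subspace_mul)
    ultimately have "P (c *\<^sub>R u) = c *\<^sub>R v" using P(2) by metis
    then show "P (c *\<^sub>R u) = c *\<^sub>R P u" using P(2) vw by simp
  qed
  moreover have "P ` E \<subseteq> F" using obt P(2) by (metis image_subsetI)
  moreover have "P w = w" if "w \<in> F" for w using P(2)[OF that subspace_0[OF Fc]] by simp
  moreover have "P w = 0" if "w \<in> Fc" for w using P(2)[OF subspace_0[OF F(1)] that] by simp
  ultimately show ?thesis using P(1) unfolding continuous_map_iff by blast
qed

end

context corner_embedding
begin

text \<open>Homogeneity covers oddness and \<open>h 0 = 0\<close>, and the embedding makes the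
  energy finite everywhere, so \<open>pos\<close> is the remaining condition for
  \<open>A0\<close>.\<close>

lemma homogeneous_in_Gamma:
  assumes h: "cont_op h" "cont_op h'" "\<And>u. u \<in> E \<Longrightarrow> h' (h u) = u \<and> h (h' u) = u" "homogeneous_on E h"
    and pos: "\<And>u. u \<in> E \<Longrightarrow> N u \<le> 1 \<Longrightarrow> 0 \<le> N (h u) powr p / p - lam / q * KK (h u) powr q"
  shows "h \<in> Gamma M p q lam"
proof -
  interpret ms: Metric_space E "\<lambda>u v. N (u - v)" by (rule metric)
  have "homeomorphic_maps ms.mtopology ms.mtopology h h'"
    unfolding homeomorphic_maps_def using h by (simp add: continuous_map_iff)
  then have "homeomorphic_map ms.mtopology ms.mtopology h" unfolding homeomorphic_map_maps by blast
  moreover have "h (- u) = - h u" if "u \<in> E" for u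
    using h(4) that unfolding homogeneous_on_def by (metis scaleR_minus1_left)
  moreover have "h ` unit_ball M p \<subseteq> A0 M p q lam"
  proof (rule image_subsetI)
    fix u assume "u \<in> unit_ball M p"
    then have u: "u \<in> E" "N u \<le> 1" unfolding unit_ball_def by auto
    have "h u \<in> E" by (rule cont_op_mem[OF h(1) u(1)])
    then show "h u \<in> A0 M p q lam"
      using pos[OF u] unfolding A0_def by (simp add: energy_KK)
  qed
  ultimately show ?thesis unfolding Gamma_def E_topology_N using homogeneous_on_0[OF h(4)] by simp
qed

end

section \<open>Divergence of the min-max values\<close>

theorem theorem1p2:
  fixes X :: "(real ^ 'n::finite) set"
    and M :: "'n pt set"
    and \<delta> p q lam N :: real
    and F Fc :: "nat \<Rightarrow> 'n pt aefun set"
    and c :: "nat \<Rightarrow> real"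
  assumes "\<delta> > 0" and "open X" and "bounded X"
    and "M = corner \<delta> X"
    and "N = real CARD('n) + 2"
    and "2 < p" and "p < N"
    and "p < q" and "q < N * p / (N - p)"
    and "lam > 0"
    and "\<And>m. subspace (F m)" and "\<And>m. F m \<subseteq> E_space M p"
    and "\<And>m. has_dimension (F m) m"
    and "\<And>m. F m \<subseteq> F (Suc m)"
    and "E_topology M p closure_of span (\<Union>m. F m) = E_space M p"
    and "\<And>m. complement_in (E_topology M p) (F m) (Fc m)"
    and "\<And>m. m \<ge> 1 \<Longrightarrow> critical_value M p q lam (c m)"
    and "\<And>m. m \<ge> 1 \<Longrightarrow> ereal (c m) = minmax_value M p q lam (Fc (m - 1))"
  shows "filterlim c at_top sequentially"
proof -
  interpret corner_domain X \<delta> p M by unfold_locales (use assms in auto)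
  \<comment> \<open>The one-dimensional space \<open>F 1\<close> contains a nonzero vector, which is
    what \<open>bump_exists\<close> asks for.\<close>
  obtain u0 where u0: "u0 \<in> E_space M p" "u0 \<noteq> 0"
  proof -
    obtain b where b: "independent b" "span b = F 1" "card b = 1"
      using assms(13)[of 1] unfolding has_dimension_def by blast
    obtain u where u: "b = {u}" using b(3) by (rule card_1_singletonE)
    have "u \<noteq> 0" using b(1) dependent_zero unfolding u by blast
    moreover have "u \<in> E_space M p" using assms(12)[of 1] span_base[of u b] b(2) u by auto
    ultimately show ?thesis using that by blast
  qed
  obtain \<phi> :: "'n pt \<Rightarrow> real" where \<phi>: "bump \<phi>" "\<phi> \<in> test_functions M" using bump_exists[OF u0] by blast
  interpret corner_bump X \<delta> p M by unfold_locales (use \<phi> in blast)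
  \<comment> \<open>A supremum over the empty set is minus infinity, whereas \<open>c 1\<close> is a
    real number.\<close>
  have "Gamma M p q lam \<noteq> {}"
  proof
    assume "Gamma M p q lam = {}"
    then have "ereal (c 1) = - \<infinity>" using assms(18)[of 1] unfolding minmax_value_def by (simp add: bot_ereal_def)
    then show False by simp
  qed
  then obtain CK where "corner_embedding X \<delta> p M q CK" using Gamma_embedding assms(8,10) by blast
  then interpret corner_embedding X \<delta> p M q CK .
  \<comment> \<open>Subcriticality of \<open>q\<close> for the dimension CARD('n) + 2, in the form
    required by the local Sobolev-Poincare inequality.\<close>
  have k1: "real (CARD('n) + 2) * (1 / p - 1 / q) < 1"
  proof -
    have "q * (N - p) < N * p" using assms(7,9) by (simp add: field_simps)
    then have "N * (q - p) < p * q" by (simp add: algebra_simps)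
    then have "N * (q - p) / (p * q) < 1" using p0 q0 by simp
    moreover have "N * (q - p) / (p * q) = N * (1 / p - 1 / q)" using p0 q0 by (simp add: field_simps)
    ultimately show ?thesis using assms(5) by (simp add: add.commute)
  qed
  note X = detection[OF exponent_bound[OF \<phi>] k1]
  from flat_directions[OF \<phi>] obtain C0 where C0: "C0 \<ge> 1" and V: "\<forall>eps>0. \<forall>n :: nat. \<exists>v f D.
      (\<forall>k<n. v k \<in> E \<and> linear_fun_on E (f k) \<and> (\<forall>u\<in>E. \<bar>f k u\<bar> \<le> D * E_norm M p u)) \<and>
      (\<forall>j<n. \<forall>k<n. f j (v k) = (if j = k then 1 else 0)) \<and>
      (\<forall>u\<in>E. E_norm M p (\<Sum>k<n. f k u *\<^sub>R v k) \<le> C0 * E_norm M p u) \<and>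
      (\<forall>a. KK (\<Sum>k<n. a k *\<^sub>R v k) \<le> eps * E_norm M p (\<Sum>k<n. a k *\<^sub>R v k))"
    by (elim exE conjE) (rule that)
  have "\<forall>m. \<exists>P. cont_op P \<and> linear_fun_on E P \<and> P ` E \<subseteq> F m \<and> (\<forall>w\<in>F m. P w = w) \<and> (\<forall>w\<in>Fc m. P w = 0)"
    using complement_projection[OF assms(11) assms(12) assms(16)] by blast
  then obtain pr where pr: "\<And>m. cont_op (pr m)" "\<And>m. linear_fun_on E (pr m)" "\<And>m. pr m ` E \<subseteq> F m"
      "\<And>m w. w \<in> F m \<Longrightarrow> pr m w = w" "\<And>m w. w \<in> Fc m \<Longrightarrow> pr m w = 0"
    by metis
  \<comment> \<open>The union of the increasing spaces is already a subspace, so it coincides with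
    its span and is itself dense.\<close>
  have dense: "\<exists>w\<in>\<Union>m. F m. E_norm M p (w - u) < e" if u: "u \<in> E" and e: "e > 0" for u e
  proof -
    interpret ms: Metric_space E "\<lambda>u v. E_norm M p (u - v)" by (rule metric)
    have mono: "F i \<subseteq> F j" if "i \<le> j" for i j using lift_Suc_mono_le[of F, OF assms(14) that] .
    have "subspace (\<Union>m. F m)"
    proof (rule subspaceI)
      show "0 \<in> (\<Union>m. F m)" using subspace_0[OF assms(11)] by blast
      show "x + y \<in> (\<Union>m. F m)" if "x \<in> (\<Union>m. F m)" "y \<in> (\<Union>m. F m)" for x y
      proof -
        obtain i j where ij: "x \<in> F i" "y \<in> F j" using \<open>x \<in> (\<Union>m. F m)\<close> \<open>y \<in> (\<Union>m. F m)\<close> by blast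
        then have "x \<in> F (max i j)" "y \<in> F (max i j)" using mono[of i "max i j"] mono[of j "max i j"] by auto
        then show ?thesis using subspace_add[OF assms(11)] by blast
      qed
      show "r *\<^sub>R x \<in> (\<Union>m. F m)" if "x \<in> (\<Union>m. F m)" for r x
        using that subspace_mul[OF assms(11)] by blast
    qed
    then have sp: "span (\<Union>m. F m) = (\<Union>m. F m)" by (rule iffD2[OF span_eq_iff])
    have "u \<in> ms.mtopology closure_of (\<Union>m. F m)"
      using assms(15) u unfolding E_topology_N sp by simp
    then obtain w where "w \<in> (\<Union>m. F m)" "E_norm M p (u - w) < e"
      using e unfolding ms.metric_closure_of ms.in_mball by blast
    then show ?thesis using N_commute[of u w] by auto
  qed
  show ?thesis
    unfolding filterlim_at_top
  proof (intro allI)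
    fix L :: real
    have "\<exists>m0. \<forall>m\<ge>m0. \<exists>h h'. cont_op h \<and> cont_op h' \<and> (\<forall>u\<in>E. h' (h u) = u \<and> h (h' u) = u) \<and>
        homogeneous_on E h \<and>
        (\<forall>u\<in>E. E_norm M p u \<le> 1 \<longrightarrow> 0 \<le> E_norm M p (h u) powr p / p - lam / q * KK (h u) powr q) \<and>
        (\<forall>u\<in>E. pr m u = 0 \<longrightarrow> E_norm M p u = 1 \<longrightarrow> L \<le> E_norm M p (h u) powr p / p - lam / q * KK (h u) powr q)"
      by (rule minimax_values_large[OF X C0 V[rule_format] assms(11,12,14) dense pr(1-4) p0 assms(8,10)])
    then obtain m0 where m0: "\<forall>m\<ge>m0. \<exists>h h'. cont_op h \<and> cont_op h' \<and> (\<forall>u\<in>E. h' (h u) = u \<and> h (h' u) = u) \<and>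
        homogeneous_on E h \<and>
        (\<forall>u\<in>E. E_norm M p u \<le> 1 \<longrightarrow> 0 \<le> E_norm M p (h u) powr p / p - lam / q * KK (h u) powr q) \<and>
        (\<forall>u\<in>E. pr m u = 0 \<longrightarrow> E_norm M p u = 1 \<longrightarrow> L \<le> E_norm M p (h u) powr p / p - lam / q * KK (h u) powr q)"
      by (elim exE) (rule that)
    \<comment> \<open>The value with index \<open>Suc m\<close> is taken over \<open>Fc m\<close>,
      hence the shift by one.\<close>
    have "L \<le> c (Suc m)" if m: "m \<ge> m0" for m
    proof -
      from m0[rule_format, OF m] obtain h h' where h: "cont_op h" "cont_op h'" "\<forall>u\<in>E. h' (h u) = u \<and> h (h' u) = u" "homogeneous_on E h"
        "\<forall>u\<in>E. E_norm M p u \<le> 1 \<longrightarrow> 0 \<le> E_norm M p (h u) powr p / p - lam / q * KK (h u) powr q"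
        "\<forall>u\<in>E. pr m u = 0 \<longrightarrow> E_norm M p u = 1 \<longrightarrow> L \<le> E_norm M p (h u) powr p / p - lam / q * KK (h u) powr q"
        by (elim exE conjE) (rule that)
      have hG: "h \<in> Gamma M p q lam"
        by (rule homogeneous_in_Gamma[OF h(1,2) _ h(4)]) (use h(3,5) in blast)+
      have "ereal L \<le> (INF u\<in>unit_sphere M p \<inter> Fc m. energy M p q lam (h u))"
      proof (rule INF_greatest)
        fix u assume u: "u \<in> unit_sphere M p \<inter> Fc m"
        then have "u \<in> E" "E_norm M p u = 1" "pr m u = 0" using pr(5) unfolding unit_sphere_def by auto
        then show "ereal L \<le> energy M p q lam (h u)"
          using h(6) cont_op_mem[OF h(1), of u] by (simp add: energy_KK)
      qed
      also have "\<dots> \<le> minmax_value M p q lam (Fc m)"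
        unfolding minmax_value_def by (rule SUP_upper[OF hG])
      also have "\<dots> = ereal (c (Suc m))" using assms(18)[of "Suc m"] by simp
      finally show ?thesis by simp
    qed
    then have "\<forall>m\<ge>Suc m0. L \<le> c m" by (metis Suc_le_D Suc_le_mono)
    then show "eventually (\<lambda>m. L \<le> c m) sequentially" unfolding eventually_sequentially by blast
  qed
qed

end
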